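(* For $\mathbb{k} \in \{\mathbb{R}, \mathbb{C}\}$, continuous bounded cohomology $\mathrm{H}_{\rm cb}^\bullet$ is stable along $(\mathrm{Sp}_{2r}(\mathbb{k}))_{r \geq 1}$, i.e. for every integer $q \ge 0$ there exists $r_0 = r_0(q)$ such that $$\mathrm{H}_{\rm cb}^q(\mathrm{Sp}_{2r_0}(\mathbb{k})) \cong \mathrm{H}_{\rm cb}^q(\mathrm{Sp}_{2(r_0+1)}(\mathbb{k})) \cong \mathrm{H}_{\rm cb}^q(\mathrm{Sp}_{2(r_0+2)}(\mathbb{k})) \cong \cdots.$$
   Context: $\mathrm{Sp}_{2r}(\mathbb{k})$ is the group of linear automorphisms of $\mathbb{k}^{2r}$ preserving the standard symplectic form, with its Lie group topology. For a locally compact second-countable group $G$, $\mathrm{H}_{\rm cb}^\bullet(G)$ denotes continuous bounded cohomology with trivial real coefficients, i.e. the cohomology of the complex $0\to L^\infty(G)^G\to L^\infty(G^2)^G\to L^\infty(G^3)^G\to\cdots$ with the homogeneous coboundary (equivalently, of $G$-invariant continuous bounded functions on $G^{\bullet+1}$). *)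

theory Defs
  imports
    "HOL-Analysis.Analysis"
    "HOL-Algebra.Module"
    "Jordan_Normal_Form.Matrix"
begin

section \<open>Symplectic groups\<close>

text \<open>Here \<open>'k\<close> stands for the real or the complex numbers. The form is bilinear
  (no conjugation), also over the complex numbers. The notation \<open>$\<close> of
  HOL-Analysis is hidden, so that \<open>v $ i\<close> is the entry of a vector of
  Jordan_Normal_Form.\<close>

unbundle no vec_syntax

definition symp_form :: "nat \<Rightarrow> 'k::field vec \<Rightarrow> 'k vec \<Rightarrow> 'k" where
  "symp_form r v w = (\<Sum>i<r. v $ i * w $ (r + i) - v $ (r + i) * w $ i)"

definition Sp_set :: "nat \<Rightarrow> 'k::field mat set" where
  "Sp_set r = {A \<in> carrier_mat (2 * r) (2 * r). invertible_mat A \<and>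
     (\<forall>v \<in> carrier_vec (2 * r). \<forall>w \<in> carrier_vec (2 * r).
        symp_form r (A *\<^sub>v v) (A *\<^sub>v w) = symp_form r v w)}"

definition Sp :: "nat \<Rightarrow> 'k::field mat monoid" where
  "Sp r = \<lparr>carrier = Sp_set r, mult = (*), one = 1\<^sub>m (2 * r)\<rparr>"

text \<open>The Lie group topology is the one induced from the space of matrices, i.e.
  from the topology of entrywise convergence.\<close>

definition Sp_top :: "nat \<Rightarrow> 'k::{field,topological_space} mat topology" where
  "Sp_top r = pullback_topology (Sp_set r)
     (\<lambda>A. \<lambda>p \<in> {..<2 * r} \<times> {..<2 * r}. A $$ p)
     (product_topology (\<lambda>_. euclidean) ({..<2 * r} \<times> {..<2 * r}))"


section \<open>Continuous bounded cohomology with trivial real coefficients\<close>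

text \<open>In this section \<open>G\<close> is a group and \<open>T\<close> a group topology on its carrier.
  An element of $G^{q+1}$ is an extensional function on \<open>{..q}\<close>.\<close>

definition tuples :: "('g, 'm) monoid_scheme \<Rightarrow> nat \<Rightarrow> (nat \<Rightarrow> 'g) set" where
  "tuples G q = {..q} \<rightarrow>\<^sub>E carrier G"

text \<open>The \<open>G\<close>-invariant continuous bounded functions on $G^{q+1}$; they are required to
  vanish outside \<open>tuples G q\<close> so that equality and the pointwise operations
  are those of functions on $G^{q+1}$.\<close>

definition cb_cochains ::
  "('g, 'm) monoid_scheme \<Rightarrow> 'g topology \<Rightarrow> nat \<Rightarrow> ((nat \<Rightarrow> 'g) \<Rightarrow> real) set" where
  "cb_cochains G T q = {f.
     continuous_map (product_topology (\<lambda>_. T) {..q}) euclideanreal f \<and>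
     bounded (f ` tuples G q) \<and>
     (\<forall>g \<in> carrier G. \<forall>x \<in> tuples G q. f (\<lambda>i \<in> {..q}. g \<otimes>\<^bsub>G\<^esub> x i) = f x) \<and>
     (\<forall>x. x \<notin> tuples G q \<longrightarrow> f x = 0)}"

text \<open>\<open>omit q i\<close> drops entry number \<open>i\<close> of an element of $G^{q+2}$.\<close>

definition omit :: "nat \<Rightarrow> nat \<Rightarrow> (nat \<Rightarrow> 'g) \<Rightarrow> nat \<Rightarrow> 'g" where
  "omit q i x = (\<lambda>j \<in> {..q}. if j < i then x j else x (Suc j))"

definition coboundary_map ::
  "('g, 'm) monoid_scheme \<Rightarrow> nat \<Rightarrow> ((nat \<Rightarrow> 'g) \<Rightarrow> real) \<Rightarrow> (nat \<Rightarrow> 'g) \<Rightarrow> real" where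
  "coboundary_map G q f x =
     (if x \<in> tuples G (Suc q) then \<Sum>i\<le>Suc q. (- 1) ^ i * f (omit q i x) else 0)"

definition cb_cocycles ::
  "('g, 'm) monoid_scheme \<Rightarrow> 'g topology \<Rightarrow> nat \<Rightarrow> ((nat \<Rightarrow> 'g) \<Rightarrow> real) set" where
  "cb_cocycles G T q = {f \<in> cb_cochains G T q. coboundary_map G q f = (\<lambda>_. 0)}"

fun cb_coboundaries ::
  "('g, 'm) monoid_scheme \<Rightarrow> 'g topology \<Rightarrow> nat \<Rightarrow> ((nat \<Rightarrow> 'g) \<Rightarrow> real) set" where
  "cb_coboundaries G T 0 = {\<lambda>_. 0}"
| "cb_coboundaries G T (Suc q) = coboundary_map G q ` cb_cochains G T q"

definition cb_class ::
  "('g, 'm) monoid_scheme \<Rightarrow> 'g topology \<Rightarrow> nat \<Rightarrow> ((nat \<Rightarrow> 'g) \<Rightarrow> real) \<Rightarrow>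
   ((nat \<Rightarrow> 'g) \<Rightarrow> real) set" where
  "cb_class G T q f = {\<lambda>x. f x + b x | b. b \<in> cb_coboundaries G T q}"

text \<open>The quotient vector space of cocycles by coboundaries. The fields \<open>mult\<close> and
  \<open>one\<close>, which records of type \<^typ>\<open>('a, 'b) module\<close> inherit from rings,
  have no meaning here. In the scalar multiplication, coboundaries have to be added so
  that \<open>0\<close> times a class is the whole zero class.\<close>

definition Hcb ::
  "('g, 'm) monoid_scheme \<Rightarrow> 'g topology \<Rightarrow> nat \<Rightarrow>
   (real, ((nat \<Rightarrow> 'g) \<Rightarrow> real) set) module" where
  "Hcb G T q = \<lparr>
     carrier = cb_class G T q ` cb_cocycles G T q,
     mult = undefined,
     one = undefined,
     zero = cb_coboundaries G T q,
     add = (\<lambda>X Y. {\<lambda>x. f x + g x | f g. f \<in> X \<and> g \<in> Y}),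
     smult = (\<lambda>c X. {\<lambda>x. c * f x + b x | f b. f \<in> X \<and> b \<in> cb_coboundaries G T q})\<rparr>"

definition lin_iso :: "(real, 'a) module \<Rightarrow> (real, 'b) module \<Rightarrow> bool" where
  "lin_iso V W \<longleftrightarrow> (\<exists>\<phi>. bij_betw \<phi> (carrier V) (carrier W) \<and>
     (\<forall>x \<in> carrier V. \<forall>y \<in> carrier V. \<phi> (x \<oplus>\<^bsub>V\<^esub> y) = \<phi> x \<oplus>\<^bsub>W\<^esub> \<phi> y) \<and>
     (\<forall>c. \<forall>x \<in> carrier V. \<phi> (c \<odot>\<^bsub>V\<^esub> x) = c \<odot>\<^bsub>W\<^esub> \<phi> x))"

end

theory Submission
  imports Defs "HOL-Library.Function_Algebras" "Jordan_Normal_Form.Determinant"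
begin

text \<open>Let \<open>G\<^sub>r\<close> be the symplectic group of rank \<open>r\<close> and \<open>X\<^sub>k\<close> the space of generic
  \<open>k\<close>-tuples of hyperbolic pairs in the standard space of rank \<open>r\<close>. For \<open>k < r\<close> the invariant continuous
  bounded functions on \<open>G\<^sub>r\<^sup>p\<^sup>+\<^sup>1 \<times> X\<^sub>k\<close> are exact in the direction of \<open>k\<close>: coning off a tuple with a moving
  pair on a moment curve is generic for all but finitely many parameters, and averaging over the parameter keeps continuity.
  Gram-Schmidt and a column selection rule, again averaged over a parameter, give equivariant retractions of \<open>G\<^sub>r\<close> onto
  the stabilizers \<open>G\<^sub>r\<^sub>-\<^sub>k\<close>. By the prism homotopy the cohomology of the column \<open>k\<close> is therefore that of \<open>G\<^sub>r\<^sub>-\<^sub>k\<close>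
  with the space of normal forms of generic tuples as a parameter space. The first differential vanishes, since the
  two faces of a generic pair are exchanged by an equivariantly and continuously chosen group element. By induction, cochains on
  \<open>G\<^sub>r\<^sup>s\<^sup>+\<^sup>1 \<times> X\<^sub>k\<close> with \<open>s < p\<close> can be replaced by cochains on \<open>G\<^sub>r\<^sup>s\<^sup>+\<^sup>1 \<times> X\<^sub>k/G\<^sub>r\<close>, and this subcomplex is
  exact too, because a normal form can be coned off with a fixed standard pair. A zigzag in the double complex then proves
  that restriction from \<open>G\<^sub>r\<close> to \<open>G\<^sub>r\<^sub>-\<^sub>1\<close> is surjective in degree \<open>p\<close> and injective in degree \<open>p + 1\<close> as soon as
  \<open>r\<close> exceeds \<open>(p + 4)\<^sup>2\<close>.\<close>

text \<open>Cochains are continuous, so every auxiliary choice (a cone point, a completion of a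
  frame) must vary continuously, while a choice made by genericity or by a selection rule jumps. A
  one-parameter family of choices jumps at a given point only for finitely many parameters, and
  cochains are bounded, so dominated convergence makes the average continuous. Hyperbolic pairs are
  used rather than vectors because the stabilizer of a pair is again a symplectic group, of rank one
  less. The normal forms of generic tuples do not form a single point. Primitives chosen point by
  point over them need be neither continuous nor uniformly bounded, so the statement proved by
  induction carries an arbitrary parameter space, which absorbs the normal forms as a further
  factor. The bound \<open>(p + 4)^2\<close> leaves room for the loss of rank: a degree
  \<open>s < p\<close> is used in columns \<open>k\<close> with \<open>k + s \<le> p + 2\<close>,
  where the rank drops to \<open>r - k\<close>, so the bounds for \<open>s\<close> and
  \<open>p\<close> have to differ by more than \<open>k\<close>.\<close>

text \<open>All groups live in one ambient space of rank \<open>N\<close>. Coordinates \<open>2 * i\<close> and \<open>2 * i + 1\<close> are dual under the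
  form, so that the group \<open>GG r\<close> of rank \<open>r\<close> consists of the elements of \<open>GG N\<close> that fix the basis vectors from
  \<open>2 * r\<close> on. An element \<open>g\<close> is the family of its columns: \<open>g j i\<close> is the entry in row \<open>i\<close> and column \<open>j\<close>.
  A tuple of length \<open>k\<close> is a function on the natural numbers that is zero from \<open>k\<close> on.\<close>

type_synonym 'k pair = "(nat \<Rightarrow> 'k) \<times> (nat \<Rightarrow> 'k)"
type_synonym 'k pairs = "nat \<Rightarrow> 'k pair"
type_synonym 'k elt = "nat \<Rightarrow> nat \<Rightarrow> 'k"
type_synonym 'k elts = "nat \<Rightarrow> 'k elt"
type_synonym ('k, 'y) cochain = "'k elts \<Rightarrow> 'y \<Rightarrow> real"

section \<open>The symplectic group\<close>

text \<open>The final statement does not mention \<open>N\<close>; any \<open>N\<close> that is at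
  least the larger of the two ranks compared will serve. Facts that depend on it carry
  \<open>r \<le> N\<close> as a premise.\<close>

locale ambient = fixes N :: nat
begin

definition bas :: "'k::real_normed_field elt" where
  "bas j = (\<lambda>i. if i = j then 1 else 0)"

lemma bas_apply: "bas j i = (if i = j then 1 else 0)" by (simp add: bas_def)

definition om :: "(nat \<Rightarrow> 'k::real_normed_field) \<Rightarrow> (nat \<Rightarrow> 'k) \<Rightarrow> 'k" where
  "om v w = (\<Sum>i<N. v (2*i) * w (2*i+1) - v (2*i+1) * w (2*i))"

text \<open>Acting as the identity on the coordinates from \<open>2*N\<close> on keeps
  \<open>app bas v = v\<close> and the inverse laws free of side conditions on
  \<open>v\<close>.\<close>

definition app :: "'k::real_normed_field elt \<Rightarrow> (nat \<Rightarrow> 'k) \<Rightarrow> nat \<Rightarrow> 'k" where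
  "app g v = (\<lambda>i. if i < 2*N then \<Sum>j<2*N. v j * g j i else v i)"

definition mul :: "'k::real_normed_field elt \<Rightarrow> 'k elt \<Rightarrow> nat \<Rightarrow> nat \<Rightarrow> 'k" where
  "mul g h = (\<lambda>j. app g (h j))"

definition VV :: "nat \<Rightarrow> (nat \<Rightarrow> 'k::real_normed_field) set" where
  "VV r = {v. \<forall>i\<ge>2*r. v i = 0}"

definition GG :: "nat \<Rightarrow> 'k::real_normed_field elt set" where
  "GG r = {g. (\<forall>j\<ge>2*r. g j = bas j) \<and> (\<forall>j<2*N. g j \<in> VV N) \<and>
     (\<forall>i<2*N. \<forall>j<2*N. om (g i) (g j) = om (bas i) (bas j))}"

text \<open>The symplectic adjoint: a coordinate of \<open>v\<close> in the basis of columns of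
  \<open>g\<close> is, up to sign, the pairing of \<open>v\<close> with the dual column. The inverse
  is thus linear in the entries of \<open>g\<close>, and its continuity is immediate.\<close>

definition inv_app :: "'k::real_normed_field elt \<Rightarrow> (nat \<Rightarrow> 'k) \<Rightarrow> nat \<Rightarrow> 'k" where
  "inv_app g v = (\<lambda>i. if i < 2*N then (if even i then om v (g (i+1)) else - om v (g (i-1))) else v i)"

definition inv' :: "'k::real_normed_field elt \<Rightarrow> nat \<Rightarrow> nat \<Rightarrow> 'k" where
  "inv' g = (\<lambda>j. inv_app g (bas j))"

lemma om_lin [simp]:
  "om (\<lambda>i. f i + h i) w = om f w + om h w"
  "om (\<lambda>i. f i - h i) w = om f w - om h w"
  "om (\<lambda>i. c * f i) w = c * om f w"
  "om (\<lambda>i. f i * c) w = om f w * c"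
  "om (\<lambda>i. f i / c) w = om f w / c"
  "om (\<lambda>i. - f i) w = - om f w"
  "om (\<lambda>i. 0) w = 0"
  "om w (\<lambda>i. f i + h i) = om w f + om w h"
  "om w (\<lambda>i. f i - h i) = om w f - om w h"
  "om w (\<lambda>i. c * f i) = c * om w f"
  "om w (\<lambda>i. f i * c) = om w f * c"
  "om w (\<lambda>i. f i / c) = om w f / c"
  "om w (\<lambda>i. - f i) = - om w f"
  "om w (\<lambda>i. 0) = 0"
  by (simp_all add: om_def algebra_simps sum.distrib sum_subtractf sum_distrib_left sum_distrib_right sum_negf sum_divide_distrib diff_divide_distrib)

lemma om_sum [simp]:
  "om (\<lambda>i. \<Sum>j\<in>J. f j i) w = (\<Sum>j\<in>J. om (f j) w)"
  "om w (\<lambda>i. \<Sum>j\<in>J. f j i) = (\<Sum>j\<in>J. om w (f j))"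
proof -
  have "(\<lambda>i. \<Sum>j\<in>J. f j i) = (\<Sum>j\<in>J. f j)" by (induction J rule: infinite_finite_induct) (auto simp: fun_eq_iff)
  moreover have "om (\<Sum>j\<in>J. f j) w = (\<Sum>j\<in>J. om (f j) w)"
    by (induction J rule: infinite_finite_induct) (auto simp: plus_fun_def zero_fun_def)
  moreover have "om w (\<Sum>j\<in>J. f j) = (\<Sum>j\<in>J. om w (f j))"
    by (induction J rule: infinite_finite_induct) (auto simp: plus_fun_def zero_fun_def)
  ultimately show "om (\<lambda>i. \<Sum>j\<in>J. f j i) w = (\<Sum>j\<in>J. om (f j) w)"
    "om w (\<lambda>i. \<Sum>j\<in>J. f j i) = (\<Sum>j\<in>J. om w (f j))" by simp_all
qed

lemma om_anti: "om w v = - om v w"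
  by (simp add: om_def algebra_simps flip: sum_negf)

lemma om_self [simp]: "om v v = 0"
  by (simp add: om_def algebra_simps)

lemma om_cong: "(\<And>i. i < 2*N \<Longrightarrow> v i = v' i) \<Longrightarrow> (\<And>i. i < 2*N \<Longrightarrow> w i = w' i) \<Longrightarrow> om v w = om v' w'"
  unfolding om_def by (intro sum.cong) auto

lemma om_bas [simp]:
  "om v (bas j) = (if j < 2*N then (if even j then - v (j+1) else v (j-1)) else 0)"
  "om (bas j) v = (if j < 2*N then (if even j then v (j+1) else - v (j-1)) else 0)"
proof -
  have A: "om v (bas j) = (if j < 2*N then (if even j then - v (j+1) else v (j-1)) else 0)" for v :: "nat \<Rightarrow> 'a"
  proof (cases "even j")
    case True
    then obtain a where a: "j = 2*a" by auto
    have "om v (bas j) = (\<Sum>i<N. if i = a then - v (2*a+1) else 0)"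
      unfolding om_def bas_def a by (intro sum.cong refl) (auto simp: Suc_double_not_eq_double double_not_eq_Suc_double)
    then show ?thesis using a by (simp add: sum.delta)
  next
    case False
    then obtain a where a: "j = 2*a+1" by (auto elim: oddE)
    have "om v (bas j) = (\<Sum>i<N. if i = a then v (2*a) else 0)"
      unfolding om_def bas_def a by (intro sum.cong refl) (auto simp: Suc_double_not_eq_double double_not_eq_Suc_double)
    then show ?thesis using a by (simp add: sum.delta)
  qed
  show "om v (bas j) = (if j < 2*N then (if even j then - v (j+1) else v (j-1)) else 0)" by (rule A)
  show "om (bas j) v = (if j < 2*N then (if even j then v (j+1) else - v (j-1)) else 0)"
    by (subst om_anti, subst A) auto
qed

lemma app_lin [simp]:
  "app g (\<lambda>i. f i + h i) = (\<lambda>i. app g f i + app g h i)"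
  "app g (\<lambda>i. f i - h i) = (\<lambda>i. app g f i - app g h i)"
  "app g (\<lambda>i. c * f i) = (\<lambda>i. c * app g f i)"
  "app g (\<lambda>i. f i * c) = (\<lambda>i. app g f i * c)"
  "app g (\<lambda>i. f i / c) = (\<lambda>i. app g f i / c)"
  "app g (\<lambda>i. - f i) = (\<lambda>i. - app g f i)"
  "app g (\<lambda>i. 0) = (\<lambda>i. 0)"
  by (auto simp: app_def sum.distrib sum_subtractf sum_distrib_left sum_distrib_right sum_negf sum_divide_distrib fun_eq_iff
      distrib_left distrib_right left_diff_distrib right_diff_distrib mult.assoc mult.left_commute intro!: sum.cong)

lemma app_bas: "j < 2*N \<Longrightarrow> g j \<in> VV N \<Longrightarrow> app g (bas j) = g j"
proof
  fix i assume j: "j < 2*N" and g: "g j \<in> VV N"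
  have "(\<Sum>l<2*N. bas j l * g l i) = (\<Sum>l<2*N. if l = j then g j i else 0)"
    by (intro sum.cong) (auto simp: bas_def)
  then show "app g (bas j) i = g j i" using j g by (auto simp: app_def VV_def bas_def)
qed

lemma app_bas_ge: "j \<ge> 2*N \<Longrightarrow> app g (bas j) = bas j"
proof
  fix i assume j: "j \<ge> 2*N"
  have "(\<Sum>l<2*N. bas j l * g l i) = 0" if "i < 2*N"
    using j by (intro sum.neutral) (auto simp: bas_def)
  then show "app g (bas j) i = bas j i" using j by (auto simp: app_def bas_def)
qed

lemma GG_ge: "g \<in> GG r \<Longrightarrow> j \<ge> 2*r \<Longrightarrow> g j = bas j"
  unfolding GG_def by blast

lemma GG_om: "g \<in> GG r \<Longrightarrow> i < 2*N \<Longrightarrow> j < 2*N \<Longrightarrow> om (g i) (g j) = om (bas i) (bas j)"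
  unfolding GG_def by blast

lemma GG_V: "g \<in> GG r \<Longrightarrow> j < 2*N \<Longrightarrow> g j \<in> VV N" unfolding GG_def by blast

lemma GG_app_bas: "g \<in> GG r \<Longrightarrow> r \<le> N \<Longrightarrow> app g (bas j) = g j"
  by (cases "j < 2*N") (simp_all add: app_bas GG_V app_bas_ge GG_ge[of g r])

lemma app_mul: "app (mul g h) v = app g (app h v)"
proof
  fix i
  show "app (mul g h) v i = app g (app h v) i"
  proof (cases "i < 2*N")
    case True
    have "(\<Sum>j<2*N. v j * (\<Sum>l<2*N. h j l * g l i)) = (\<Sum>l<2*N. (\<Sum>j<2*N. v j * h j l) * g l i)"
      by (simp add: sum_distrib_left sum_distrib_right mult.assoc) (rule sum.swap)
    then show ?thesis using True by (simp add: app_def mul_def)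
  qed (simp add: app_def mul_def)
qed

lemma mul_assoc: "mul (mul g h) k = mul g (mul h k)"
proof
  fix j
  have "mul (mul g h) k j = app (mul g h) (k j)" unfolding mul_def[of "mul g h"] ..
  also have "\<dots> = app g (mul h k j)" unfolding app_mul mul_def[of h] ..
  also have "\<dots> = mul g (mul h k) j" unfolding mul_def[of g] ..
  finally show "mul (mul g h) k j = mul g (mul h k) j" .
qed

lemma om_app:
  assumes "g \<in> GG r" "r \<le> N"
  shows "om (app g v) (app g w) = om v w"
proof -
  define e where "e u = (\<lambda>i. \<Sum>j<2*N. u j * (if i < 2*N then bas j i else 0::'a))" for u :: "nat \<Rightarrow> 'a"
  define e' where "e' u = (\<lambda>i. \<Sum>j<2*N. u j * bas j i)" for u :: "nat \<Rightarrow> 'a"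
  define f where "f u = (\<lambda>i. \<Sum>j<2*N. u j * g j i)" for u :: "nat \<Rightarrow> 'a"
  have e': "e' u i = u i" if "i < 2*N" for u i
    using that by (simp add: e'_def bas_def sum.delta if_distrib[of "\<lambda>x. u _ * x"] cong: if_cong)
  have "om (app g v) (app g w) = om (f v) (f w)"
    by (intro om_cong) (auto simp: app_def f_def)
  also have "\<dots> = (\<Sum>j<2*N. \<Sum>l<2*N. v j * w l * om (g j) (g l))"
    by (simp add: f_def sum_distrib_left mult.assoc)
  also have "\<dots> = (\<Sum>j<2*N. \<Sum>l<2*N. v j * w l * om (bas j) (bas l))"
    using assms(1) by (intro sum.cong refl) (simp add: GG_om[OF assms(1)] del: om_bas)
  also have "\<dots> = om (e' v) (e' w)"
    unfolding e'_def om_sum om_lin by (simp only: sum_distrib_left mult.assoc)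
  also have "\<dots> = om v w" by (intro om_cong) (auto simp: e')
  finally show ?thesis .
qed


lemma mul_apply: "mul g h j = app g (h j)" by (simp add: mul_def)

lemma om_expand: "om v w = (\<Sum>j<2*N. v j * om (bas j) w)"
proof -
  have "om v w = om (\<lambda>i. \<Sum>j<2*N. v j * bas j i) w"
    by (intro om_cong) (simp_all add: bas_def sum.delta if_distrib[of "\<lambda>x. v _ * x"] cong: if_cong)
  also have "\<dots> = (\<Sum>j<2*N. v j * om (bas j) w)" by (simp only: om_sum om_lin)
  finally show ?thesis .
qed

lemma inv_app_app:
  assumes "g \<in> GG r" "r \<le> N"
  shows "inv_app g (app g v) = v"
proof
  fix i
  have *: "om (app g v) (g j) = om v (bas j)" for j
    using om_app[OF assms, of v "bas j"] GG_app_bas[OF assms, of j] by simp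
  show "inv_app g (app g v) i = v i"
  proof (cases "i < 2*N")
    case True
    then show ?thesis
      by (cases "even i") (auto simp: inv_app_def * elim!: evenE)
  qed (simp add: inv_app_def app_def)
qed

lemma inv_app_expand: "i < 2*N \<Longrightarrow> inv_app g v i = (\<Sum>l<2*N. v l * inv_app g (bas l) i)"
  by (simp add: inv_app_def om_expand[of v] sum_negf del: om_bas)

text \<open>Preservation of the form yields a left inverse directly. For the other side a left
  inverse of a square matrix is a right inverse, hence the passage to the matrices \<open>A\<close>
  and \<open>B\<close> of size \<open>2*N\<close>.\<close>

lemma app_inv_app:
  assumes "g \<in> GG r" "r \<le> N"
  shows "app g (inv_app g v) = v"
proof
  fix i
  define A where "A = mat (2*N) (2*N) (\<lambda>(i,j). g j i)"
  define B where "B = mat (2*N) (2*N) (\<lambda>(i,j). inv_app g (bas j) i)"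
  have c: "A \<in> carrier_mat (2*N) (2*N)" "B \<in> carrier_mat (2*N) (2*N)" by (auto simp: A_def B_def)
  have "B * A = 1\<^sub>m (2*N)"
  proof (rule eq_matI)
    fix i j assume ij: "i < dim_row (1\<^sub>m (2*N))" "j < dim_col (1\<^sub>m (2*N))"
    have "(B * A) $$ (i,j) = (\<Sum>l<2*N. g j l * inv_app g (bas l) i)"
      using ij by (simp add: A_def B_def scalar_prod_def lessThan_atLeast0 mult.commute)
    also have "\<dots> = inv_app g (app g (bas j)) i"
      using ij by (subst inv_app_expand) (auto simp: GG_app_bas[OF assms])
    also have "\<dots> = bas j i" by (simp add: inv_app_app[OF assms])
    finally show "(B * A) $$ (i,j) = 1\<^sub>m (2*N) $$ (i,j)" using ij by (auto simp: bas_def)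
  qed (auto simp: A_def B_def)
  then have AB: "A * B = 1\<^sub>m (2*N)" by (rule mat_mult_left_right_inverse[OF c(2,1)])
  show "app g (inv_app g v) i = v i"
  proof (cases "i < 2*N")
    case True
    have *: "(\<Sum>l<2*N. inv_app g (bas j) l * g l i) = bas j i" if "j < 2*N" for j
    proof -
      have "(A * B) $$ (i,j) = (\<Sum>l<2*N. inv_app g (bas j) l * g l i)"
        using True that by (simp add: A_def B_def scalar_prod_def lessThan_atLeast0 mult.commute)
      then show ?thesis using AB True that by (auto simp: bas_def)
    qed
    have "app g (inv_app g v) i = (\<Sum>l<2*N. (\<Sum>j<2*N. v j * inv_app g (bas j) l) * g l i)"
      using True by (simp add: app_def) (intro sum.cong refl, subst inv_app_expand, auto)
    also have "\<dots> = (\<Sum>j<2*N. v j * (\<Sum>l<2*N. inv_app g (bas j) l * g l i))"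
      by (simp add: sum_distrib_left sum_distrib_right mult.assoc) (rule sum.swap)
    also have "\<dots> = (\<Sum>j<2*N. v j * bas j i)" by (intro sum.cong) (auto simp: *)
    also have "\<dots> = v i" using True
      by (simp add: bas_def sum.delta if_distrib[of "\<lambda>x. v _ * x"] cong: if_cong)
    finally show ?thesis .
  qed (simp add: app_def inv_app_def)
qed

lemma app_one [simp]: "app bas v = v"
proof
  fix i show "app bas v i = v i"
    by (simp add: app_def bas_def sum.delta if_distrib[of "\<lambda>x. v _ * x"] cong: if_cong)
qed

lemma app_inv: "app (inv' g) v = inv_app g v"
proof
  fix i show "app (inv' g) v i = inv_app g v i"
  proof (cases "i < 2*N")
    case True
    then show ?thesis by (simp add: app_def inv'_def inv_app_expand[of i g v])
  qed (simp add: app_def inv_app_def)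
qed

lemma GGI: "(\<And>j. j \<ge> 2*r \<Longrightarrow> g j = bas j) \<Longrightarrow> (\<And>j. j < 2*N \<Longrightarrow> g j \<in> VV N) \<Longrightarrow>
  (\<And>i j. i < 2*N \<Longrightarrow> j < 2*N \<Longrightarrow> om (g i) (g j) = om (bas i) (bas j)) \<Longrightarrow> g \<in> GG r"
  unfolding GG_def by blast

lemma bas_VV: "j < 2*r \<Longrightarrow> bas j \<in> VV r"
  by (auto simp: VV_def bas_def)

lemma one_GG: "bas \<in> GG r"
  by (intro GGI) (auto simp: bas_VV simp del: om_bas)

lemma mul_one: "g \<in> GG r \<Longrightarrow> r \<le> N \<Longrightarrow> mul g bas = g"
  by (auto simp: mul_def GG_app_bas)

lemma one_mul [simp]: "mul bas g = g"
  by (auto simp: mul_def)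

lemma inv_mul: 
  assumes "g \<in> GG r" "r \<le> N"
  shows "mul (inv' g) g = bas"
proof
  fix j show "mul (inv' g) g j = bas j"
    using inv_app_app[OF assms, of "bas j"] by (simp add: mul_def app_inv GG_app_bas[OF assms])
qed

lemma mul_inv: "g \<in> GG r \<Longrightarrow> r \<le> N \<Longrightarrow> mul g (inv' g) = bas"
  by (auto simp: mul_def inv'_def app_inv_app)

lemma VV_mono: "r \<le> r' \<Longrightarrow> VV r \<subseteq> VV r'" unfolding VV_def by auto

text \<open>The element fixes the basis vectors from \<open>2*r\<close> on and preserves the form,
  so the image of \<open>v\<close> pairs to zero with them just as \<open>v\<close> does.\<close>

lemma app_VV:
  assumes "g \<in> GG r" "r \<le> N" "v \<in> VV r"
  shows "app g v \<in> VV r"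
  unfolding VV_def
proof safe
  fix i assume i: "i \<ge> 2*r"
  show "app g v i = 0"
  proof (cases "i < 2*N")
    case True
    \<comment> \<open>The index dual to \<open>i\<close> under the form. It belongs to the same pair
      of coordinates, so it is again at least \<open>2*r\<close>.\<close>
    define i' where "i' = (if even i then i+1 else i-1)"
    have i': "i' < 2*N" "i' \<ge> 2*r" using True i by (auto simp: i'_def elim!: evenE oddE)
    have "om (app g v) (bas i') = om v (bas i')"
      using om_app[OF assms(1,2), of v "bas i'"] GG_app_bas[OF assms(1,2), of i'] GG_ge[OF assms(1) i'(2)] by simp
    moreover have "om v (bas i') = 0" using assms(3) i' i by (auto simp: VV_def i'_def)
    ultimately have "om (app g v) (bas i') = 0" by simp
    then show ?thesis using i' i by (auto simp: i'_def split: if_splits)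
  next
    case False then show ?thesis using assms(3) i by (simp add: app_def VV_def)
  qed
qed

lemma app_fix:
  assumes "g \<in> GG r" "r \<le> N" "\<And>i. i < 2*r \<Longrightarrow> v i = 0"
  shows "app g v = v"
proof
  fix i show "app g v i = v i"
  proof (cases "i < 2*N")
    case True
    have "(\<Sum>j<2*N. v j * g j i) = (\<Sum>j<2*N. v j * bas j i)"
    proof (intro sum.cong refl)
      fix j show "v j * g j i = v j * bas j i"
        using assms(3)[of j] GG_ge[OF assms(1), of j] by (cases "j < 2*r") auto
    qed
    also have "\<dots> = v i" using True by (simp add: bas_def sum.delta if_distrib[of "\<lambda>x. v _ * x"] cong: if_cong)
    finally show ?thesis using True by (simp add: app_def)
  qed (simp add: app_def)
qed

lemma mul_GG:
  assumes "g \<in> GG r" "h \<in> GG r" "r \<le> N"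
  shows "mul g h \<in> GG r"
proof (rule GGI)
  have gN: "g \<in> GG N" if "g \<in> GG r" for g :: "'a elt"
    using that assms(3) unfolding GG_def by auto
  fix j show "j \<ge> 2*r \<Longrightarrow> mul g h j = bas j"
    using assms by (simp add: mul_def GG_ge[of h r] GG_app_bas[of g r] GG_ge[of g r])
  show "j < 2*N \<Longrightarrow> mul g h j \<in> VV N"
    using GG_V[OF assms(2)] app_VV[OF gN[OF assms(1)]] by (simp add: mul_def)
next
  fix i j assume "i < 2*N" "j < 2*N"
  then show "om (mul g h i) (mul g h j) = om (bas i) (bas j)"
    using om_app[OF assms(1,3)] GG_om[OF assms(2)] by (simp add: mul_def del: om_bas)
qed

lemma GG_mono: assumes "r \<le> r'" shows "GG r \<subseteq> GG r'"
proof
  fix g :: "'a elt" assume "g \<in> GG r"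
  with assms show "g \<in> GG r'" unfolding GG_def by auto
qed

lemma inv_app_VV:
  assumes "v \<in> VV N"
  shows "inv_app g v \<in> VV N"
  using assms unfolding VV_def inv_app_def by auto

lemma inv_GG:
  assumes "g \<in> GG r" "r \<le> N"
  shows "inv' g \<in> GG r"
proof (rule GGI)
  fix j show "j \<ge> 2*r \<Longrightarrow> inv' g j = bas j"
    using inv_app_app[OF assms, of "bas j"] GG_app_bas[OF assms, of j] GG_ge[OF assms(1), of j] by (simp add: inv'_def)
  show "j < 2*N \<Longrightarrow> inv' g j \<in> VV N" by (simp add: inv'_def inv_app_VV bas_VV)
next
  fix i j assume "i < 2*N" "j < 2*N"
  show "om (inv' g i) (inv' g j) = om (bas i) (bas j)"
    using om_app[OF assms, of "inv' g i" "inv' g j"] by (simp add: inv'_def app_inv_app[OF assms] del: om_bas)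
qed

lemma mul_cancel: 
  assumes "g \<in> GG r" "r \<le> N"
  shows "mul (inv' g) (mul g h) = h" "mul g (mul (inv' g) h) = h"
  using assms by (simp_all flip: mul_assoc add: inv_mul mul_inv)

section \<open>Symplectic frames and Gram-Schmidt\<close>

definition ap :: "'k::real_normed_field elt \<Rightarrow> 'k pair \<Rightarrow> 'k pair" where
  "ap g p = (app g (fst p), app g (snd p))"

lemma ap_simps [simp]: "fst (ap g p) = app g (fst p)" "snd (ap g p) = app g (snd p)"
  by (simp_all add: ap_def)

text \<open>For a symplectic frame this is the projection onto the symplectic complement of its
  span. Throughout, \<open>prj F y = (\<lambda>_. 0)\<close> expresses that \<open>y\<close> lies in
  the span of \<open>F\<close>.\<close>

fun prj :: "'k::real_normed_field pair list \<Rightarrow> (nat \<Rightarrow> 'k) \<Rightarrow> nat \<Rightarrow> 'k" where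
  "prj [] y = y"
| "prj (n # F) y = (\<lambda>i. prj F y i - om y (snd n) * fst n i + om y (fst n) * snd n i)"

definition perp :: "(nat \<Rightarrow> 'k::real_normed_field) \<Rightarrow> 'k pair list \<Rightarrow> bool" where
  "perp y F \<longleftrightarrow> (\<forall>n\<in>set F. om y (fst n) = 0 \<and> om y (snd n) = 0)"

fun sframe :: "nat \<Rightarrow> 'k::real_normed_field pair list \<Rightarrow> bool" where
  "sframe r [] = True"
| "sframe r (n # F) = (sframe r F \<and> fst n \<in> VV r \<and> snd n \<in> VV r \<and> om (fst n) (snd n) = 1 \<and>
     perp (fst n) F \<and> perp (snd n) F)"

lemma perp_nth: "perp y F \<longleftrightarrow> (\<forall>i<length F. om y (fst (F!i)) = 0 \<and> om y (snd (F!i)) = 0)"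
  by (simp add: perp_def all_set_conv_all_nth)

lemma perp_Nil [simp]: "perp y []" by (simp add: perp_def)
lemma perp_Cons [simp]: "perp y (n # F) \<longleftrightarrow> om y (fst n) = 0 \<and> om y (snd n) = 0 \<and> perp y F" by (auto simp: perp_def)

lemma prj_lin [simp]:
  "prj F (\<lambda>i. f i + h i) = (\<lambda>i. prj F f i + prj F h i)"
  "prj F (\<lambda>i. f i - h i) = (\<lambda>i. prj F f i - prj F h i)"
  "prj F (\<lambda>i. c * f i) = (\<lambda>i. c * prj F f i)"
  "prj F (\<lambda>i. f i * c) = (\<lambda>i. prj F f i * c)"
  "prj F (\<lambda>i. f i / c) = (\<lambda>i. prj F f i / c)"
  "prj F (\<lambda>i. - f i) = (\<lambda>i. - prj F f i)"
  "prj F (\<lambda>i. 0) = (\<lambda>i. 0)"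
  by (induction F) (auto simp: fun_eq_iff algebra_simps diff_divide_distrib add_divide_distrib)

lemma VV_lin [simp]:
  "f \<in> VV r \<Longrightarrow> h \<in> VV r \<Longrightarrow> (\<lambda>i. f i + h i) \<in> VV r"
  "f \<in> VV r \<Longrightarrow> h \<in> VV r \<Longrightarrow> (\<lambda>i. f i - h i) \<in> VV r"
  "f \<in> VV r \<Longrightarrow> (\<lambda>i. c * f i) \<in> VV r"
  "f \<in> VV r \<Longrightarrow> (\<lambda>i. f i / c) \<in> VV r"
  by (auto simp: VV_def)

lemma prj_VV: "sframe r F \<Longrightarrow> y \<in> VV r \<Longrightarrow> prj F y \<in> VV r"
  by (induction F) auto

lemma prj_perp_id: "perp y F \<Longrightarrow> prj F y = y"
  by (induction F) auto

lemma om_zero_sym: "om v w = 0 \<longleftrightarrow> om w v = 0"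
  by (subst om_anti) simp

lemma om_prj_perp: "perp z F \<Longrightarrow> om (prj F y) z = om y z"
proof (induction F)
  case (Cons n F)
  then have "om (fst n) z = 0" "om (snd n) z = 0" by (auto simp: om_zero_sym)
  then show ?case using Cons by simp
qed simp

lemma om_perp_prj: "perp z F \<Longrightarrow> om z (prj F y) = om z y"
  using om_prj_perp[of z F y] by (subst (1 2) om_anti) simp

lemma perp_prj: "sframe r F \<Longrightarrow> perp (prj F y) F"
proof (induction F)
  case (Cons n F)
  have 1: "om (prj F y) (fst n) = om y (fst n)" "om (prj F y) (snd n) = om y (snd n)"
    using Cons.prems by (auto intro: om_prj_perp)
  have 2: "om (snd n) (fst n) = -1" using Cons.prems by (subst om_anti) auto
  have 3: "perp (prj F y) F" "perp (fst n) F" "perp (snd n) F" using Cons by auto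
  then have "perp (prj (n # F) y) F" by (auto simp: perp_def)
  then show ?case using 1 2 Cons.prems by simp
qed simp

lemma om_prj_prj: "sframe r F \<Longrightarrow> om (prj F y) (prj F z) = om (prj F y) z"
  by (intro om_perp_prj perp_prj)

lemma om_prj_prj': "sframe r F \<Longrightarrow> om (prj F y) (prj F z) = om y (prj F z)"
  by (intro om_prj_perp perp_prj)

lemma om_ap [simp]: "g \<in> GG r \<Longrightarrow> r \<le> N \<Longrightarrow> om (app g v) (app g w) = om v w"
  by (rule om_app)

lemma prj_ap: "g \<in> GG r \<Longrightarrow> r \<le> N \<Longrightarrow> prj (map (ap g) F) (app g y) = app g (prj F y)"
  by (induction F) (auto simp: ap_def)

text \<open>The trace of a projection is its rank, and here it replaces a dimension count. The
  operator sending \<open>y\<close> to \<open>om y w\<close> times \<open>v\<close> has trace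
  \<open>om v w\<close>, so each pair of the frame takes two from the trace.\<close>

lemma trace_prj: "sframe r F \<Longrightarrow> r \<le> N \<Longrightarrow> (\<Sum>j<2*r. prj F (bas j) j) = of_nat (2*r) - 2 * of_nat (length F)"
proof (induction F)
  case Nil show ?case by (simp add: bas_def)
next
  case (Cons n F)
  have tr: "(\<Sum>j<2*r. om (bas j) w * v j) = om v w" if "v \<in> VV r" for v w :: "nat \<Rightarrow> 'a"
  proof -
    have "om v w = (\<Sum>j<2*N. v j * om (bas j) w)" by (rule om_expand)
    also have "\<dots> = (\<Sum>j<2*r. v j * om (bas j) w)"
      using that Cons.prems(2) by (intro sum.mono_neutral_right) (auto simp: VV_def)
    finally show ?thesis by (simp add: mult.commute del: om_bas)
  qed
  have "om (snd n) (fst n) = -1" using Cons.prems by (subst om_anti) auto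
  then show ?case using Cons tr[of "fst n" "snd n"] tr[of "snd n" "fst n"]
    by (simp add: sum.distrib sum_subtractf del: om_bas)
qed

text \<open>The form on the pair after projection to the complement of the frame. It is non-zero
  exactly when Gram-Schmidt can continue with this pair.\<close>

definition dsc :: "'k::real_normed_field pair list \<Rightarrow> 'k pair \<Rightarrow> 'k" where
  "dsc F p = om (prj F (fst p)) (prj F (snd p))"

lemma dsc_ap: "g \<in> GG r \<Longrightarrow> r \<le> N \<Longrightarrow> dsc (map (ap g) F) (ap g p) = dsc F p"
  by (simp add: dsc_def ap_def[of g p] prj_ap)

lemma dsc_app: "g \<in> GG r \<Longrightarrow> r \<le> N \<Longrightarrow> dsc (map (ap g) F) (app g v, app g w) = dsc F (v, w)"
  using dsc_ap[of g r F "(v, w)"] by (simp add: ap_def[of g "(_, _)"])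

text \<open>The diagonal entry at \<open>j\<close> of the matrix of \<open>prj F\<close> is, up to
  sign, the discriminant of \<open>bas j\<close> and its dual basis vector. If all discriminants
  vanished, so would the trace, which is non-zero for a short frame in characteristic zero.\<close>

lemma nondeg_bas:
  assumes F: "sframe r (F :: 'k::real_normed_field pair list)" and r: "r \<le> N" and len: "length F < r"
  shows "\<exists>i<2*r. \<exists>j<2*r. dsc F (bas i, bas j) \<noteq> 0"
proof (rule ccontr)
  assume "\<not> ?thesis"
  then have *: "om (prj F (bas i)) (bas j) = 0" if "i < 2*r" "j < 2*r" for i j
    using that om_prj_prj[OF F] by (auto simp: dsc_def)
  have "prj F (bas j) j = 0" if "j < 2*r" for j
  proof (cases "even j")
    case True
    then have "j+1 < 2*r" using that by presburger
    then show ?thesis using *[OF that, of "j+1"] True r by simp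
  next
    case False
    then show ?thesis using *[OF that, of "j-1"] that r by (auto elim!: oddE)
  qed
  then have "(\<Sum>j<2*r. prj F (bas j) j) = 0" by simp
  with trace_prj[OF F r] have "of_nat (2*r) = (of_nat (2 * length F) :: 'k)" by simp
  then show False using len by (simp only: of_nat_eq_iff)
qed

lemma dsc_bilin: 
  fixes n m :: nat
  shows "dsc F (\<lambda>i. \<Sum>j<n. v j * f j i, \<lambda>i. \<Sum>j<m. w j * h j i) = (\<Sum>j<n. \<Sum>l<m. v j * w l * dsc F (f j, h l))"
proof -
  have P: "prj F (\<lambda>i. \<Sum>j<n. v j * f j i) = (\<lambda>i. \<Sum>j<n. v j * prj F (f j) i)" for n :: nat and v f
    by (induction n) simp_all
  show ?thesis unfolding dsc_def fst_conv snd_conv P om_sum om_lin by (simp add: sum_distrib_left mult.assoc)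
qed

lemma app_VV_sum: 
  assumes "g \<in> GG r" "r \<le> N" "v \<in> VV r"
  shows "app g v = (\<lambda>i. \<Sum>j<2*r. v j * g j i)"
proof
  fix i
  have g: "g j \<in> VV r" if "j < 2*r" for j
    using app_VV[OF assms(1,2) bas_VV[OF that]] GG_app_bas[OF assms(1,2), of j] by simp
  show "app g v i = (\<Sum>j<2*r. v j * g j i)"
  proof (cases "i < 2*N")
    case True
    have "(\<Sum>j<2*N. v j * g j i) = (\<Sum>j<2*r. v j * g j i)"
      using assms(2,3) by (intro sum.mono_neutral_right) (auto simp: VV_def)
    then show ?thesis using True by (simp add: app_def)
  next
    case False
    then have "v i = 0" "\<And>j. j < 2*r \<Longrightarrow> g j i = 0" using g assms by (auto simp: VV_def)
    then show ?thesis using False by (simp add: app_def)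
  qed
qed

text \<open>The columns of \<open>g\<close> span \<open>VV r\<close>, so a bilinear form that
  vanished on them would vanish on the standard basis.\<close>

lemma nondeg:
  assumes F: "sframe r F" and r: "r \<le> N" and len: "length F < r" and g: "g \<in> GG r"
  shows "\<exists>i<2*r. \<exists>j<2*r. dsc F (g i, g j) \<noteq> 0"
proof (rule ccontr)
  assume "\<not> ?thesis"
  then have *: "dsc F (g i, g j) = 0" if "i < 2*r" "j < 2*r" for i j
    using that by auto
  obtain i j where ij: "i < 2*r" "j < 2*r" "dsc F (bas i, bas j) \<noteq> 0" using nondeg_bas[OF F r len] by auto
  have e: "bas i = (\<lambda>l. \<Sum>j<2*r. inv' g i j * g j l)" if "i < 2*r" for i
  proof -
    have "app (inv' g) (bas i) = inv' g i" unfolding app_inv unfolding inv'_def ..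
    then have "inv' g i \<in> VV r" using app_VV[OF inv_GG[OF g r] r bas_VV[OF that]] by simp
    then have "app g (inv' g i) = (\<lambda>l. \<Sum>j<2*r. inv' g i j * g j l)" by (rule app_VV_sum[OF g r])
    then show ?thesis by (simp add: inv'_def app_inv_app[OF g r])
  qed
  have "dsc F (bas i, bas j) = 0"
    unfolding e[OF ij(1)] e[OF ij(2)] dsc_bilin by (intro sum.neutral ballI) (auto simp: *)
  with ij show False by simp
qed


definition inV :: "nat \<Rightarrow> 'k::real_normed_field pair \<Rightarrow> bool" where
  "inV r p \<longleftrightarrow> fst p \<in> VV r \<and> snd p \<in> VV r"

text \<open>Only the second vector is rescaled: no square root is taken, and the step is continuous
  wherever the discriminant is non-zero.\<close>

definition stp :: "'k::real_normed_field pair list \<Rightarrow> 'k pair \<Rightarrow> 'k pair list" where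
  "stp F p = (prj F (fst p), \<lambda>i. prj F (snd p) i / dsc F p) # F"

text \<open>The newest pair is at the head of the list, both for \<open>gs\<close> and for the frames it produces.\<close>

fun gs :: "'k::real_normed_field pair list \<Rightarrow> 'k pair list" where
  "gs [] = []"
| "gs (p # L) = stp (gs L) p"

fun good :: "'k::real_normed_field pair list \<Rightarrow> bool" where
  "good [] = True"
| "good (p # L) = (good L \<and> dsc (gs L) p \<noteq> 0)"

lemma length_stp [simp]: "length (stp F p) = Suc (length F)" by (simp add: stp_def)

lemma length_gs [simp]: "length (gs L) = length L"
  by (induction L) auto

lemma sframe_stp:
  assumes "sframe r F" "inV r p" "dsc F p \<noteq> 0"
  shows "sframe r (stp F p)"
proof -
  have "perp (\<lambda>i. prj F (snd p) i / dsc F p) F"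
    using perp_prj[OF assms(1), of "snd p"] by (auto simp: perp_def)
  then show ?thesis
    using assms perp_prj[OF assms(1)] by (simp add: stp_def prj_VV inV_def) (simp add: dsc_def)
qed

lemma sframe_gs: "good L \<Longrightarrow> (\<forall>p\<in>set L. inV r p) \<Longrightarrow> sframe r (gs L)"
  by (induction L) (auto intro: sframe_stp)

lemma stp_ap:
  assumes "g \<in> GG r" "r \<le> N"
  shows "stp (map (ap g) F) (ap g p) = map (ap g) (stp F p)"
proof -
  show ?thesis by (simp add: stp_def dsc_ap[OF assms] prj_ap[OF assms] ap_def[of g "(_,_)"])
qed

lemma gs_ap: "g \<in> GG r \<Longrightarrow> r \<le> N \<Longrightarrow> gs (map (ap g) L) = map (ap g) (gs L)"
  by (induction L) (simp_all add: stp_ap)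

lemma good_ap: "g \<in> GG r \<Longrightarrow> r \<le> N \<Longrightarrow> good (map (ap g) L) = good L"
  by (induction L) (simp_all add: gs_ap dsc_ap)

lemma inV_ap: "g \<in> GG r \<Longrightarrow> r \<le> N \<Longrightarrow> inV r p \<Longrightarrow> inV r (ap g p)"
  by (auto simp: inV_def ap_def app_VV)

text \<open>In terms of spans: the new frame spans both vectors of \<open>p\<close> and everything
  that the old frame spanned.\<close>

lemma prj_stp:
  assumes "sframe r F" "dsc F p \<noteq> 0"
  shows "prj (stp F p) (fst p) = (\<lambda>_. 0)" "prj (stp F p) (snd p) = (\<lambda>_. 0)"
    "prj F y = (\<lambda>_. 0) \<Longrightarrow> prj (stp F p) y = (\<lambda>_. 0)"
proof -
  have d: "om (fst p) (prj F (snd p)) = dsc F p"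
    by (simp only: dsc_def om_prj_prj'[OF assms(1)])
  have d0: "om z (prj F z) = 0" for z
    using om_prj_prj'[OF assms(1), of z z] by simp
  have d2: "om (snd p) (prj F (fst p)) = - dsc F p"
    using om_prj_prj'[OF assms(1), of "snd p" "fst p"] om_anti[of "prj F (snd p)" "prj F (fst p)"] by (simp add: dsc_def)
  show "prj (stp F p) (fst p) = (\<lambda>_. 0)" using assms(2) d by (simp add: stp_def d0)
  show "prj (stp F p) (snd p) = (\<lambda>_. 0)" using assms(2) d d2 by (simp add: stp_def d0)
  assume y: "prj F y = (\<lambda>_. 0)"
  then have "om y (prj F z) = 0" for z
    using om_prj_prj'[OF assms(1), of y z] by simp
  then show "prj (stp F p) y = (\<lambda>_. 0)" using y by (simp add: stp_def)
qed

lemma prj_gs: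
  assumes "good L" "\<forall>p\<in>set L. inV r p" "p \<in> set L"
  shows "prj (gs L) (fst p) = (\<lambda>_. 0) \<and> prj (gs L) (snd p) = (\<lambda>_. 0)"
  using assms
proof (induction L)
  case (Cons q L)
  then have s: "sframe r (gs L)" and d: "dsc (gs L) q \<noteq> 0" by (auto intro: sframe_gs)
  show ?case using Cons prj_stp[OF s d] by auto
qed simp

lemma perp_gs: "perp z L \<Longrightarrow> perp z (gs L)"
proof (induction L)
  case (Cons p L)
  then show ?case using om_perp_prj[of z "gs L"] by (simp add: stp_def)
qed simp

section \<open>Equivariant completion of a frame by columns of a group element\<close>

definition cand :: "nat \<Rightarrow> (nat \<times> nat) list" where
  "cand r = List.product [0..<2*r] [0..<2*r]"

text \<open>The first pair of columns whose discriminant exceeds \<open>t\<close> times the average discriminant. Such a pair exists for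
  \<open>t < 1\<close>, and the strict threshold makes the choice locally constant except for finitely many \<open>t\<close>.\<close>

definition sel :: "nat \<Rightarrow> real \<Rightarrow> 'k::real_normed_field elt \<Rightarrow> 'k pair list \<Rightarrow> nat \<times> nat" where
  "sel r t g F = hd (filter (\<lambda>ij. t * (\<Sum>ij\<in>set (cand r). norm (dsc F (g (fst ij), g (snd ij)))) <
      norm (dsc F (g (fst ij), g (snd ij))) * real (card (set (cand r)))) (cand r))"

definition ext :: "nat \<Rightarrow> real \<Rightarrow> 'k::real_normed_field elt \<Rightarrow> 'k pair list \<Rightarrow> 'k pair list" where
  "ext r t g F = stp F (g (fst (sel r t g F)), g (snd (sel r t g F)))"

fun extn :: "nat \<Rightarrow> real \<Rightarrow> 'k::real_normed_field elt \<Rightarrow> nat \<Rightarrow> 'k pair list \<Rightarrow> 'k pair list" where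
  "extn r t g 0 F = F"
| "extn r t g (Suc n) F = extn r t g n (ext r t g F)"

text \<open>If no candidate exceeded \<open>t\<close> times the mean, summation would bound the sum
  of all candidates by \<open>t\<close> times itself, although it is positive by
  \<open>nondeg\<close> and \<open>t < 1\<close>. For non-negative \<open>t\<close> the strict
  threshold also forces the selected discriminant to be non-zero.\<close>

lemma sel:
  assumes F: "sframe r F" and r: "r \<le> N" and len: "length F < r" and g: "g \<in> GG r" and t: "t < 1"
  shows "sel r t g F \<in> set (cand r)" "dsc F (g (fst (sel r t g F)), g (snd (sel r t g F))) \<noteq> 0 \<or> t < 0"
proof -
  define d where "d = (\<lambda>ij. norm (dsc F (g (fst ij), g (snd ij))))"
  define S where "S = (\<Sum>ij\<in>set (cand r). d ij)"
  define c where "c = real (card (set (cand r)))"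
  let ?P = "\<lambda>ij. t * S < d ij * c"
  have sel_eq: "sel r t g F = hd (filter ?P (cand r))" by (simp add: sel_def d_def S_def c_def)
  obtain i j where "i<2*r" "j<2*r" "dsc F (g i, g j) \<noteq> 0" using nondeg[OF F r len g] by blast
  then have ij: "(i,j) \<in> set (cand r)" "d (i,j) > 0" by (auto simp: cand_def d_def)
  then have S: "S > 0" unfolding S_def by (intro sum_pos2[of _ "(i,j)"]) (auto simp: d_def)
  have c: "c > 0" using ij(1) unfolding c_def by (metis List.finite_set card_gt_0_iff empty_iff of_nat_0_less_iff)
  have "\<exists>ij\<in>set (cand r). ?P ij"
  proof (rule ccontr)
    assume "\<not> ?thesis"
    then have "(\<Sum>ij\<in>set (cand r). d ij * c) \<le> (\<Sum>ij\<in>set (cand r). t * S)"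
      by (intro sum_mono) (auto simp: not_less)
    then have "S * c \<le> c * (t * S)"
      unfolding S_def[symmetric] sum_distrib_right[symmetric] sum_constant c_def[symmetric] by (simp only: mult.assoc)
    then have "c * S \<le> c * (t * S)" by (simp only: mult.commute)
    then have "S \<le> t * S" using c by (simp only: mult_le_cancel_left_pos)
    with S t show False by simp
  qed
  then have ne: "filter ?P (cand r) \<noteq> []" by (auto simp: filter_empty_conv)
  have "sel r t g F \<in> set (filter ?P (cand r))" unfolding sel_eq by (rule hd_in_set[OF ne])
  then have s: "sel r t g F \<in> set (cand r)" "?P (sel r t g F)" by auto
  show "sel r t g F \<in> set (cand r)" by (rule s)
  show "dsc F (g (fst (sel r t g F)), g (snd (sel r t g F))) \<noteq> 0 \<or> t < 0"
    using s(2) S by (auto simp: not_less mult_less_0_iff d_def)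
qed

lemma GG_inV: "g \<in> GG r \<Longrightarrow> r \<le> N \<Longrightarrow> i < 2*r \<Longrightarrow> g i \<in> VV r"
  using app_VV[of g r "bas i"] by (simp add: GG_app_bas bas_VV)

lemma sframe_ext:
  assumes F: "sframe r F" and r: "r \<le> N" and len: "length F < r" and g: "g \<in> GG r" and t: "0 < t" "t < 1"
  shows "sframe r (ext r t g F)"
proof -
  have "inV r (g (fst (sel r t g F)), g (snd (sel r t g F)))"
    using sel(1)[OF F r len g t(2)] GG_inV[OF g r] by (auto simp: inV_def cand_def)
  then show ?thesis using sel(2)[OF F r len g t(2)] t unfolding ext_def by (intro sframe_stp[OF F]) auto
qed

lemma length_ext [simp]: "length (ext r t g F) = Suc (length F)" by (simp add: ext_def)

lemma length_extn [simp]: "length (extn r t g n F) = n + length F"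
  by (induction n arbitrary: F) auto

lemma sframe_extn:
  assumes "r \<le> N" "g \<in> GG r" "0 < t" "t < 1"
  shows "sframe r F \<Longrightarrow> n + length F \<le> r \<Longrightarrow> sframe r (extn r t g n F)"
proof (induction n arbitrary: F)
  case (Suc n)
  then show ?case using sframe_ext[OF Suc.prems(1) assms(1) _ assms(2-4)] by simp
qed simp

lemma extn_append: "\<exists>H. extn r t g n F = H @ F"
proof (induction n arbitrary: F)
  case (Suc n)
  obtain H where "extn r t g (Suc n) F = H @ ext r t g F" using Suc[of "ext r t g F"] by auto
  then show ?case by (auto simp: ext_def stp_def)
qed simp

lemma sel_ap: "a \<in> GG r \<Longrightarrow> r \<le> N \<Longrightarrow> sel r t (mul a g) (map (ap a) F) = sel r t g F"
  by (simp add: sel_def mul_apply dsc_app)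

lemma stp_app: "g \<in> GG r \<Longrightarrow> r \<le> N \<Longrightarrow> stp (map (ap g) F) (app g v, app g w) = map (ap g) (stp F (v, w))"
  using stp_ap[of g r F "(v, w)"] by (simp add: ap_def[of g "(_, _)"])

lemma ext_ap: "a \<in> GG r \<Longrightarrow> r \<le> N \<Longrightarrow> ext r t (mul a g) (map (ap a) F) = map (ap a) (ext r t g F)"
  by (simp add: ext_def sel_ap mul_apply stp_app)

lemma extn_ap: "a \<in> GG r \<Longrightarrow> r \<le> N \<Longrightarrow> extn r t (mul a g) n (map (ap a) F) = map (ap a) (extn r t g n F)"
  by (induction n arbitrary: F) (simp_all add: ext_ap)

text \<open>The head of the list fills the columns \<open>0\<close> and \<open>1\<close>. A
  completion \<open>H @ F\<close> to length \<open>r\<close> has \<open>F\<close> at its end, so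
  \<open>F\<close> fills the last columns below \<open>2*r\<close>, exactly where the elements of
  \<open>GG (r - length F)\<close> are trivial.\<close>

definition fmat :: "nat \<Rightarrow> 'k::real_normed_field pair list \<Rightarrow> nat \<Rightarrow> nat \<Rightarrow> 'k" where
  "fmat r F = (\<lambda>j. if j < 2*r then (if even j then fst (F ! (j div 2)) else snd (F ! (j div 2))) else bas j)"

lemma sframe_nth:
  assumes "sframe r F" "i < length F" "j < length F"
  shows "om (fst (F!i)) (snd (F!j)) = (if i = j then 1 else 0)"
    "om (snd (F!i)) (fst (F!j)) = (if i = j then -1 else 0)"
    "om (fst (F!i)) (fst (F!j)) = 0" "om (snd (F!i)) (snd (F!j)) = 0" 
    "fst (F!i) \<in> VV r" "snd (F!i) \<in> VV r"
proof -
  have A: "om (fst (F!i)) (snd (F!j)) = (if i = j then 1 else 0) \<and> om (fst (F!i)) (fst (F!j)) = 0 \<and> om (snd (F!i)) (snd (F!j)) = 0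
     \<and> fst (F!i) \<in> VV r \<and> snd (F!i) \<in> VV r" if "i < length F" "j < length F" for i j
    using assms(1) that
  proof (induction F arbitrary: i j)
    case (Cons n F)
    have *: "om (fst m) (snd n) = 0 \<and> om (fst m) (fst n) = 0 \<and> om (snd m) (snd n) = 0 \<and> om (fst n) (snd m) = 0 \<and> om (fst n) (fst m) = 0 \<and> om (snd n) (snd m) = 0"
      if "m \<in> set F" for m
      using that Cons.prems(1) by (auto simp: perp_def om_zero_sym)
    show ?case
      using Cons * by (cases i; cases j) auto
  qed simp
  show "om (fst (F!i)) (snd (F!j)) = (if i = j then 1 else 0)"
    "om (fst (F!i)) (fst (F!j)) = 0" "om (snd (F!i)) (snd (F!j)) = 0" 
    "fst (F!i) \<in> VV r" "snd (F!i) \<in> VV r"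
    using A[OF assms(2,3)] by auto
  show "om (snd (F!i)) (fst (F!j)) = (if i = j then -1 else 0)"
    by (subst om_anti) (use A[OF assms(3,2)] in auto)
qed

lemma fmat_GG:
  assumes F: "sframe r F" "length F = r" and r: "r \<le> N"
  shows "fmat r F \<in> GG r"
proof (rule GGI)
  fix j show "j \<ge> 2*r \<Longrightarrow> fmat r F j = bas j" by (simp add: fmat_def)
  show "j < 2*N \<Longrightarrow> fmat r F j \<in> VV N"
    using sframe_nth(5,6)[OF F(1), of "j div 2" "j div 2"] F(2) VV_mono[OF r] by (auto simp: fmat_def bas_VV)
next
  fix i j assume ij: "i < 2*N" "j < 2*N"
  have mixed: "om (fmat r F i) (bas j) = om (bas i) (bas j)" if "i < 2*r" "j \<ge> 2*r" "j < 2*N" for i j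
  proof -
    have "fmat r F i \<in> VV r" using that sframe_nth(5,6)[OF F(1), of "i div 2" "i div 2"] F(2) by (auto simp: fmat_def)
    moreover have "(bas i :: nat \<Rightarrow> 'a) \<in> VV r" using that bas_VV by blast
    moreover have "om v (bas j) = 0" if "v \<in> VV r" for v :: "nat \<Rightarrow> 'a"
    proof -
      have "odd j \<Longrightarrow> j - 1 \<ge> 2*r" using \<open>j \<ge> 2*r\<close> by presburger
      then show ?thesis using that \<open>j \<ge> 2*r\<close> by (auto simp: VV_def)
    qed
    ultimately show ?thesis by metis
  qed
  show "om (fmat r F i) (fmat r F j) = om (bas i) (bas j)"
  proof (cases "i < 2*r")
    case i: True
    show ?thesis
    proof (cases "j < 2*r")
      case True
      then show ?thesis using i ij sframe_nth[OF F(1), of "i div 2" "j div 2"] F(2)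
        by (cases "even i"; cases "even j") (auto simp: fmat_def bas_apply elim!: evenE oddE, (presburger+)?)
    next
      case False
      then show ?thesis using i ij mixed[of i j] by (simp add: fmat_def[of r F] del: om_bas)
    qed
  next
    case i: False
    show ?thesis
    proof (cases "j < 2*r")
      case True
      then show ?thesis using i ij mixed[of j i] by (subst (1 2) om_anti) (simp add: fmat_def[of r F] del: om_bas)
    next
      case False
      then show ?thesis using i by (simp add: fmat_def)
    qed
  qed
qed

definition nuv :: "nat \<Rightarrow> 'k::real_normed_field pair list \<Rightarrow> (nat \<Rightarrow> 'k) \<Rightarrow> nat \<Rightarrow> 'k" where
  "nuv r F y = (\<lambda>j. if 2*(r - length F) \<le> j \<and> j < 2*r then
     (if even j then om y (snd (F ! (j div 2 - (r - length F)))) else - om y (fst (F ! (j div 2 - (r - length F))))) else 0)"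

text \<open>A vector in the span of \<open>F\<close> is orthogonal to the completing pairs in
  \<open>H\<close>, so its coordinates in the completed basis do not depend on the completion. This
  makes the normal form well defined and free of the parameter \<open>t\<close>.\<close>

lemma inv_app_fmat:
  assumes F: "sframe r (H @ F)" "length (H @ F) = r" and r: "r \<le> N" and y: "y \<in> VV r" "prj F y = (\<lambda>_. 0)"
  shows "inv_app (fmat r (H @ F)) y = nuv r F y"
proof
  fix j
  have lH: "r - length F = length H" using F(2) by auto
  have z: "om y h = 0" if "perp h F" for h
    using om_prj_perp[OF that, of y] y(2) by simp
  have perpH: "perp (fst (H!i)) F" "perp (snd (H!i)) F" if "i < length H" for i
  proof -
    have "\<And>m. m < length F \<Longrightarrow> F!m = (H@F)!(length H + m)" "H!i = (H@F)!i"
      using that by (auto simp: nth_append)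
    then show "perp (fst (H!i)) F" "perp (snd (H!i)) F"
      using sframe_nth(1-4)[OF F(1), of i "length H + _"] that
      by (auto simp: perp_nth)
  qed
  consider "j < 2 * length H" | "2 * length H \<le> j" "j < 2*r" | "j \<ge> 2*r" by linarith
  then show "inv_app (fmat r (H @ F)) y j = nuv r F y j"
  proof cases
    case 1
    then have "j < 2*r" "j < 2*N" using F(2) r by auto
    moreover have "j div 2 < length H" using 1 by auto
    ultimately show ?thesis using 1 z[OF perpH(1)] z[OF perpH(2)] F(2)
      by (auto simp: inv_app_def fmat_def nuv_def lH nth_append elim!: evenE oddE)
  next
    case 2
    define b where "b = j div 2"
    have b: "b < r" "length H \<le> b" "b < N" "j < 2*N" "j < 2*r" "2 * length H \<le> j" using 2 r by (auto simp: b_def)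
    have nth: "(H @ F) ! b = F ! (b - length H)" using b by (simp add: nth_append)
    show ?thesis
    proof (cases "even j")
      case True
      then have j: "j = 2*b" by (simp add: b_def)
      have "inv_app (fmat r (H @ F)) y j = om y (snd (F ! (b - length H)))"
        using b nth by (simp add: inv_app_def fmat_def j)
      then show ?thesis using b True by (simp add: nuv_def lH flip: b_def)
    next
      case False
      then have j: "j = 2*b+1" by (simp add: b_def)
      have "inv_app (fmat r (H @ F)) y j = - om y (fst (F ! (b - length H)))"
        using b nth by (simp add: inv_app_def fmat_def j)
      then show ?thesis using b False by (simp add: nuv_def lH flip: b_def)
    qed
  next
    case 3
    then have "odd j \<Longrightarrow> j - 1 \<ge> 2*r" by presburger
    then show ?thesis using 3 y(1) by (auto simp: inv_app_def fmat_def nuv_def VV_def)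
  qed
qed

end

section \<open>Generic tuples of hyperbolic pairs\<close>

definition dr :: "nat \<Rightarrow> (nat \<Rightarrow> 'a) \<Rightarrow> nat \<Rightarrow> 'a" where
  "dr j x = (\<lambda>i. if i < j then x i else x (Suc i))"

context ambient
begin

definition apx :: "'k::real_normed_field elt \<Rightarrow> 'k pairs \<Rightarrow> nat \<Rightarrow> 'k pair" where
  "apx a x = (\<lambda>j. ap a (x j))"

text \<open>Goodness is asked of all increasing subtuples, so that faces remain generic. Entries are
  hyperbolic pairs, so a single entry is its own Gram-Schmidt frame.\<close>

definition XX :: "nat \<Rightarrow> nat \<Rightarrow> 'k::real_normed_field pairs set" where
  "XX r k = {x. (\<forall>j\<ge>k. x j = (\<lambda>_. 0, \<lambda>_. 0)) \<and>
     (\<forall>j<k. inV r (x j) \<and> om (fst (x j)) (snd (x j)) = 1) \<and>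
     (\<forall>idx. sorted_wrt (<) idx \<and> set idx \<subseteq> {..<k} \<longrightarrow> good (map x idx))}"

definition gsx :: "nat \<Rightarrow> 'k::real_normed_field pairs \<Rightarrow> 'k pair list" where
  "gsx k x = gs (map x [0..<k])"

text \<open>The normal form of \<open>x\<close>: the element taking the frame \<open>gsx k x\<close> to the last \<open>k\<close> standard pairs is applied to \<open>x\<close>.
  It is a complete invariant of the orbit of \<open>x\<close>, and its stabilizer in \<open>GG r\<close> is \<open>GG (r - k)\<close>.\<close>

definition nu :: "nat \<Rightarrow> nat \<Rightarrow> 'k::real_normed_field pairs \<Rightarrow> nat \<Rightarrow> 'k pair" where
  "nu r k x = (\<lambda>j. (nuv r (gsx k x) (fst (x j)), nuv r (gsx k x) (snd (x j))))"

text \<open>For fixed \<open>x\<close> the values lie in one left coset of the stabilizer of the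
  normal form: the elements that carry \<open>nu r k x\<close> to \<open>x\<close>. Equivariance in
  \<open>g\<close> and \<open>x\<close> together holds because the frame of \<open>x\<close> is
  completed with columns of \<open>g\<close>.\<close>

definition Theta :: "nat \<Rightarrow> nat \<Rightarrow> real \<Rightarrow> 'k::real_normed_field elt \<Rightarrow> 'k pairs \<Rightarrow> nat \<Rightarrow> nat \<Rightarrow> 'k" where
  "Theta r k t g x = fmat r (extn r t g (r - k) (gsx k x))"

lemma XX_tail: "x \<in> XX r k \<Longrightarrow> j \<ge> k \<Longrightarrow> x j = (\<lambda>_. 0, \<lambda>_. 0)"
  unfolding XX_def by blast
lemma XX_inV: "x \<in> XX r k \<Longrightarrow> j < k \<Longrightarrow> inV r (x j)"
  unfolding XX_def by blast
lemma XX_om: "x \<in> XX r k \<Longrightarrow> j < k \<Longrightarrow> om (fst (x j)) (snd (x j)) = 1"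
  unfolding XX_def by blast
lemma XX_good: "x \<in> XX r k \<Longrightarrow> sorted_wrt (<) idx \<Longrightarrow> set idx \<subseteq> {..<k} \<Longrightarrow> good (map x idx)"
  unfolding XX_def by blast
lemma XXI: "(\<And>j. j \<ge> k \<Longrightarrow> x j = (\<lambda>_. 0, \<lambda>_. 0)) \<Longrightarrow> (\<And>j. j < k \<Longrightarrow> inV r (x j)) \<Longrightarrow>
  (\<And>j. j < k \<Longrightarrow> om (fst (x j)) (snd (x j)) = 1) \<Longrightarrow>
  (\<And>idx. sorted_wrt (<) idx \<Longrightarrow> set idx \<subseteq> {..<k} \<Longrightarrow> good (map x idx)) \<Longrightarrow> x \<in> XX r k"
  unfolding XX_def by blast

lemma XX_gs: "x \<in> XX r k \<Longrightarrow> sorted_wrt (<) idx \<Longrightarrow> set idx \<subseteq> {..<k} \<Longrightarrow> sframe r (gs (map x idx))"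
  by (intro sframe_gs XX_good) (auto simp: XX_inV)

lemma XX_gsx: "x \<in> XX r k \<Longrightarrow> sframe r (gsx k x)"
  unfolding gsx_def by (rule XX_gs) auto

lemma length_gsx [simp]: "length (gsx k x) = k" by (simp add: gsx_def)

lemma ap_zero [simp]: "ap a (\<lambda>_. 0, \<lambda>_. 0) = (\<lambda>_. 0, \<lambda>_. 0)" by (simp add: ap_def)

lemma apx_XX:
  assumes "a \<in> GG r" "r \<le> N" "x \<in> XX r k"
  shows "apx a x \<in> XX r k"
proof (rule XXI)
  fix j show "j \<ge> k \<Longrightarrow> apx a x j = (\<lambda>_. 0, \<lambda>_. 0)" by (simp add: apx_def XX_tail[OF assms(3)])
  show "j < k \<Longrightarrow> inV r (apx a x j)" by (simp add: apx_def XX_inV[OF assms(3)] inV_ap[OF assms(1,2)])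
  show "j < k \<Longrightarrow> om (fst (apx a x j)) (snd (apx a x j)) = 1"
    by (simp add: apx_def XX_om[OF assms(3)] om_app[OF assms(1,2)])
next
  fix idx assume "sorted_wrt (<) idx" "set idx \<subseteq> {..<k}"
  then have "good (map (ap a) (map x idx))" using good_ap[OF assms(1,2)] XX_good[OF assms(3)] by blast
  then show "good (map (apx a x) idx)" by (simp add: apx_def comp_def)
qed

lemma gsx_apx: "a \<in> GG r \<Longrightarrow> r \<le> N \<Longrightarrow> gsx k (apx a x) = map (ap a) (gsx k x)"
  using gs_ap[of a r "map x [0..<k]"] by (simp add: gsx_def apx_def comp_def)

lemma nuv_ap: "a \<in> GG r \<Longrightarrow> r \<le> N \<Longrightarrow> length F \<le> r \<Longrightarrow> nuv r (map (ap a) F) (app a y) = nuv r F y"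
  by (auto simp: nuv_def fun_eq_iff om_app)

lemma nu_apx: "a \<in> GG r \<Longrightarrow> r \<le> N \<Longrightarrow> k \<le> r \<Longrightarrow> nu r k (apx a x) = nu r k x"
  by (simp add: nu_def gsx_apx nuv_ap) (simp add: apx_def nuv_ap)

lemma nuv_zero [simp]: "nuv r F (\<lambda>_. 0) = (\<lambda>_. 0)" by (auto simp: nuv_def)

lemma fmat_ap: "a \<in> GG r \<Longrightarrow> r \<le> N \<Longrightarrow> length F = r \<Longrightarrow> fmat r (map (ap a) F) = mul a (fmat r F)"
  by (auto simp: fun_eq_iff fmat_def mul_apply GG_app_bas GG_ge)

lemma Theta_mul: "a \<in> GG r \<Longrightarrow> r \<le> N \<Longrightarrow> k \<le> r \<Longrightarrow> Theta r k t (mul a g) (apx a x) = mul a (Theta r k t g x)"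
  by (simp add: Theta_def gsx_apx extn_ap fmat_ap)

lemma Theta_GG:
  assumes "r \<le> N" "k \<le> r" "g \<in> GG r" "0 < t" "t < 1" "x \<in> XX r k"
  shows "Theta r k t g x \<in> GG r"
  unfolding Theta_def using assms by (intro fmat_GG sframe_extn XX_gsx) auto

lemma inv_app_Theta:
  assumes "r \<le> N" "k \<le> r" "g \<in> GG r" "0 < t" "t < 1" "x \<in> XX r k" "y \<in> VV r" "prj (gsx k x) y = (\<lambda>_. 0)"
  shows "inv_app (Theta r k t g x) y = nuv r (gsx k x) y"
proof -
  obtain H where H: "extn r t g (r - k) (gsx k x) = H @ gsx k x" using extn_append by blast
  have "length (H @ gsx k x) = r" unfolding H[symmetric] using assms by simp
  moreover have "sframe r (H @ gsx k x)" unfolding H[symmetric] using assms by (intro sframe_extn XX_gsx) auto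
  ultimately show ?thesis unfolding Theta_def H using assms by (intro inv_app_fmat) auto
qed

lemma prj_gsx: "x \<in> XX r k \<Longrightarrow> j < k \<Longrightarrow> prj (gsx k x) (fst (x j)) = (\<lambda>_. 0) \<and> prj (gsx k x) (snd (x j)) = (\<lambda>_. 0)"
  unfolding gsx_def by (rule prj_gs[of _ r]) (auto intro!: XX_good[of _ r] XX_inV)

text \<open>The inverse of \<open>Theta\<close> reads off coordinates in the completed frame. The
  entries of \<open>x\<close> lie in the span of the frame \<open>gsx k x\<close>, so these
  coordinates are those of the normal form.\<close>

lemma Theta_nu:
  assumes "r \<le> N" "k \<le> r" "g \<in> GG r" "0 < t" "t < 1" "x \<in> XX r k"
  shows "apx (Theta r k t g x) (nu r k x) = x"
proof
  fix j
  note T = Theta_GG[OF assms]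
  show "apx (Theta r k t g x) (nu r k x) j = x j"
  proof (cases "j < k")
    case True
    have "nuv r (gsx k x) (fst (x j)) = inv_app (Theta r k t g x) (fst (x j))"
      "nuv r (gsx k x) (snd (x j)) = inv_app (Theta r k t g x) (snd (x j))"
      using prj_gsx[OF assms(6) True] XX_inV[OF assms(6) True] inv_app_Theta[OF assms] by (auto simp: inV_def)
    then show ?thesis by (simp add: apx_def nu_def ap_def app_inv_app[OF T assms(1)])
  next
    case False
    then show ?thesis by (simp add: apx_def nu_def XX_tail[OF assms(6)])
  qed
qed

lemma apx_mul: "apx (mul a b) x = apx a (apx b x)"
  by (simp add: apx_def ap_def app_mul)

lemma apx_one [simp]: "apx bas x = x" by (simp add: apx_def ap_def)

lemma apx_inv: "a \<in> GG r \<Longrightarrow> r \<le> N \<Longrightarrow> apx (inv' a) (apx a x) = x" "a \<in> GG r \<Longrightarrow> r \<le> N \<Longrightarrow> apx a (apx (inv' a) x) = x"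
  by (simp_all flip: apx_mul add: inv_mul mul_inv)

lemma orbit:
  assumes "r \<le> N" "k \<le> r" "x \<in> XX r k"
  shows "\<exists>a\<in>GG r. apx a (nu r k x) = x"
  using Theta_GG[OF assms(1,2) one_GG, of "1/2"] Theta_nu[OF assms(1,2) one_GG, of "1/2"] assms(3) by auto

lemma nu_XX:
  assumes "r \<le> N" "k \<le> r" "x \<in> XX r k"
  shows "nu r k x \<in> XX r k"
proof -
  obtain a where a: "a \<in> GG r" "apx a (nu r k x) = x" using orbit[OF assms] by auto
  then have "nu r k x = apx (inv' a) x" using apx_inv(1)[OF a(1) assms(1), of "nu r k x"] by simp
  then show ?thesis using apx_XX[OF inv_GG[OF a(1) assms(1)] assms(1,3)] by simp
qed

lemma nu_nu:
  assumes "r \<le> N" "k \<le> r" "x \<in> XX r k"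
  shows "nu r k (nu r k x) = nu r k x"
proof -
  obtain a where a: "a \<in> GG r" "apx a (nu r k x) = x" using orbit[OF assms] by auto
  then show ?thesis using nu_apx[OF a(1) assms(1,2), of "nu r k x"] by simp
qed

lemma nu_fix:
  assumes "r \<le> N" "k \<le> r" "a \<in> GG (r - k)"
  shows "apx a (nu r k x) = nu r k x"
proof -
  have "app a (nuv r (gsx k x) y) = nuv r (gsx k x) y" for y
    using assms by (intro app_fix[OF assms(3)]) (auto simp: nuv_def)
  then show ?thesis by (simp add: apx_def ap_def nu_def)
qed

text \<open>The Gram-Schmidt frame of a tuple in normal form consists of the last standard pairs,
  and an element fixing the tuple fixes its frame by equivariance.\<close>

lemma stab:
  assumes "r \<le> N" "k \<le> r" "x \<in> XX r k" "nu r k x = x" "a \<in> GG r" "apx a x = x"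
  shows "a \<in> GG (r - k)"
proof -
  define T where "T = Theta r k (1/2) bas x"
  have T: "T \<in> GG r" unfolding T_def using assms by (intro Theta_GG one_GG) auto
  have "apx T x = x" using Theta_nu[OF assms(1,2) one_GG, of "1/2" x] assms by (simp add: T_def)
  then have mT: "map (ap T) (gsx k x) = gsx k x" using gsx_apx[OF T assms(1), of k x] by simp
  have ma: "map (ap a) (gsx k x) = gsx k x" using gsx_apx[OF assms(5,1), of k x] assms(6) by simp
  obtain H where H: "extn r (1/2) bas (r - k) (gsx k x) = H @ gsx k x" using extn_append by blast
  have "length (H @ gsx k x) = r" unfolding H[symmetric] using assms by simp
  then have lH: "length H = r - k" using assms by auto
  have fixed: "a j = bas j" if j: "2*(r-k) \<le> j" "j < 2*r" for j
  proof -
    define i where "i = j div 2 - (r - k)"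
    have i: "i < k" "j div 2 = length H + i" using j assms(2) by (auto simp: i_def lH)
    define f where "f = (if even j then fst (gsx k x ! i) else snd (gsx k x ! i))"
    have Tj: "T j = f" using j(2) i by (simp add: T_def Theta_def H fmat_def nth_append f_def)
    have "ap T (gsx k x ! i) = gsx k x ! i" "ap a (gsx k x ! i) = gsx k x ! i"
      using mT ma i(1) by (metis length_gsx nth_map)+
    then have Tf: "app T f = f" "app a f = f" by (auto simp: f_def ap_def) (metis fst_conv snd_conv)+
    \<comment> \<open>\<open>T\<close> fixes \<open>x\<close>, hence \<open>f\<close>, but
      \<open>f\<close> is also column \<open>j\<close> of \<open>T\<close>, the image of
      \<open>bas j\<close>. Injectivity of \<open>T\<close> identifies the two.\<close>
    have "f = bas j"
      using inv_app_app[OF T assms(1), of "f"] inv_app_app[OF T assms(1), of "bas j"] Tf Tj GG_app_bas[OF T assms(1), of j] by metis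
    then show ?thesis using Tf GG_app_bas[OF assms(5,1), of j] by simp
  qed
  show ?thesis
  proof (rule GGI)
    fix j assume "2*(r-k) \<le> j"
    then show "a j = bas j" using fixed[of j] GG_ge[OF assms(5), of j] by (cases "j < 2*r") auto
  qed (use assms(5) in \<open>auto simp: GG_V GG_om simp del: om_bas\<close>)
qed

lemma XX_dr:
  assumes "x \<in> XX r (Suc k)" "j \<le> k"
  shows "dr j x \<in> XX r k"
proof (rule XXI)
  fix i show "i \<ge> k \<Longrightarrow> dr j x i = (\<lambda>_. 0, \<lambda>_. 0)" using assms(2) by (auto simp: dr_def XX_tail[OF assms(1)])
  show "i < k \<Longrightarrow> inV r (dr j x i)" by (auto simp: dr_def XX_inV[OF assms(1)])
  show "i < k \<Longrightarrow> om (fst (dr j x i)) (snd (dr j x i)) = 1" by (auto simp: dr_def XX_om[OF assms(1)])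
next
  fix idx assume idx: "sorted_wrt (<) idx" "set idx \<subseteq> {..<k}"
  \<comment> \<open>The increasing map that skips \<open>j\<close>; it turns an increasing subtuple
    of the face into one of \<open>x\<close>.\<close>
  define s where "s = (\<lambda>i. if i < j then i else Suc i)"
  have "sorted_wrt (<) (map s idx)" using idx(1) unfolding sorted_wrt_map by (rule sorted_wrt_mono_rel[rotated]) (auto simp: s_def)
  moreover have "set (map s idx) \<subseteq> {..<Suc k}" using idx(2) by (auto simp: s_def)
  ultimately have "good (map x (map s idx))" by (rule XX_good[OF assms(1)])
  moreover have "map x (map s idx) = map (dr j x) idx" unfolding map_map by (rule map_cong[OF refl]) (simp add: dr_def s_def)
  ultimately show "good (map (dr j x) idx)" by (simp only:)
qed

lemma dr_0_case_nat [simp]: "dr 0 (case_nat u x) = x" by (simp add: dr_def)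
lemma dr_Suc_case_nat [simp]: "dr (Suc j) (case_nat u x) = case_nat u (dr j x)"
  by (auto simp: dr_def fun_eq_iff split: nat.split)

text \<open>\<open>good\<close> processes the head of a list last. A vertex put in front is
  therefore projected against the old ones only at the very end, and genericity of the cone reduces
  to one non-vanishing condition for each increasing subtuple.\<close>

lemma XX_cons:
  assumes "x \<in> XX r k" "inV r u" "om (fst u) (snd u) = 1"
    "\<And>idx. sorted_wrt (<) idx \<Longrightarrow> set idx \<subseteq> {..<k} \<Longrightarrow> dsc (gs (map x idx)) u \<noteq> 0"
  shows "case_nat u x \<in> XX r (Suc k)"
proof (rule XXI)
  fix i show "i \<ge> Suc k \<Longrightarrow> case_nat u x i = (\<lambda>_. 0, \<lambda>_. 0)" by (auto simp: XX_tail[OF assms(1)] split: nat.split)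
  show "i < Suc k \<Longrightarrow> inV r (case_nat u x i)" using assms(2) by (auto simp: XX_inV[OF assms(1)] split: nat.split)
  show "i < Suc k \<Longrightarrow> om (fst (case_nat u x i)) (snd (case_nat u x i)) = 1" using assms(3) by (auto simp: XX_om[OF assms(1)] split: nat.split)
next
  fix idx :: "nat list" assume idx: "sorted_wrt (<) idx" "set idx \<subseteq> {..<Suc k}"
  have pos: "\<exists>l. idx = map Suc l \<and> sorted_wrt (<) l \<and> set l \<subseteq> {..<k}" if "sorted_wrt (<) idx" "set idx \<subseteq> {..<Suc k}" "0 \<notin> set idx" for idx
  proof (intro exI conjI)
    have *: "i \<in> set idx \<Longrightarrow> Suc (i - 1) = i" for i using that(3) by (cases i) auto
    then show "idx = map Suc (map (\<lambda>i. i - 1) idx)" by (simp add: map_idI)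
    show "sorted_wrt (<) (map (\<lambda>i. i - 1) idx)" using that(1) unfolding sorted_wrt_map
      by (rule sorted_wrt_mono_rel[rotated]) (use * in fastforce)
    show "set (map (\<lambda>i. i - 1) idx) \<subseteq> {..<k}" using that(2) * by fastforce
  qed
  show "good (map (case_nat u x) idx)"
  proof (cases "0 \<in> set idx")
    case False
    then obtain l where "idx = map Suc l" "sorted_wrt (<) l" "set l \<subseteq> {..<k}" using pos[OF idx] by auto
    then show ?thesis using XX_good[OF assms(1)] by (simp add: comp_def)
  next
    case True
    then obtain i idx' where i: "idx = i # idx'" by (cases idx) auto
    with True idx have "i = 0" by auto
    with i idx have "0 \<notin> set idx'" "sorted_wrt (<) idx'" "set idx' \<subseteq> {..<Suc k}" by auto
    then obtain l where "idx' = map Suc l" "sorted_wrt (<) l" "set l \<subseteq> {..<k}" using pos[of idx'] by auto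
    then show ?thesis using XX_good[OF assms(1)] assms(4) i \<open>i = 0\<close> by (simp add: comp_def)
  qed
qed

section \<open>Cones with a pair orthogonal to the tuple\<close>

definition stdp :: "'k::real_normed_field pairs" where
  "stdp i = (bas (2*i), bas (2*i+1))"

text \<open>Such a pair is unchanged by projection and has discriminant one against every subframe,
  so it can be put in front of any generic tuple and Gram-Schmidt leaves it as it is.\<close>

definition orthx :: "nat \<Rightarrow> 'k::real_normed_field pairs \<Rightarrow> 'k pair \<Rightarrow> bool" where
  "orthx k x u \<longleftrightarrow> om (fst u) (snd u) = 1 \<and> (\<forall>j<k. om (fst u) (fst (x j)) = 0 \<and> om (fst u) (snd (x j)) = 0 \<and>
     om (snd u) (fst (x j)) = 0 \<and> om (snd u) (snd (x j)) = 0)"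

lemma orthx_perp:
  assumes "orthx k x u" "set idx \<subseteq> {..<k}"
  shows "perp (fst u) (gs (map x idx))" "perp (snd u) (gs (map x idx))"
  using assms by (auto intro!: perp_gs simp: perp_def[of _ "map x idx"] orthx_def subset_iff)

lemma orthx_dsc:
  assumes "orthx k x u" "set idx \<subseteq> {..<k}"
  shows "dsc (gs (map x idx)) u = 1"
proof -
  show ?thesis using assms(1) unfolding dsc_def prj_perp_id[OF orthx_perp(1)[OF assms]] prj_perp_id[OF orthx_perp(2)[OF assms]]
    by (simp add: orthx_def)
qed

lemma XX_orthx: "x \<in> XX r k \<Longrightarrow> inV r u \<Longrightarrow> orthx k x u \<Longrightarrow> case_nat u x \<in> XX r (Suc k)"
  by (rule XX_cons) (simp_all add: orthx_dsc, simp add: orthx_def)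

lemma gsx_orthx:
  assumes "orthx k x u"
  shows "gsx (Suc k) (case_nat u x) = u # gsx k x"
proof -
  have idx: "set [0..<k] \<subseteq> {..<k}" by auto
  have "[0..<Suc k] = 0 # map Suc [0..<k]" by (simp only: map_Suc_upt upt_conv_Cons zero_less_Suc)
  then have "map (case_nat u x) [0..<Suc k] = u # map x [0..<k]" by (simp only: list.map map_map) (simp add: comp_def)
  moreover have "stp (gs (map x [0..<k])) u = u # gs (map x [0..<k])"
    using orthx_perp[OF assms idx] orthx_dsc[OF assms idx] by (simp add: stp_def prj_perp_id)
  ultimately show ?thesis by (simp only: gsx_def gs.simps)
qed

text \<open>The right-hand side does not involve \<open>u\<close>: cones with different orthogonal
  pairs have the same normal form. The exactness of the separately invariant cochains rests on
  this.\<close>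

lemma nu_orthx:
  assumes "orthx k x u" "k < r" "x \<in> XX r k"
  shows "nu r (Suc k) (case_nat u x) = case_nat (stdp (r - Suc k)) (nu r k x)"
proof
  fix j
  let ?F = "gsx k x"
  have pF: "perp (fst u) ?F" "perp (snd u) ?F" unfolding gsx_def
    using orthx_perp[OF assms(1), of "[0..<k]"] by (auto simp: lessThan_atLeast0)
  have nuv_Cons: "nuv r (u # ?F) y = nuv r ?F y" if "om y (fst u) = 0" "om y (snd u) = 0" for y
  proof
    fix j 
    have "j div 2 - (r - k) = n \<Longrightarrow> j \<ge> 2*(r-k) \<Longrightarrow> (u # ?F) ! (j div 2 - (r - Suc k)) = ?F ! n" for n
    proof -
      assume "j div 2 - (r - k) = n" "j \<ge> 2*(r-k)"
      then have "j div 2 - (r - Suc k) = Suc n" using assms(2) by linarith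
      then show ?thesis by simp
    qed
    moreover have "j < 2*(r-k) \<Longrightarrow> j \<ge> 2*(r - Suc k) \<Longrightarrow> (u # ?F) ! (j div 2 - (r - Suc k)) = u"
    proof -
      assume "j < 2*(r-k)" "j \<ge> 2*(r - Suc k)"
      then have "j div 2 - (r - Suc k) = 0" using assms(2) by linarith
      then show ?thesis by simp
    qed
    ultimately show "nuv r (u # ?F) y j = nuv r ?F y j" using that assms(2)
      by (cases "j < 2*(r - Suc k)"; cases "j < 2*(r-k)") (auto simp: nuv_def)
  qed
  have nuv_u: "nuv r (u # ?F) y j = (if j = 2*(r - Suc k) then om y (snd u) else if j = 2*(r-Suc k)+1 then - om y (fst u) else 0)" 
    if "perp y ?F" for j y
  proof -
    consider "j < 2*(r-Suc k)" | "j = 2*(r-Suc k)" | "j = 2*(r-Suc k)+1" | "j \<ge> 2*(r-k)" "j < 2*r" | "j \<ge> 2*r" using assms(2) by linarith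
    then show ?thesis
    proof cases
      case 4
      define n where "n = j div 2 - (r-k)"
      have "j div 2 - (r - Suc k) = Suc n" "n < k" using 4 assms(2) unfolding n_def by linarith+
      then show ?thesis using that 4 assms(2) by (auto simp: nuv_def perp_nth)
    qed (use assms(2) in \<open>auto simp: nuv_def\<close>)
  qed
  have u: "om (fst u) (snd u) = 1" "om (snd u) (fst u) = -1" using assms(1) om_anti[of "snd u" "fst u"] by (auto simp: orthx_def)
  show "nu r (Suc k) (case_nat u x) j = case_nat (stdp (r - Suc k)) (nu r k x) j"
  proof (cases j)
    case 0
    have "nuv r (u # ?F) (fst u) = bas (2*(r - Suc k))" "nuv r (u # ?F) (snd u) = bas (2*(r-Suc k)+1)"
      using nuv_u[OF pF(1)] nuv_u[OF pF(2)] u by (auto simp: fun_eq_iff bas_apply)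
    then show ?thesis using 0 by (simp add: nu_def gsx_orthx[OF assms(1)] stdp_def)
  next
    case (Suc i)
    show ?thesis
    proof (cases "i < k")
      case True
      then have "om (fst (x i)) (fst u) = 0 \<and> om (fst (x i)) (snd u) = 0 \<and> om (snd (x i)) (fst u) = 0 \<and> om (snd (x i)) (snd u) = 0"
        using assms(1) by (subst (1 2 3 4) om_anti) (auto simp: orthx_def)
      then show ?thesis using Suc by (simp add: nu_def gsx_orthx[OF assms(1)] nuv_Cons)
    next
      case False
      then show ?thesis using Suc by (simp add: nu_def XX_tail[OF assms(3)])
    qed
  qed
qed

text \<open>The exponents are chosen such that a bilinear form evaluated at \<open>moment r 1 t\<close> and \<open>moment r (2*r) t\<close> is a polynomial
  in \<open>t\<close> whose coefficients are the entries of the form, without collisions.\<close>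

definition moment :: "nat \<Rightarrow> nat \<Rightarrow> real \<Rightarrow> nat \<Rightarrow> 'k::real_normed_field" where
  "moment r m t = (\<lambda>i. if i < 2*r then of_real (t ^ (m * i)) else 0)"

definition moment_pair :: "nat \<Rightarrow> real \<Rightarrow> 'k::real_normed_field pair" where
  "moment_pair r t = (moment r 1 t, \<lambda>i. moment r (2*r) t i / om (moment r 1 t) (moment r (2*r) t))"

lemma finite_roots_bilinear:
  fixes B :: "'k::real_normed_field elt"
  assumes "i < n" "j < n" "B i j \<noteq> 0"
  shows "finite {t::real. (\<Sum>i<n. \<Sum>j<n. of_real (t ^ i) * of_real (t ^ (n * j)) * B i j) = 0}"
proof -
  \<comment> \<open>The coefficient at exponent \<open>m\<close>: the two digits of \<open>m\<close>
    in base \<open>n\<close> are the row and the column, so distinct entries of \<open>B\<close>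
    belong to distinct exponents.\<close>
  define c where "c m = B (m mod n) (m div n)" for m
  have n: "n > 0" using assms(1) by simp
  have "(\<Sum>i<n. \<Sum>j<n. of_real (t ^ i) * of_real (t ^ (n * j)) * B i j) = (\<Sum>m<n*n. c m * of_real t ^ m)" for t :: real
  proof -
    have "(\<Sum>m<n*n. c m * of_real t ^ m) = (\<Sum>j<n. \<Sum>m=j*n..<j*n+n. c m * of_real t ^ m)"
      by (rule sum.nat_group[symmetric])
    also have "\<dots> = (\<Sum>j<n. \<Sum>i<n. c (j*n+i) * of_real t ^ (j*n+i))"
    proof (rule sum.cong[OF refl])
      fix j
      show "(\<Sum>m=j*n..<j*n+n. c m * of_real t ^ m) = (\<Sum>i<n. c (j*n+i) * of_real t ^ (j*n+i))"
        using sum.shift_bounds_nat_ivl[of "\<lambda>m. c m * of_real t ^ m" 0 "j*n" n] by (simp add: lessThan_atLeast0 add.commute)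
    qed
    also have "\<dots> = (\<Sum>j<n. \<Sum>i<n. of_real (t ^ i) * of_real (t ^ (n * j)) * B i j)"
    proof (rule sum.cong[OF refl], rule sum.cong[OF refl])
      fix i j assume "i \<in> {..<n}"
      then have "c (j*n+i) = B i j" by (simp add: c_def)
      then show "c (j*n+i) * of_real t ^ (j*n+i) = of_real (t ^ i) * of_real (t ^ (n * j)) * B i j"
        by (simp add: power_add mult_ac)
    qed
    also have "\<dots> = (\<Sum>i<n. \<Sum>j<n. of_real (t ^ i) * of_real (t ^ (n * j)) * B i j)"
      by (rule sum.swap)
    finally show ?thesis by simp
  qed
  moreover have "finite {t::real. (\<Sum>m<n*n. c m * of_real t ^ m) = 0}"
  proof -
    have "finite {z. (\<Sum>m\<le>n*n-1. c m * z ^ m) = 0}"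
    proof -
      have "i + j * n < n + j * n" using assms by simp
      also have "\<dots> = Suc j * n" by simp
      also have "\<dots> \<le> n * n" using assms(2) by (intro mult_right_mono) auto
      finally have "i + j*n \<le> n*n - 1" by simp
      moreover have "c (i + j*n) \<noteq> 0" using assms by (simp add: c_def)
      ultimately show ?thesis by (subst polyfun_finite_roots) blast
    qed
    moreover have "{..n*n-1} = {..<n*n}" using n by (auto simp: less_eq_iff_succ_less)
    ultimately have "finite {z. (\<Sum>m<n*n. c m * z ^ m) = 0}" by simp
    then have "finite ((of_real :: real \<Rightarrow> 'k) -` {z. (\<Sum>m<n*n. c m * z ^ m) = 0})"
      by (intro finite_vimageI) (auto intro: injI)
    then show ?thesis by (simp add: vimage_def)
  qed
  ultimately show ?thesis by simp
qed

lemma moment_VV: "moment r m t \<in> VV r" by (simp add: moment_def VV_def)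

lemma dsc_moment_finite:
  assumes F: "sframe r F" and r: "r \<le> N" and len: "length F < r" and g: "g \<in> GG r"
  shows "finite {t. dsc F (app g (moment r 1 t), app g (moment r (2*r) t)) = 0}"
proof -
  obtain i j where ij: "i<2*r" "j<2*r" "dsc F (g i, g j) \<noteq> 0" using nondeg[OF F r len g] by blast
  have "app g (moment r m t) = (\<lambda>i. \<Sum>j<2*r. of_real (t ^ (m*j)) * g j i)" for m t
    unfolding app_VV_sum[OF g r moment_VV] by (intro ext sum.cong) (auto simp: moment_def)
  then have "dsc F (app g (moment r 1 t), app g (moment r (2*r) t)) =
     (\<Sum>i<2*r. \<Sum>j<2*r. of_real (t^i) * of_real (t^(2*r*j)) * dsc F (g i, g j))" for t
    by (simp add: dsc_bilin)
  then show ?thesis using finite_roots_bilinear[of i "2*r" j "\<lambda>i j. dsc F (g i, g j)"] ij by simp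
qed

lemma moment_om_finite:
  assumes "0 < r" "r \<le> N"
  shows "finite {t. om (moment r 1 t) (moment r (2*r) t :: nat \<Rightarrow> 'k::real_normed_field) = 0}"
proof -
  have "finite {t. dsc [] (app bas (moment r 1 t :: nat \<Rightarrow> 'k), app bas (moment r (2*r) t)) = 0}"
    using assms by (intro dsc_moment_finite one_GG) auto
  then show ?thesis by (simp add: dsc_def)
qed

lemma dsc_moment_pair_finite:
  assumes F: "sframe r F" and r: "r \<le> N" and len: "length F < r" and g: "g \<in> GG r"
  shows "finite {t. dsc F (ap g (moment_pair r t)) = 0}"
proof -
  have "dsc F (ap g (moment_pair r t)) = dsc F (app g (moment r 1 t), app g (moment r (2*r) t)) / om (moment r 1 t :: nat \<Rightarrow> 'a) (moment r (2*r) t)" for t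
    by (simp add: dsc_def moment_pair_def)
  then have "{t. dsc F (ap g (moment_pair r t)) = 0} \<subseteq> {t. dsc F (app g (moment r 1 t), app g (moment r (2*r) t)) = 0} \<union> {t. om (moment r 1 t :: nat \<Rightarrow> 'a) (moment r (2*r) t) = 0}"
    by auto
  then show ?thesis using dsc_moment_finite[OF assms] moment_om_finite[where 'k='a, of r] r len by (auto intro: finite_subset)
qed

end

section \<open>Averaging over a parameter\<close>

text \<open>Joint continuity in \<open>t\<close> and \<open>y\<close> serves two purposes: at fixed
  \<open>t\<close> it feeds dominated convergence, and at fixed \<open>y\<close> it makes the
  integrand measurable in \<open>t\<close>.\<close>

definition cont_pt :: "(real \<Rightarrow> 'y::topological_space \<Rightarrow> 'z::topological_space) \<Rightarrow> 'y set \<Rightarrow> real \<Rightarrow> 'y \<Rightarrow> bool" where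
  "cont_pt \<phi> Y t y \<longleftrightarrow> (\<forall>ts ys. (\<forall>n. 0 < ts n \<and> ts n < 1) \<longrightarrow> (\<forall>n. ys n \<in> Y) \<longrightarrow> ts \<longlonglongrightarrow> t \<longrightarrow> ys \<longlonglongrightarrow> y \<longrightarrow>
     (\<lambda>n. \<phi> (ts n) (ys n)) \<longlonglongrightarrow> \<phi> t y)"

definition ract :: "(real \<Rightarrow> 'y::topological_space \<Rightarrow> 'z::topological_space) \<Rightarrow> 'y set \<Rightarrow> bool" where
  "ract \<phi> Y \<longleftrightarrow> (\<forall>y\<in>Y. \<exists>B. finite B \<and> (\<forall>t. 0 < t \<and> t < 1 \<and> t \<notin> B \<longrightarrow> cont_pt \<phi> Y t y))"

definition avg :: "(real \<Rightarrow> real) \<Rightarrow> real" where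
  "avg f = set_lebesgue_integral lborel {0<..<1} f"

definition avgable :: "(real \<Rightarrow> real) \<Rightarrow> bool" where
  "avgable f \<longleftrightarrow> set_integrable lborel {0<..<1} f"

lemma cont_ptD: "cont_pt \<phi> Y t y \<Longrightarrow> (\<And>n. 0 < ts n \<and> ts n < 1) \<Longrightarrow> (\<And>n. ys n \<in> Y) \<Longrightarrow> ts \<longlonglongrightarrow> t \<Longrightarrow> ys \<longlonglongrightarrow> y \<Longrightarrow>
     (\<lambda>n. \<phi> (ts n) (ys n)) \<longlonglongrightarrow> \<phi> t y"
  unfolding cont_pt_def by blast

lemma ractD: "ract \<phi> Y \<Longrightarrow> y \<in> Y \<Longrightarrow> \<exists>B. finite B \<and> (\<forall>t. 0 < t \<and> t < 1 \<and> t \<notin> B \<longrightarrow> cont_pt \<phi> Y t y)"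
  by (simp add: ract_def)

lemma tendsto_fun_iff:
  fixes f :: "'a \<Rightarrow> 'i \<Rightarrow> 'b::topological_space"
  shows "(f \<longlongrightarrow> l) F \<longleftrightarrow> (\<forall>i. ((\<lambda>s. f s i) \<longlongrightarrow> l i) F)"
proof -
  have "limitin euclidean f l F \<longleftrightarrow> (\<forall>i\<in>UNIV. limitin euclidean (\<lambda>c. f c i) (l i) F)"
    unfolding euclidean_product_topology[symmetric] limitin_componentwise by simp
  then show ?thesis by simp
qed

lemma avg_lin:
  assumes "avgable f" "avgable g"
  shows "avg (\<lambda>t. f t + g t) = avg f + avg g" "avg (\<lambda>t. f t - g t) = avg f - avg g"
    "avgable (\<lambda>t. f t + g t)" "avgable (\<lambda>t. f t - g t)"
  using assms by (auto simp: avg_def avgable_def set_integral_add set_integral_diff)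

lemma avg_cmult: "avgable f \<Longrightarrow> avg (\<lambda>t. c * f t) = c * avg f" "avgable f \<Longrightarrow> avgable (\<lambda>t. c * f t)"
  by (auto simp: avg_def avgable_def)

lemma avg_const [simp]: "avg (\<lambda>t. c) = c" "avgable (\<lambda>t. c)"
  by (auto simp: avg_def avgable_def set_integrable_def set_lebesgue_integral_def)

lemma avg_sum: "finite J \<Longrightarrow> (\<And>j. j \<in> J \<Longrightarrow> avgable (f j)) \<Longrightarrow> avg (\<lambda>t. \<Sum>j\<in>J. f j t) = (\<Sum>j\<in>J. avg (f j)) \<and> avgable (\<lambda>t. \<Sum>j\<in>J. f j t)"
  by (induction J rule: finite_induct) (auto simp: avg_lin)

lemma avg_cong: "(\<And>t. 0 < t \<Longrightarrow> t < 1 \<Longrightarrow> f t = g t) \<Longrightarrow> avg f = avg g"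
  unfolding avg_def by (intro set_lebesgue_integral_cong) auto

lemma avg_cong_finite:
  assumes B: "finite B" and fg: "\<And>t. 0 < t \<Longrightarrow> t < 1 \<Longrightarrow> t \<notin> B \<Longrightarrow> f t = g t" and f: "avgable f" and g: "avgable g"
  shows "avg f = avg g"
  unfolding avg_def set_lebesgue_integral_def
proof (rule integral_cong_AE)
  have "AE t in lborel. t \<notin> B" using B by (intro AE_not_in finite_imp_null_set_lborel)
  then show "AE t in lborel. indicator {0<..<1} t *\<^sub>R f t = indicator {0<..<1} t *\<^sub>R g t"
    by eventually_elim (auto simp: indicator_def fg)
qed (use f g in \<open>auto simp: avgable_def set_integrable_def\<close>)

lemma avg_bound:
  assumes "avgable f" "\<And>t. 0 < t \<Longrightarrow> t < 1 \<Longrightarrow> \<bar>f t\<bar> \<le> C"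
  shows "\<bar>avg f\<bar> \<le> C"
proof -
  have "avg f \<le> avg (\<lambda>_. C)" unfolding avg_def
    using assms by (intro set_integral_mono) (auto simp: avgable_def[symmetric] abs_le_iff)
  moreover have "avg (\<lambda>_. - C) \<le> avg f" unfolding avg_def
  proof (intro set_integral_mono)
    fix t :: real assume "t \<in> {0<..<1}" then show "- C \<le> f t" using assms(2)[of t] by auto
  qed (use assms in \<open>auto simp: avgable_def[symmetric]\<close>)
  ultimately show ?thesis by (simp add: abs_le_iff)
qed

lemma cont_pt_borel:
  fixes \<phi> :: "real \<Rightarrow> 'y::topological_space \<Rightarrow> real"
  assumes B: "finite B" and c: "\<And>t. 0 < t \<Longrightarrow> t < 1 \<Longrightarrow> t \<notin> B \<Longrightarrow> cont_pt (\<lambda>t y. \<phi> t y) Y t y" and y: "y \<in> Y"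
  shows "(\<lambda>t. indicator {0<..<1} t *\<^sub>R \<phi> t y) \<in> borel_measurable lborel" (is "?f \<in> _")
proof -
  have inv_app: "continuous_on ({0<..<1} - B) (\<lambda>t. \<phi> t y)"
    unfolding continuous_on_sequentially
  proof (intro allI ballI impI)
    fix ts t assume "t \<in> {0<..<1} - B" "(\<forall>n. ts n \<in> {0<..<1} - B) \<and> ts \<longlonglongrightarrow> t"
    then show "((\<lambda>t. \<phi> t y) \<circ> ts) \<longlonglongrightarrow> \<phi> t y"
      using cont_ptD[OF c[of t], of ts "\<lambda>_. y"] y by (simp add: comp_def)
  qed
  have o: "open ({0<..<1} - B)" using B by (intro open_Diff finite_imp_closed) auto
  have "(\<lambda>t. indicator ({0<..<1} - B) t *\<^sub>R \<phi> t y) \<in> borel_measurable borel"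
    using borel_measurable_continuous_on_indicator[OF borel_open[OF o] inv_app] .
  then have "(\<lambda>t. indicator ({0<..<1} - B) t *\<^sub>R \<phi> t y) \<in> borel_measurable lborel" by simp
  then show ?thesis
    by (rule measurable_discrete_difference[where X=B]) (use B in \<open>auto simp: indicator_def countable_finite\<close>)
qed

lemma ract_avgable:
  assumes r: "ract \<phi> Y" and C: "\<And>t. 0 < t \<Longrightarrow> t < 1 \<Longrightarrow> \<bar>\<phi> t y\<bar> \<le> C" and y: "y \<in> Y"
  shows "avgable (\<lambda>t. \<phi> t y)"
proof -
  obtain B where B0: "finite B \<and> (\<forall>t. 0 < t \<and> t < 1 \<and> t \<notin> B \<longrightarrow> cont_pt \<phi> Y t y)"
    using ractD[OF r y] ..
    then have B: "finite B" "\<And>t. 0 < t \<Longrightarrow> t < 1 \<Longrightarrow> t \<notin> B \<Longrightarrow> cont_pt \<phi> Y t y" by simp_all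
  from B have m: "(\<lambda>t. indicator {0<..<1} t *\<^sub>R \<phi> t y) \<in> borel_measurable lborel" by (rule cont_pt_borel[OF _ _ y])
  have i: "integrable lborel (\<lambda>t::real. indicator {0<..<1} t *\<^sub>R C)"
    using avg_const(2)[of C] unfolding avgable_def set_integrable_def .
  have C': "\<bar>\<phi> t y\<bar> \<le> \<bar>C\<bar>" if "0 < t" "t < 1" for t using C[OF that] by linarith
  show ?thesis unfolding avgable_def set_integrable_def
    by (rule Bochner_Integration.integrable_bound[OF i m], rule AE_I2) (simp add: indicator_def C')
qed

text \<open>Dominated convergence along a sequence \<open>ys\<close>. The exceptional set is that of
  the limit point alone, so a single finite set is discarded for the whole sequence.\<close>

lemma avg_continuous_on:
  fixes Y :: "'y::metric_space set"
  assumes r: "ract \<phi> Y" and C: "\<And>t y. 0 < t \<Longrightarrow> t < 1 \<Longrightarrow> y \<in> Y \<Longrightarrow> \<bar>\<phi> t y\<bar> \<le> C"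
  shows "continuous_on Y (\<lambda>y. avg (\<lambda>t. \<phi> t y))"
  unfolding continuous_on_sequentially
proof (intro allI ballI impI)
  fix ys y assume y: "y \<in> Y" and ys: "(\<forall>n. ys n \<in> Y) \<and> ys \<longlonglongrightarrow> y"
  have m: "(\<lambda>t. indicator {0<..<1} t *\<^sub>R \<phi> t y) \<in> borel_measurable lborel" if y: "y \<in> Y" for y
  proof -
    obtain B where B0: "finite B \<and> (\<forall>t. 0 < t \<and> t < 1 \<and> t \<notin> B \<longrightarrow> cont_pt \<phi> Y t y)"
      using ractD[OF r y] ..
      then have B: "finite B" "\<And>t. 0 < t \<Longrightarrow> t < 1 \<Longrightarrow> t \<notin> B \<Longrightarrow> cont_pt \<phi> Y t y" by simp_all
    from B show ?thesis by (rule cont_pt_borel[OF _ _ y])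
  qed
  obtain B where B0: "finite B \<and> (\<forall>t. 0 < t \<and> t < 1 \<and> t \<notin> B \<longrightarrow> cont_pt \<phi> Y t y)"
    using ractD[OF r y] ..
    then have B: "finite B" "\<And>t. 0 < t \<Longrightarrow> t < 1 \<Longrightarrow> t \<notin> B \<Longrightarrow> cont_pt \<phi> Y t y" by simp_all
  have "(\<lambda>n. integral\<^sup>L lborel (\<lambda>t. indicator {0<..<1} t *\<^sub>R \<phi> t (ys n))) \<longlonglongrightarrow> integral\<^sup>L lborel (\<lambda>t. indicator {0<..<1} t *\<^sub>R \<phi> t y)"
  proof (rule integral_dominated_convergence[where w = "\<lambda>t. indicator {0<..<1} t *\<^sub>R C"])
    show "integrable lborel (\<lambda>t::real. indicator {0<..<1} t *\<^sub>R C)" using avg_const(2)[of C] unfolding avgable_def set_integrable_def .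
    have "AE t in lborel. t \<notin> B" using B by (intro AE_not_in finite_imp_null_set_lborel)
    then show "AE t in lborel. (\<lambda>n. indicator {0<..<1} t *\<^sub>R \<phi> t (ys n)) \<longlonglongrightarrow> indicator {0<..<1} t *\<^sub>R \<phi> t y"
    proof eventually_elim
      case (elim t)
      show ?case
      proof (cases "0 < t \<and> t < 1")
        case True
        then have "cont_pt \<phi> Y t y" using B elim by auto
        then have "(\<lambda>n. \<phi> t (ys n)) \<longlonglongrightarrow> \<phi> t y" using ys True cont_ptD[of \<phi> Y t y "\<lambda>_. t" ys] by simp
        then show ?thesis by (intro tendsto_scaleR tendsto_const)
      qed (auto simp: indicator_def)
    qed
    show "AE t in lborel. norm (indicator {0<..<1} t *\<^sub>R \<phi> t (ys n)) \<le> indicator {0<..<1} t *\<^sub>R C" for n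
      using C ys by (intro AE_I2) (auto simp: indicator_def)
  qed (use m y ys in auto)
  then show "((\<lambda>y. avg (\<lambda>t. \<phi> t y)) \<circ> ys) \<longlonglongrightarrow> avg (\<lambda>t. \<phi> t y)"
    by (simp add: avg_def set_lebesgue_integral_def comp_def)
qed

text \<open>Continuity of a cochain is known only on its domain \<open>D\<close>, and nearby values
  of \<Psi> might leave \<open>D\<close>. That they eventually stay inside has to be recorded along
  with convergence.\<close>

definition good_pt :: "(real \<Rightarrow> 'y::topological_space \<Rightarrow> 'z::topological_space) \<Rightarrow> 'y set \<Rightarrow> 'z set \<Rightarrow> real \<Rightarrow> 'y \<Rightarrow> bool" where
  "good_pt \<Psi> Y D t y \<longleftrightarrow> cont_pt \<Psi> Y t y \<and> \<Psi> t y \<in> D \<and>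
    (\<forall>ts ys. (\<forall>n. 0 < ts n \<and> ts n < 1) \<longrightarrow> (\<forall>n. ys n \<in> Y) \<longrightarrow> ts \<longlonglongrightarrow> t \<longrightarrow> ys \<longlonglongrightarrow> y \<longrightarrow> (\<forall>\<^sub>F n in sequentially. \<Psi> (ts n) (ys n) \<in> D))"

lemma good_ptD:
  assumes "good_pt \<Psi> Y D t y"
  shows "cont_pt \<Psi> Y t y" "\<Psi> t y \<in> D"
    "(\<And>n. 0 < ts n \<and> ts n < 1) \<Longrightarrow> (\<And>n. ys n \<in> Y) \<Longrightarrow> ts \<longlonglongrightarrow> t \<Longrightarrow> ys \<longlonglongrightarrow> y \<Longrightarrow> (\<forall>\<^sub>F n in sequentially. \<Psi> (ts n) (ys n) \<in> D)"
  using assms by (simp_all add: good_pt_def)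

lemma good_ptI:
  assumes "0 < t" "t < 1" "y \<in> Y" "\<Psi> t y \<in> D"
    "\<And>ts ys. (\<And>n. 0 < ts n \<and> ts n < 1) \<Longrightarrow> (\<And>n. ys n \<in> Y) \<Longrightarrow> ts \<longlonglongrightarrow> t \<Longrightarrow> ys \<longlonglongrightarrow> y \<Longrightarrow> 
      (\<lambda>n. \<Psi> (ts n) (ys n)) \<longlonglongrightarrow> \<Psi> t y \<and> (\<forall>\<^sub>F n in sequentially. \<Psi> (ts n) (ys n) \<in> D)"
  shows "good_pt \<Psi> Y D t y"
  using assms by (simp add: good_pt_def cont_pt_def)

lemma ract_compose:
  assumes f: "continuous_on D f"
    and P: "\<And>y. y \<in> Y \<Longrightarrow> \<exists>B. finite B \<and> (\<forall>t. 0 < t \<and> t < 1 \<and> t \<notin> B \<longrightarrow> good_pt \<Psi> Y D t y)"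
  shows "ract (\<lambda>t y. f (\<Psi> t y)) Y"
  unfolding ract_def
proof
  fix y assume "y \<in> Y"
  from P[OF this] obtain B where B: "finite B \<and> (\<forall>t. 0 < t \<and> t < 1 \<and> t \<notin> B \<longrightarrow> good_pt \<Psi> Y D t y)" ..
  show "\<exists>B. finite B \<and> (\<forall>t. 0 < t \<and> t < 1 \<and> t \<notin> B \<longrightarrow> cont_pt (\<lambda>t y. f (\<Psi> t y)) Y t y)"
  proof (intro exI conjI allI impI)
    show "finite B" using B ..
    fix t assume t: "0 < t \<and> t < 1 \<and> t \<notin> B"
    with B have g: "good_pt \<Psi> Y D t y" by simp
    show "cont_pt (\<lambda>t y. f (\<Psi> t y)) Y t y"
      unfolding cont_pt_def
    proof (intro allI impI)
      fix ts ys assume a: "\<forall>n. 0 < ts n \<and> ts n < 1" "\<forall>n. ys n \<in> Y" "ts \<longlonglongrightarrow> t" "ys \<longlonglongrightarrow> y"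
      show "(\<lambda>n. f (\<Psi> (ts n) (ys n))) \<longlonglongrightarrow> f (\<Psi> t y)"
        using a by (intro continuous_on_tendsto_compose[OF f] cont_ptD[OF good_ptD(1)[OF g]] good_ptD(2,3)[OF g]) simp_all
    qed
  qed
qed

context ambient
begin

section \<open>Continuity of frames, completions, normal forms and moving cone points\<close>

lemma tendsto_om [tendsto_intros]:
  assumes "(v \<longlongrightarrow> v0) F" "(w \<longlongrightarrow> w0) F"
  shows "((\<lambda>s. om (v s) (w s)) \<longlongrightarrow> om v0 w0) F"
  unfolding om_def using assms unfolding tendsto_fun_iff[where f=v] tendsto_fun_iff[where f=w]
  by (intro tendsto_intros) auto

lemma tendsto_app [tendsto_intros]:
  assumes "(g \<longlongrightarrow> g0) F" "(v \<longlongrightarrow> v0) F"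
  shows "((\<lambda>s. app (g s) (v s)) \<longlongrightarrow> app g0 v0) F"
  unfolding tendsto_fun_iff
proof
  fix i
  have g: "((\<lambda>s. g s j i) \<longlongrightarrow> g0 j i) F" for j
    using assms(1) by (simp add: tendsto_fun_iff)
  have v: "((\<lambda>s. v s j) \<longlongrightarrow> v0 j) F" for j
    using assms(2) by (simp add: tendsto_fun_iff)
  show "((\<lambda>s. app (g s) (v s) i) \<longlongrightarrow> app g0 v0 i) F"
    unfolding app_def by (cases "i < 2*N") (auto intro!: tendsto_intros g v)
qed

lemma tendsto_mul [tendsto_intros]:
  assumes "(g \<longlongrightarrow> g0) F" "(h \<longlongrightarrow> h0) F"
  shows "((\<lambda>s. mul (g s) (h s)) \<longlongrightarrow> mul g0 h0) F"
  unfolding tendsto_fun_iff[where f="\<lambda>s. mul (g s) (h s)"] mul_apply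
  using assms(2) unfolding tendsto_fun_iff[where f=h] by (intro allI tendsto_app assms(1)) auto

lemma tendsto_inv' [tendsto_intros]:
  assumes "(g \<longlongrightarrow> g0) F"
  shows "((\<lambda>s. inv' (g s)) \<longlongrightarrow> inv' g0) F"
proof -
  have g: "((\<lambda>s. g s j) \<longlongrightarrow> g0 j) F" for j
    using assms by (simp add: tendsto_fun_iff[where f=g])
  show ?thesis unfolding tendsto_fun_iff inv'_def inv_app_def
  proof (intro allI)
    fix i j
    show "((\<lambda>s. if j < 2*N then if even j then om (bas i) (g s (j+1)) else - om (bas i) (g s (j-1)) else bas i j) \<longlongrightarrow>
      (if j < 2*N then if even j then om (bas i) (g0 (j+1)) else - om (bas i) (g0 (j-1)) else bas i j)) F"
      by (cases "j < 2*N"; cases "even j") (auto intro!: tendsto_intros g simp del: om_bas)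
  qed
qed

lemma tendsto_ap [tendsto_intros]:
  assumes "(g \<longlongrightarrow> g0) F" "(p \<longlongrightarrow> p0) F"
  shows "((\<lambda>s. ap (g s) (p s)) \<longlongrightarrow> ap g0 p0) F"
  unfolding ap_def by (intro tendsto_intros assms)

lemma apx_apply: "apx a x j = ap a (x j)" by (simp add: apx_def)

lemma nu_apply: "nu r k x j = (nuv r (gsx k x) (fst (x j)), nuv r (gsx k x) (snd (x j)))" by (simp add: nu_def)

lemma tendsto_apx [tendsto_intros]:
  assumes "(g \<longlongrightarrow> g0) F" "(x \<longlongrightarrow> x0) F"
  shows "((\<lambda>s. apx (g s) (x s)) \<longlongrightarrow> apx g0 x0) F"
  unfolding tendsto_fun_iff[where f="\<lambda>s. apx (g s) (x s)"] apx_apply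
  using assms(2) unfolding tendsto_fun_iff[where f=x] by (intro allI tendsto_ap assms(1)) auto

text \<open>Entrywise convergence of lists of a constant length, formulated for every
  \<open>s\<close> and not just eventually, so that convergence can be treated by recursion on the
  limit list.\<close>

definition ltends :: "('s \<Rightarrow> 'p::topological_space list) \<Rightarrow> 'p list \<Rightarrow> 's filter \<Rightarrow> bool" where
  "ltends Ls L F \<longleftrightarrow> (\<forall>s. length (Ls s) = length L) \<and> (\<forall>i<length L. ((\<lambda>s. Ls s ! i) \<longlongrightarrow> L ! i) F)"

lemma ltends_Nil [simp]: "ltends (\<lambda>s. []) [] F" by (simp add: ltends_def)

lemma ltends_Cons: "(p \<longlongrightarrow> p0) F \<Longrightarrow> ltends Ls L F \<Longrightarrow> ltends (\<lambda>s. p s # Ls s) (p0 # L) F"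
  by (auto simp: ltends_def nth_Cons split: nat.split)

lemma ltends_ConsD:
  assumes "ltends Ls (p0 # L) F"
  shows "\<exists>p Ls'. Ls = (\<lambda>s. p s # Ls' s) \<and> (p \<longlongrightarrow> p0) F \<and> ltends Ls' L F"
proof (intro exI conjI)
  have l: "length (Ls s) = Suc (length L)" for s using assms by (auto simp: ltends_def)
  then have ne: "Ls s = hd (Ls s) # tl (Ls s)" for s by (metis length_0_conv list.exhaust_sel nat.distinct(1))
  then show "Ls = (\<lambda>s. hd (Ls s) # tl (Ls s))" by blast
  have h: "Ls s ! 0 = hd (Ls s)" for s using l[of s] by (cases "Ls s") auto
  have t: "Ls s ! Suc i = tl (Ls s) ! i" for s i using l[of s] by (cases "Ls s") auto
  have a: "((\<lambda>s. Ls s ! i) \<longlongrightarrow> (p0 # L) ! i) F" if "i < Suc (length L)" for i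
    using assms that by (auto simp: ltends_def)
  show "((\<lambda>s. hd (Ls s)) \<longlongrightarrow> p0) F" using a[of 0] by (simp add: h)
  show "ltends (\<lambda>s. tl (Ls s)) L F" using a[of "Suc _"] l by (simp add: ltends_def t)
qed

lemma ltends_NilD: "ltends Ls [] F \<Longrightarrow> Ls = (\<lambda>s. [])"
  by (auto simp: ltends_def)

lemma ltends_cong:
  assumes "ltends Ls L F" "\<forall>\<^sub>F s in F. Ls s = Ls' s" "\<And>s. length (Ls' s) = length L"
  shows "ltends Ls' L F"
  unfolding ltends_def
proof (intro conjI allI impI assms(3))
  fix i assume i: "i < length L"
  have "((\<lambda>s. Ls s ! i) \<longlongrightarrow> L ! i) F" using assms(1) i by (simp add: ltends_def)
  then show "((\<lambda>s. Ls' s ! i) \<longlongrightarrow> L ! i) F"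
    by (rule Lim_transform_eventually) (use assms(2) in eventually_elim, simp)
qed

lemma ltends_map: 
  assumes "(x \<longlongrightarrow> x0) F"
  shows "ltends (\<lambda>s. map (x s) idx) (map x0 idx) F"
  using assms by (simp add: ltends_def tendsto_fun_iff[where f=x])

lemma tendsto_prj:
  "ltends Ls L F \<Longrightarrow> (y \<longlongrightarrow> y0) F \<Longrightarrow> ((\<lambda>s. prj (Ls s) (y s)) \<longlongrightarrow> prj L y0) F"
proof (induction L arbitrary: Ls)
  case Nil then show ?case by (auto dest: ltends_NilD)
next
  case (Cons p0 L)
  obtain p Ls' where *: "Ls = (\<lambda>s. p s # Ls' s)" "(p \<longlongrightarrow> p0) F" "ltends Ls' L F"
    using ltends_ConsD[OF Cons.prems(1)] by blast
  have P: "((\<lambda>s. prj (Ls' s) (y s) i) \<longlongrightarrow> prj L y0 i) F" for i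
    using Cons.IH[OF *(3) Cons.prems(2)] by (simp add: tendsto_fun_iff)
  have p: "((\<lambda>s. fst (p s)) \<longlongrightarrow> fst p0) F" "((\<lambda>s. snd (p s)) \<longlongrightarrow> snd p0) F" using *(2) by (auto intro: tendsto_intros)
  then have pi: "((\<lambda>s. fst (p s) i) \<longlongrightarrow> fst p0 i) F" "((\<lambda>s. snd (p s) i) \<longlongrightarrow> snd p0 i) F" for i
    unfolding tendsto_fun_iff by auto
  show ?case unfolding tendsto_fun_iff *(1) prj.simps by (intro allI tendsto_intros P p pi Cons.prems(2))
qed

lemma tendsto_dsc:
  assumes "ltends Ls L F" "(p \<longlongrightarrow> p0) F"
  shows "((\<lambda>s. dsc (Ls s) (p s)) \<longlongrightarrow> dsc L p0) F"
  unfolding dsc_def by (intro tendsto_om tendsto_prj assms tendsto_intros)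

lemma ltends_stp:
  assumes "ltends Ls L F" "(p \<longlongrightarrow> p0) F" "dsc L p0 \<noteq> 0"
  shows "ltends (\<lambda>s. stp (Ls s) (p s)) (stp L p0) F"
proof -
  have P: "((\<lambda>s. prj (Ls s) (snd (p s))) \<longlongrightarrow> prj L (snd p0)) F" "((\<lambda>s. prj (Ls s) (fst (p s))) \<longlongrightarrow> prj L (fst p0)) F"
    by (intro tendsto_prj assms tendsto_intros)+
  have "((\<lambda>s i. prj (Ls s) (snd (p s)) i / dsc (Ls s) (p s)) \<longlongrightarrow> (\<lambda>i. prj L (snd p0) i / dsc L p0)) F"
    unfolding tendsto_fun_iff using P(1) assms(3) unfolding tendsto_fun_iff
    by (intro allI tendsto_intros tendsto_dsc assms) auto
  then show ?thesis unfolding stp_def by (intro ltends_Cons assms(1) tendsto_Pair P(2))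
qed

lemma ltends_gs: "ltends Ls L F \<Longrightarrow> good L \<Longrightarrow> ltends (\<lambda>s. gs (Ls s)) (gs L) F"
proof (induction L arbitrary: Ls)
  case Nil then show ?case by (auto dest: ltends_NilD)
next
  case (Cons p0 L)
  obtain p Ls' where *: "Ls = (\<lambda>s. p s # Ls' s)" "(p \<longlongrightarrow> p0) F" "ltends Ls' L F"
    using ltends_ConsD[OF Cons.prems(1)] by blast
  then show ?case using Cons by (auto intro: ltends_stp)
qed

definition bad_step :: "nat \<Rightarrow> 'k::real_normed_field elt \<Rightarrow> 'k pair list \<Rightarrow> real set" where
  "bad_step r g F = {t. \<exists>ij\<in>set (cand r). t * (\<Sum>ij\<in>set (cand r). norm (dsc F (g (fst ij), g (snd ij)))) =
      norm (dsc F (g (fst ij), g (snd ij))) * real (card (set (cand r)))}"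

text \<open>The pair selected at each step itself depends on \<open>t\<close>. Collecting the
  exceptional parameters of all admissible selections gives a set that is defined independently of
  \<open>t\<close> and is still finite.\<close>

fun bad_times :: "nat \<Rightarrow> 'k::real_normed_field elt \<Rightarrow> nat \<Rightarrow> 'k pair list \<Rightarrow> real set" where
  "bad_times r g 0 F = {}"
| "bad_times r g (Suc n) F = bad_step r g F \<union> (\<Union>ij\<in>{ij\<in>set (cand r). dsc F (g (fst ij), g (snd ij)) \<noteq> 0}. bad_times r g n (stp F (g (fst ij), g (snd ij))))"

lemma finite_bad_step:
  assumes F: "sframe r F" and r: "r \<le> N" and len: "length F < r" and g: "g \<in> GG r"
  shows "finite (bad_step r g F)"
proof -
  define d where "d = (\<lambda>ij. norm (dsc F (g (fst ij), g (snd ij))))"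
  define S where "S = (\<Sum>ij\<in>set (cand r). d ij)"
  define c where "c = real (card (set (cand r)))"
  obtain i j where "i<2*r" "j<2*r" "dsc F (g i, g j) \<noteq> 0" using nondeg[OF F r len g] by blast
  then have ij: "(i,j) \<in> set (cand r)" "d (i,j) > 0" by (auto simp: cand_def d_def)
  then have S: "S > 0" unfolding S_def by (intro sum_pos2[of _ "(i,j)"]) (auto simp: d_def)
  have "bad_step r g F \<subseteq> (\<lambda>ij. d ij * c / S) ` set (cand r)"
  proof
    fix t assume "t \<in> bad_step r g F"
    then have "\<exists>ij\<in>set (cand r). t * S = d ij * c" by (simp add: bad_step_def d_def S_def c_def)
    then obtain ij where "ij \<in> set (cand r)" "t * S = d ij * c" by blast
    then show "t \<in> (\<lambda>ij. d ij * c / S) ` set (cand r)" using S by (auto simp: field_simps)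
  qed
  then show ?thesis by (rule finite_subset) auto
qed

lemma cand_inV: "g \<in> GG r \<Longrightarrow> r \<le> N \<Longrightarrow> ij \<in> set (cand r) \<Longrightarrow> inV r (g (fst ij), g (snd ij))"
  by (auto simp: cand_def inV_def GG_inV)

lemma finite_bad_times:
  assumes r: "r \<le> N" and g: "g \<in> GG r"
  shows "sframe r F \<Longrightarrow> n + length F \<le> r \<Longrightarrow> finite (bad_times r g n F)"
proof (induction n arbitrary: F)
  case (Suc n)
  have "finite (bad_step r g F)" using Suc.prems by (intro finite_bad_step r g) auto
  moreover have "finite (bad_times r g n (stp F (g (fst ij), g (snd ij))))" if "ij \<in> {ij\<in>set (cand r). dsc F (g (fst ij), g (snd ij)) \<noteq> 0}" for ij
    using that Suc.prems by (intro Suc.IH sframe_stp cand_inV g r) auto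
  ultimately show ?case by simp
qed simp

text \<open>Away from equality each comparison with the threshold is a strict inequality in one
  direction or the other, which persists nearby. With finitely many candidates the filtered list,
  and hence its head, is eventually constant.\<close>

lemma sel_eventually:
  assumes F: "ltends Fs F A" and t: "(ts \<longlongrightarrow> t) A" and g: "(gg \<longlongrightarrow> g) A" and nb: "t \<notin> bad_step r g F"
  shows "\<forall>\<^sub>F s in A. sel r (ts s) (gg s) (Fs s) = sel r t g F"
proof -
  have gj: "((\<lambda>s. gg s j) \<longlongrightarrow> g j) A" for j using g by (simp add: tendsto_fun_iff[where f=gg])
  have d: "((\<lambda>s. norm (dsc (Fs s) (gg s i, gg s j))) \<longlongrightarrow> norm (dsc F (g i, g j))) A" for i j
    by (intro tendsto_norm tendsto_dsc F tendsto_Pair gj)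
  let ?ls = "\<lambda>s. ts s * (\<Sum>ij\<in>set (cand r). norm (dsc (Fs s) (gg s (fst ij), gg s (snd ij))))"
  let ?lhs = "t * (\<Sum>ij\<in>set (cand r). norm (dsc F (g (fst ij), g (snd ij))))"
  let ?rs = "\<lambda>ij s. norm (dsc (Fs s) (gg s (fst ij), gg s (snd ij))) * real (card (set (cand r)))"
  let ?rhs = "\<lambda>ij. norm (dsc F (g (fst ij), g (snd ij))) * real (card (set (cand r)))"
  have "(?ls \<longlongrightarrow> ?lhs) A" by (intro tendsto_intros t d)
  moreover have "(?rs ij \<longlongrightarrow> ?rhs ij) A" for ij by (intro tendsto_intros d)
  ultimately have diff: "((\<lambda>s. ?rs ij s - ?ls s) \<longlongrightarrow> ?rhs ij - ?lhs) A" for ij by (intro tendsto_diff)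
  have "\<forall>\<^sub>F s in A. \<forall>ij\<in>set (cand r). (?ls s < ?rs ij s) = (?lhs < ?rhs ij)"
  proof (rule eventually_ball_finite)
    show "\<forall>ij\<in>set (cand r). \<forall>\<^sub>F s in A. (?ls s < ?rs ij s) = (?lhs < ?rhs ij)"
    proof
      fix ij assume ij: "ij \<in> set (cand r)"
      have "?lhs \<noteq> ?rhs ij" using nb ij unfolding bad_step_def by blast
      then consider "?rhs ij - ?lhs > 0" | "?rhs ij - ?lhs < 0" by linarith
      then show "\<forall>\<^sub>F s in A. (?ls s < ?rs ij s) = (?lhs < ?rhs ij)"
      proof cases
        case 1
        have "\<forall>\<^sub>F s in A. ?rs ij s - ?ls s > 0" by (rule order_tendstoD(1)[OF diff 1])
        then show ?thesis by eventually_elim (use 1 in linarith)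
      next
        case 2
        have "\<forall>\<^sub>F s in A. ?rs ij s - ?ls s < 0" by (rule order_tendstoD(2)[OF diff 2])
        then show ?thesis by eventually_elim (use 2 in linarith)
      qed
    qed
  qed simp
  then show ?thesis
  proof eventually_elim
    case (elim s)
    have "filter (\<lambda>ij. ?ls s < ?rs ij s) (cand r) = filter (\<lambda>ij. ?lhs < ?rhs ij) (cand r)"
      using elim by (intro filter_cong refl) blast
    then show ?case unfolding sel_def by (rule arg_cong)
  qed
qed

lemma ltends_extn:
  assumes t: "(ts \<longlongrightarrow> t) A" "0 < t" "t < 1" and g: "(gg \<longlongrightarrow> g) A" "g \<in> GG r" and r: "r \<le> N"
  shows "ltends Fs F A \<Longrightarrow> sframe r F \<Longrightarrow> n + length F \<le> r \<Longrightarrow> t \<notin> bad_times r g n F \<Longrightarrow>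
     ltends (\<lambda>s. extn r (ts s) (gg s) n (Fs s)) (extn r t g n F) A"
proof (induction n arbitrary: F Fs)
  case (Suc n)
  define ij where "ij = sel r t g F"
  have len: "length F < r" using Suc.prems by simp
  have ij: "ij \<in> set (cand r)" "dsc F (g (fst ij), g (snd ij)) \<noteq> 0"
    using sel[OF Suc.prems(2) r len g(2) t(3)] t(2) by (auto simp: ij_def)
  have nb: "t \<notin> bad_times r g n (stp F (g (fst ij), g (snd ij)))"
    using Suc.prems(4) ij unfolding bad_times.simps by blast
  have gj: "((\<lambda>s. gg s j) \<longlongrightarrow> g j) A" for j using g(1) by (simp add: tendsto_fun_iff[where f=gg])
  have "ltends (\<lambda>s. stp (Fs s) (gg s (fst ij), gg s (snd ij))) (stp F (g (fst ij), g (snd ij))) A"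
    by (intro ltends_stp Suc.prems tendsto_Pair gj ij)
  moreover have "\<forall>\<^sub>F s in A. stp (Fs s) (gg s (fst ij), gg s (snd ij)) = ext r (ts s) (gg s) (Fs s)"
    using sel_eventually[OF Suc.prems(1) t(1) g(1), of r] Suc.prems(4) by (auto elim!: eventually_mono simp: ext_def ij_def)
  ultimately have l: "ltends (\<lambda>s. ext r (ts s) (gg s) (Fs s)) (stp F (g (fst ij), g (snd ij))) A"
    by (rule ltends_cong) (use Suc.prems(1) in \<open>simp add: ltends_def\<close>)
  have "ltends (\<lambda>s. extn r (ts s) (gg s) n (ext r (ts s) (gg s) (Fs s))) (extn r t g n (stp F (g (fst ij), g (snd ij)))) A"
    using Suc.prems(2,3) ij nb by (intro Suc.IH l sframe_stp cand_inV g r) auto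
  then show ?case by (simp add: ext_def ij_def)
qed simp

lemma tendsto_fmat:
  assumes "ltends Fs F A" "length F = r"
  shows "((\<lambda>s. fmat r (Fs s)) \<longlongrightarrow> fmat r F) A"
  unfolding tendsto_fun_iff[where f = "\<lambda>s. fmat r (Fs s)"]
proof
  fix j
  show "((\<lambda>s. fmat r (Fs s) j) \<longlongrightarrow> fmat r F j) A"
  proof (cases "j < 2*r")
    case True
    then have "((\<lambda>s. Fs s ! (j div 2)) \<longlongrightarrow> F ! (j div 2)) A" using assms by (simp add: ltends_def)
    then show ?thesis using True by (auto simp: fmat_def intro: tendsto_intros)
  qed (simp add: fmat_def)
qed

lemma ltends_gsx:
  assumes "(xs \<longlongrightarrow> x) A" "x \<in> XX r k"
  shows "ltends (\<lambda>s. gsx k (xs s)) (gsx k x) A"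
  unfolding gsx_def by (intro ltends_gs ltends_map assms XX_good[OF assms(2)]) auto

lemma tendsto_Theta:
  assumes "(ts \<longlongrightarrow> t) A" "0 < t" "t < 1" "(gg \<longlongrightarrow> g) A" "g \<in> GG r" "r \<le> N" "k \<le> r"
    "(xs \<longlongrightarrow> x) A" "x \<in> XX r k" "t \<notin> bad_times r g (r - k) (gsx k x)"
  shows "((\<lambda>s. Theta r k (ts s) (gg s) (xs s)) \<longlongrightarrow> Theta r k t g x) A"
  unfolding Theta_def using assms by (intro tendsto_fmat ltends_extn ltends_gsx[where r=r] XX_gsx) auto

lemma tendsto_nuv:
  assumes F: "ltends Fs F A" and y: "(ys \<longlongrightarrow> y) A" and l: "length F \<le> r"
  shows "((\<lambda>s. nuv r (Fs s) (ys s)) \<longlongrightarrow> nuv r F y) A"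
  unfolding tendsto_fun_iff
proof
  fix j
  have len: "length (Fs s) = length F" for s using F by (simp add: ltends_def)
  show "((\<lambda>s. nuv r (Fs s) (ys s) j) \<longlongrightarrow> nuv r F y j) A"
  proof (cases "2*(r - length F) \<le> j \<and> j < 2*r")
    case True
    define m where "m = j div 2 - (r - length F)"
    have "m < length F" using l True unfolding m_def by linarith
    then have m: "((\<lambda>s. Fs s ! m) \<longlongrightarrow> F ! m) A" using F by (simp add: ltends_def)
    have e: "nuv r (Fs s) v j = (if even j then om v (snd (Fs s ! m)) else - om v (fst (Fs s ! m)))" for s v
      using True by (simp add: nuv_def len m_def)
    have e0: "nuv r F v j = (if even j then om v (snd (F ! m)) else - om v (fst (F ! m)))" for v
      using True by (simp add: nuv_def m_def)
    show ?thesis unfolding e e0 by (cases "even j") (auto intro!: tendsto_intros m y)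
  next
    case False
    have "nuv r (Fs s) v j = 0" "nuv r F v j = 0" for s v using False by (auto simp: nuv_def len)
    then show ?thesis by simp
  qed
qed

lemma tendsto_nu:
  assumes "(xs \<longlongrightarrow> x) A" "x \<in> XX r k" "k \<le> r"
  shows "((\<lambda>s. nu r k (xs s)) \<longlongrightarrow> nu r k x) A"
  unfolding tendsto_fun_iff[where f = "\<lambda>s. nu r k (xs s)"] nu_apply
proof
  fix j
  have "((\<lambda>s. xs s j) \<longlongrightarrow> x j) A" using assms(1) by (simp add: tendsto_fun_iff[where f=xs])
  then show "((\<lambda>s. (nuv r (gsx k (xs s)) (fst (xs s j)), nuv r (gsx k (xs s)) (snd (xs s j)))) \<longlongrightarrow>
     (nuv r (gsx k x) (fst (x j)), nuv r (gsx k x) (snd (x j)))) A"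
    using assms by (intro tendsto_Pair tendsto_nuv ltends_gsx[where r=r] tendsto_intros) auto
qed

lemma tendsto_case_nat [tendsto_intros]:
  assumes "(u \<longlongrightarrow> u0) A" "(x \<longlongrightarrow> x0) A"
  shows "((\<lambda>s. case_nat (u s) (x s)) \<longlongrightarrow> case_nat u0 x0) A"
  unfolding tendsto_fun_iff[where f = "\<lambda>s. case_nat (u s) (x s)"]
  using assms by (auto simp: tendsto_fun_iff[where f = x] split: nat.split)

lemma tendsto_dr [tendsto_intros]:
  assumes "(x \<longlongrightarrow> x0) A"
  shows "((\<lambda>s. dr j (x s)) \<longlongrightarrow> dr j x0) A"
  using assms unfolding tendsto_fun_iff[where f = x] tendsto_fun_iff[where f = "\<lambda>s. dr j (x s)"]
  by (auto simp: dr_def)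

definition moment_generic :: "nat \<Rightarrow> nat \<Rightarrow> 'k::real_normed_field elt \<Rightarrow> 'k pairs \<Rightarrow> real \<Rightarrow> bool" where
  "moment_generic r k g x t \<longleftrightarrow> om (moment r 1 t :: nat \<Rightarrow> 'k) (moment r (2*r) t) \<noteq> 0 \<and>
     (\<forall>idx\<in>{idx. sorted_wrt (<) idx \<and> set idx \<subseteq> {..<k}}. dsc (gs (map x idx)) (ap g (moment_pair r t)) \<noteq> 0)"

lemma finite_incr: "finite {idx::nat list. sorted_wrt (<) idx \<and> set idx \<subseteq> {..<k}}"
  and length_incr: "sorted_wrt (<) idx \<Longrightarrow> set idx \<subseteq> {..<k::nat} \<Longrightarrow> length idx \<le> k"
proof -
  have len: "length idx \<le> k" if "sorted_wrt (<) idx" "set idx \<subseteq> {..<k}" for idx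
    using that strict_sorted_iff[of idx] card_mono[of "{..<k}" "set idx"] by (auto simp: distinct_card)
  then show "sorted_wrt (<) idx \<Longrightarrow> set idx \<subseteq> {..<k} \<Longrightarrow> length idx \<le> k" .
  have "{idx. sorted_wrt (<) idx \<and> set idx \<subseteq> {..<k}} \<subseteq> {xs. set xs \<subseteq> {..<k} \<and> length xs \<le> k}" using len by auto
  then show "finite {idx::nat list. sorted_wrt (<) idx \<and> set idx \<subseteq> {..<k}}"
    using finite_lists_length_le[of "{..<k}" k] by (rule finite_subset) auto
qed

lemma finite_moment_bad:
  assumes x: "x \<in> XX r k" and r: "k < r" "r \<le> N" and g: "g \<in> GG r"
  shows "finite {t. \<not> moment_generic r k g x t}"
proof -
  define I where "I = {idx::nat list. sorted_wrt (<) idx \<and> set idx \<subseteq> {..<k}}"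
  have "finite {t. dsc (gs (map x idx)) (ap g (moment_pair r t)) = 0}" if "idx \<in> I" for idx
    using that length_incr[of idx k] r by (intro dsc_moment_pair_finite[OF _ r(2) _ g] XX_gs[OF x]) (auto simp: I_def)
  moreover have "{t. \<not> moment_generic r k g x t} = (\<Union>idx\<in>I. {t. dsc (gs (map x idx)) (ap g (moment_pair r t)) = 0}) \<union> {t. om (moment r 1 t :: nat \<Rightarrow> 'a) (moment r (2*r) t) = 0}"
    unfolding moment_generic_def I_def by blast
  moreover have "finite I" unfolding I_def by (rule finite_incr)
  ultimately show ?thesis using moment_om_finite[where 'k='a, of r] r by auto
qed

lemma moment_generic_XX:
  assumes x: "x \<in> XX r k" and r: "r \<le> N" and g: "g \<in> GG r" and t: "moment_generic r k g x t"
  shows "case_nat (ap g (moment_pair r t)) x \<in> XX r (Suc k)"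
proof -
  have om: "om (fst (moment_pair r t :: 'a pair)) (snd (moment_pair r t)) = 1" using t by (simp add: moment_generic_def moment_pair_def)
  have "inV r (moment_pair r t :: 'a pair)" by (simp add: inV_def moment_pair_def moment_VV)
  then show ?thesis
    using t om by (intro XX_cons[OF x] inV_ap[OF g r]) (auto simp: moment_generic_def om_app[OF g r])
qed

lemma tendsto_moment: "(ts \<longlongrightarrow> t) A \<Longrightarrow> ((\<lambda>s. moment r m (ts s)) \<longlongrightarrow> moment r m t) A"
  unfolding tendsto_fun_iff moment_def by (auto intro!: tendsto_intros)

lemma tendsto_moment_pair:
  assumes "(ts \<longlongrightarrow> t) A" "om (moment r 1 t :: nat \<Rightarrow> 'k::real_normed_field) (moment r (2*r) t) \<noteq> 0"
  shows "((\<lambda>s. moment_pair r (ts s) :: 'k pair) \<longlongrightarrow> moment_pair r t) A"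
proof -
  have c: "((\<lambda>s. moment r (2*r) (ts s) :: nat \<Rightarrow> 'k) \<longlongrightarrow> moment r (2*r) t) A" by (rule tendsto_moment[OF assms(1)])
  have "((\<lambda>s i. moment r (2*r) (ts s) i / om (moment r 1 (ts s)) (moment r (2*r) (ts s))) \<longlongrightarrow>
     (\<lambda>i. moment r (2*r) t i / om (moment r 1 t) (moment r (2*r) t :: nat \<Rightarrow> 'k))) A"
    unfolding tendsto_fun_iff
  proof
    fix i
    show "((\<lambda>s. moment r (2*r) (ts s) i / om (moment r 1 (ts s)) (moment r (2*r) (ts s))) \<longlongrightarrow>
     moment r (2*r) t i / om (moment r 1 t) (moment r (2*r) t :: nat \<Rightarrow> 'k)) A"
      using c assms(2) by (intro tendsto_divide tendsto_om tendsto_moment assms(1)) (simp_all add: tendsto_fun_iff)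
  qed
  then show ?thesis unfolding moment_pair_def by (intro tendsto_Pair tendsto_moment assms)
qed

text \<open>Finitely many quantities are required to be non-zero, each depending continuously on the
  data at the generic point.\<close>

lemma moment_generic_eventually:
  fixes gg :: "'s \<Rightarrow> nat \<Rightarrow> nat \<Rightarrow> 'k::real_normed_field"
  assumes t: "(ts \<longlongrightarrow> t) A" and g: "(gg \<longlongrightarrow> g) A" and x: "(xs \<longlongrightarrow> x) A" "x \<in> XX r k"
    and good: "moment_generic r k g x t"
  shows "\<forall>\<^sub>F s in A. moment_generic r k (gg s) (xs s) (ts s)"
proof -
  have o: "om (moment r 1 t :: nat \<Rightarrow> 'k) (moment r (2*r) t) \<noteq> 0" using good by (simp add: moment_generic_def)
  have "((\<lambda>s. om (moment r 1 (ts s) :: nat \<Rightarrow> 'k) (moment r (2*r) (ts s))) \<longlongrightarrow> om (moment r 1 t) (moment r (2*r) t)) A"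
    by (intro tendsto_om tendsto_moment t)
  then have "\<forall>\<^sub>F s in A. om (moment r 1 (ts s) :: nat \<Rightarrow> 'k) (moment r (2*r) (ts s)) \<noteq> 0" by (rule tendsto_imp_eventually_ne[OF _ o])
  moreover have "\<forall>\<^sub>F s in A. \<forall>idx\<in>{idx. sorted_wrt (<) idx \<and> set idx \<subseteq> {..<k}}. dsc (gs (map (xs s) idx)) (ap (gg s) (moment_pair r (ts s))) \<noteq> 0"
  proof (rule eventually_ball_finite[OF finite_incr], rule ballI)
    fix idx assume idx: "idx \<in> {idx. sorted_wrt (<) idx \<and> set idx \<subseteq> {..<k}}"
    have "((\<lambda>s. dsc (gs (map (xs s) idx)) (ap (gg s) (moment_pair r (ts s)))) \<longlongrightarrow> dsc (gs (map x idx)) (ap g (moment_pair r t))) A"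
      using idx by (intro tendsto_dsc ltends_gs ltends_map x XX_good[OF x(2)] tendsto_ap g tendsto_moment_pair t o) auto
    moreover have "dsc (gs (map x idx)) (ap g (moment_pair r t)) \<noteq> 0" using good idx by (simp add: moment_generic_def)
    ultimately show "\<forall>\<^sub>F s in A. dsc (gs (map (xs s) idx)) (ap (gg s) (moment_pair r (ts s))) \<noteq> 0"
      by (rule tendsto_imp_eventually_ne)
  qed
  ultimately show ?thesis by eventually_elim (simp add: moment_generic_def)
qed

end

lemma dr_dr: "i \<le> j \<Longrightarrow> dr j (dr i x) = dr i (dr (Suc j) x)"
  by (auto simp: dr_def fun_eq_iff)

lemma alternating_square_zero:
  fixes f :: "(nat \<Rightarrow> 'a) \<Rightarrow> real"
  shows "(\<Sum>i\<le>Suc n. (-1)^i * (\<Sum>j\<le>n. (-1)^j * f (dr j (dr i x)))) = 0"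
proof -
  define e where "e = (\<lambda>(i,j). (-1)^(i+j) * f (dr j (dr i x)))"
  define A where "A = {(i,j). i \<le> j \<and> j \<le> n}"
  define B where "B = {(i,j). j < i \<and> i \<le> Suc n}"
  have finA: "finite A" by (rule finite_subset[of _ "{..n} \<times> {..n}"]) (auto simp: A_def)
  have finB: "finite B" by (rule finite_subset[of _ "{..Suc n} \<times> {..Suc n}"]) (auto simp: B_def)
  have "(\<Sum>i\<le>Suc n. (-1)^i * (\<Sum>j\<le>n. (-1)^j * f (dr j (dr i x)))) = (\<Sum>i\<le>Suc n. \<Sum>j\<le>n. e (i,j))"
    unfolding sum_distrib_left e_def by (intro sum.cong refl) (simp add: power_add mult.assoc)
  also have "\<dots> = sum e ({..Suc n} \<times> {..n})" by (simp add: sum.cartesian_product)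
  also have "{..Suc n} \<times> {..n} = A \<union> B" by (auto simp: A_def B_def)
  also have "sum e (A \<union> B) = sum e A + sum e B" by (rule sum.union_disjoint) (auto simp: finA finB, auto simp: A_def B_def)
  also have "sum e B = sum (\<lambda>(i,j). e (Suc j, i)) A"
    by (rule sum.reindex_bij_witness[where i = "\<lambda>(i,j). (Suc j, i)" and j = "\<lambda>(i,j). (j, i - 1)"]) (auto simp: A_def B_def)
  also have "\<dots> = - sum e A" unfolding sum_negf[symmetric]
    by (rule sum.cong) (auto simp: A_def e_def dr_dr[symmetric] add.commute)
  finally show ?thesis by simp
qed

section \<open>Homogeneous cochains and the prism homotopy\<close>

text \<open>The simplex number \<open>i\<close> of the prism from \<open>a\<close> to
  \<open>b\<close>, with vertices \<open>a 0, ..., a i, b i, b (i + 1), ...\<close>; the index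
  \<open>i\<close> occurs in both rows.\<close>

definition mix :: "nat \<Rightarrow> (nat \<Rightarrow> 'a) \<Rightarrow> (nat \<Rightarrow> 'a) \<Rightarrow> nat \<Rightarrow> 'a" where
  "mix i a b = (\<lambda>j. if j \<le> i then a j else b (j - 1))"

text \<open>Faces of the prism simplices that omit neither of the two vertices with index
  \<open>i\<close> are prism simplices over faces, and these cancel against the second sum. The
  remaining ones are shared by neighbouring simplices and telescope to the two ends.\<close>

lemma prism_identity:
  fixes f :: "(nat \<Rightarrow> 'a) \<Rightarrow> real"
  assumes tail: "\<And>j. j > Suc n \<Longrightarrow> a j = b j"
  shows "(\<Sum>i\<le>Suc n. (-1)^i * (\<Sum>j\<le>Suc (Suc n). (-1)^j * f (dr j (mix i a b)))) +
    (\<Sum>j\<le>Suc n. (-1)^j * (\<Sum>i\<le>n. (-1)^i * f (mix i (dr j a) (dr j b)))) = f b - f a"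
proof -
  define h where "h i j = (-1)^(i+j) * f (mix i (dr j a) (dr j b))" for i j
  define e where "e i j = (-1)^(i+j) * f (dr j (mix i a b))" for i j
  \<comment> \<open>The face shared by neighbouring prism simplices: entries of \<open>a\<close>
    before position \<open>i\<close>, entries of \<open>b\<close> from \<open>i\<close> on. The ends
    are \<open>b\<close> for \<open>i = 0\<close> and, thanks to the common tail, \<open>a\<close>
    for \<open>i = Suc (Suc n)\<close>.\<close>
  define t where "t i = (\<lambda>l. if l < i then a l else b l)" for i
  have 1: "(\<Sum>j<i. e i j) = - (\<Sum>j<i. h (i - 1) j)" if "i \<le> Suc n" for i
    unfolding sum_negf[symmetric]
  proof (rule sum.cong[OF refl])
    fix j assume "j \<in> {..<i}"
    then obtain i' where i: "i = Suc i'" "j \<le> i'" by (cases i) auto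
    have "dr j (mix i a b) = mix i' (dr j a) (dr j b)" using i by (auto simp: dr_def mix_def fun_eq_iff)
    then show "e i j = - h (i - 1) j" using i by (simp add: e_def h_def)
  qed
  have 2: "(\<Sum>j=Suc (Suc i)..Suc (Suc n). e i j) = - (\<Sum>j=Suc i..Suc n. h i j)" for i
  proof -
   have "(\<Sum>j=Suc (Suc i)..Suc (Suc n). e i j) = (\<Sum>j=Suc i..Suc n. e i (Suc j))"
     by (rule sum.shift_bounds_cl_Suc_ivl)
   also have "\<dots> = (\<Sum>j=Suc i..Suc n. - h i j)"
   proof (rule sum.cong[OF refl])
    fix j assume j: "j \<in> {Suc i..Suc n}"
    have "dr (Suc j) (mix i a b) = mix i (dr j a) (dr j b)" using j by (auto simp: dr_def mix_def fun_eq_iff)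
    then show "e i (Suc j) = - h i j" by (simp add: e_def h_def)
   qed
   finally show ?thesis by (simp only: sum_negf)
  qed
  have 3: "e i i = f (t i)" "e i (Suc i) = - f (t (Suc i))" for i
  proof -
    have "dr i (mix i a b) = t i" "dr (Suc i) (mix i a b) = t (Suc i)" by (auto simp: dr_def mix_def t_def fun_eq_iff)
    then show "e i i = f (t i)" "e i (Suc i) = - f (t (Suc i))" by (auto simp: e_def mult_2[symmetric])
  qed
  have "(\<Sum>j\<le>Suc (Suc n). e i j) = (\<Sum>j<i. e i j) + (e i i + e i (Suc i)) + (\<Sum>j=Suc (Suc i)..Suc (Suc n). e i j)" if "i \<le> Suc n" for i
  proof -
    have "{..Suc (Suc n)} = {..<i} \<union> {i, Suc i} \<union> {Suc (Suc i)..Suc (Suc n)}" using that by auto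
    moreover have "sum (e i) ({..<i} \<union> {i, Suc i} \<union> {Suc (Suc i)..Suc (Suc n)}) = sum (e i) ({..<i} \<union> {i, Suc i}) + sum (e i) {Suc (Suc i)..Suc (Suc n)}"
      by (intro sum.union_disjoint) auto
    moreover have "sum (e i) ({..<i} \<union> {i, Suc i}) = sum (e i) {..<i} + sum (e i) {i, Suc i}"
      by (intro sum.union_disjoint) auto
    ultimately show ?thesis by simp
  qed
  then have row: "(\<Sum>j\<le>Suc (Suc n). e i j) = (f (t i) - f (t (Suc i))) - (\<Sum>j<i. h (i - 1) j) - (\<Sum>j=Suc i..Suc n. h i j)" if "i \<le> Suc n" for i
    using that by (simp only: 1 2 3)
  have "(\<Sum>i\<le>Suc n. (-1)^i * (\<Sum>j\<le>Suc (Suc n). (-1)^j * f (dr j (mix i a b)))) = (\<Sum>i\<le>Suc n. \<Sum>j\<le>Suc (Suc n). e i j)"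
    unfolding sum_distrib_left e_def by (intro sum.cong refl) (simp add: power_add mult.assoc)
  also have "\<dots> = (\<Sum>i\<le>Suc n. (f (t i) - f (t (Suc i))) - (\<Sum>j<i. h (i - 1) j) - (\<Sum>j=Suc i..Suc n. h i j))"
    by (intro sum.cong refl row) simp
  also have "\<dots> = (\<Sum>i\<le>Suc n. f (t i) - f (t (Suc i))) - (\<Sum>i\<le>Suc n. \<Sum>j<i. h (i - 1) j) - (\<Sum>i\<le>Suc n. \<Sum>j=Suc i..Suc n. h i j)"
    by (simp only: sum_subtractf)
  also have "(\<Sum>i\<le>Suc n. f (t i) - f (t (Suc i))) = f (t 0) - f (t (Suc (Suc n)))"
    by (rule sum_telescope)
  also have "t 0 = b" by (simp add: t_def)
  also have "t (Suc (Suc n)) = a" using tail by (auto simp: t_def fun_eq_iff)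
  also have "(\<Sum>i\<le>Suc n. \<Sum>j<i. h (i - 1) j) = (\<Sum>i\<le>n. \<Sum>j\<le>i. h i j)"
    by (simp only: sum.atMost_Suc_shift) (simp add: lessThan_Suc_atMost)
  also have "(\<Sum>i\<le>Suc n. \<Sum>j=Suc i..Suc n. h i j) = (\<Sum>i\<le>n. \<Sum>j=Suc i..Suc n. h i j)" by simp
  finally have A: "(\<Sum>i\<le>Suc n. (-1)^i * (\<Sum>j\<le>Suc (Suc n). (-1)^j * f (dr j (mix i a b)))) =
     f b - f a - (\<Sum>i\<le>n. \<Sum>j\<le>i. h i j) - (\<Sum>i\<le>n. \<Sum>j=Suc i..Suc n. h i j)" .
  have "(\<Sum>j\<le>Suc n. (-1)^j * (\<Sum>i\<le>n. (-1)^i * f (mix i (dr j a) (dr j b)))) = (\<Sum>j\<le>Suc n. \<Sum>i\<le>n. h i j)"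
    unfolding sum_distrib_left h_def by (intro sum.cong refl) (simp add: power_add mult_ac)
  also have "\<dots> = (\<Sum>i\<le>n. \<Sum>j\<le>Suc n. h i j)" by (rule sum.swap)
  also have "\<dots> = (\<Sum>i\<le>n. (\<Sum>j\<le>i. h i j) + (\<Sum>j=Suc i..Suc n. h i j))"
  proof (rule sum.cong[OF refl])
    fix i assume "i \<in> {..n}"
    then have "{..Suc n} = {..i} \<union> {Suc i..Suc n}" by auto
    then show "(\<Sum>j\<le>Suc n. h i j) = (\<Sum>j\<le>i. h i j) + (\<Sum>j=Suc i..Suc n. h i j)"
      by (simp only:) (intro sum.union_disjoint, auto)
  qed
  finally show ?thesis using A by (simp add: sum.distrib)
qed

context ambient
begin

text \<open>The entries after \<open>p\<close> are padded with the zero family, which is not a group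
  element but is fixed under left multiplication, so padding is compatible with the action and with
  faces.\<close>

definition Tup :: "nat \<Rightarrow> nat \<Rightarrow> 'k::real_normed_field elts set" where
  "Tup r p = {g. (\<forall>j\<le>p. g j \<in> GG r) \<and> (\<forall>j>p. g j = (\<lambda>_ _. 0))}"

definition lact :: "'k::real_normed_field elt \<Rightarrow> 'k elts \<Rightarrow> nat \<Rightarrow> nat \<Rightarrow> nat \<Rightarrow> 'k" where
  "lact a g = (\<lambda>j. mul a (g j))"

text \<open>The action on the parameter space is left open: the trivial one gives cochains with
  parameters, the diagonal one the columns of the double complex. The bound is uniform over the
  parameters, and vanishing off the domain makes equality of functions the right equality of
  cochains.\<close>

definition Co :: "nat \<Rightarrow> ('k::real_normed_field elt \<Rightarrow> 'y::topological_space \<Rightarrow> 'y) \<Rightarrow> 'y set \<Rightarrow> nat \<Rightarrow>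
    ('k, 'y) cochain set" where
  "Co r act Y p = {F. continuous_on (Tup r p \<times> Y) (\<lambda>z. F (fst z) (snd z)) \<and> (\<exists>B. \<forall>g y. \<bar>F g y\<bar> \<le> B) \<and>
     (\<forall>a\<in>GG r. \<forall>g\<in>Tup r p. \<forall>y\<in>Y. F (lact a g) (act a y) = F g y) \<and>
     (\<forall>g y. \<not> (g \<in> Tup r p \<and> y \<in> Y) \<longrightarrow> F g y = 0)}"

definition dd :: "nat \<Rightarrow> nat \<Rightarrow> ('k::real_normed_field, 'y) cochain \<Rightarrow> 'k elts \<Rightarrow> 'y \<Rightarrow> real" where
  "dd r p F = (\<lambda>g y. if g \<in> Tup r (Suc p) then \<Sum>i\<le>Suc p. (-1)^i * F (dr i g) y else 0)"

definition Bd :: "nat \<Rightarrow> ('k::real_normed_field elt \<Rightarrow> 'y::topological_space \<Rightarrow> 'y) \<Rightarrow> 'y set \<Rightarrow> nat \<Rightarrow>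
    ('k, 'y) cochain set" where
  "Bd r act Y p = (case p of 0 \<Rightarrow> {0} | Suc q \<Rightarrow> dd r q ` Co r act Y q)"

lemma CoI:
  assumes "continuous_on (Tup r p \<times> Y) (\<lambda>z. F (fst z) (snd z))" "\<And>g y. \<bar>F g y\<bar> \<le> B"
    "\<And>a g y. a \<in> GG r \<Longrightarrow> g \<in> Tup r p \<Longrightarrow> y \<in> Y \<Longrightarrow> F (lact a g) (act a y) = F g y"
    "\<And>g y. \<not> (g \<in> Tup r p \<and> y \<in> Y) \<Longrightarrow> F g y = 0"
  shows "F \<in> Co r act Y p"
  using assms unfolding Co_def by blast

lemma Co_cont: "F \<in> Co r act Y p \<Longrightarrow> continuous_on (Tup r p \<times> Y) (\<lambda>z. F (fst z) (snd z))"
  unfolding Co_def by blast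
lemma Co_bdd: "F \<in> Co r act Y p \<Longrightarrow> \<exists>B. \<forall>g y. \<bar>F g y\<bar> \<le> B"
  unfolding Co_def by blast
lemma Co_inv: "F \<in> Co r act Y p \<Longrightarrow> a \<in> GG r \<Longrightarrow> g \<in> Tup r p \<Longrightarrow> y \<in> Y \<Longrightarrow> F (lact a g) (act a y) = F g y"
  unfolding Co_def by blast
lemma Co_zero: "F \<in> Co r act Y p \<Longrightarrow> \<not> (g \<in> Tup r p \<and> y \<in> Y) \<Longrightarrow> F g y = 0"
  unfolding Co_def by blast

lemma TupI: "(\<And>j. j \<le> p \<Longrightarrow> g j \<in> GG r) \<Longrightarrow> (\<And>j. j > p \<Longrightarrow> g j = (\<lambda>_ _. 0)) \<Longrightarrow> g \<in> Tup r p"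
  unfolding Tup_def by blast
lemma Tup_GG: "g \<in> Tup r p \<Longrightarrow> j \<le> p \<Longrightarrow> g j \<in> GG r" unfolding Tup_def by blast
lemma Tup_tail: "g \<in> Tup r p \<Longrightarrow> j > p \<Longrightarrow> g j = (\<lambda>_ _. 0)" unfolding Tup_def by blast

lemma Tup_dr: 
  assumes "g \<in> Tup r (Suc p)" "i \<le> Suc p"
  shows "dr i g \<in> Tup r p"
  by (rule TupI) (use assms in \<open>auto simp: dr_def Tup_GG Tup_tail\<close>)

lemma mul_zero [simp]: "mul a (\<lambda>_ _. 0) = (\<lambda>_ _. 0)" by (simp add: mul_def)

lemma Tup_lact: 
  assumes "a \<in> GG r" "r \<le> N" "g \<in> Tup r p"
  shows "lact a g \<in> Tup r p"
  by (rule TupI) (use assms in \<open>auto simp: lact_def Tup_GG Tup_tail mul_GG\<close>)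

lemma dr_lact: "dr i (lact a g) = lact a (dr i g)" by (auto simp: dr_def lact_def)

lemma Tup_mono: "r \<le> r' \<Longrightarrow> Tup r p \<subseteq> Tup r' p"
  using GG_mono[of r r'] unfolding Tup_def by blast

lemma continuous_on_dr: "continuous_on S f \<Longrightarrow> continuous_on S (\<lambda>z. dr i (f z))"
proof (rule continuous_on_coordinatewise_then_product)
  fix j assume "continuous_on S f"
  then have "continuous_on S (\<lambda>z. f z l)" for l by (rule continuous_on_product_then_coordinatewise)
  then show "continuous_on S (\<lambda>z. dr i (f z) j)" by (cases "j < i") (simp_all add: dr_def)
qed

lemma Co_dd:
  fixes F :: "('k::real_normed_field, 'y::topological_space) cochain"
  assumes r: "r \<le> N" and F: "F \<in> Co r act Y p"
  shows "dd r p F \<in> Co r act Y (Suc p)"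
proof -
  obtain B where B: "\<bar>F g y\<bar> \<le> B" for g y using Co_bdd[OF F] by blast
  show ?thesis
  proof (rule CoI)
    have "continuous_on (Tup r (Suc p) \<times> Y) (\<lambda>z. \<Sum>i\<le>Suc p. (-1)^i * F (dr i (fst z)) (snd z))"
    proof (intro continuous_intros)
      fix i assume i: "i \<in> {..Suc p}"
      have "continuous_on (Tup r (Suc p) \<times> Y) (\<lambda>z. (\<lambda>z. F (fst z) (snd z)) (dr i (fst z), snd z))"
        by (rule continuous_on_compose2[OF Co_cont[OF F]], intro continuous_on_Pair continuous_on_dr continuous_on_fst continuous_on_snd continuous_on_id)
          (use i in \<open>auto simp: Tup_dr\<close>)
      then show "continuous_on (Tup r (Suc p) \<times> Y) (\<lambda>z. F (dr i (fst z)) (snd z))" by simp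
    qed
    then show "continuous_on (Tup r (Suc p) \<times> Y) (\<lambda>z. dd r p F (fst z) (snd z))"
      by (rule continuous_on_eq) (auto simp: dd_def)
    show "\<bar>dd r p F g y\<bar> \<le> (\<Sum>i\<le>Suc p. B)" for g y
    proof (cases "g \<in> Tup r (Suc p)")
      case True
      have "\<bar>\<Sum>i\<le>Suc p. (-1)^i * F (dr i g) y\<bar> \<le> (\<Sum>i\<le>Suc p. B)"
        by (rule order_trans[OF sum_abs], rule sum_mono) (simp add: abs_mult B)
      then show ?thesis using True by (simp add: dd_def)
    next
      case False
      have "0 \<le> B" using B[of g y] by linarith
      then have "0 \<le> (\<Sum>i\<le>Suc p. B)" by (intro sum_nonneg)
      then show ?thesis using False by (simp add: dd_def)
    qed
    fix a :: "'k elt" and y :: 'y and g :: "'k elts" assume a: "a \<in> GG r" "g \<in> Tup r (Suc p)" "y \<in> Y"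
    then show "dd r p F (lact a g) (act a y) = dd r p F g y"
      using Tup_lact[OF a(1) r a(2)] by (auto simp: dd_def dr_lact Co_inv[OF F] Tup_dr intro!: sum.cong)
  next
    fix y and g :: "'k elts" assume "\<not> (g \<in> Tup r (Suc p) \<and> y \<in> Y)"
    then show "dd r p F g y = 0" by (auto simp: dd_def Co_zero[OF F])
  qed
qed

lemma dd_dd: "dd r (Suc p) (dd r p F) = 0"
proof (intro ext)
  fix g y
  show "dd r (Suc p) (dd r p F) g y = 0 g y"
  proof (cases "g \<in> Tup r (Suc (Suc p))")
    case True
    then have "dd r (Suc p) (dd r p F) g y = (\<Sum>i\<le>Suc (Suc p). (-1)^i * (\<Sum>j\<le>Suc p. (-1)^j * (\<lambda>h. F h y) (dr j (dr i g))))"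
      unfolding dd_def by (auto simp: Tup_dr intro!: sum.cong)
    also have "\<dots> = 0" using alternating_square_zero[where f="\<lambda>h. F h y" and n="Suc p" and x=g] by (simp only:)
    finally show ?thesis by simp
  qed (simp add: dd_def)
qed

lemma dd_lin:
  "dd r p (F + H) = dd r p F + dd r p H" "dd r p (F - H) = dd r p F - dd r p H" "dd r p 0 = 0" "dd r p (- F) = - dd r p F"
  by (auto simp: dd_def fun_eq_iff sum.distrib sum_subtractf algebra_simps sum_negf)

lemma Co_0: "0 \<in> Co r act Y p"
  by (rule CoI[where B=0]) auto

lemma Co_add:
  assumes "F \<in> Co r act Y p" "H \<in> Co r act Y p"
  shows "F + H \<in> Co r act Y p"
proof -
  obtain B where B: "\<bar>F g y\<bar> \<le> B" for g y using Co_bdd[OF assms(1)] by blast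
  obtain B' where B': "\<bar>H g y\<bar> \<le> B'" for g y using Co_bdd[OF assms(2)] by blast
  show ?thesis
  proof (rule CoI)
    show "continuous_on (Tup r p \<times> Y) (\<lambda>z. (F + H) (fst z) (snd z))"
      using continuous_on_add[OF Co_cont[OF assms(1)] Co_cont[OF assms(2)]] by simp
    show "\<bar>(F + H) g y\<bar> \<le> B + B'" for g y using B[of g y] B'[of g y] by simp
  qed (simp_all add: Co_inv[OF assms(1)] Co_inv[OF assms(2)] Co_zero[OF assms(1)] Co_zero[OF assms(2)])
qed

lemma Co_uminus:
  assumes "F \<in> Co r act Y p"
  shows "- F \<in> Co r act Y p"
proof -
  obtain B where B: "\<bar>F g y\<bar> \<le> B" for g y using Co_bdd[OF assms(1)] by blast
  show ?thesis
  proof (rule CoI)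
    show "continuous_on (Tup r p \<times> Y) (\<lambda>z. (- F) (fst z) (snd z))"
      using continuous_on_minus[OF Co_cont[OF assms(1)]] by simp
    show "\<bar>(- F) g y\<bar> \<le> B" for g y using B[of g y] by simp
  qed (simp_all add: Co_inv[OF assms(1)] Co_zero[OF assms(1)])
qed

lemma Co_diff: "F \<in> Co r act Y p \<Longrightarrow> H \<in> Co r act Y p \<Longrightarrow> F - H \<in> Co r act Y p"
  using Co_add[of F r act Y p "- H"] Co_uminus[of H] by simp

lemma Bd_closed: "r \<le> N \<Longrightarrow> F \<in> Bd r act Y p \<Longrightarrow> dd r p F = 0"
  by (cases p) (auto simp: Bd_def dd_dd dd_lin)

lemma Bd_0: "0 \<in> Bd r act Y p"
  by (cases p) (auto simp: Bd_def image_iff intro!: bexI[of _ 0] simp: dd_lin Co_0)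

lemma Bd_add: "F \<in> Bd r act Y p \<Longrightarrow> H \<in> Bd r act Y p \<Longrightarrow> F + H \<in> Bd r act Y p"
  by (cases p) (auto simp: Bd_def dd_lin[symmetric] Co_add)

lemma Bd_uminus: "F \<in> Bd r act Y p \<Longrightarrow> - F \<in> Bd r act Y p"
  by (cases p) (auto simp: Bd_def dd_lin[symmetric] Co_uminus)

lemma Bd_dd: "F \<in> Co r act Y p \<Longrightarrow> dd r p F \<in> Bd r act Y (Suc p)"
  by (simp add: Bd_def)


text \<open>Pullback along a random map, with expectation taken over \<open>t\<close>. At
  exceptional parameters \<Psi> may take values outside the domain of \<open>f\<close>, where
  \<open>f\<close> is zero, so the integrand is bounded for all \<open>t\<close>; invariance holds
  for each \<open>t\<close> separately.\<close>

lemma avg_Co: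
  fixes Y :: "'y::metric_space set" and Y' :: "'z::metric_space set"
    and \<Psi> :: "real \<Rightarrow> 'k::real_normed_field elts \<times> 'y \<Rightarrow> 'k elts \<times> 'z"
  assumes f: "f \<in> Co r' act' Y' q" 
    and r: "r \<le> N" and act: "\<And>a y. a \<in> GG r \<Longrightarrow> y \<in> Y \<Longrightarrow> act a y \<in> Y"
    and P: "\<And>z. z \<in> Tup r p \<times> Y \<Longrightarrow> \<exists>B. finite B \<and> (\<forall>t. 0 < t \<and> t < 1 \<and> t \<notin> B \<longrightarrow> good_pt \<Psi> (Tup r p \<times> Y) (Tup r' q \<times> Y') t z)"
    and inv: "\<And>t a g y. 0 < t \<Longrightarrow> t < 1 \<Longrightarrow> a \<in> GG r \<Longrightarrow> g \<in> Tup r p \<Longrightarrow> y \<in> Y \<Longrightarrow>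
      f (fst (\<Psi> t (lact a g, act a y))) (snd (\<Psi> t (lact a g, act a y))) = f (fst (\<Psi> t (g, y))) (snd (\<Psi> t (g, y)))"
  shows "(\<lambda>g y. if g \<in> Tup r p \<and> y \<in> Y then avg (\<lambda>t. f (fst (\<Psi> t (g, y))) (snd (\<Psi> t (g, y)))) else 0) \<in> Co r act Y p"
    and "\<And>g y. g \<in> Tup r p \<Longrightarrow> y \<in> Y \<Longrightarrow> avgable (\<lambda>t. f (fst (\<Psi> t (g, y))) (snd (\<Psi> t (g, y))))"
proof -
  obtain B where B: "\<bar>f g y\<bar> \<le> B" for g y using Co_bdd[OF f] by blast
  have B0: "0 \<le> B" using B[of undefined undefined] by linarith
  have R: "ract (\<lambda>t z. (\<lambda>w. f (fst w) (snd w)) (\<Psi> t z)) (Tup r p \<times> Y)"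
    by (rule ract_compose[OF Co_cont[OF f] P])
  show av: "avgable (\<lambda>t. f (fst (\<Psi> t (g, y))) (snd (\<Psi> t (g, y))))" if "g \<in> Tup r p" "y \<in> Y" for g y
    using ract_avgable[OF R B, of "(g, y)"] that by simp
  show "(\<lambda>g y. if g \<in> Tup r p \<and> y \<in> Y then avg (\<lambda>t. f (fst (\<Psi> t (g, y))) (snd (\<Psi> t (g, y)))) else 0) \<in> Co r act Y p"
  proof (rule CoI)
    have "continuous_on (Tup r p \<times> Y) (\<lambda>z. avg (\<lambda>t. f (fst (\<Psi> t z)) (snd (\<Psi> t z))))"
      by (rule avg_continuous_on[OF R]) (rule B)
    then show "continuous_on (Tup r p \<times> Y) (\<lambda>z. if fst z \<in> Tup r p \<and> snd z \<in> Y then 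
       avg (\<lambda>t. f (fst (\<Psi> t (fst z, snd z))) (snd (\<Psi> t (fst z, snd z)))) else 0)"
      by (rule continuous_on_eq) auto
    show "\<bar>if g \<in> Tup r p \<and> y \<in> Y then avg (\<lambda>t. f (fst (\<Psi> t (g, y))) (snd (\<Psi> t (g, y)))) else 0\<bar> \<le> B" for g y
      using avg_bound[OF av B] B0 by simp
  next
    fix a :: "'k elt" and g :: "'k elts" and y assume a: "a \<in> GG r" "g \<in> Tup r p" "y \<in> Y"
    have "avg (\<lambda>t. f (fst (\<Psi> t (lact a g, act a y))) (snd (\<Psi> t (lact a g, act a y)))) = avg (\<lambda>t. f (fst (\<Psi> t (g, y))) (snd (\<Psi> t (g, y))))"
      by (rule avg_cong) (rule inv[OF _ _ a])
    then show "(if lact a g \<in> Tup r p \<and> act a y \<in> Y then avg (\<lambda>t. f (fst (\<Psi> t (lact a g, act a y))) (snd (\<Psi> t (lact a g, act a y)))) else 0) =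
      (if g \<in> Tup r p \<and> y \<in> Y then avg (\<lambda>t. f (fst (\<Psi> t (g, y))) (snd (\<Psi> t (g, y)))) else 0)"
      using a Tup_lact[OF a(1) r a(2)] act[OF a(1,3)] by simp
  qed auto
qed

lemma mix_Tup:
  assumes "a \<in> Tup r p" "b \<in> Tup r p" "i \<le> p"
  shows "mix i a b \<in> Tup r (Suc p)"
  by (rule TupI) (use assms in \<open>auto simp: mix_def Tup_GG Tup_tail\<close>)

lemma mix_lact: "mix i (lact a g) (lact a h) = lact a (mix i g h)"
  by (auto simp: mix_def lact_def)

lemma tendsto_mix:
  assumes "(a \<longlongrightarrow> a0) F" "(b \<longlongrightarrow> b0) F"
  shows "((\<lambda>s. mix i (a s) (b s)) \<longlongrightarrow> mix i a0 b0) F"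
  using assms unfolding tendsto_fun_iff[where f=a] tendsto_fun_iff[where f=b] tendsto_fun_iff[where f="\<lambda>s. mix i (a s) (b s)"]
  by (auto simp: mix_def)

definition map_tup :: "(real \<Rightarrow> 'k::real_normed_field elt \<Rightarrow> 'y \<Rightarrow> nat \<Rightarrow> nat \<Rightarrow> 'k) \<Rightarrow> nat \<Rightarrow> real \<Rightarrow>
    'k elts \<Rightarrow> 'y \<Rightarrow> nat \<Rightarrow> nat \<Rightarrow> nat \<Rightarrow> 'k" where
  "map_tup \<Theta> p t g y = (\<lambda>j. if j \<le> p then \<Theta> t (g j) y else (\<lambda>_ _. 0))"

definition avg_map :: "nat \<Rightarrow> 'y set \<Rightarrow> (real \<Rightarrow> 'k::real_normed_field elt \<Rightarrow> 'y \<Rightarrow> nat \<Rightarrow> nat \<Rightarrow> 'k) \<Rightarrow> nat \<Rightarrow>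
    ('k, 'y) cochain \<Rightarrow> 'k elts \<Rightarrow> 'y \<Rightarrow> real" where
  "avg_map r Y \<Theta> p F = (\<lambda>g y. if g \<in> Tup r p \<and> y \<in> Y then avg (\<lambda>t. F (map_tup \<Theta> p t g y) y) else 0)"

lemma dr_map_tup: "i \<le> Suc p \<Longrightarrow> dr i (map_tup \<Theta> (Suc p) t g y) = map_tup \<Theta> p t (dr i g) y"
  by (auto simp: dr_def map_tup_def fun_eq_iff)

lemma Co_sum: "finite I \<Longrightarrow> (\<And>i. i \<in> I \<Longrightarrow> F i \<in> Co r act Y p) \<Longrightarrow> (\<Sum>i\<in>I. F i) \<in> Co r act Y p"
  by (induction I rule: finite_induct) (auto simp: Co_0 Co_add)

lemma Co_sign: "F \<in> Co r act Y p \<Longrightarrow> (\<lambda>g y. (-1)^i * F g y) \<in> Co r act Y p"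
proof (cases "even i")
  case False
  assume "F \<in> Co r act Y p"
  moreover have "(\<lambda>g y. (-1)^i * F g y) = - F" using False by (simp add: fun_eq_iff)
  ultimately show ?thesis by (simp add: Co_uminus)
qed simp

section \<open>Averaged equivariant self-maps of the group act as the identity on cohomology\<close>

context
  fixes r :: nat and act :: "'k::real_normed_field elt \<Rightarrow> 'y::metric_space \<Rightarrow> 'y" and Y :: "'y set"
    and \<Theta> :: "real \<Rightarrow> 'k elt \<Rightarrow> 'y \<Rightarrow> nat \<Rightarrow> nat \<Rightarrow> 'k"
  assumes r: "r \<le> N" and act: "\<And>a y. a \<in> GG r \<Longrightarrow> y \<in> Y \<Longrightarrow> act a y \<in> Y"
    and TG: "\<And>t g y. 0 < t \<Longrightarrow> t < 1 \<Longrightarrow> g \<in> GG r \<Longrightarrow> y \<in> Y \<Longrightarrow> \<Theta> t g y \<in> GG r"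
    and TE: "\<And>t a g y. 0 < t \<Longrightarrow> t < 1 \<Longrightarrow> a \<in> GG r \<Longrightarrow> g \<in> GG r \<Longrightarrow> y \<in> Y \<Longrightarrow> \<Theta> t (mul a g) (act a y) = mul a (\<Theta> t g y)"
    and TR: "ract (\<lambda>t z. \<Theta> t (fst z) (snd z)) (GG r \<times> Y)"
begin

lemma map_tup_Tup:
  assumes "0 < t" "t < 1" "g \<in> Tup r p" "y \<in> Y"
  shows "map_tup \<Theta> p t g y \<in> Tup r p"
  by (rule TupI) (use assms in \<open>auto simp: map_tup_def TG Tup_GG\<close>)

lemma map_tup_lact:
  assumes "0 < t" "t < 1" "a \<in> GG r" "g \<in> Tup r p" "y \<in> Y"
  shows "map_tup \<Theta> p t (lact a g) (act a y) = lact a (map_tup \<Theta> p t g y)"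
  using assms by (auto simp: map_tup_def lact_def fun_eq_iff TE Tup_GG)

lemma map_tup_ract: "ract (\<lambda>t z. map_tup \<Theta> p t (fst z) (snd z)) (Tup r p \<times> Y)"
  unfolding ract_def
proof (rule ballI)
  fix z :: "'k elts \<times> 'y" assume "z \<in> Tup r p \<times> Y"
  then obtain g y where z: "z = (g, y)" and g: "g \<in> Tup r p" and y: "y \<in> Y" by auto
  let ?P = "\<lambda>j B. finite B \<and> (\<forall>t. 0 < t \<and> t < 1 \<and> t \<notin> B \<longrightarrow> cont_pt (\<lambda>t z. \<Theta> t (fst z) (snd z)) (GG r \<times> Y) t (g j, y))"
  have "\<forall>j. \<exists>B. j \<le> p \<longrightarrow> ?P j B"
  proof
    fix j
    show "\<exists>B. j \<le> p \<longrightarrow> ?P j B"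
    proof (cases "j \<le> p")
      case True
      then have "(g j, y) \<in> GG r \<times> Y" using Tup_GG[OF g] y by simp
      from ractD[OF TR this] obtain B where "?P j B" ..
      then show ?thesis by (intro exI impI)
    qed simp
  qed
  from choice[OF this] obtain B where B0: "\<forall>j. j \<le> p \<longrightarrow> ?P j (B j)" ..
  have B1: "finite (B j)" if "j \<le> p" for j using B0 that by simp
  have B2: "cont_pt (\<lambda>t z. \<Theta> t (fst z) (snd z)) (GG r \<times> Y) t (g j, y)" if "j \<le> p" "0 < t" "t < 1" "t \<notin> B j" for j t
    using B0 that by simp
  have C: "cont_pt (\<lambda>t z. map_tup \<Theta> p t (fst z) (snd z)) (Tup r p \<times> Y) t z"
    if t: "0 < t" "t < 1" "t \<notin> (\<Union>j\<le>p. B j)" for t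
    unfolding cont_pt_def
  proof (intro allI impI)
    fix ts :: "nat \<Rightarrow> real" and zs :: "nat \<Rightarrow> 'k elts \<times> 'y"
    assume a: "\<forall>n. 0 < ts n \<and> ts n < 1" "\<forall>n. zs n \<in> Tup r p \<times> Y" "ts \<longlonglongrightarrow> t" "zs \<longlonglongrightarrow> z"
    have c: "(\<lambda>n. fst (zs n)) \<longlonglongrightarrow> g" "(\<lambda>n. snd (zs n)) \<longlonglongrightarrow> y" using tendsto_fst[OF a(4)] tendsto_snd[OF a(4)] by (simp_all add: z)
    have d: "fst (zs n) \<in> Tup r p" "snd (zs n) \<in> Y" for n using spec[OF a(2), of n] by auto
    show "(\<lambda>n. map_tup \<Theta> p (ts n) (fst (zs n)) (snd (zs n))) \<longlonglongrightarrow> map_tup \<Theta> p t (fst z) (snd z)"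
      unfolding tendsto_fun_iff[where f = "\<lambda>n. map_tup \<Theta> p (ts n) (fst (zs n)) (snd (zs n))"]
    proof
      fix j
      show "(\<lambda>n. map_tup \<Theta> p (ts n) (fst (zs n)) (snd (zs n)) j) \<longlonglongrightarrow> map_tup \<Theta> p t (fst z) (snd z) j"
      proof (cases "j \<le> p")
        case True
        then have cc: "cont_pt (\<lambda>t z. \<Theta> t (fst z) (snd z)) (GG r \<times> Y) t (g j, y)" using B2[of j t] t by simp
        have gj: "(\<lambda>n. fst (zs n) j) \<longlonglongrightarrow> g j" using c(1) by (simp add: tendsto_fun_iff[where f="\<lambda>n. fst (zs n)"])
        have "(\<lambda>n. \<Theta> (ts n) (fst (fst (zs n) j, snd (zs n))) (snd (fst (zs n) j, snd (zs n)))) \<longlonglongrightarrow> \<Theta> t (fst (g j, y)) (snd (g j, y))"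
        proof (rule cont_ptD[OF cc])
          show "(fst (zs n) j, snd (zs n)) \<in> GG r \<times> Y" for n using Tup_GG[OF d(1) True] d(2) by simp
          show "(\<lambda>n. (fst (zs n) j, snd (zs n))) \<longlonglongrightarrow> (g j, y)" by (rule tendsto_Pair[OF gj c(2)])
        qed (use a in simp_all)
        then show ?thesis using True by (simp add: map_tup_def z)
      qed (simp add: map_tup_def)
    qed
  qed
  show "\<exists>B. finite B \<and> (\<forall>t. 0 < t \<and> t < 1 \<and> t \<notin> B \<longrightarrow> cont_pt (\<lambda>t z. map_tup \<Theta> p t (fst z) (snd z)) (Tup r p \<times> Y) t z)"
  proof (intro exI conjI allI impI)
    show "finite (\<Union>j\<le>p. B j)" using B1 by auto
    fix t assume t: "0 < t \<and> t < 1 \<and> t \<notin> (\<Union>j\<le>p. B j)"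
    show "cont_pt (\<lambda>t z. map_tup \<Theta> p t (fst z) (snd z)) (Tup r p \<times> Y) t z"
      by (rule C) (use t in simp_all)
  qed
qed

lemma good_pt_config:
  assumes W: "\<And>g h. g \<in> Tup r p \<Longrightarrow> h \<in> Tup r p \<Longrightarrow> W g h \<in> Tup r q"
    and C: "\<And>gs g hs h. gs \<longlonglongrightarrow> g \<Longrightarrow> hs \<longlonglongrightarrow> h \<Longrightarrow> (\<lambda>n. W (gs n) (hs n)) \<longlonglongrightarrow> W g h"
    and z: "z \<in> Tup r p \<times> Y"
  shows "\<exists>B. finite B \<and> (\<forall>t. 0 < t \<and> t < 1 \<and> t \<notin> B \<longrightarrow>
     good_pt (\<lambda>t z. (W (fst z) (map_tup \<Theta> p t (fst z) (snd z)), snd z)) (Tup r p \<times> Y) (Tup r q \<times> Y) t z)"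
proof -
  have D: "(W (fst z) (map_tup \<Theta> p t (fst z) (snd z)), snd z) \<in> Tup r q \<times> Y" if "0 < t" "t < 1" "z \<in> Tup r p \<times> Y" for t z
    using that by (auto intro!: W map_tup_Tup)
  from ractD[OF map_tup_ract z] obtain B where B: "finite B \<and> (\<forall>t. 0 < t \<and> t < 1 \<and> t \<notin> B \<longrightarrow> cont_pt (\<lambda>t z. map_tup \<Theta> p t (fst z) (snd z)) (Tup r p \<times> Y) t z)" ..
  show ?thesis
  proof (intro exI conjI allI impI)
    show "finite B" using B ..
    fix t assume t: "0 < t \<and> t < 1 \<and> t \<notin> B"
    with B have cp: "cont_pt (\<lambda>t z. map_tup \<Theta> p t (fst z) (snd z)) (Tup r p \<times> Y) t z" by simp
    show "good_pt (\<lambda>t z. (W (fst z) (map_tup \<Theta> p t (fst z) (snd z)), snd z)) (Tup r p \<times> Y) (Tup r q \<times> Y) t z"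
    proof (rule good_ptI)
      fix ts :: "nat \<Rightarrow> real" and zs :: "nat \<Rightarrow> 'k elts \<times> 'y"
      assume a: "\<And>n. 0 < ts n \<and> ts n < 1" "\<And>n. zs n \<in> Tup r p \<times> Y" "ts \<longlonglongrightarrow> t" "zs \<longlonglongrightarrow> z"
      have "(\<lambda>n. (W (fst (zs n)) (map_tup \<Theta> p (ts n) (fst (zs n)) (snd (zs n))), snd (zs n))) \<longlonglongrightarrow> (W (fst z) (map_tup \<Theta> p t (fst z) (snd z)), snd z)"
        by (intro tendsto_Pair C tendsto_fst tendsto_snd a(4) cont_ptD[OF cp a])
      moreover have "\<forall>\<^sub>F n in sequentially. (W (fst (zs n)) (map_tup \<Theta> p (ts n) (fst (zs n)) (snd (zs n))), snd (zs n)) \<in> Tup r q \<times> Y"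
        by (intro always_eventually allI D) (simp_all only: a(1,2))
      ultimately show "(\<lambda>n. (W (fst (zs n)) (map_tup \<Theta> p (ts n) (fst (zs n)) (snd (zs n))), snd (zs n))) \<longlonglongrightarrow> (W (fst z) (map_tup \<Theta> p t (fst z) (snd z)), snd z) \<and>
        (\<forall>\<^sub>F n in sequentially. (W (fst (zs n)) (map_tup \<Theta> p (ts n) (fst (zs n)) (snd (zs n))), snd (zs n)) \<in> Tup r q \<times> Y)" ..
    next
      show "0 < t" "t < 1" using t by simp_all
      then show "(W (fst z) (map_tup \<Theta> p t (fst z) (snd z)), snd z) \<in> Tup r q \<times> Y" by (rule D[OF _ _ z])
    qed (rule z)
  qed
qed

text \<open>\<open>W\<close> combines a tuple and its image under the self-map. It is
  \<open>mix i\<close> for the prism operator and the second projection for the averaged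
  pullback.\<close>

lemma config_Co:
  assumes F: "F \<in> Co r act Y q"
    and W: "\<And>g h. g \<in> Tup r p \<Longrightarrow> h \<in> Tup r p \<Longrightarrow> W g h \<in> Tup r q"
    and C: "\<And>gs g hs h. gs \<longlonglongrightarrow> g \<Longrightarrow> hs \<longlonglongrightarrow> h \<Longrightarrow> (\<lambda>n. W (gs n) (hs n)) \<longlonglongrightarrow> W g h"
    and E: "\<And>a g h. W (lact a g) (lact a h) = lact a (W g h)"
  shows "(\<lambda>g y. if g \<in> Tup r p \<and> y \<in> Y then avg (\<lambda>t. F (W g (map_tup \<Theta> p t g y)) y) else 0) \<in> Co r act Y p" (is ?A)
    and "\<And>g y. g \<in> Tup r p \<Longrightarrow> y \<in> Y \<Longrightarrow> avgable (\<lambda>t. F (W g (map_tup \<Theta> p t g y)) y)"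
proof -
  define \<Psi> where "\<Psi> = (\<lambda>t z. (W (fst z) (map_tup \<Theta> p t (fst z) (snd z)), snd z))"
  have G: "\<exists>B. finite B \<and> (\<forall>t. 0 < t \<and> t < 1 \<and> t \<notin> B \<longrightarrow> good_pt \<Psi> (Tup r p \<times> Y) (Tup r q \<times> Y) t z)"
    if "z \<in> Tup r p \<times> Y" for z
    unfolding \<Psi>_def by (rule good_pt_config[OF W C that])
  have inv: "F (fst (\<Psi> t (lact a g, act a y))) (snd (\<Psi> t (lact a g, act a y))) = F (fst (\<Psi> t (g, y))) (snd (\<Psi> t (g, y)))"
    if "0 < t" "t < 1" "a \<in> GG r" "g \<in> Tup r p" "y \<in> Y" for t a g y
    using that by (simp add: \<Psi>_def map_tup_lact E Co_inv[OF F] W map_tup_Tup)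
  have "(\<lambda>g y. if g \<in> Tup r p \<and> y \<in> Y then avg (\<lambda>t. F (fst (\<Psi> t (g, y))) (snd (\<Psi> t (g, y)))) else 0) \<in> Co r act Y p"
    by (rule avg_Co(1)[where \<Psi>=\<Psi>, OF F r], fact act, fact G, fact inv)
  then show ?A by (simp add: \<Psi>_def cong: if_cong)
  fix g :: "'k elts" and y assume gy: "g \<in> Tup r p" "y \<in> Y"
  have "avgable (\<lambda>t. F (fst (\<Psi> t (g, y))) (snd (\<Psi> t (g, y))))"
    by (rule avg_Co(2)[where \<Psi>=\<Psi> and act=act, OF F r], fact act, fact G, fact inv, fact gy, fact gy)
  then show "avgable (\<lambda>t. F (W g (map_tup \<Theta> p t g y)) y)" by (simp add: \<Psi>_def)
qed

lemma mix_Co: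
  assumes "F \<in> Co r act Y (Suc p)" "i \<le> p"
  shows "(\<lambda>g y. if g \<in> Tup r p \<and> y \<in> Y then avg (\<lambda>t. F (mix i g (map_tup \<Theta> p t g y)) y) else 0) \<in> Co r act Y p"
    "\<And>g y. g \<in> Tup r p \<Longrightarrow> y \<in> Y \<Longrightarrow> avgable (\<lambda>t. F (mix i g (map_tup \<Theta> p t g y)) y)"
  using config_Co[OF assms(1), of p "mix i"] assms(2) by (simp_all add: mix_Tup tendsto_mix mix_lact)

definition prismF :: "nat \<Rightarrow> ('k, 'y) cochain \<Rightarrow> 'k elts \<Rightarrow> 'y \<Rightarrow> real" where
  "prismF p F = (\<lambda>g y. if g \<in> Tup r p \<and> y \<in> Y then \<Sum>i\<le>p. (-1)^i * avg (\<lambda>t. F (mix i g (map_tup \<Theta> p t g y)) y) else 0)"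

lemma prismF_Co:
  assumes "F \<in> Co r act Y (Suc p)"
  shows "prismF p F \<in> Co r act Y p"
proof -
  have "(\<Sum>i\<le>p. (\<lambda>g y. (-1)^i * (\<lambda>g y. if g \<in> Tup r p \<and> y \<in> Y then avg (\<lambda>t. F (mix i g (map_tup \<Theta> p t g y)) y) else 0) g y)) \<in> Co r act Y p"
    by (intro Co_sum Co_sign mix_Co(1) assms) auto
  also have "(\<Sum>i\<le>p. (\<lambda>g y. (-1)^i * (\<lambda>g y. if g \<in> Tup r p \<and> y \<in> Y then avg (\<lambda>t. F (mix i g (map_tup \<Theta> p t g y)) y) else 0) g y)) = prismF p F"
  proof -
    have sum_app: "(\<Sum>i\<in>I. H i) g y = (\<Sum>i\<in>I. H i g y)" if "finite I" for I g y and H :: "nat \<Rightarrow> 'k elts \<Rightarrow> 'y \<Rightarrow> real"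
      using that by (induction I rule: finite_induct) auto
    show ?thesis by (intro ext) (auto simp: sum_app prismF_def intro!: sum.neutral)
  qed
  finally show ?thesis .
qed

text \<open>For each \<open>t\<close> the prism identity compares a tuple with its image, and the
  terms with the coboundary of \<open>F\<close> vanish on cocycles. Averaging over \<open>t\<close>
  turns the rest into the coboundary of a cochain that is again continuous.\<close>

lemma avg_map_homotopic:
  assumes F: "F \<in> Co r act Y p" and dF: "dd r p F = 0"
  shows "F - avg_map r Y \<Theta> p F \<in> Bd r act Y p"
proof (cases p)
  case 0
  have "avg_map r Y \<Theta> p F g y = F g y" for g y
  proof (cases "g \<in> Tup r p \<and> y \<in> Y")
    case True
    have "F (map_tup \<Theta> p t g y) y = F g y" if t: "0 < t" "t < 1" for t
    proof -
      let ?h = "map_tup \<Theta> p t g y"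
      have h: "?h \<in> Tup r 0" using map_tup_Tup[OF t, of g p y] True 0 by simp
      have g: "g \<in> Tup r 0" using True 0 by simp
      \<comment> \<open>In degree zero no coboundaries are available, so equality is needed. The
        cocycle condition on the edge from \<open>g\<close> to its image provides it.\<close>
      have "mix 0 g ?h \<in> Tup r (Suc 0)" using mix_Tup[OF g h] by simp
      moreover have "dr 0 (mix 0 g ?h) = ?h" by (auto simp: dr_def mix_def)
      moreover have "dr (Suc 0) (mix 0 g ?h) = g" using Tup_tail[OF g] Tup_tail[OF h] by (auto simp: dr_def mix_def fun_eq_iff)
      moreover have "dd r 0 F (mix 0 g ?h) y = 0" using dF 0 by simp
      ultimately show ?thesis by (simp add: dd_def)
    qed
    then have "avg (\<lambda>t. F (map_tup \<Theta> p t g y) y) = avg (\<lambda>t. F g y)" by (intro avg_cong)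
    then show ?thesis using True by (simp add: avg_map_def)
  next
    case False
    then show ?thesis using Co_zero[OF F, of g y] by (auto simp: avg_map_def)
  qed
  then have "avg_map r Y \<Theta> p F = F" by blast
  then show ?thesis by (simp add: Bd_0)
next
  case (Suc n)
  have F': "F \<in> Co r act Y (Suc n)" using F Suc by simp
  have "dd r n (prismF n F) g y = avg_map r Y \<Theta> p F g y - F g y" for g y
  proof (cases "g \<in> Tup r (Suc n) \<and> y \<in> Y")
    case True
    then have g: "g \<in> Tup r (Suc n)" and y: "y \<in> Y" by auto
    let ?b = "\<lambda>t. map_tup \<Theta> (Suc n) t g y"
    have id: "(\<Sum>j\<le>Suc n. (-1)^j * (\<Sum>i\<le>n. (-1)^i * F (mix i (dr j g) (dr j (?b t))) y)) = F (?b t) y - F g y" if t: "0 < t" "t < 1" for t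
    proof -
      have b: "?b t \<in> Tup r (Suc n)" by (rule map_tup_Tup[OF t g y])
      have tail: "g j = ?b t j" if "j > Suc n" for j using Tup_tail[OF g that] Tup_tail[OF b that] by simp
      have z: "(\<Sum>j\<le>Suc (Suc n). (-1)^j * F (dr j (mix i g (?b t))) y) = 0" if "i \<le> Suc n" for i
      proof -
        have "dd r (Suc n) F (mix i g (?b t)) y = 0" using dF Suc by simp
        then show ?thesis using mix_Tup[OF g b that] unfolding dd_def by simp
      qed
      have "(\<Sum>i\<le>Suc n. (-1)^i * (\<Sum>j\<le>Suc (Suc n). (-1)^j * F (dr j (mix i g (?b t))) y)) = 0"
        by (intro sum.neutral ballI) (simp only: z atMost_iff mult_zero_right)
      then show ?thesis using prism_identity[of n g "?b t" "\<lambda>h. F h y", OF tail] by linarith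
    qed
    have drg: "dr j g \<in> Tup r n" if "j \<le> Suc n" for j using Tup_dr[OF g that] .
    have "dd r n (prismF n F) g y = (\<Sum>j\<le>Suc n. (-1)^j * (\<Sum>i\<le>n. (-1)^i * avg (\<lambda>t. F (mix i (dr j g) (map_tup \<Theta> n t (dr j g) y)) y)))"
      using g y drg by (auto simp: dd_def prismF_def intro!: sum.cong)
    also have "\<dots> = (\<Sum>j\<le>Suc n. (-1)^j * (\<Sum>i\<le>n. (-1)^i * avg (\<lambda>t. F (mix i (dr j g) (dr j (?b t))) y)))"
      by (intro sum.cong refl) (simp add: dr_map_tup)
    also have "\<dots> = avg (\<lambda>t. \<Sum>j\<le>Suc n. (-1)^j * (\<Sum>i\<le>n. (-1)^i * F (mix i (dr j g) (dr j (?b t))) y))"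
    proof -
      have A: "avgable (\<lambda>t. F (mix i (dr j g) (dr j (?b t))) y)" if "i \<le> n" "j \<le> Suc n" for i j
        using mix_Co(2)[OF F' that(1) drg[OF that(2)] y] that by (simp add: dr_map_tup)
      have A2: "avg (\<lambda>t. \<Sum>i\<le>n. (-1)^i * F (mix i (dr j g) (dr j (?b t))) y) = (\<Sum>i\<le>n. (-1)^i * avg (\<lambda>t. F (mix i (dr j g) (dr j (?b t))) y)) \<and>
         avgable (\<lambda>t. \<Sum>i\<le>n. (-1)^i * F (mix i (dr j g) (dr j (?b t))) y)" if "j \<le> Suc n" for j
        using avg_sum[of "{..n}" "\<lambda>i t. (-1)^i * F (mix i (dr j g) (dr j (?b t))) y"] A that by (simp add: avg_cmult)
      have "avg (\<lambda>t. \<Sum>j\<le>Suc n. (-1)^j * (\<Sum>i\<le>n. (-1)^i * F (mix i (dr j g) (dr j (?b t))) y)) =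
        (\<Sum>j\<le>Suc n. avg (\<lambda>t. (-1)^j * (\<Sum>i\<le>n. (-1)^i * F (mix i (dr j g) (dr j (?b t))) y)))"
        using A2 by (intro conjunct1[OF avg_sum] avg_cmult(2)) auto
      also have "\<dots> = (\<Sum>j\<le>Suc n. (-1)^j * (\<Sum>i\<le>n. (-1)^i * avg (\<lambda>t. F (mix i (dr j g) (dr j (?b t))) y)))"
        by (intro sum.cong refl) (simp add: avg_cmult(1) A2)
      finally show ?thesis by simp
    qed
    also have "\<dots> = avg (\<lambda>t. F (?b t) y - F g y)" by (rule avg_cong) (rule id)
    also have "\<dots> = avg (\<lambda>t. F (?b t) y) - F g y"
      using config_Co(2)[OF F', of "Suc n" "\<lambda>g h. h" g y] g y by (subst avg_lin(2)) auto
    finally show ?thesis using True Suc by (simp add: avg_map_def)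
  next
    case False
    then show ?thesis using Co_zero[OF F', of g y] Co_zero[OF Co_dd[OF r prismF_Co[OF F']], of g y] Suc by (auto simp: avg_map_def)
  qed
  then have "F - avg_map r Y \<Theta> p F = dd r n (- prismF n F)" by (auto simp: fun_eq_iff dd_lin)
  then show ?thesis using Suc prismF_Co[OF F'] by (simp add: Bd_dd Co_uminus)
qed

end


section \<open>The double complex\<close>

definition actx :: "'k::real_normed_field elt \<Rightarrow> 'k pairs \<times> 'm \<Rightarrow> 'k pairs \<times> 'm" where
  "actx a z = (apx a (fst z), snd z)"

abbreviation Cc :: "nat \<Rightarrow> nat \<Rightarrow> 'm::metric_space set \<Rightarrow> nat \<Rightarrow>
    ('k::real_normed_field, 'k pairs \<times> 'm) cochain set" where
  "Cc r k M p \<equiv> Co r actx (XX r k \<times> M) p"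

text \<open>Invariance under both factors separately: these are the cochains on \<open>G\<^sup>p\<^sup>+\<^sup>1 \<times> X/G\<close>.\<close>

definition Kk :: "nat \<Rightarrow> nat \<Rightarrow> 'm::metric_space set \<Rightarrow> nat \<Rightarrow>
    ('k::real_normed_field, 'k pairs \<times> 'm) cochain set" where
  "Kk r k M p = {F \<in> Cc r k M p. \<forall>a\<in>GG r. \<forall>g. \<forall>x\<in>XX r k. \<forall>m. F g (apx a x, m) = F g (x, m)}"

definition dl :: "nat \<Rightarrow> nat \<Rightarrow> ('k::real_normed_field, 'k pairs \<times> 'm) cochain \<Rightarrow>
    'k elts \<Rightarrow> 'k pairs \<times> 'm \<Rightarrow> real" where
  "dl r k F = (\<lambda>g z. if fst z \<in> XX r (Suc k) then \<Sum>j\<le>k. (-1)^j * F g (dr j (fst z), snd z) else 0)"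

lemma actx_in: "r \<le> N \<Longrightarrow> a \<in> GG r \<Longrightarrow> z \<in> XX r k \<times> M \<Longrightarrow> actx a z \<in> XX r k \<times> M"
  by (auto simp: actx_def apx_XX)

lemma apx_XX_iff: "a \<in> GG r \<Longrightarrow> r \<le> N \<Longrightarrow> apx a x \<in> XX r k \<longleftrightarrow> x \<in> XX r k"
  using apx_XX[of a r x k] apx_XX[OF inv_GG[of a r], of "apx a x" k] apx_inv(1)[of a r x] by auto

lemma Cc_inv_all:
  assumes F: "F \<in> Cc r k M p" and a: "a \<in> GG r" "r \<le> N" and g: "g \<in> Tup r p"
  shows "F (lact a g) (apx a x, m) = F g (x, m)"
proof (cases "x \<in> XX r k \<and> m \<in> M")
  case True
  then show ?thesis using Co_inv[OF F a(1) g, of "(x, m)"] by (simp add: actx_def)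
next
  case False
  then have "F g (x, m) = 0" "F (lact a g) (apx a x, m) = 0"
    using apx_XX_iff[OF a] by (auto intro!: Co_zero[OF F])
  then show ?thesis by simp
qed

lemma dr_apx: "dr j (apx a x) = apx a (dr j x)" by (auto simp: dr_def apx_def)

lemma KkI: "F \<in> Cc r k M p \<Longrightarrow> (\<And>a g x m. a \<in> GG r \<Longrightarrow> x \<in> XX r k \<Longrightarrow> F g (apx a x, m) = F g (x, m)) \<Longrightarrow> F \<in> Kk r k M p"
  unfolding Kk_def by blast
lemma Kk_Cc: "F \<in> Kk r k M p \<Longrightarrow> F \<in> Cc r k M p" unfolding Kk_def by blast
lemma Kk_inv: "F \<in> Kk r k M p \<Longrightarrow> a \<in> GG r \<Longrightarrow> x \<in> XX r k \<Longrightarrow> F g (apx a x, m) = F g (x, m)" unfolding Kk_def by blast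

lemma face_Cc:
  fixes F :: "('k::real_normed_field, 'k pairs \<times> 'm::metric_space) cochain"
  assumes r: "r \<le> N" and F: "F \<in> Cc r k M p" and j: "j \<le> k"
  shows "(\<lambda>g z. if fst z \<in> XX r (Suc k) then F g (dr j (fst z), snd z) else 0) \<in> Cc r (Suc k) M p" (is "?F \<in> _")
proof -
  obtain B where B: "\<bar>F g y\<bar> \<le> B" for g y using Co_bdd[OF F] by blast
  have B0: "0 \<le> B" using B[of undefined undefined] by linarith
  show ?thesis
  proof (rule CoI)
    have "continuous_on (Tup r p \<times> (XX r (Suc k) \<times> M)) (\<lambda>z. (\<lambda>z. F (fst z) (snd z)) (fst z, dr j (fst (snd z)), snd (snd z)))"
      by (rule continuous_on_compose2[OF Co_cont[OF F]], intro continuous_on_Pair continuous_on_dr continuous_on_fst continuous_on_snd continuous_on_id)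
        (use j in \<open>auto simp: XX_dr\<close>)
    then show "continuous_on (Tup r p \<times> (XX r (Suc k) \<times> M)) (\<lambda>z. ?F (fst z) (snd z))"
      by (rule continuous_on_eq) auto
    show "\<bar>?F g y\<bar> \<le> B" for g y using B B0 by simp
  next
    fix a :: "'k elt" and z :: "'k pairs \<times> 'm" and g :: "'k elts"
    assume a: "a \<in> GG r" "g \<in> Tup r p" "z \<in> XX r (Suc k) \<times> M"
    then show "?F (lact a g) (actx a z) = ?F g z"
      by (auto simp: actx_def dr_apx Cc_inv_all[OF F a(1) r a(2)] apx_XX_iff[OF a(1) r])
  next
    fix z :: "'k pairs \<times> 'm" and g :: "'k elts"
    assume "\<not> (g \<in> Tup r p \<and> z \<in> XX r (Suc k) \<times> M)"
    then show "?F g z = 0" by (cases z) (auto simp: Co_zero[OF F])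
  qed
qed

lemma dl_Cc:
  assumes r: "r \<le> N" and F: "F \<in> Cc r k M p"
  shows "dl r k F \<in> Cc r (Suc k) M p"
proof -
  have sum_app: "(\<Sum>i\<in>I. H i) g y = (\<Sum>i\<in>I. H i g y)" for I :: "nat set" and g y and H :: "nat \<Rightarrow> 'g \<Rightarrow> 'z \<Rightarrow> real"
    by (induction I rule: infinite_finite_induct) auto
  have "dl r k F = (\<Sum>j\<le>k. (\<lambda>g z. (-1)^j * (\<lambda>g z. if fst z \<in> XX r (Suc k) then F g (dr j (fst z), snd z) else 0) g z))"
    by (intro ext) (simp add: dl_def sum_app)
  also have "\<dots> \<in> Cc r (Suc k) M p"
    by (intro Co_sum Co_sign face_Cc r F) auto
  finally show ?thesis .
qed

lemma dl_dl: "dl r (Suc k) (dl r k F) = 0"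
proof (intro ext)
  fix g and z :: "'a pairs \<times> 'b"
  show "dl r (Suc k) (dl r k F) g z = 0 g z"
  proof (cases "fst z \<in> XX r (Suc (Suc k))")
    case True
    then have "dl r (Suc k) (dl r k F) g z = (\<Sum>i\<le>Suc k. (-1)^i * (\<Sum>j\<le>k. (-1)^j * (\<lambda>x. F g (x, snd z)) (dr j (dr i (fst z)))))"
      unfolding dl_def by (auto simp: XX_dr intro!: sum.cong)
    also have "\<dots> = 0" using alternating_square_zero[where f="\<lambda>x. F g (x, snd z)" and n=k and x="fst z"] by (simp only:)
    finally show ?thesis by simp
  qed (simp add: dl_def)
qed

lemma dl_lin:
  "dl r k (F + H) = dl r k F + dl r k H" "dl r k (F - H) = dl r k F - dl r k H" "dl r k 0 = 0" "dl r k (- F) = - dl r k F"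
  by (auto simp: dl_def fun_eq_iff sum.distrib sum_subtractf algebra_simps sum_negf)

lemma dd_dl: "dd r p (dl r k F) = dl r k (dd r p F)"
proof (intro ext)
  fix g and z :: "'a pairs \<times> 'b"
  show "dd r p (dl r k F) g z = dl r k (dd r p F) g z"
  proof (cases "g \<in> Tup r (Suc p) \<and> fst z \<in> XX r (Suc k)")
    case True
    then have "dd r p (dl r k F) g z = (\<Sum>i\<le>Suc p. \<Sum>j\<le>k. (-1)^i * ((-1)^j * F (dr i g) (dr j (fst z), snd z)))"
      by (simp only: dd_def dl_def if_True simp_thms sum_distrib_left)
    also have "\<dots> = (\<Sum>j\<le>k. \<Sum>i\<le>Suc p. (-1)^i * ((-1)^j * F (dr i g) (dr j (fst z), snd z)))" by (rule sum.swap)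
    also have "\<dots> = dl r k (dd r p F) g z" using True
      by (simp only: dd_def dl_def if_True simp_thms sum_distrib_left) (intro sum.cong refl, simp)
    finally show ?thesis .
  qed (auto simp: dd_def dl_def)
qed

lemma dd_Kk: "r \<le> N \<Longrightarrow> F \<in> Kk r k M p \<Longrightarrow> dd r p F \<in> Kk r k M (Suc p)"
  by (rule KkI, rule Co_dd, assumption, erule Kk_Cc) (auto simp: dd_def Kk_inv)

lemma dl_Kk: "r \<le> N \<Longrightarrow> F \<in> Kk r k M p \<Longrightarrow> dl r k F \<in> Kk r (Suc k) M p"
  by (rule KkI, rule dl_Cc, assumption, erule Kk_Cc) (auto simp: dl_def dr_apx Kk_inv XX_dr apx_XX_iff)

lemma Kk_add: "F \<in> Kk r k M p \<Longrightarrow> H \<in> Kk r k M p \<Longrightarrow> F + H \<in> Kk r k M p"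
  by (rule KkI) (auto simp: Co_add Kk_Cc Kk_inv)
lemma Kk_uminus: "F \<in> Kk r k M p \<Longrightarrow> - F \<in> Kk r k M p"
  by (rule KkI) (auto simp: Co_uminus Kk_Cc Kk_inv)
lemma Kk_0: "0 \<in> Kk r k M p"
  by (rule KkI) (auto simp: Co_0)

text \<open>Only the empty tuple lies in \<open>XX r 0\<close>, and it is fixed by the
  group.\<close>

lemma Cc_0_Kk: 
  assumes "F \<in> Cc r 0 M p"
  shows "F \<in> Kk r 0 M p"
proof (rule KkI[OF assms])
  fix a :: "'a elt" and g m and x :: "'a pairs"
  assume "x \<in> XX r 0"
  then have "apx a x = x" by (auto simp: apx_def XX_tail)
  then show "F g (apx a x, m) = F g (x, m)" by simp
qed

text \<open>Coning is a contracting homotopy. A fixed cone point would be neither generic for all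
  tuples nor equivariant, so it moves along the moment curve and is averaged. The bound on
  \<open>k\<close> keeps all subframes of a \<open>Suc k\<close>-tuple short enough for the curve to
  be generic at almost all times.\<close>

lemma exact_Cc:
  fixes F :: "('k::real_normed_field, 'k pairs \<times> 'm::metric_space) cochain"
  assumes r: "r \<le> N" and k: "Suc k < r" and F: "F \<in> Cc r (Suc k) M p" and dF: "dl r (Suc k) F = 0"
  shows "\<exists>H\<in>Cc r k M p. dl r k H = F"
proof -
  \<comment> \<open>The curve is translated by the first group element \<open>fst z 0\<close>; this
    makes the cone point equivariant.\<close>
  define \<Psi> where "\<Psi> = (\<lambda>t (z :: 'k elts \<times> 'k pairs \<times> 'm).
     (fst z, (case_nat (ap (fst z 0) (moment_pair r t)) (fst (snd z)), snd (snd z))))"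
  define H where "H = (\<lambda>g y. if g \<in> Tup r p \<and> y \<in> XX r k \<times> M then avg (\<lambda>t. F (fst (\<Psi> t (g, y))) (snd (\<Psi> t (g, y)))) else 0)"
  have act: "\<And>a y. a \<in> GG r \<Longrightarrow> y \<in> XX r k \<times> M \<Longrightarrow> actx a y \<in> XX r k \<times> M" by (rule actx_in[OF r])
  have G: "\<exists>B. finite B \<and> (\<forall>t. 0 < t \<and> t < 1 \<and> t \<notin> B \<longrightarrow> good_pt \<Psi> (Tup r p \<times> (XX r k \<times> M)) (Tup r p \<times> (XX r (Suc k) \<times> M)) t z)"
    if z: "z \<in> Tup r p \<times> (XX r k \<times> M)" for z
  proof (intro exI conjI allI impI)
    let ?g = "fst z 0" and ?x = "fst (snd z)"
    have gz: "fst z \<in> Tup r p" "?x \<in> XX r k" "snd (snd z) \<in> M" "?g \<in> GG r" using z by (auto intro: Tup_GG)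
    show "finite {t. \<not> moment_generic r k ?g ?x t}" using gz k r by (intro finite_moment_bad) auto
    fix t assume t: "0 < t \<and> t < 1 \<and> t \<notin> {t. \<not> moment_generic r k ?g ?x t}"
    then have good: "moment_generic r k ?g ?x t" by simp
    then have o: "om (moment r 1 t :: nat \<Rightarrow> 'k) (moment r (2*r) t) \<noteq> 0" by (simp add: moment_generic_def)
    have in_D: "\<Psi> t z \<in> Tup r p \<times> (XX r (Suc k) \<times> M)" if "z \<in> Tup r p \<times> (XX r k \<times> M)" "moment_generic r k (fst z 0) (fst (snd z)) t" for t z
      using that by (auto simp: \<Psi>_def intro!: moment_generic_XX r Tup_GG)
    show "good_pt \<Psi> (Tup r p \<times> (XX r k \<times> M)) (Tup r p \<times> (XX r (Suc k) \<times> M)) t z"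
    proof (rule good_ptI)
      show "0 < t" "t < 1" using t by auto
      show "\<Psi> t z \<in> Tup r p \<times> (XX r (Suc k) \<times> M)" by (rule in_D[OF z good])
      fix ts :: "nat \<Rightarrow> real" and zs :: "nat \<Rightarrow> 'k elts \<times> 'k pairs \<times> 'm"
      assume a: "\<And>n. 0 < ts n \<and> ts n < 1" "\<And>n. zs n \<in> Tup r p \<times> (XX r k \<times> M)" "ts \<longlonglongrightarrow> t" "zs \<longlonglongrightarrow> z"
      have c: "(\<lambda>n. fst (zs n)) \<longlonglongrightarrow> fst z" "(\<lambda>n. fst (snd (zs n))) \<longlonglongrightarrow> ?x" "(\<lambda>n. snd (snd (zs n))) \<longlonglongrightarrow> snd (snd z)"
        by (intro tendsto_intros a(4))+
      then have g0: "(\<lambda>n. fst (zs n) 0) \<longlonglongrightarrow> ?g" by (simp add: tendsto_fun_iff[where f="\<lambda>n. fst (zs n)"])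
      have "(\<lambda>n. \<Psi> (ts n) (zs n)) \<longlonglongrightarrow> \<Psi> t z"
        unfolding \<Psi>_def by (intro tendsto_Pair c tendsto_case_nat tendsto_ap g0 tendsto_moment_pair a(3) o)
      moreover have "\<forall>\<^sub>F n in sequentially. \<Psi> (ts n) (zs n) \<in> Tup r p \<times> (XX r (Suc k) \<times> M)"
        using moment_generic_eventually[OF a(3) g0 c(2) gz(2) good] by (rule eventually_mono) (rule in_D[OF a(2)])
      ultimately show "(\<lambda>n. \<Psi> (ts n) (zs n)) \<longlonglongrightarrow> \<Psi> t z \<and> (\<forall>\<^sub>F n in sequentially. \<Psi> (ts n) (zs n) \<in> Tup r p \<times> (XX r (Suc k) \<times> M))" ..
    qed (rule z)
  qed
  have inv: "F (fst (\<Psi> t (lact a g, actx a y))) (snd (\<Psi> t (lact a g, actx a y))) = F (fst (\<Psi> t (g, y))) (snd (\<Psi> t (g, y)))"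
    if "0 < t" "t < 1" "a \<in> GG r" "g \<in> Tup r p" "y \<in> XX r k \<times> M" for t a g y
  proof -
    have "case_nat (ap (mul a (g 0)) (moment_pair r t)) (apx a (fst y)) = apx a (case_nat (ap (g 0) (moment_pair r t)) (fst y))"
      by (auto simp: apx_def ap_def app_mul split: nat.split)
    then show ?thesis using Cc_inv_all[OF F that(3) r that(4)] by (simp add: \<Psi>_def actx_def lact_def)
  qed
  have H: "H \<in> Cc r k M p" unfolding H_def
    by (rule avg_Co(1)[where \<Psi>=\<Psi>, OF F r], fact act, fact G, fact inv)
  have av: "avgable (\<lambda>t. F (fst (\<Psi> t (g, y))) (snd (\<Psi> t (g, y))))" if "g \<in> Tup r p" "y \<in> XX r k \<times> M" for g y
    by (rule avg_Co(2)[where \<Psi>=\<Psi> and act=actx, OF F r], fact act, fact G, fact inv, fact that(1), fact that(2))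
  have "dl r k H g (x, m) = F g (x, m)" for g x m
  proof (cases "g \<in> Tup r p \<and> x \<in> XX r (Suc k) \<and> m \<in> M")
    case True
    then have g: "g \<in> Tup r p" and x: "x \<in> XX r (Suc k)" and m: "m \<in> M" by auto
    let ?u = "\<lambda>t. ap (g 0) (moment_pair r t)"
    have A: "avgable (\<lambda>t. F g (case_nat (?u t) (dr j x), m))" if "j \<le> k" for j
      using av[OF g, of "(dr j x, m)"] XX_dr[OF x that] m by (simp add: \<Psi>_def)
    have S: "avg (\<lambda>t. \<Sum>j\<le>k. (-1)^j * F g (case_nat (?u t) (dr j x), m)) = (\<Sum>j\<le>k. avg (\<lambda>t. (-1)^j * F g (case_nat (?u t) (dr j x), m))) \<and>
       avgable (\<lambda>t. \<Sum>j\<le>k. (-1)^j * F g (case_nat (?u t) (dr j x), m))"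
      using A by (intro avg_sum avg_cmult(2)) auto
    \<comment> \<open>Closedness of \<open>F\<close> on the cone over \<open>x\<close>: the face
      opposite the cone point is \<open>x\<close>, and the others are cones over the faces of
      \<open>x\<close>. This fails only for the finitely many \<open>t\<close> at which the cone is
      not generic.\<close>
    have id: "(\<Sum>j\<le>k. (-1)^j * F g (case_nat (?u t) (dr j x), m)) = F g (x, m)" if t: "moment_generic r (Suc k) (g 0) x t" for t
    proof -
      have z: "case_nat (?u t) x \<in> XX r (Suc (Suc k))" using moment_generic_XX[OF x r Tup_GG[OF g] t] by simp
      have "dl r (Suc k) F g (case_nat (?u t) x, m) = 0" using dF by simp
      then have "(\<Sum>j\<le>Suc k. (-1)^j * F g (dr j (case_nat (?u t) x), m)) = 0" using z by (simp add: dl_def)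
      then show ?thesis by (simp only: sum.atMost_Suc_shift) (simp add: sum_negf)
    qed
    have "dl r k H g (x, m) = (\<Sum>j\<le>k. (-1)^j * avg (\<lambda>t. F g (case_nat (?u t) (dr j x), m)))"
      using g x m XX_dr[OF x] by (auto simp: dl_def H_def \<Psi>_def intro!: sum.cong)
    also have "\<dots> = (\<Sum>j\<le>k. avg (\<lambda>t. (-1)^j * F g (case_nat (?u t) (dr j x), m)))"
      using A by (intro sum.cong refl) (simp add: avg_cmult(1))
    also have "\<dots> = avg (\<lambda>t. \<Sum>j\<le>k. (-1)^j * F g (case_nat (?u t) (dr j x), m))" using S by simp
    also have "\<dots> = avg (\<lambda>t. F g (x, m))"
    proof (rule avg_cong_finite)
      show "finite {t. \<not> moment_generic r (Suc k) (g 0) x t}" using x k r Tup_GG[OF g] by (intro finite_moment_bad) auto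
    qed (use S id in auto)
    finally show ?thesis by simp
  next
    case False
    then show ?thesis using Co_zero[OF F, of g "(x, m)"] Co_zero[OF dl_Cc[OF r H], of g "(x, m)"] by auto
  qed
  then have "dl r k H = F" by (auto simp: fun_eq_iff)
  with H show ?thesis by blast
qed

text \<open>The coordinates of a normal form vanish before the last \<open>k\<close> pairs below
  \<open>2*r\<close>, so every earlier standard pair is orthogonal to it.\<close>

lemma stdp_orthx:
  assumes "r \<le> N" "k \<le> j" "j < r"
  shows "orthx k (nu r k x) (stdp (r - Suc j))" "inV r (stdp (r - Suc j) :: 'k::real_normed_field pair)"
proof -
  define n where "n = r - Suc j"
  have n: "n < r - k" "n < N" "n < r" using assms by (auto simp: n_def)
  have z: "nuv r (gsx k x) y i = 0" if "i < 2*(r-k)" for y i using that by (simp add: nuv_def)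
  show "orthx k (nu r k x) (stdp (r - Suc j))" using n
    by (simp add: orthx_def stdp_def nu_apply z bas_apply flip: n_def)
  show "inV r (stdp (r - Suc j) :: 'k pair)"
    using n by (simp add: inV_def stdp_def bas_VV flip: n_def)
qed

lemma orthx_dr: "orthx (Suc k) x u \<Longrightarrow> orthx k (dr j x) u"
  by (auto simp: orthx_def dr_def)

lemma nu_dr_nu:
  assumes "r \<le> N" "Suc k \<le> r" "x \<in> XX r (Suc k)"
  shows "nu r k (dr j (nu r (Suc k) x)) = nu r k (dr j x)"
proof -
  obtain a where a: "a \<in> GG r" "apx a (nu r (Suc k) x) = x" using orbit[OF assms] by auto
  then have "dr j x = apx a (dr j (nu r (Suc k) x))" by (metis dr_apx)
  then show ?thesis using nu_apx[OF a(1) assms(1), of k] assms(2) by simp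
qed

lemma Kk_nu:
  assumes "r \<le> N" "k \<le> r" "F \<in> Kk r k M p" "x \<in> XX r k"
  shows "F g (nu r k x, m) = F g (x, m)"
proof -
  obtain a where a: "a \<in> GG r" "apx a (nu r k x) = x" using orbit[OF assms(1,2,4)] by auto
  then show ?thesis using Kk_inv[OF assms(3) a(1) nu_XX[OF assms(1,2,4)], of g m] by simp
qed

lemma continuous_on_nu: "k \<le> r \<Longrightarrow> continuous_on (XX r k) (nu r k)"
  unfolding continuous_on_def by (auto intro!: tendsto_nu tendsto_ident_at)

text \<open>Separately invariant cochains depend on a tuple through its normal form only, so a fixed
  standard pair can serve as cone point after passing to the normal form. This cone is continuous
  without averaging. By \<open>nu_orthx\<close>, cones with different orthogonal pairs are
  indistinguishable to such a cochain.\<close>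

lemma exact_Kk:
  fixes F :: "('k::real_normed_field, 'k pairs \<times> 'm::metric_space) cochain"
  assumes r: "r \<le> N" and k: "Suc k < r" and F: "F \<in> Kk r (Suc k) M p" and dF: "dl r (Suc k) F = 0"
  shows "\<exists>H\<in>Kk r k M p. dl r k H = F"
proof -
  define s where "s = (stdp (r - Suc k) :: 'k pair)"
  \<comment> \<open>\<open>s\<close> is orthogonal to normal forms of length \<open>k\<close>,
    whereas the cone over a tuple of length \<open>Suc k\<close> needs a pair one position earlier.
    On faces the two cones have the same normal form.\<close>
  define s2 where "s2 = (stdp (r - Suc (Suc k)) :: 'k pair)"
  define H where "H = (\<lambda>g (y :: 'k pairs \<times> 'm). if fst y \<in> XX r k then F g (case_nat s (nu r k (fst y)), snd y) else 0)"
  have kr: "k \<le> r" "k < r" "Suc k \<le> r" using k by auto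
  note FC = Kk_Cc[OF F]
  have s_in: "case_nat s (nu r k x) \<in> XX r (Suc k)" if "x \<in> XX r k" for x
    unfolding s_def by (rule XX_orthx[OF nu_XX[OF r kr(1) that] stdp_orthx(2)[OF r order_refl kr(2)] stdp_orthx(1)[OF r order_refl kr(2)]])
  have s2_in: "case_nat s2 (nu r (Suc k) x) \<in> XX r (Suc (Suc k))" if "x \<in> XX r (Suc k)" for x
    unfolding s2_def by (rule XX_orthx[OF nu_XX[OF r kr(3) that] stdp_orthx(2)[OF r order_refl k] stdp_orthx(1)[OF r order_refl k]])
  obtain B where B: "\<bar>F g y\<bar> \<le> B" for g y using Co_bdd[OF FC] by blast
  have inv: "F (lact a g) (case_nat s (nu r k x), m) = F g (case_nat s (nu r k x), m)" if a: "a \<in> GG r" "g \<in> Tup r p" "x \<in> XX r k" for a g x m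
    using Cc_inv_all[OF FC a(1) r a(2), of "case_nat s (nu r k x)" m] Kk_inv[OF F a(1) s_in[OF a(3)], of "lact a g" m] by simp
  have HC: "H \<in> Cc r k M p"
  proof (rule CoI)
    have c: "continuous_on (Tup r p \<times> (XX r k \<times> M)) (\<lambda>z. nu r k (fst (snd z)))"
      by (rule continuous_on_compose2[OF continuous_on_nu[OF kr(1)]], intro continuous_on_fst continuous_on_snd continuous_on_id, auto)
    have c2: "continuous_on (Tup r p \<times> (XX r k \<times> M)) (\<lambda>z. case_nat s (nu r k (fst (snd z))))"
      using c unfolding continuous_on_def by (auto intro!: tendsto_case_nat)
    have "continuous_on (Tup r p \<times> (XX r k \<times> M)) (\<lambda>z. (\<lambda>z. F (fst z) (snd z)) (fst z, case_nat s (nu r k (fst (snd z))), snd (snd z)))"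
      by (rule continuous_on_compose2[OF Co_cont[OF FC]], intro continuous_on_Pair c2 continuous_on_fst continuous_on_snd continuous_on_id)
         (auto simp: s_in)
    then show "continuous_on (Tup r p \<times> (XX r k \<times> M)) (\<lambda>z. H (fst z) (snd z))"
      by (rule continuous_on_eq) (auto simp: H_def)
    show "\<bar>H g y\<bar> \<le> B" for g y using B[of g "(case_nat s (nu r k (fst y)), snd y)"] by (auto simp: H_def)
  next
    fix a :: "'k elt" and z :: "'k pairs \<times> 'm" and g :: "'k elts"
    assume a: "a \<in> GG r" "g \<in> Tup r p" "z \<in> XX r k \<times> M"
    then show "H (lact a g) (actx a z) = H g z"
      by (auto simp: H_def actx_def apx_XX_iff[OF a(1) r] nu_apx[OF a(1) r kr(1)] inv)
  next
    fix z :: "'k pairs \<times> 'm" and g :: "'k elts"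
    assume "\<not> (g \<in> Tup r p \<and> z \<in> XX r k \<times> M)"
    then show "H g z = 0" by (cases z) (auto simp: H_def intro: Co_zero[OF FC])
  qed
  have HK: "H \<in> Kk r k M p"
    by (rule KkI[OF HC]) (auto simp: H_def apx_XX_iff[OF _ r] nu_apx[OF _ r kr(1)])
  have "dl r k H g (x, m) = F g (x, m)" for g x m
  proof (cases "x \<in> XX r (Suc k)")
    case x: True
    have e: "H g (dr j x, m) = F g (case_nat s2 (dr j (nu r (Suc k) x)), m)" if j: "j \<le> k" for j
    proof -
      have d: "dr j (nu r (Suc k) x) \<in> XX r k" "dr j x \<in> XX r k" using XX_dr[OF nu_XX[OF r kr(3) x] j] XX_dr[OF x j] .
      have o: "orthx k (dr j (nu r (Suc k) x)) s2" unfolding s2_def by (rule orthx_dr[OF stdp_orthx(1)[OF r order_refl k]])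
      have o': "orthx k (nu r k (dr j x)) s" unfolding s_def by (rule stdp_orthx(1)[OF r order_refl kr(2)])
      have in1: "case_nat s2 (dr j (nu r (Suc k) x)) \<in> XX r (Suc k)"
        unfolding s2_def by (rule XX_orthx[OF d(1) stdp_orthx(2)[OF r _ k, of k]]) (use o in \<open>simp_all add: s2_def\<close>)
      have "nu r (Suc k) (case_nat s2 (dr j (nu r (Suc k) x))) = case_nat s (nu r k (dr j (nu r (Suc k) x)))"
        using nu_orthx[OF o kr(2) d(1)] by (simp add: s_def)
      also have "\<dots> = case_nat s (nu r k (dr j x))" by (simp only: nu_dr_nu[OF r kr(3) x])
      also have "\<dots> = nu r (Suc k) (case_nat s (nu r k (dr j x)))"
        using nu_orthx[OF o' kr(2) nu_XX[OF r kr(1) d(2)]] nu_nu[OF r kr(1) d(2)] by (simp add: s_def)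
      finally have n: "nu r (Suc k) (case_nat s2 (dr j (nu r (Suc k) x))) = nu r (Suc k) (case_nat s (nu r k (dr j x)))" .
      have "F g (case_nat s2 (dr j (nu r (Suc k) x)), m) = F g (case_nat s (nu r k (dr j x)), m)"
        using Kk_nu[OF r kr(3) F in1, of g m] Kk_nu[OF r kr(3) F s_in[OF d(2)], of g m] n by simp
      then show ?thesis using d(2) by (simp add: H_def)
    qed
    have "dl r (Suc k) F g (case_nat s2 (nu r (Suc k) x), m) = 0" using dF by simp
    then have "(\<Sum>j\<le>Suc k. (-1)^j * F g (dr j (case_nat s2 (nu r (Suc k) x)), m)) = 0" using s2_in[OF x] by (simp add: dl_def)
    then have "F g (nu r (Suc k) x, m) = (\<Sum>j\<le>k. (-1)^j * F g (case_nat s2 (dr j (nu r (Suc k) x)), m))"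
      by (simp only: sum.atMost_Suc_shift) (simp add: sum_negf)
    also have "\<dots> = dl r k H g (x, m)" using x by (simp add: dl_def e)
    finally show ?thesis using Kk_nu[OF r kr(3) F x, of g m] by simp
  next
    case False
    then show ?thesis using Co_zero[OF FC, of g "(x, m)"] by (simp add: dl_def)
  qed
  then have "dl r k H = F" by (auto simp: fun_eq_iff)
  with HK show ?thesis by blast
qed


section \<open>Restriction to the stabilizer of a normal form\<close>

abbreviation Aa :: "nat \<Rightarrow> 'y::metric_space set \<Rightarrow> nat \<Rightarrow> ('k::real_normed_field, 'y) cochain set" where
  "Aa r Y p \<equiv> Co r (\<lambda>_ y. y) Y p"

text \<open>A strict fundamental domain: one point in each orbit of \<open>GG r\<close> on
  \<open>XX r k\<close>, and all its points have the same stabilizer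
  \<open>GG (r - k)\<close>.\<close>

definition Mk :: "nat \<Rightarrow> nat \<Rightarrow> 'k::real_normed_field pairs set" where
  "Mk r k = {x \<in> XX r k. nu r k x = x}"

definition res :: "nat \<Rightarrow> 'y set \<Rightarrow> nat \<Rightarrow> ('k::real_normed_field, 'y) cochain \<Rightarrow> 'k elts \<Rightarrow> 'y \<Rightarrow> real" where
  "res r Y p F = (\<lambda>g y. if g \<in> Tup r p \<and> y \<in> Y then F g y else 0)"

lemma res_dd:
  assumes "r' \<le> r"
  shows "dd r' p (res r' Y p F) = res r' Y (Suc p) (dd r p F)"
proof (intro ext)
  fix g y
  show "dd r' p (res r' Y p F) g y = res r' Y (Suc p) (dd r p F) g y"
  proof (cases "g \<in> Tup r' (Suc p) \<and> y \<in> Y")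
    case True
    then have "g \<in> Tup r (Suc p)" using Tup_mono[OF assms] by blast
    then show ?thesis using True by (auto simp: dd_def res_def Tup_dr intro!: sum.cong)
  qed (auto simp: dd_def res_def)
qed

lemma res_Co:
  fixes F :: "('k::real_normed_field, 'y::topological_space) cochain"
  assumes N: "r' \<le> N" and r: "r' \<le> r" and Y: "Y' \<subseteq> Y" and F: "F \<in> Co r act Y p" 
    and inv: "\<And>a y. a \<in> GG r' \<Longrightarrow> y \<in> Y' \<Longrightarrow> act a y = y"
  shows "res r' Y' p F \<in> Co r' (\<lambda>_ y. y) Y' p"
proof -
  obtain B where B: "\<bar>F g y\<bar> \<le> B" for g y using Co_bdd[OF F] by blast
  have B0: "0 \<le> B" using B[of undefined undefined] by linarith
  show ?thesis
  proof (rule CoI)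
    have "continuous_on (Tup r' p \<times> Y') (\<lambda>z. F (fst z) (snd z))"
      by (rule continuous_on_subset[OF Co_cont[OF F]]) (use Y Tup_mono[OF r] in auto)
    then show "continuous_on (Tup r' p \<times> Y') (\<lambda>z. res r' Y' p F (fst z) (snd z))"
      by (rule continuous_on_eq) (auto simp: res_def)
    show "\<bar>res r' Y' p F g y\<bar> \<le> B" for g y using B B0 by (auto simp: res_def)
  next
    fix a :: "'k elt" and g :: "'k elts" and y :: 'y
    assume a: "a \<in> GG r'" "g \<in> Tup r' p" "y \<in> Y'"
    then have a': "a \<in> GG r" "g \<in> Tup r p" "y \<in> Y" using GG_mono[OF r] Tup_mono[OF r] Y by blast+
    have "lact a g \<in> Tup r' p" by (rule Tup_lact[OF a(1) N a(2)])
    then show "res r' Y' p F (lact a g) y = res r' Y' p F g y"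
      using Co_inv[OF F a'] inv[OF a(1,3)] a by (simp add: res_def)
  qed (auto simp: res_def)
qed

lemma Mk_XX: "x \<in> Mk r k \<Longrightarrow> x \<in> XX r k" by (simp add: Mk_def)

lemma Mk_fix: "r \<le> N \<Longrightarrow> k \<le> r \<Longrightarrow> a \<in> GG (r - k) \<Longrightarrow> x \<in> Mk r k \<Longrightarrow> apx a x = x"
  using nu_fix[of r k a x] by (simp add: Mk_def)

lemma nu_Mk: "r \<le> N \<Longrightarrow> k \<le> r \<Longrightarrow> x \<in> XX r k \<Longrightarrow> nu r k x \<in> Mk r k"
  by (simp add: Mk_def nu_XX nu_nu)

lemma inv_mul_mul:
  assumes "a \<in> GG r" "b \<in> GG r" "r \<le> N"
  shows "mul (inv' (mul a b)) (mul a c) = mul (inv' b) c"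
proof -
  have "mul a c = mul (mul a b) (mul (inv' b) c)"
    by (simp add: mul_assoc mul_cancel(2)[OF assms(2,3)])
  then show ?thesis using mul_cancel(1)[OF mul_GG[OF assms] assms(3)] by simp
qed

lemma lact_lact: "lact a (lact b g) = lact (mul a b) g"
  by (simp add: lact_def mul_assoc)

lemma lact_apply: "lact a g j = mul a (g j)" by (simp add: lact_def)

lemma tendsto_lact:
  assumes "(a \<longlongrightarrow> a0) F" "(g \<longlongrightarrow> g0) F"
  shows "((\<lambda>s. lact (a s) (g s)) \<longlongrightarrow> lact a0 g0) F"
  unfolding tendsto_fun_iff[where f="\<lambda>s. lact (a s) (g s)"] lact_apply
  using assms(2) unfolding tendsto_fun_iff[where f=g] by (intro allI tendsto_mul assms(1)) auto

definition Theta_fst :: "nat \<Rightarrow> nat \<Rightarrow> real \<Rightarrow> 'k::real_normed_field elt \<Rightarrow> 'k pairs \<times> 'm \<Rightarrow> nat \<Rightarrow> nat \<Rightarrow> 'k" where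
  "Theta_fst r k t g z = Theta r k t g (fst z)"

context
  fixes r k :: nat and M :: "'m::metric_space set"
  assumes r: "r \<le> N" and k: "k \<le> r"
begin

lemma Theta_fst_GG:
  fixes z :: "'k::real_normed_field pairs \<times> 'm"
  shows "0 < t \<Longrightarrow> t < 1 \<Longrightarrow> g \<in> GG r \<Longrightarrow> z \<in> XX r k \<times> M \<Longrightarrow> Theta_fst r k t g z \<in> GG r"
  unfolding Theta_fst_def by (rule Theta_GG[OF r k]) auto

lemma Theta_fst_mul: "a \<in> GG r \<Longrightarrow> Theta_fst r k t (mul a g) (actx a z) = mul a (Theta_fst r k t g z)"
  unfolding Theta_fst_def actx_def by (simp add: Theta_mul[OF _ r k])

lemma Theta_fst_ract:
  "ract (\<lambda>t z. Theta_fst r k t (fst z) (snd z)) (GG r \<times> (XX r k \<times> M) :: ('k::real_normed_field elt \<times> 'k pairs \<times> 'm) set)"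
  unfolding ract_def
proof (rule ballI)
  fix z :: "'k elt \<times> 'k pairs \<times> 'm"
  assume "z \<in> GG r \<times> (XX r k \<times> M)"
  then have g: "fst z \<in> GG r" and x: "fst (snd z) \<in> XX r k" by auto
  show "\<exists>B. finite B \<and> (\<forall>t. 0 < t \<and> t < 1 \<and> t \<notin> B \<longrightarrow> cont_pt (\<lambda>t z. Theta_fst r k t (fst z) (snd z)) (GG r \<times> (XX r k \<times> M)) t z)"
  proof (intro exI conjI allI impI)
    show "finite (bad_times r (fst z) (r - k) (gsx k (fst (snd z))))"
      by (rule finite_bad_times[OF r g XX_gsx[OF x]]) (use k in auto)
    fix t assume t: "0 < t \<and> t < 1 \<and> t \<notin> bad_times r (fst z) (r - k) (gsx k (fst (snd z)))"
    show "cont_pt (\<lambda>t z. Theta_fst r k t (fst z) (snd z)) (GG r \<times> (XX r k \<times> M)) t z"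
      unfolding cont_pt_def Theta_fst_def
    proof (intro allI impI)
      fix ts and zs :: "nat \<Rightarrow> 'k elt \<times> 'k pairs \<times> 'm"
      assume a: "ts \<longlonglongrightarrow> t" "zs \<longlonglongrightarrow> z"
      show "(\<lambda>n. Theta r k (ts n) (fst (zs n)) (fst (snd (zs n)))) \<longlonglongrightarrow> Theta r k t (fst z) (fst (snd z))"
        by (rule tendsto_Theta[OF a(1) _ _ tendsto_fst[OF a(2)] g r k tendsto_fst[OF tendsto_snd[OF a(2)]] x]) (use t in auto)
    qed
  qed
qed

lemma Theta_fst_stab:
  fixes z :: "'k::real_normed_field pairs \<times> 'm"
  assumes "0 < t" "t < 1" "g \<in> GG r" "g' \<in> GG r" "z \<in> XX r k \<times> M"
  shows "mul (inv' (Theta_fst r k t g z)) (Theta_fst r k t g' z) \<in> GG (r - k)"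
    "apx (inv' (Theta_fst r k t g z)) (fst z) = nu r k (fst z)"
proof -
  let ?a = "Theta_fst r k t g z" and ?b = "Theta_fst r k t g' z"
  have x: "fst z \<in> XX r k" using assms(5) by auto
  have a: "?a \<in> GG r" "?b \<in> GG r" using assms by (auto intro: Theta_fst_GG)
  have ax: "apx ?a (nu r k (fst z)) = fst z" "apx ?b (nu r k (fst z)) = fst z"
    unfolding Theta_fst_def using Theta_nu[OF r k _ assms(1,2) x] assms(3,4) by auto
  show i: "apx (inv' ?a) (fst z) = nu r k (fst z)"
    using apx_inv(1)[OF a(1) r, of "nu r k (fst z)"] ax(1) by simp
  show "mul (inv' ?a) ?b \<in> GG (r - k)"
  proof (rule stab[OF r k nu_XX[OF r k x] nu_nu[OF r k x] mul_GG[OF inv_GG[OF a(1) r] a(2) r]])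
    show "apx (mul (inv' ?a) ?b) (nu r k (fst z)) = nu r k (fst z)"
      by (simp add: apx_mul ax(2) i)
  qed
qed

lemma Theta_fst_Mk_GG:
  fixes z :: "'k::real_normed_field pairs \<times> 'm"
  assumes "0 < t" "t < 1" "g \<in> GG (r - k)" "z \<in> Mk r k \<times> M"
  shows "Theta_fst r k t g z \<in> GG (r - k)"
proof -
  have x: "fst z \<in> XX r k" "nu r k (fst z) = fst z" using assms(4) by (auto simp: Mk_def)
  have g: "g \<in> GG r" using assms(3) GG_mono[of "r-k" r] by auto
  have "apx (Theta_fst r k t g z) (fst z) = fst z" 
    using Theta_nu[OF r k g assms(1,2) x(1)] x(2) by (simp add: Theta_fst_def)
  then show ?thesis using stab[OF r k x] Theta_GG[OF r k g assms(1,2) x(1)] by (simp add: Theta_fst_def)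
qed

lemma Theta_fst_Mk_mul:
  assumes "a \<in> GG (r - k)" "z \<in> Mk r k \<times> M"
  shows "Theta_fst r k t (mul a g) z = mul a (Theta_fst r k t g z)"
proof -
  have "a \<in> GG r" using assms(1) GG_mono[of "r-k" r] by auto
  moreover have "actx a z = z" using Mk_fix[OF r k assms(1), of "fst z"] assms(2) by (auto simp: actx_def)
  ultimately show ?thesis using Theta_fst_mul[of a t g z] by simp
qed

lemma ract_mono: "ract \<phi> Y \<Longrightarrow> Y' \<subseteq> Y \<Longrightarrow> ract \<phi> Y'"
  unfolding ract_def cont_pt_def by (meson subsetD)

lemma Theta_fst_Mk_ract:
  "ract (\<lambda>t z. Theta_fst r k t (fst z) (snd z)) (GG (r - k) \<times> (Mk r k \<times> M) :: ('k::real_normed_field elt \<times> 'k pairs \<times> 'm) set)"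
  by (rule ract_mono[OF Theta_fst_ract]) (use GG_mono[of "r-k" r] in \<open>auto simp: Mk_def\<close>)

text \<open>All entries of \<open>T\<close> carry the normal form to the given tuple, so they differ
  by elements of the stabilizer. Dividing by the entry \<open>T 0\<close> gives a tuple in
  \<open>GG (r - k)\<close> that is invariant under \<open>GG r\<close>; this is the retraction
  behind a Shapiro-type isomorphism.\<close>

definition extend_pt :: "nat \<Rightarrow> real \<Rightarrow> 'k::real_normed_field elts \<times> 'k pairs \<times> 'm \<Rightarrow>
    'k elts \<times> 'k pairs \<times> 'm" where
  "extend_pt p t w = (let T = map_tup (Theta_fst r k) p t (fst w) (snd w) in (lact (inv' (T 0)) T, (nu r k (fst (snd w)), snd (snd w))))"

definition extend :: "nat \<Rightarrow> ('k::real_normed_field, 'k pairs \<times> 'm) cochain \<Rightarrow>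
    'k elts \<Rightarrow> 'k pairs \<times> 'm \<Rightarrow> real" where
  "extend p f = (\<lambda>g y. if g \<in> Tup r p \<and> y \<in> XX r k \<times> M then avg (\<lambda>t. f (fst (extend_pt p t (g, y))) (snd (extend_pt p t (g, y)))) else 0)"

lemma extend_pt_in:
  fixes w :: "'k::real_normed_field elts \<times> 'k pairs \<times> 'm"
  assumes "0 < t" "t < 1" "w \<in> Tup r p \<times> (XX r k \<times> M)"
  shows "extend_pt p t w \<in> Tup (r - k) p \<times> (Mk r k \<times> M)"
proof -
  have w: "fst w \<in> Tup r p" "snd w \<in> XX r k \<times> M" "fst (snd w) \<in> XX r k" "snd (snd w) \<in> M" using assms(3) by auto
  let ?T = "map_tup (Theta_fst r k) p t (fst w) (snd w)"
  have "lact (inv' (?T 0)) ?T \<in> Tup (r - k) p"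
  proof (rule TupI)
    fix j assume "j \<le> p"
    then show "lact (inv' (?T 0)) ?T j \<in> GG (r - k)"
      using Theta_fst_stab(1)[OF assms(1,2) Tup_GG[OF w(1)] Tup_GG[OF w(1)] w(2), of 0 j] by (simp add: lact_def map_tup_def)
  next
    fix j assume "j > p"
    then show "lact (inv' (?T 0)) ?T j = (\<lambda>_ _. 0)" by (simp add: lact_def map_tup_def)
  qed
  then show ?thesis using nu_Mk[OF r k w(3)] w(4) by (simp add: extend_pt_def Let_def)
qed

lemma actx_cl: "\<And>a y. a \<in> GG r \<Longrightarrow> y \<in> XX r k \<times> M \<Longrightarrow> actx a y \<in> XX r k \<times> M" by (rule actx_in[OF r])

lemma extend_pt_good:
  fixes w :: "'k::real_normed_field elts \<times> 'k pairs \<times> 'm"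
  assumes w: "w \<in> Tup r p \<times> (XX r k \<times> M)"
  shows "\<exists>B. finite B \<and> (\<forall>t. 0 < t \<and> t < 1 \<and> t \<notin> B \<longrightarrow> good_pt (extend_pt p) (Tup r p \<times> (XX r k \<times> M)) (Tup (r - k) p \<times> (Mk r k \<times> M)) t w)"
proof -
  have R: "ract (\<lambda>t z. map_tup (Theta_fst r k) p t (fst z) (snd z)) (Tup r p \<times> (XX r k \<times> M) :: ('k elts \<times> 'k pairs \<times> 'm) set)"
    by (rule map_tup_ract[where act=actx, OF r], fact actx_cl, rule Theta_fst_GG, assumption+, rule Theta_fst_mul, assumption, rule Theta_fst_ract)
  from ractD[OF R w] obtain B where B: "finite B \<and> (\<forall>t. 0 < t \<and> t < 1 \<and> t \<notin> B \<longrightarrow>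
     cont_pt (\<lambda>t z. map_tup (Theta_fst r k) p t (fst z) (snd z)) (Tup r p \<times> (XX r k \<times> M)) t w)" ..
  have x: "fst (snd w) \<in> XX r k" using w by auto
  show ?thesis
  proof (intro exI conjI allI impI)
    show "finite B" using B ..
    fix t assume t: "0 < t \<and> t < 1 \<and> t \<notin> B"
    with B have cp: "cont_pt (\<lambda>t z. map_tup (Theta_fst r k) p t (fst z) (snd z)) (Tup r p \<times> (XX r k \<times> M)) t w" by simp
    show "good_pt (extend_pt p) (Tup r p \<times> (XX r k \<times> M)) (Tup (r - k) p \<times> (Mk r k \<times> M)) t w"
    proof (rule good_ptI)
      fix ts :: "nat \<Rightarrow> real" and ws :: "nat \<Rightarrow> 'k elts \<times> 'k pairs \<times> 'm"
      assume a: "\<And>n. 0 < ts n \<and> ts n < 1" "\<And>n. ws n \<in> Tup r p \<times> (XX r k \<times> M)" "ts \<longlonglongrightarrow> t" "ws \<longlonglongrightarrow> w"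
      have c: "(\<lambda>n. map_tup (Theta_fst r k) p (ts n) (fst (ws n)) (snd (ws n))) \<longlonglongrightarrow> map_tup (Theta_fst r k) p t (fst w) (snd w)"
        by (rule cont_ptD[OF cp a])
      have c0: "(\<lambda>n. map_tup (Theta_fst r k) p (ts n) (fst (ws n)) (snd (ws n)) 0) \<longlonglongrightarrow> map_tup (Theta_fst r k) p t (fst w) (snd w) 0"
        using c by (simp add: tendsto_fun_iff[where f="\<lambda>n. map_tup (Theta_fst r k) p (ts n) (fst (ws n)) (snd (ws n))"])
      have "(\<lambda>n. extend_pt p (ts n) (ws n)) \<longlonglongrightarrow> extend_pt p t w"
        unfolding extend_pt_def Let_def by (intro tendsto_Pair tendsto_lact tendsto_inv' c c0 tendsto_nu[OF _ x k] tendsto_fst tendsto_snd a(4))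
      moreover have "\<forall>\<^sub>F n in sequentially. extend_pt p (ts n) (ws n) \<in> Tup (r - k) p \<times> (Mk r k \<times> M)"
        by (intro always_eventually allI extend_pt_in) (simp_all only: a(1,2))
      ultimately show "(\<lambda>n. extend_pt p (ts n) (ws n)) \<longlonglongrightarrow> extend_pt p t w \<and> (\<forall>\<^sub>F n in sequentially. extend_pt p (ts n) (ws n) \<in> Tup (r - k) p \<times> (Mk r k \<times> M))" ..
    next
      show "0 < t" "t < 1" using t by simp_all
      then show "extend_pt p t w \<in> Tup (r - k) p \<times> (Mk r k \<times> M)" by (rule extend_pt_in[OF _ _ w])
    qed (rule w)
  qed
qed

lemma extend_pt_inv:
  fixes y :: "'k::real_normed_field pairs \<times> 'm"
  assumes "0 < t" "t < 1" "a \<in> GG r" "g \<in> Tup r p" "y \<in> XX r k \<times> M"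
  shows "extend_pt p t (lact a g, actx a y) = extend_pt p t (g, y)"
proof -
  let ?T = "map_tup (Theta_fst r k) p t g y"
  have T: "map_tup (Theta_fst r k) p t (lact a g) (actx a y) = lact a ?T"
    by (auto simp: map_tup_def lact_def Theta_fst_mul[OF assms(3)])
  have "?T 0 \<in> GG r" using Theta_fst_GG[OF assms(1,2) Tup_GG[OF assms(4), of 0] assms(5)] by (simp add: map_tup_def)
  then have "lact (inv' (mul a (?T 0))) (lact a ?T) = lact (inv' (?T 0)) ?T"
    by (simp add: lact_def inv_mul_mul[OF assms(3) _ r])
  moreover have "nu r k (fst (actx a y)) = nu r k (fst y)" "snd (actx a y) = snd y"
    by (simp_all add: actx_def nu_apx[OF assms(3) r k])
  ultimately show ?thesis by (simp add: extend_pt_def T Let_def lact_apply)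
qed

lemma extend_Co:
  fixes f :: "('k::real_normed_field, 'k pairs \<times> 'm) cochain"
  assumes f: "f \<in> Aa (r - k) (Mk r k \<times> M) p"
  shows "extend p f \<in> Cc r k M p"
    "g \<in> Tup r p \<Longrightarrow> y \<in> XX r k \<times> M \<Longrightarrow> avgable (\<lambda>t. f (fst (extend_pt p t (g, y))) (snd (extend_pt p t (g, y))))"
proof -
  have inv: "f (fst (extend_pt p t (lact a g, actx a y))) (snd (extend_pt p t (lact a g, actx a y))) = f (fst (extend_pt p t (g, y))) (snd (extend_pt p t (g, y)))"
    if "0 < t" "t < 1" "a \<in> GG r" "g \<in> Tup r p" "y \<in> XX r k \<times> M" for t a g y
    by (simp only: extend_pt_inv[OF that])
  show "extend p f \<in> Cc r k M p" unfolding extend_def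
    by (rule avg_Co(1)[where \<Psi>="extend_pt p", OF f r], fact actx_cl, fact extend_pt_good, fact inv)
  show "avgable (\<lambda>t. f (fst (extend_pt p t (g, y))) (snd (extend_pt p t (g, y))))" if "g \<in> Tup r p" "y \<in> XX r k \<times> M"
    by (rule avg_Co(2)[where \<Psi>="extend_pt p" and act=actx, OF f r], fact actx_cl, fact extend_pt_good, fact inv, fact that(1), fact that(2))
qed

lemma extend_dd:
  fixes f :: "('k::real_normed_field, 'k pairs \<times> 'm) cochain"
  assumes f: "f \<in> Aa (r - k) (Mk r k \<times> M) p"
  shows "extend (Suc p) (dd (r - k) p f) = dd r p (extend p f)"
proof (intro ext)
  fix g :: "'k elts" and y :: "'k pairs \<times> 'm"
  show "extend (Suc p) (dd (r - k) p f) g y = dd r p (extend p f) g y"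
  proof (cases "g \<in> Tup r (Suc p) \<and> y \<in> XX r k \<times> M")
    case True
    then have g: "g \<in> Tup r (Suc p)" and y: "y \<in> XX r k \<times> M" by auto
    have drg: "dr i g \<in> Tup r p" if "i \<le> Suc p" for i by (rule Tup_dr[OF g that])
    have id: "dd (r - k) p f (fst (extend_pt (Suc p) t (g, y))) (snd (extend_pt (Suc p) t (g, y))) =
       (\<Sum>i\<le>Suc p. (-1)^i * f (fst (extend_pt p t (dr i g, y))) (snd (extend_pt p t (dr i g, y))))" if t: "0 < t" "t < 1" for t
    proof -
      let ?T = "map_tup (Theta_fst r k) (Suc p) t g y"
      have P: "extend_pt (Suc p) t (g, y) \<in> Tup (r - k) (Suc p) \<times> (Mk r k \<times> M)" by (rule extend_pt_in[OF t]) (use g y in auto)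
      have e: "f (dr i (fst (extend_pt (Suc p) t (g, y)))) (snd (extend_pt (Suc p) t (g, y))) = f (fst (extend_pt p t (dr i g, y))) (snd (extend_pt p t (dr i g, y)))"
        if i: "i \<le> Suc p" for i
      proof -
        define T' where "T' = map_tup (Theta_fst r k) p t (dr i g) y"
        have T': "dr i ?T = T'" unfolding T'_def by (rule dr_map_tup[OF i])
        have a: "?T 0 \<in> GG r" using Theta_fst_GG[OF t Tup_GG[OF g, of 0] y] by (simp add: map_tup_def)
        have b: "T' 0 \<in> GG r" using Theta_fst_GG[OF t Tup_GG[OF drg[OF i], of 0] y] by (simp add: map_tup_def T'_def)
        have c: "mul (inv' (?T 0)) (T' 0) \<in> GG (r - k)"
          using Theta_fst_stab(1)[OF t Tup_GG[OF g, of 0] Tup_GG[OF drg[OF i], of 0] y] by (simp add: map_tup_def T'_def)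
        \<comment> \<open>The face that drops entry \<open>0\<close> changes the entry by which the
          tuple is divided. The correction \<open>mul (inv' (?T 0)) (T' 0)\<close> lies in the
          stabilizer, under which \<open>f\<close> is invariant.\<close>
        have "lact (mul (inv' (?T 0)) (T' 0)) (lact (inv' (T' 0)) T') = lact (inv' (?T 0)) T'"
          by (simp add: lact_lact mul_assoc mul_inv[OF b r] mul_one[OF inv_GG[OF a r] r])
        then have "dr i (fst (extend_pt (Suc p) t (g, y))) = lact (mul (inv' (?T 0)) (T' 0)) (fst (extend_pt p t (dr i g, y)))"
          by (simp add: extend_pt_def Let_def dr_lact T' flip: T'_def)
        moreover have "snd (extend_pt (Suc p) t (g, y)) = snd (extend_pt p t (dr i g, y))" by (simp add: extend_pt_def Let_def)
        moreover have "extend_pt p t (dr i g, y) \<in> Tup (r - k) p \<times> (Mk r k \<times> M)" by (rule extend_pt_in[OF t]) (use drg[OF i] y in auto)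
        ultimately show ?thesis using Co_inv[OF f c, of "fst (extend_pt p t (dr i g, y))" "snd (extend_pt p t (dr i g, y))"]
          by (simp add: mem_Times_iff)
      qed
      have "fst (extend_pt (Suc p) t (g, y)) \<in> Tup (r - k) (Suc p)" using P by (simp add: mem_Times_iff)
      then show ?thesis unfolding dd_def by (simp only: if_True) (intro sum.cong refl, simp only: e atMost_iff)
    qed
    have A: "avgable (\<lambda>t. f (fst (extend_pt p t (dr i g, y))) (snd (extend_pt p t (dr i g, y))))" if "i \<le> Suc p" for i
      by (rule extend_Co(2)[OF f drg[OF that] y])
    have "extend (Suc p) (dd (r - k) p f) g y = avg (\<lambda>t. \<Sum>i\<le>Suc p. (-1)^i * f (fst (extend_pt p t (dr i g, y))) (snd (extend_pt p t (dr i g, y))))"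
      unfolding extend_def using g y by (simp only: simp_thms if_True) (intro avg_cong id)
    also have "\<dots> = (\<Sum>i\<le>Suc p. avg (\<lambda>t. (-1)^i * f (fst (extend_pt p t (dr i g, y))) (snd (extend_pt p t (dr i g, y)))))"
      using A by (intro conjunct1[OF avg_sum] avg_cmult(2)) auto
    also have "\<dots> = (\<Sum>i\<le>Suc p. (-1)^i * avg (\<lambda>t. f (fst (extend_pt p t (dr i g, y))) (snd (extend_pt p t (dr i g, y)))))"
      using A by (intro sum.cong refl avg_cmult(1)) auto
    also have "\<dots> = dd r p (extend p f) g y" unfolding dd_def
      using g by (simp only: if_True) (intro sum.cong refl, simp add: extend_def drg y)
    finally show ?thesis .
  qed (auto simp: extend_def dd_def)
qed

text \<open>Translating by the inverse of \<open>T 0\<close> shows that extension after restriction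
  is the averaged pullback along \<open>Theta_fst\<close>, an equivariant self-map.\<close>

lemma extend_res:
  fixes F :: "('k::real_normed_field, 'k pairs \<times> 'm) cochain"
  assumes F: "F \<in> Cc r k M p" and dF: "dd r p F = 0"
  shows "F - extend p (res (r - k) (Mk r k \<times> M) p F) \<in> Bd r actx (XX r k \<times> M) p"
proof -
  have "extend p (res (r - k) (Mk r k \<times> M) p F) = avg_map r (XX r k \<times> M) (Theta_fst r k) p F"
    unfolding extend_def avg_map_def
  proof (intro ext if_cong refl avg_cong)
    fix g :: "'k elts" and y :: "'k pairs \<times> 'm" and t :: real
    assume gy: "g \<in> Tup r p \<and> y \<in> XX r k \<times> M" and t: "0 < t" "t < 1"
    let ?T = "map_tup (Theta_fst r k) p t g y"
    have a: "?T 0 \<in> GG r" using Theta_fst_GG[OF t Tup_GG[of g r p 0]] gy by (simp add: map_tup_def)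
    have T: "?T \<in> Tup r p" by (rule TupI) (use gy t in \<open>auto simp: map_tup_def Theta_fst_GG Tup_GG\<close>)
    have P: "extend_pt p t (g, y) \<in> Tup (r - k) p \<times> (Mk r k \<times> M)" by (rule extend_pt_in[OF t]) (use gy in auto)
    have "apx (inv' (?T 0)) (fst y) = nu r k (fst y)"
      using Theta_fst_stab(2)[OF t Tup_GG[of g r p 0] Tup_GG[of g r p 0], of y] gy by (simp add: map_tup_def)
    then have "snd (extend_pt p t (g, y)) = actx (inv' (?T 0)) y" by (simp add: extend_pt_def Let_def actx_def)
    moreover have "fst (extend_pt p t (g, y)) = lact (inv' (?T 0)) ?T" by (simp add: extend_pt_def Let_def)
    ultimately have "F (fst (extend_pt p t (g, y))) (snd (extend_pt p t (g, y))) = F ?T y"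
      using Co_inv[OF F inv_GG[OF a r] T, of y] gy by simp
    then show "res (r - k) (Mk r k \<times> M) p F (fst (extend_pt p t (g, y))) (snd (extend_pt p t (g, y))) = F ?T y"
      using P by (simp add: res_def mem_Times_iff)
  qed
  moreover have "F - avg_map r (XX r k \<times> M) (Theta_fst r k) p F \<in> Bd r actx (XX r k \<times> M) p"
    by (rule avg_map_homotopic[OF r]) (auto intro: actx_cl Theta_fst_GG Theta_fst_mul Theta_fst_ract F dF)
  ultimately show ?thesis by simp
qed

text \<open>Over a normal form \<open>Theta_fst\<close> maps the stabilizer to itself, so
  restriction after extension is the averaged pullback for the smaller group. With
  \<open>extend_res\<close> this identifies the cohomology of a column with that of the stabilizer
  over the normal forms.\<close>

lemma res_extend:
  fixes b :: "('k::real_normed_field, 'k pairs \<times> 'm) cochain"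
  assumes b: "b \<in> Aa (r - k) (Mk r k \<times> M) p" and db: "dd (r - k) p b = 0"
  shows "b - res (r - k) (Mk r k \<times> M) p (extend p b) \<in> Bd (r - k) (\<lambda>_ y. y) (Mk r k \<times> M) p"
proof -
  have rk: "r - k \<le> N" "r - k \<le> r" using r by auto
  have "res (r - k) (Mk r k \<times> M) p (extend p b) = avg_map (r - k) (Mk r k \<times> M) (Theta_fst r k) p b"
  proof (intro ext)
    fix g :: "'k elts" and y :: "'k pairs \<times> 'm"
    show "res (r - k) (Mk r k \<times> M) p (extend p b) g y = avg_map (r - k) (Mk r k \<times> M) (Theta_fst r k) p b g y"
    proof (cases "g \<in> Tup (r - k) p \<and> y \<in> Mk r k \<times> M")
      case True
      then have g': "g \<in> Tup r p" and y': "y \<in> XX r k \<times> M" and x: "nu r k (fst y) = fst y"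
        using Tup_mono[OF rk(2)] by (auto simp: Mk_def)
      have "b (fst (extend_pt p t (g, y))) (snd (extend_pt p t (g, y))) = b (map_tup (Theta_fst r k) p t g y) y" if t: "0 < t" "t < 1" for t
      proof -
        let ?T = "map_tup (Theta_fst r k) p t g y"
        have a: "?T 0 \<in> GG (r - k)" using Theta_fst_Mk_GG[OF t Tup_GG[of g "r - k" p 0]] True by (simp add: map_tup_def)
        have T: "?T \<in> Tup (r - k) p" by (rule TupI) (use True t in \<open>auto simp: map_tup_def Theta_fst_Mk_GG Tup_GG\<close>)
        have "extend_pt p t (g, y) = (lact (inv' (?T 0)) ?T, y)" by (simp add: extend_pt_def Let_def x)
        then show ?thesis using Co_inv[OF b inv_GG[OF a rk(1)] T, of y] True by simp
      qed
      then have "avg (\<lambda>t. b (fst (extend_pt p t (g, y))) (snd (extend_pt p t (g, y)))) = avg (\<lambda>t. b (map_tup (Theta_fst r k) p t g y) y)" by (rule avg_cong)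
      then show ?thesis using True g' y' by (simp add: res_def extend_def avg_map_def)
    qed (auto simp: res_def avg_map_def)
  qed
  moreover have "b - avg_map (r - k) (Mk r k \<times> M) (Theta_fst r k) p b \<in> Bd (r - k) (\<lambda>_ y. y) (Mk r k \<times> M) p"
    by (rule avg_map_homotopic[OF rk(1)]) (auto intro: Theta_fst_Mk_GG Theta_fst_Mk_mul Theta_fst_Mk_ract b db)
  ultimately show ?thesis by simp
qed

end


section \<open>The zigzag\<close>

text \<open>\<open>ty\<close> names the field, which otherwise occurs only in the type of the
  quantified cochains.\<close>

definition Surj :: "'k::real_normed_field itself \<Rightarrow> nat \<Rightarrow> nat \<Rightarrow> nat \<Rightarrow> 'y::metric_space set \<Rightarrow> bool" where
  "Surj ty r r' p Y \<longleftrightarrow> (\<forall>b\<in>(Aa r' Y p :: ('k, 'y) cochain set). dd r' p b = 0 \<longrightarrow>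
     (\<exists>a\<in>Aa r Y p. dd r p a = 0 \<and> b - res r' Y p a \<in> Bd r' (\<lambda>_ y. y) Y p))"

definition Inj :: "'k::real_normed_field itself \<Rightarrow> nat \<Rightarrow> nat \<Rightarrow> nat \<Rightarrow> 'y::metric_space set \<Rightarrow> bool" where
  "Inj ty r r' p Y \<longleftrightarrow> (\<forall>a\<in>(Aa r Y p :: ('k, 'y) cochain set). dd r p a = 0 \<longrightarrow>
     res r' Y p a \<in> Bd r' (\<lambda>_ y. y) Y p \<longrightarrow> a \<in> Bd r (\<lambda>_ y. y) Y p)"

lemma res_lin: "res r Y p (F + H) = res r Y p F + res r Y p H" "res r Y p (F - H) = res r Y p F - res r Y p H" "res r Y p 0 = 0"
  by (auto simp: res_def fun_eq_iff)

lemma res_res: "r'' \<le> r' \<Longrightarrow> res r'' Y p (res r' Y p F) = res r'' Y p F"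
  using Tup_mono[of r'' r' p] by (auto simp: res_def fun_eq_iff)

lemma res_Bd:
  assumes N: "r' \<le> N" and r: "r' \<le> r" and Y: "Y' \<subseteq> Y" and F: "F \<in> Bd r act Y p"
    and inv: "\<And>a y. a \<in> GG r' \<Longrightarrow> y \<in> Y' \<Longrightarrow> act a y = y"
  shows "res r' Y' p F \<in> Bd r' (\<lambda>_ y. y) Y' p"
proof (cases p)
  case 0
  then show ?thesis using F by (simp add: Bd_def res_lin)
next
  case (Suc q)
  then obtain H where H: "H \<in> Co r act Y q" "F = dd r q H" using F by (auto simp: Bd_def)
  have "res r' Y' p F = dd r' q (res r' Y' q H)" using Suc H(2) res_dd[OF r, where Y=Y' and p=q and F=H] by simp
  then show ?thesis using Suc res_Co[OF N r Y H(1) inv] by (simp add: Bd_dd)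
qed

lemma res_Aa: "r' \<le> N \<Longrightarrow> r' \<le> r \<Longrightarrow> F \<in> Aa r Y p \<Longrightarrow> res r' Y p F \<in> Aa r' Y p"
  by (rule res_Co[of r' r Y Y]) auto

lemma dd_res_0: "r' \<le> r \<Longrightarrow> dd r p F = 0 \<Longrightarrow> dd r' p (res r' Y p F) = 0"
  by (simp add: res_dd res_lin)

lemma Surj_trans:
  assumes N: "r \<le> N" and r: "r'' \<le> r'" "r' \<le> r" and S: "Surj ty r r' p Y" "Surj ty r' r'' p Y"
  shows "Surj ty r r'' p Y"
  unfolding Surj_def
proof (intro ballI impI)
  fix b :: "('a, 'b) cochain" assume b: "b \<in> Aa r'' Y p" "dd r'' p b = 0"
  from S(2) b obtain b' where b': "b' \<in> Aa r' Y p" "dd r' p b' = 0" "b - res r'' Y p b' \<in> Bd r'' (\<lambda>_ y. y) Y p"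
    unfolding Surj_def by blast
  from S(1) b' obtain a where a: "a \<in> Aa r Y p" "dd r p a = 0" "b' - res r' Y p a \<in> Bd r' (\<lambda>_ y. y) Y p"
    unfolding Surj_def by blast
  have "res r'' Y p (b' - res r' Y p a) \<in> Bd r'' (\<lambda>_ y. y) Y p"
    by (rule res_Bd[OF _ r(1) order_refl a(3)]) (use N r in auto)
  then have "(b - res r'' Y p b') + (res r'' Y p b' - res r'' Y p a) \<in> Bd r'' (\<lambda>_ y. y) Y p"
    by (intro Bd_add b'(3)) (simp add: res_lin res_res[OF r(1)])
  then show "\<exists>a\<in>Aa r Y p. dd r p a = 0 \<and> b - res r'' Y p a \<in> Bd r'' (\<lambda>_ y. y) Y p"
    using a by (intro bexI[of _ a]) auto
qed

lemma Inj_trans: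
  assumes N: "r \<le> N" and r: "r'' \<le> r'" "r' \<le> r" and S: "Inj ty r r' p Y" "Inj ty r' r'' p Y"
  shows "Inj ty r r'' p Y"
  unfolding Inj_def
proof (intro ballI impI)
  fix a :: "('a, 'b) cochain" 
  assume a: "a \<in> Aa r Y p" "dd r p a = 0" "res r'' Y p a \<in> Bd r'' (\<lambda>_ y. y) Y p"
  have "res r' Y p a \<in> Bd r' (\<lambda>_ y. y) Y p"
    using S(2) res_Aa[OF _ r(2) a(1)] dd_res_0[OF r(2) a(2)] a(3) res_res[OF r(1), of Y p a] N r unfolding Inj_def by auto
  then show "a \<in> Bd r (\<lambda>_ y. y) Y p" using S(1) a unfolding Inj_def by blast
qed

lemma Surj_chain:
  assumes N: "r \<le> N" and kr: "k \<le> r" and S: "\<And>r'. r - k < r' \<Longrightarrow> r' \<le> r \<Longrightarrow> Surj ty r' (r' - 1) p Y"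
  shows "Surj ty r (r - k) p Y"
  using kr S
proof (induction k)
  case 0
  show ?case unfolding Surj_def
  proof (intro ballI impI)
    fix b :: "('a, 'b) cochain" assume b: "b \<in> Aa (r - 0) Y p" "dd (r - 0) p b = 0"
    have "res r Y p b = b" using Co_zero[OF b(1)] by (auto simp: res_def fun_eq_iff)
    then show "\<exists>a\<in>Aa r Y p. dd r p a = 0 \<and> b - res (r - 0) Y p a \<in> Bd (r - 0) (\<lambda>_ y. y) Y p"
      using b by (intro bexI[of _ b]) (auto simp: Bd_0)
  qed
next
  case (Suc k)
  have "Surj ty r (r - k) p Y" by (rule Suc.IH) (use Suc.prems in auto)
  moreover have "Surj ty (r - k) (r - Suc k) p Y" using Suc.prems(2)[of "r - k"] Suc.prems(1) by (simp add: Suc_diff_Suc)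
  ultimately show ?case by (rule Surj_trans[OF N _ _, rotated 2]) auto
qed

lemma Inj_chain:
  assumes N: "r \<le> N" and kr: "k \<le> r" and S: "\<And>r'. r - k < r' \<Longrightarrow> r' \<le> r \<Longrightarrow> Inj ty r' (r' - 1) p Y"
  shows "Inj ty r (r - k) p Y"
  using kr S
proof (induction k)
  case 0
  show ?case unfolding Inj_def
  proof (intro ballI impI)
    fix b :: "('a, 'b) cochain" assume b: "b \<in> Aa r Y p" "res (r - 0) Y p b \<in> Bd (r - 0) (\<lambda>_ y. y) Y p"
    have "res r Y p b = b" using Co_zero[OF b(1)] by (auto simp: res_def fun_eq_iff)
    then show "b \<in> Bd r (\<lambda>_ y. y) Y p" using b by simp
  qed
next
  case (Suc k)
  have "Inj ty r (r - k) p Y" by (rule Suc.IH) (use Suc.prems in auto)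
  moreover have "Inj ty (r - k) (r - Suc k) p Y" using Suc.prems(2)[of "r - k"] Suc.prems(1) by (simp add: Suc_diff_Suc)
  ultimately show ?case by (rule Inj_trans[OF N _ _, rotated 2]) auto
qed

section \<open>Change of the parameter space along continuous maps and homeomorphisms\<close>

lemma pull_Aa:
  fixes e :: "'y::metric_space \<Rightarrow> 'z::metric_space"
  assumes e: "continuous_on UNIV e" and Y: "\<And>y. y \<in> Y \<longleftrightarrow> e y \<in> Z" and F: "F \<in> Aa r Z p"
  shows "(\<lambda>g y. F g (e y)) \<in> Aa r Y p"
proof -
  obtain B where B: "\<bar>F g y\<bar> \<le> B" for g y using Co_bdd[OF F] by blast
  show ?thesis
  proof (rule CoI)
    have "continuous_on (Tup r p \<times> Y) (\<lambda>z. (\<lambda>z. F (fst z) (snd z)) (fst z, e (snd z)))"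
      by (rule continuous_on_compose2[OF Co_cont[OF F]], intro continuous_on_Pair continuous_on_fst continuous_on_id continuous_on_compose2[OF e])
         (auto simp: Y intro: continuous_intros)
    then show "continuous_on (Tup r p \<times> Y) (\<lambda>z. F (fst z) (e (snd z)))" by simp
  qed (use B Co_inv[OF F] Co_zero[OF F] in \<open>auto simp: Y\<close>)
qed

lemma pull_Bd:
  fixes e :: "'y::metric_space \<Rightarrow> 'z::metric_space"
  assumes e: "continuous_on UNIV e" and Y: "\<And>y. y \<in> Y \<longleftrightarrow> e y \<in> Z" and F: "F \<in> Bd r (\<lambda>_ y. y) Z p"
  shows "(\<lambda>g y. F g (e y)) \<in> Bd r (\<lambda>_ y. y) Y p"
proof (cases p)
  case 0 then show ?thesis using F by (auto simp: Bd_def fun_eq_iff)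
next
  case (Suc q)
  then obtain H where H: "H \<in> Aa r Z q" "F = dd r q H" using F by (auto simp: Bd_def)
  have "(\<lambda>g y. F g (e y)) = dd r q (\<lambda>g y. H g (e y))" by (auto simp: H dd_def)
  then show ?thesis using Suc pull_Aa[OF e Y H(1)] by (simp add: Bd_dd)
qed

lemma dd_pull: "dd r p (\<lambda>g y. F g (e y)) = (\<lambda>g y. dd r p F g (e y))"
  by (auto simp: dd_def)

context
  fixes e :: "'y::metric_space \<Rightarrow> 'z::metric_space" and d :: "'z \<Rightarrow> 'y" and Y :: "'y set" and Z :: "'z set"
  assumes e: "continuous_on UNIV e" and d: "continuous_on UNIV d" and de: "\<And>y. d (e y) = y" and ed: "\<And>z. e (d z) = z"
    and Z: "Z = e ` Y"
begin

lemma transport_in: "y \<in> Y \<longleftrightarrow> e y \<in> Z" "z \<in> Z \<longleftrightarrow> d z \<in> Y"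
  using Z de ed by (metis image_iff)+

lemma Surj_transport:
  assumes "Surj ty r r' p Z" shows "Surj ty r r' p Y"
  unfolding Surj_def
proof (intro ballI impI)
  fix b :: "('a, 'y) cochain" assume b: "b \<in> Aa r' Y p" "dd r' p b = 0"
  have "(\<lambda>g z. b g (d z)) \<in> Aa r' Z p" by (rule pull_Aa[OF d transport_in(2) b(1)])
  moreover have "dd r' p (\<lambda>g z. b g (d z)) = 0" unfolding dd_pull using b(2) by (simp add: fun_eq_iff)
  ultimately obtain a where a: "a \<in> Aa r Z p" "dd r p a = 0" "(\<lambda>g z. b g (d z)) - res r' Z p a \<in> Bd r' (\<lambda>_ y. y) Z p"
    using assms unfolding Surj_def by blast
  show "\<exists>a\<in>Aa r Y p. dd r p a = 0 \<and> b - res r' Y p a \<in> Bd r' (\<lambda>_ y. y) Y p"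
  proof (intro bexI conjI)
    show "(\<lambda>g y. a g (e y)) \<in> Aa r Y p" by (rule pull_Aa[OF e transport_in(1) a(1)])
    show "dd r p (\<lambda>g y. a g (e y)) = 0" unfolding dd_pull using a(2) by (simp add: fun_eq_iff)
    have "b - res r' Y p (\<lambda>g y. a g (e y)) = (\<lambda>g y. ((\<lambda>g z. b g (d z)) - res r' Z p a) g (e y))"
      by (auto simp: fun_eq_iff res_def de transport_in(1))
    then show "b - res r' Y p (\<lambda>g y. a g (e y)) \<in> Bd r' (\<lambda>_ y. y) Y p"
      using pull_Bd[OF e transport_in(1) a(3)] by simp
  qed
qed

lemma Inj_transport:
  assumes "Inj ty r r' p Z" shows "Inj ty r r' p Y"
  unfolding Inj_def
proof (intro ballI impI)
  fix a :: "('a, 'y) cochain" 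
  assume a: "a \<in> Aa r Y p" "dd r p a = 0" "res r' Y p a \<in> Bd r' (\<lambda>_ y. y) Y p"
  let ?a = "\<lambda>g z. a g (d z)"
  have "?a \<in> Aa r Z p" by (rule pull_Aa[OF d transport_in(2) a(1)])
  moreover have "dd r p ?a = 0" unfolding dd_pull using a(2) by (simp add: fun_eq_iff)
  moreover have "res r' Z p ?a = (\<lambda>g z. res r' Y p a g (d z))" by (auto simp: fun_eq_iff res_def transport_in(2))
  then have "res r' Z p ?a \<in> Bd r' (\<lambda>_ y. y) Z p" using pull_Bd[OF d transport_in(2) a(3)] by simp
  ultimately have "?a \<in> Bd r (\<lambda>_ y. y) Z p" using assms unfolding Inj_def by blast
  then have "(\<lambda>g y. ?a g (e y)) \<in> Bd r (\<lambda>_ y. y) Y p" by (rule pull_Bd[OF e transport_in(1)])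
  then show "a \<in> Bd r (\<lambda>_ y. y) Y p" by (simp add: de)
qed

end

text \<open>The modified cochain differs from the given one only by a coboundary, so a cochain may be moved into \<open>Kk\<close> once its coboundary is there.\<close>

definition lifts :: "'k::real_normed_field itself \<Rightarrow> nat \<Rightarrow> nat \<Rightarrow> nat \<Rightarrow> 'm::metric_space set \<Rightarrow> bool" where
  "lifts ty s r k M \<longleftrightarrow> (\<forall>b\<in>(Cc r k M s :: ('k, 'k pairs \<times> 'm) cochain set). dd r s b \<in> Kk r k M (Suc s) \<longrightarrow>
     (\<exists>a\<in>Kk r k M s. b - a \<in> Bd r actx (XX r k \<times> M) s))"

definition BdK :: "nat \<Rightarrow> nat \<Rightarrow> 'm::metric_space set \<Rightarrow> nat \<Rightarrow>
    ('k::real_normed_field, 'k pairs \<times> 'm) cochain set" where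
  "BdK r k M s = (case s of 0 \<Rightarrow> {0} | Suc q \<Rightarrow> dd r q ` Kk r k M q)"

text \<open>Descending one degree moves one column to the right, so \<open>k + s\<close> stays the
  same through the recursion, and with it the range where \<open>lifts\<close> is assumed. The
  clause on \<open>BdK\<close> is there for the recursion itself: it makes a corrected right-hand
  side in the next degree closed under \<open>dl\<close>.\<close>

definition zigzag_at :: "'k::real_normed_field itself \<Rightarrow> nat \<Rightarrow> 'm::metric_space set \<Rightarrow> nat \<Rightarrow> bool" where
  "zigzag_at ty r M s \<longleftrightarrow> (\<forall>k (b :: 'k elts \<Rightarrow> 'k pairs \<times> 'm \<Rightarrow> real) \<kappa>.
    (\<forall>s'<s. \<forall>k'. k' + s' \<le> k + s + 2 \<longrightarrow> lifts ty s' r k' M) \<longrightarrow> k + s + 2 < r \<longrightarrow> b \<in> Cc r (Suc k) M s \<longrightarrow>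
    \<kappa> \<in> Kk r (Suc (Suc k)) M s \<longrightarrow> dl r (Suc k) b - \<kappa> \<in> Bd r actx (XX r (Suc (Suc k)) \<times> M) s \<longrightarrow>
    (\<exists>u\<in>Kk r (Suc k) M s. \<exists>\<beta>\<in>Cc r k M s. b - u - dl r k \<beta> \<in> Bd r actx (XX r (Suc k) \<times> M) s \<and> \<kappa> - dl r (Suc k) u \<in> BdK r (Suc (Suc k)) M s))"

lemma zigzag_atD:
  fixes b \<kappa> :: "('k::real_normed_field, 'k pairs \<times> 'm::metric_space) cochain"
  assumes "zigzag_at TYPE('k) r M s" "\<And>s' k'. s' < s \<Longrightarrow> k' + s' \<le> k + s + 2 \<Longrightarrow> lifts TYPE('k) s' r k' M" "k + s + 2 < r" "b \<in> Cc r (Suc k) M s"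
    "\<kappa> \<in> Kk r (Suc (Suc k)) M s" "dl r (Suc k) b - \<kappa> \<in> Bd r actx (XX r (Suc (Suc k)) \<times> M) s"
  shows "\<exists>u\<in>Kk r (Suc k) M s. \<exists>\<beta>\<in>Cc r k M s. b - u - dl r k \<beta> \<in> Bd r actx (XX r (Suc k) \<times> M) s \<and> \<kappa> - dl r (Suc k) u \<in> BdK r (Suc (Suc k)) M s"
  using assms(1)[unfolded zigzag_at_def, rule_format, of k b \<kappa>] assms(2-) by blast

lemma zigzag_atI:
  assumes "\<And>k (b :: 'k::real_normed_field elts \<Rightarrow> 'k pairs \<times> 'm::metric_space \<Rightarrow> real) \<kappa>.
    (\<And>s' k'. s' < s \<Longrightarrow> k' + s' \<le> k + s + 2 \<Longrightarrow> lifts TYPE('k) s' r k' M) \<Longrightarrow> k + s + 2 < r \<Longrightarrow> b \<in> Cc r (Suc k) M s \<Longrightarrow>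
    \<kappa> \<in> Kk r (Suc (Suc k)) M s \<Longrightarrow> dl r (Suc k) b - \<kappa> \<in> Bd r actx (XX r (Suc (Suc k)) \<times> M) s \<Longrightarrow>
    \<exists>u\<in>Kk r (Suc k) M s. \<exists>\<beta>\<in>Cc r k M s. b - u - dl r k \<beta> \<in> Bd r actx (XX r (Suc k) \<times> M) s \<and> \<kappa> - dl r (Suc k) u \<in> BdK r (Suc (Suc k)) M s"
  shows "zigzag_at TYPE('k) r M s"
  unfolding zigzag_at_def by (intro allI impI) (rule assms, auto)

lemma zigzag:
  assumes r: "r \<le> N"
  shows "zigzag_at TYPE('k::real_normed_field) r (M :: 'm::metric_space set) s"
proof (induct s)
  case 0
  show ?case
  proof (rule zigzag_atI)
  fix k and b \<kappa> :: "('k, 'k pairs \<times> 'm) cochain"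
  assume prems: "k + 0 + 2 < r" "b \<in> Cc r (Suc k) M 0"
    "\<kappa> \<in> Kk r (Suc (Suc k)) M 0" "dl r (Suc k) b - \<kappa> \<in> Bd r actx (XX r (Suc (Suc k)) \<times> M) 0"
  have db: "dl r (Suc k) b = \<kappa>" using prems(4) by (simp add: Bd_def)
  then have "dl r (Suc (Suc k)) \<kappa> = 0" using dl_dl[of r "Suc k" b] by simp
  then obtain u where u: "u \<in> Kk r (Suc k) M 0" "dl r (Suc k) u = \<kappa>"
    using exact_Kk[OF r _ prems(3)] prems(1) by auto
  have "dl r (Suc k) (b - u) = 0" by (simp add: dl_lin db u)
  then obtain \<beta> where \<beta>: "\<beta> \<in> Cc r k M 0" "dl r k \<beta> = b - u"
    using exact_Cc[OF r _ Co_diff[OF prems(2) Kk_Cc[OF u(1)]]] prems(1) by auto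
  show "\<exists>u\<in>Kk r (Suc k) M 0. \<exists>\<beta>\<in>Cc r k M 0. b - u - dl r k \<beta> \<in> Bd r actx (XX r (Suc k) \<times> M) 0 \<and> \<kappa> - dl r (Suc k) u \<in> BdK r (Suc (Suc k)) M 0" using u \<beta> by (intro bexI[of _ u] bexI[of _ \<beta>]) (auto simp: Bd_def BdK_def)
  qed
next
  case (Suc s)
  show ?case
  proof (rule zigzag_atI)
  fix k and b \<kappa> :: "('k, 'k pairs \<times> 'm) cochain"
  assume Q: "\<And>s' k'. s' < Suc s \<Longrightarrow> k' + s' \<le> k + Suc s + 2 \<Longrightarrow> lifts TYPE('k) s' r k' M"
    and prems: "k + Suc s + 2 < r" "b \<in> Cc r (Suc k) M (Suc s)"
    "\<kappa> \<in> Kk r (Suc (Suc k)) M (Suc s)" "dl r (Suc k) b - \<kappa> \<in> Bd r actx (XX r (Suc (Suc k)) \<times> M) (Suc s)"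
  obtain b1 where b1: "b1 \<in> Cc r (Suc (Suc k)) M s" "dl r (Suc k) b - \<kappa> = dd r s b1"
    using prems(4) by (auto simp: Bd_def)
  have dlb: "dl r (Suc k) b = \<kappa> + dd r s b1" using b1(2) by (simp add: algebra_simps)
  have "dl r (Suc (Suc k)) (dl r (Suc k) b) = dl r (Suc (Suc k)) \<kappa> + dd r s (dl r (Suc (Suc k)) b1)"
    by (simp add: dlb dl_lin dd_dl)
  then have dk: "dd r s (dl r (Suc (Suc k)) b1) = - dl r (Suc (Suc k)) \<kappa>"
    using dl_dl[of r "Suc k" b] by (simp add: eq_neg_iff_add_eq_0 add.commute)
  \<comment> \<open>The coboundary of \<open>dl r (Suc (Suc k)) b1\<close> is an element of
    \<open>Kk\<close>, so \<open>lifts\<close> replaces this cochain by an element \<kappa>2 of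
    \<open>Kk\<close>. That puts \<open>b1\<close> and \<kappa>2 in the situation of the induction
    hypothesis, one column further.\<close>
  have "lifts TYPE('k) s r (Suc (Suc (Suc k))) M" using Q[of s "Suc (Suc (Suc k))"] by simp
  moreover have "dd r s (dl r (Suc (Suc k)) b1) \<in> Kk r (Suc (Suc (Suc k))) M (Suc s)"
    unfolding dk by (intro Kk_uminus dl_Kk r prems(3))
  ultimately obtain \<kappa>2 where k2: "\<kappa>2 \<in> Kk r (Suc (Suc (Suc k))) M s" "dl r (Suc (Suc k)) b1 - \<kappa>2 \<in> Bd r actx (XX r (Suc (Suc (Suc k))) \<times> M) s"
    unfolding lifts_def using dl_Cc[OF r b1(1)] by blast
  have "\<exists>u\<in>Kk r (Suc (Suc k)) M s. \<exists>\<beta>\<in>Cc r (Suc k) M s. b1 - u - dl r (Suc k) \<beta> \<in> Bd r actx (XX r (Suc (Suc k)) \<times> M) s \<and>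
      \<kappa>2 - dl r (Suc (Suc k)) u \<in> BdK r (Suc (Suc (Suc k))) M s"
    by (rule zigzag_atD[OF Suc _ _ b1(1) k2]) (use Q prems(1) in auto)
  then obtain u1 \<beta>1 where l1: "u1 \<in> Kk r (Suc (Suc k)) M s" "\<beta>1 \<in> Cc r (Suc k) M s"
    "b1 - u1 - dl r (Suc k) \<beta>1 \<in> Bd r actx (XX r (Suc (Suc k)) \<times> M) s" "\<kappa>2 - dl r (Suc (Suc k)) u1 \<in> BdK r (Suc (Suc (Suc k))) M s"
    by blast
  have "dd r s (b1 - u1 - dl r (Suc k) \<beta>1) = 0" by (rule Bd_closed[OF r l1(3)])
  then have ddb1: "dd r s b1 = dd r s u1 + dl r (Suc k) (dd r s \<beta>1)" by (simp add: dd_lin dd_dl algebra_simps)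
  have "dd r s (dl r (Suc (Suc k)) b1 - \<kappa>2) = 0" by (rule Bd_closed[OF r k2(2)])
  moreover have "dd r s (\<kappa>2 - dl r (Suc (Suc k)) u1) = 0"
  proof (cases s)
    case 0 then show ?thesis using l1(4) by (simp add: BdK_def dd_lin)
  next
    case (Suc q)
    then obtain x where "\<kappa>2 - dl r (Suc (Suc k)) u1 = dd r q x" using l1(4) by (auto simp: BdK_def)
    then show ?thesis using Suc by (simp add: dd_dd)
  qed
  ultimately have "dd r s (dl r (Suc (Suc k)) b1) = dl r (Suc (Suc k)) (dd r s u1)" by (simp add: dd_lin dd_dl)
  then have "- dl r (Suc (Suc k)) \<kappa> = dl r (Suc (Suc k)) (dd r s u1)" using dk by simp
  \<comment> \<open>\<kappa> itself need not be \<open>dl\<close> of an element of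
    \<open>Kk\<close>; the correction by \<open>dd r s u1\<close>, a coboundary inside
    \<open>Kk\<close>, makes it closed so that exactness applies.\<close>
  then have "dl r (Suc (Suc k)) (\<kappa> + dd r s u1) = 0" unfolding dl_lin by (metis add.right_inverse)
  then obtain u where u: "u \<in> Kk r (Suc k) M (Suc s)" "dl r (Suc k) u = \<kappa> + dd r s u1"
    using exact_Kk[OF r _ Kk_add[OF prems(3) dd_Kk[OF r l1(1)]]] prems(1) by auto
  \<comment> \<open>The part of \<open>dd r s b1\<close> not absorbed by \<open>u1\<close> is
    \<open>dl\<close> of \<open>dd r s \<beta>1\<close>, so subtracting this coboundary leaves a
    cochain closed under \<open>dl\<close>.\<close>
  have "dl r (Suc k) (b - u - dd r s \<beta>1) = 0" by (simp add: dl_lin dlb u(2) ddb1)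
  then obtain \<beta> where \<beta>: "\<beta> \<in> Cc r k M (Suc s)" "dl r k \<beta> = b - u - dd r s \<beta>1"
    using exact_Cc[OF r _ Co_diff[OF Co_diff[OF prems(2) Kk_Cc[OF u(1)]] Co_dd[OF r l1(2)]]] prems(1) by auto
  have "b - u - dl r k \<beta> = dd r s \<beta>1" by (simp add: \<beta>(2))
  moreover have "\<kappa> - dl r (Suc k) u = dd r s (- u1)" by (simp add: u(2) dd_lin)
  ultimately show "\<exists>u\<in>Kk r (Suc k) M (Suc s). \<exists>\<beta>\<in>Cc r k M (Suc s). b - u - dl r k \<beta> \<in> Bd r actx (XX r (Suc k) \<times> M) (Suc s) \<and> \<kappa> - dl r (Suc k) u \<in> BdK r (Suc (Suc k)) M (Suc s)" using u(1) \<beta>(1) l1(1,2)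
    by (intro bexI[of _ u] bexI[of _ \<beta>]) (auto simp: Bd_dd BdK_def Kk_uminus intro!: imageI)
  qed
qed


section \<open>Separately invariant cochains as cochains over the normal forms\<close>

definition inflate :: "nat \<Rightarrow> nat \<Rightarrow> ('k::real_normed_field, 'k pairs \<times> 'm) cochain \<Rightarrow>
    'k elts \<Rightarrow> 'k pairs \<times> 'm \<Rightarrow> real" where
  "inflate r k a = (\<lambda>g y. if fst y \<in> XX r k then a g (nu r k (fst y), snd y) else 0)"

lemma inflate_dd: "dd r p (inflate r k a) = inflate r k (dd r p a)"
  by (auto simp: inflate_def dd_def fun_eq_iff)

context
  fixes r k :: nat and M :: "'m::metric_space set"
  assumes r: "r \<le> N" and k: "k \<le> r"
begin

lemma inflate_Kk:
  fixes a :: "('k::real_normed_field, 'k pairs \<times> 'm) cochain"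
  assumes a: "a \<in> Aa r (Mk r k \<times> M) p"
  shows "inflate r k a \<in> Kk r k M p"
proof (rule KkI)
  obtain B where B: "\<And>g y. \<bar>a g y\<bar> \<le> B" using Co_bdd[OF a] by blast
  have B0: "0 \<le> B" by (rule order_trans[OF abs_ge_zero B])
  show "inflate r k a \<in> Cc r k M p"
  proof (rule CoI)
    have "continuous_on (Tup r p \<times> XX r k \<times> M) (\<lambda>z. (\<lambda>w. a (fst w) (snd w)) (fst z, (nu r k (fst (snd z)), snd (snd z))))"
      by (rule continuous_on_compose2[OF Co_cont[OF a]],
          intro continuous_on_Pair continuous_on_fst continuous_on_snd continuous_on_id continuous_on_compose2[OF continuous_on_nu[OF k]])
         (auto intro: nu_Mk[OF r k])
    then have "continuous_on (Tup r p \<times> XX r k \<times> M) (\<lambda>z. a (fst z) (nu r k (fst (snd z)), snd (snd z)))" by simp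
    then show "continuous_on (Tup r p \<times> XX r k \<times> M) (\<lambda>z. inflate r k a (fst z) (snd z))"
      by (rule continuous_on_eq) (auto simp: inflate_def)
  next
    show "\<bar>inflate r k a g y\<bar> \<le> B" for g y using B B0 by (simp add: inflate_def)
  next
    fix b :: "'k elt" and g :: "'k elts" and y :: "'k pairs \<times> 'm"
    assume "b \<in> GG r" "g \<in> Tup r p" "y \<in> XX r k \<times> M"
    then show "inflate r k a (lact b g) (actx b y) = inflate r k a g y"
      using Co_inv[OF a, of b g "(nu r k (fst y), snd y)"] nu_Mk[OF r k, of "fst y"] 
      by (auto simp: inflate_def actx_def apx_XX_iff[OF _ r] nu_apx[OF _ r k])
  next
    fix g :: "'k elts" and y :: "'k pairs \<times> 'm"
    assume "\<not> (g \<in> Tup r p \<and> y \<in> XX r k \<times> M)"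
    then show "inflate r k a g y = 0"
      using Co_zero[OF a, of g "(nu r k (fst y), snd y)"] by (auto simp: inflate_def mem_Times_iff)
  qed
next
  fix b :: "'k elt" and g :: "'k elts" and x :: "'k pairs" and m :: 'm
  assume "b \<in> GG r" "x \<in> XX r k"
  then show "inflate r k a g (apx b x, m) = inflate r k a g (x, m)"
    by (simp add: inflate_def apx_XX_iff[OF _ r] nu_apx[OF _ r k])
qed

lemma res_inflate: "res (r - k) (Mk r k \<times> M) p (inflate r k a) = res (r - k) (Mk r k \<times> M) p a"
  by (auto simp: res_def inflate_def Mk_def intro!: ext)

lemma res_Kk:
  fixes F :: "('k::real_normed_field, 'k pairs \<times> 'm) cochain"
  assumes F: "F \<in> Kk r k M p"
  shows "res r (Mk r k \<times> M) p F \<in> Aa r (Mk r k \<times> M) p" "inflate r k (res r (Mk r k \<times> M) p F) = F"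
proof -
  have FC: "F \<in> Cc r k M p" by (rule Kk_Cc[OF F])
  obtain B where B: "\<And>g y. \<bar>F g y\<bar> \<le> B" using Co_bdd[OF FC] by blast
  have B0: "0 \<le> B" by (rule order_trans[OF abs_ge_zero B])
  show "res r (Mk r k \<times> M) p F \<in> Aa r (Mk r k \<times> M) p"
  proof (rule CoI)
    have "continuous_on (Tup r p \<times> Mk r k \<times> M) (\<lambda>z. F (fst z) (snd z))"
      by (rule continuous_on_subset[OF Co_cont[OF FC]]) (auto simp: Mk_def)
    then show "continuous_on (Tup r p \<times> Mk r k \<times> M) (\<lambda>z. res r (Mk r k \<times> M) p F (fst z) (snd z))"
      by (rule continuous_on_eq) (auto simp: res_def)
  next
    show "\<bar>res r (Mk r k \<times> M) p F g y\<bar> \<le> B" for g y using B B0 by (simp add: res_def)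
  next
    fix b :: "'k elt" and g :: "'k elts" and y :: "'k pairs \<times> 'm"
    assume b: "b \<in> GG r" "g \<in> Tup r p" "y \<in> Mk r k \<times> M"
    then have x: "fst y \<in> XX r k" by (auto simp: Mk_def)
    have "F (lact b g) y = F (lact b g) (apx b (fst y), snd y)" using Kk_inv[OF F b(1) x, of "lact b g" "snd y"] by simp
    also have "\<dots> = F g y" using Cc_inv_all[OF FC b(1) r b(2), of "fst y" "snd y"] by simp
    finally show "res r (Mk r k \<times> M) p F (lact b g) y = res r (Mk r k \<times> M) p F g y"
      using b Tup_lact[OF b(1) r b(2)] by (simp add: res_def)
  qed (auto simp: res_def)
  show "inflate r k (res r (Mk r k \<times> M) p F) = F"
  proof (intro ext)
    fix g :: "'k elts" and y :: "'k pairs \<times> 'm"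
    show "inflate r k (res r (Mk r k \<times> M) p F) g y = F g y"
    proof (cases "g \<in> Tup r p \<and> y \<in> XX r k \<times> M")
      case True
      then show ?thesis using Kk_nu[OF r k F, of "fst y" g "snd y"] nu_Mk[OF r k, of "fst y"]
        by (auto simp: inflate_def res_def)
    next
      case False
      then show ?thesis using Co_zero[OF FC False] by (auto simp: inflate_def res_def mem_Times_iff)
    qed
  qed
qed

lemma extend_Bd:
  fixes b :: "('k::real_normed_field, 'k pairs \<times> 'm) cochain"
  assumes b: "b \<in> Bd (r - k) (\<lambda>_ y. y) (Mk r k \<times> M) p"
  shows "extend r k M p b \<in> Bd r actx (XX r k \<times> M) p"
proof (cases p)
  case 0
  then have "b = 0" using b by (simp add: Bd_def)
  then have "extend r k M p b = 0" by (simp add: extend_def[OF r k] zero_fun_def cong: if_cong)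
  then show ?thesis by (simp add: Bd_0)
next
  case (Suc q)
  then obtain f where f: "f \<in> Aa (r - k) (Mk r k \<times> M) q" "b = dd (r - k) q f" using b by (auto simp: Bd_def)
  show ?thesis unfolding Suc f(2) extend_dd[OF r k f(1)] by (rule Bd_dd[OF extend_Co(1)[OF r k f(1)]])
qed

text \<open>Restriction to the stabilizer determines the class of a cocycle in column
  \<open>k\<close>, by \<open>extend_res\<close>. Surjectivity provides a cocycle over the normal
  forms with the same restriction up to a coboundary, and its inflation lies in
  \<open>Kk\<close>.\<close>

lemma cocycle_Kk:
  fixes w :: "('k::real_normed_field, 'k pairs \<times> 'm) cochain"
  assumes S: "Surj TYPE('k) r (r - k) p (Mk r k \<times> M :: ('k pairs \<times> 'm) set)" and w: "w \<in> Cc r k M p" "dd r p w = 0"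
  shows "\<exists>\<kappa>\<in>Kk r k M p. dd r p \<kappa> = 0 \<and> w - \<kappa> \<in> Bd r actx (XX r k \<times> M) p"
proof -
  let ?Y = "Mk r k \<times> M :: ('k pairs \<times> 'm) set"
  have rk: "r - k \<le> N" "r - k \<le> r" using r by auto
  have id: "actx a y = y" if "a \<in> GG (r - k)" "y \<in> ?Y" for a y
    using Mk_fix[OF r k that(1), of "fst y"] that(2) by (auto simp: actx_def)
  have "res (r - k) ?Y p w \<in> Aa (r - k) ?Y p"
    by (rule res_Co[OF rk _ w(1)]) (use id in \<open>auto simp: Mk_def\<close>)
  moreover have "dd (r - k) p (res (r - k) ?Y p w) = 0" by (rule dd_res_0[OF rk(2) w(2)])
  ultimately obtain a where a: "a \<in> Aa r ?Y p" "dd r p a = 0" "res (r - k) ?Y p w - res (r - k) ?Y p a \<in> Bd (r - k) (\<lambda>_ y. y) ?Y p"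
    using S unfolding Surj_def by blast
  have K: "inflate r k a \<in> Kk r k M p" by (rule inflate_Kk[OF a(1)])
  have d: "dd r p (inflate r k a) = 0" by (simp add: inflate_dd a(2)) (simp add: inflate_def fun_eq_iff)
  let ?F = "w - inflate r k a"
  have "?F - extend r k M p (res (r - k) ?Y p ?F) \<in> Bd r actx (XX r k \<times> M) p"
    by (rule extend_res[OF r k Co_diff[OF w(1) Kk_Cc[OF K]]]) (simp add: dd_lin w(2) d)
  moreover have "extend r k M p (res (r - k) ?Y p ?F) \<in> Bd r actx (XX r k \<times> M) p"
    by (rule extend_Bd) (use a(3) in \<open>simp add: res_lin res_inflate\<close>)
  ultimately have "?F \<in> Bd r actx (XX r k \<times> M) p" using Bd_add by fastforce
  then show ?thesis using K d by blast
qed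

text \<open>The restriction of \<open>dd r p b\<close> to the smaller group is the coboundary of the
  restriction of \<open>b\<close>. Injectivity in degree \<open>p + 1\<close> therefore gives
  \<open>dd r p b\<close> a primitive in \<open>Kk\<close>. The difference of \<open>b\<close> and
  this primitive is a cocycle, which surjectivity in degree \<open>p\<close> moves into
  \<open>Kk\<close>.\<close>

lemma lifts_if:
  assumes S: "Surj TYPE('k::real_normed_field) r (r - k) p (Mk r k \<times> M :: ('k pairs \<times> 'm) set)" 
    and I: "Inj TYPE('k) r (r - k) (Suc p) (Mk r k \<times> M :: ('k pairs \<times> 'm) set)"
  shows "lifts TYPE('k) p r k M"
  unfolding lifts_def
proof (intro ballI impI)
  fix b :: "('k, 'k pairs \<times> 'm) cochain"
  assume b: "b \<in> Cc r k M p" "dd r p b \<in> Kk r k M (Suc p)"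
  let ?Y = "Mk r k \<times> M :: ('k pairs \<times> 'm) set"
  have rk: "r - k \<le> N" "r - k \<le> r" using r by auto
  have id: "actx a y = y" if "a \<in> GG (r - k)" "y \<in> ?Y" for a y
    using Mk_fix[OF r k that(1), of "fst y"] that(2) by (auto simp: actx_def)
  let ?a = "res r ?Y (Suc p) (dd r p b)"
  have "res (r - k) ?Y p b \<in> Aa (r - k) ?Y p"
    by (rule res_Co[OF rk _ b(1)]) (use id in \<open>auto simp: Mk_def\<close>)
  then have "res (r - k) ?Y (Suc p) ?a \<in> Bd (r - k) (\<lambda>_ y. y) ?Y (Suc p)"
    unfolding res_res[OF rk(2)] res_dd[OF rk(2), symmetric] by (rule Bd_dd)
  moreover have "dd r (Suc p) ?a = 0" by (rule dd_res_0[OF order_refl dd_dd])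
  ultimately have "?a \<in> Bd r (\<lambda>_ y. y) ?Y (Suc p)" using I res_Kk(1)[OF b(2)] unfolding Inj_def by blast
  then obtain a0 where a0: "a0 \<in> Aa r ?Y p" "?a = dd r p a0" by (auto simp: Bd_def)
  have K: "inflate r k a0 \<in> Kk r k M p" by (rule inflate_Kk[OF a0(1)])
  have "dd r p (inflate r k a0) = dd r p b" unfolding inflate_dd a0(2)[symmetric] by (rule res_Kk(2)[OF b(2)])
  then have "dd r p (b - inflate r k a0) = 0" by (simp add: dd_lin)
  then obtain \<kappa> where "\<kappa> \<in> Kk r k M p" "b - inflate r k a0 - \<kappa> \<in> Bd r actx (XX r k \<times> M) p"
    using cocycle_Kk[OF S Co_diff[OF b(1) Kk_Cc[OF K]]] by blast
  then show "\<exists>a\<in>Kk r k M p. b - a \<in> Bd r actx (XX r k \<times> M) p"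
    using K by (intro bexI[of _ "inflate r k a0 + \<kappa>"]) (auto simp: Kk_add algebra_simps)
qed

end


section \<open>Exchanging the two faces of a generic pair\<close>

text \<open>The component of \<open>y\<close> along the hyperbolic pair \<open>n\<close>, rewritten
  with the same coefficients in the pair \<open>n'\<close>.\<close>

definition recomb :: "'k::real_normed_field pair \<Rightarrow> 'k pair \<Rightarrow> (nat \<Rightarrow> 'k) \<Rightarrow> nat \<Rightarrow> 'k" where
  "recomb n n' y = (\<lambda>i. om y (snd n) * fst n' i - om y (fst n) * snd n' i)"

definition reframe :: "'k::real_normed_field pair list \<Rightarrow> 'k pair list \<Rightarrow> (nat \<Rightarrow> 'k) \<Rightarrow> nat \<Rightarrow> 'k" where
  "reframe F F' y = (\<lambda>i. prj F y i + recomb (F ! 0) (F' ! 0) y i + recomb (F ! 1) (F' ! 1) y i)"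

lemma reframe_self: "reframe [n0, n1] [n0, n1] y = y"
  by (auto simp: reframe_def recomb_def fun_eq_iff)

text \<open>The formula \<open>e\<close> for the form does not involve the target frame. Comparing
  the target \<open>[m0, m1]\<close> with the target \<open>[n0, n1]\<close>, for which
  \<open>reframe\<close> is the identity, gives the claim.\<close>

lemma om_reframe:
  assumes F: "sframe r [n0, n1]" and F': "sframe r' [m0, m1]" and p: "\<And>y. perp (prj [n0, n1] y) [m0, m1]"
  shows "om (reframe [n0, n1] [m0, m1] y) (reframe [n0, n1] [m0, m1] z) = om y z"
proof -
  define P where "P = prj [n0, n1]"
  have e: "om (reframe [n0, n1] [k0, k1] y) (reframe [n0, n1] [k0, k1] z) = om (P y) (P z)
    + (om y (fst n0) * om z (snd n0) - om y (snd n0) * om z (fst n0)) + (om y (fst n1) * om z (snd n1) - om y (snd n1) * om z (fst n1))"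
    if K: "sframe r'' [k0, k1]" and p: "\<And>y. perp (P y) [k0, k1]" for k0 k1 r'' y z
  proof -
    have c: "om (P y) (fst k0) = 0" "om (P y) (snd k0) = 0" "om (P y) (fst k1) = 0" "om (P y) (snd k1) = 0" for y
      using p[of y] by auto
    have c': "om (fst k0) (P y) = 0" "om (snd k0) (P y) = 0" "om (fst k1) (P y) = 0" "om (snd k1) (P y) = 0" for y
      using c[of y] om_zero_sym by blast+
    have k: "om (fst k0) (snd k0) = 1" "om (fst k1) (snd k1) = 1" "om (fst k0) (fst k1) = 0" "om (fst k0) (snd k1) = 0"
      "om (snd k0) (fst k1) = 0" "om (snd k0) (snd k1) = 0" using K by auto
    have k': "om (snd k0) (fst k0) = - 1" "om (snd k1) (fst k1) = - 1"
      by (simp_all only: om_anti[of "snd k0" "fst k0"] om_anti[of "snd k1" "fst k1"] k)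
    have k'': "om (fst k1) (fst k0) = 0" "om (snd k1) (fst k0) = 0" "om (fst k1) (snd k0) = 0" "om (snd k1) (snd k0) = 0"
      using k(3-6) om_zero_sym by blast+
    have "om (\<lambda>i. P y i + (om y (snd n0) * fst k0 i - om y (fst n0) * snd k0 i) + (om y (snd n1) * fst k1 i - om y (fst n1) * snd k1 i))
       (\<lambda>i. P z i + (om z (snd n0) * fst k0 i - om z (fst n0) * snd k0 i) + (om z (snd n1) * fst k1 i - om z (fst n1) * snd k1 i)) =
       om (P y) (P z) + (om y (fst n0) * om z (snd n0) - om y (snd n0) * om z (fst n0)) + (om y (fst n1) * om z (snd n1) - om y (snd n1) * om z (fst n1))"
      by (simp only: om_lin om_self c c' k k' k'', simp only: mult_zero_left mult_zero_right mult_1_left mult_1_right mult_minus_left mult_minus_right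
        minus_zero minus_minus diff_0_right diff_0 add_0_left add_0_right diff_minus_eq_add uminus_add_conv_diff)
    then show ?thesis by (simp add: reframe_def recomb_def P_def)
  qed
  have pn: "perp (P y) [n0, n1]" for y unfolding P_def by (rule perp_prj[OF F])
  have "om (reframe [n0, n1] [n0, n1] y) (reframe [n0, n1] [n0, n1] z) = om (reframe [n0, n1] [m0, m1] y) (reframe [n0, n1] [m0, m1] z)"
    unfolding e[OF F' p[folded P_def]] e[OF F pn] ..
  then show ?thesis unfolding reframe_self ..
qed

text \<open>Takes the frame of \<open>(x 0, x 1)\<close> to that of \<open>(x 1, x 0)\<close> and is the identity on their common complement.\<close>

definition switch :: "'k::real_normed_field pairs \<Rightarrow> nat \<Rightarrow> nat \<Rightarrow> 'k" where
  "switch x = (\<lambda>j. reframe (gs [x 0, x 1]) (gs [x 1, x 0]) (bas j))"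

lemma gs_single: "om (fst p) (snd p) = 1 \<Longrightarrow> gs [p] = [p]"
  by (cases p) (simp add: stp_def dsc_def)

lemma dsc_single: 
  fixes p q :: "'k::real_normed_field pair"
  assumes "om (fst p) (snd p) = 1"
  shows "dsc [p] q = om (fst q) (snd q) - om (fst q) (snd p) * om (fst p) (snd q) + om (fst q) (fst p) * om (snd p) (snd q)"
proof -
  have a: "om (snd p) (fst p) = - 1" by (subst om_anti) (simp only: assms)
  have b: "om (snd p) (snd q) = - om (snd q) (snd p)" "om (fst p) (snd q) = - om (snd q) (fst p)" by (rule om_anti)+
  have c: "om (fst p) (fst q) = - om (fst q) (fst p)" by (rule om_anti)
  have "dsc [p] q = om (\<lambda>i. fst q i - om (fst q) (snd p) * fst p i + om (fst q) (fst p) * snd p i)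
     (\<lambda>i. snd q i - om (snd q) (snd p) * fst p i + om (snd q) (fst p) * snd p i)"
    by (simp only: dsc_def prj.simps)
  also have "\<dots> = om (fst q) (snd q) + om (snd q) (fst p) * om (fst q) (snd p) - om (snd q) (snd p) * om (fst q) (fst p)"
    by (simp only: om_lin om_self assms a b c, simp only: mult_zero_left mult_zero_right mult_1_left mult_1_right mult_minus_left mult_minus_right minus_zero minus_minus diff_0_right diff_0 add_0_left add_0_right diff_self diff_add_eq left_minus)
  finally have e: "dsc [p] q = om (fst q) (snd q) + om (snd q) (fst p) * om (fst q) (snd p) - om (snd q) (snd p) * om (fst q) (fst p)" .
  show ?thesis by (simp only: e b mult_minus_right diff_minus_eq_add add_uminus_conv_diff mult.commute)
qed

text \<open>Genericity is required in increasing order only. This symmetry makes the reversed pair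
  generic as well, so that both frames in \<open>switch\<close> exist.\<close>

lemma dsc_sym: 
  assumes "om (fst p) (snd p) = 1" "om (fst q) (snd q) = 1"
  shows "dsc [p] q = dsc [q] p"
proof -
  have "om (fst q) (fst p) = - om (fst p) (fst q)" "om (snd q) (snd p) = - om (snd p) (snd q)" by (rule om_anti)+
  then show ?thesis unfolding dsc_single[OF assms(1)] dsc_single[OF assms(2)] assms by simp
qed

context
  fixes r :: nat and x :: "'k::real_normed_field pairs"
  assumes r: "r \<le> N" and x: "x \<in> XX r 2"
begin

lemma om01: "om (fst (x 0)) (snd (x 0)) = 1" "om (fst (x 1)) (snd (x 1)) = 1"
  using XX_om[OF x] by auto

lemma good01: "good [x 0, x 1]" using XX_good[OF x, of "[0, 1]"] by simp

lemma good10: "good [x 1, x 0]"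
proof -
  have "gs [x 1] = [x 1]" "gs [x 0] = [x 0]" by (rule gs_single, rule om01)+
  then show ?thesis using good01 dsc_sym[OF om01] om01(1) by (simp only: good.simps) (simp add: dsc_def)
qed

lemma fr01: "sframe r (gs [x 0, x 1])" "sframe r (gs [x 1, x 0])"
  using sframe_gs[OF good01, of r] sframe_gs[OF good10, of r] XX_inV[OF x] by auto

lemma prj01: "prj (gs [x 0, x 1]) (fst (x 0)) = (\<lambda>_. 0)" "prj (gs [x 0, x 1]) (snd (x 0)) = (\<lambda>_. 0)"
  "prj (gs [x 0, x 1]) (fst (x 1)) = (\<lambda>_. 0)" "prj (gs [x 0, x 1]) (snd (x 1)) = (\<lambda>_. 0)"
  using prj_gs[OF good01, of r] XX_inV[OF x] by (auto simp del: gs.simps)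

text \<open>The first frame spans both entries \<open>x 0\<close> and \<open>x 1\<close>, so its
  complement is orthogonal to them and hence to the frame built from them in the other
  order.\<close>

lemma perp_prj01: "perp (prj (gs [x 0, x 1]) y) (gs [x 1, x 0])"
proof (rule perp_gs)
  have "om (prj (gs [x 0, x 1]) y) z = 0" if "prj (gs [x 0, x 1]) z = (\<lambda>_. 0)" for z
    using om_prj_prj[OF fr01(1), of y z] that by simp
  then show "perp (prj (gs [x 0, x 1]) y) [x 1, x 0]" using prj01 by (simp del: gs.simps)
qed

lemma gs01: "\<exists>n0. gs [x 0, x 1] = [n0, x 1]" "\<exists>n1. gs [x 1, x 0] = [n1, x 0]"
  unfolding gs.simps(2)[of "x 0" "[x 1]"] gs.simps(2)[of "x 1" "[x 0]"] gs_single[OF om01(1)] gs_single[OF om01(2)] stp_def by simp_all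

lemma switch_GG: "switch x \<in> GG r"
proof -
  obtain n0 where n0: "gs [x 0, x 1] = [n0, x 1]" using gs01 by blast
  obtain n1 where n1: "gs [x 1, x 0] = [n1, x 0]" using gs01 by blast
  have F: "sframe r [n0, x 1]" "sframe r [n1, x 0]" using fr01 unfolding n0 n1 .
  have g: "switch x = (\<lambda>j. reframe [n0, x 1] [n1, x 0] (bas j))" unfolding switch_def n0 n1 ..
  have V: "om (bas j) v = 0" if "j \<ge> 2 * r" "v \<in> VV r" for j and v :: "nat \<Rightarrow> 'k"
    using that by (auto simp: om_bas VV_def elim!: oddE)
  have VN: "v \<in> VV N" if "v \<in> VV r" for v :: "nat \<Rightarrow> 'k" using VV_mono[OF r] that by blast
  show ?thesis unfolding g
  proof (rule GGI)
    fix j assume "j \<ge> 2 * r"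
    then show "reframe [n0, x 1] [n1, x 0] (bas j) = bas j"
      using F V[of j] by (simp add: reframe_def recomb_def del: om_bas)
  next
    fix j assume "j < 2 * N"
    then have b: "bas j \<in> VV N" by (rule bas_VV)
    have "sframe N [n0, x 1]" using F(1) VN by auto
    then have "prj [n0, x 1] (bas j) \<in> VV N" using b by (rule prj_VV)
    then show "reframe [n0, x 1] [n1, x 0] (bas j) \<in> VV N"
      using F VN unfolding reframe_def recomb_def by (intro VV_lin) auto
  next
    fix i j
    show "om (reframe [n0, x 1] [n1, x 0] (bas i)) (reframe [n0, x 1] [n1, x 0] (bas j)) = om (bas i) (bas j)"
      by (rule om_reframe[OF F]) (use perp_prj01 in \<open>simp only: n0 n1\<close>)
  qed
qed

lemma app_switch: "app (switch x) v = reframe (gs [x 0, x 1]) (gs [x 1, x 0]) v"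
proof
  fix i
  obtain n0 where n0: "gs [x 0, x 1] = [n0, x 1]" using gs01 by blast
  obtain n1 where n1: "gs [x 1, x 0] = [n1, x 0]" using gs01 by blast
  have F: "sframe r [n0, x 1]" "sframe r [n1, x 0]" using fr01 unfolding n0 n1 .
  have e: "om v w = (\<Sum>j<2*N. v j * om (bas j) w)" for w by (rule om_expand)
  show "app (switch x) v i = reframe (gs [x 0, x 1]) (gs [x 1, x 0]) v i"
  proof (cases "i < 2 * N")
    case True
    have b: "v i = (\<Sum>j<2*N. v j * bas j i)" using True by (simp add: bas_apply if_distrib cong: if_cong)
    have "reframe [n0, x 1] [n1, x 0] v i = v i + om v (snd (x 1)) * (fst (x 0) i - fst (x 1) i) + om v (fst (x 1)) * (snd (x 1) i - snd (x 0) i)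
       + om v (snd n0) * (fst n1 i - fst n0 i) + om v (fst n0) * (snd n0 i - snd n1 i)" for v
      unfolding reframe_def recomb_def by (simp add: algebra_simps del: om_bas)
    note t = this
    have "app (switch x) v i = (\<Sum>j<2*N. v j * reframe [n0, x 1] [n1, x 0] (bas j) i)" using True by (simp add: app_def switch_def n0 n1 del: gs.simps One_nat_def)
    also have "\<dots> = reframe [n0, x 1] [n1, x 0] v i"
      unfolding t e[of "fst n0"] e[of "snd n0"] e[of "fst (x 1)"] e[of "snd (x 1)"] 
      by (subst b) (simp only: sum_distrib_right sum.distrib[symmetric] distrib_left mult.assoc)
    finally show ?thesis unfolding n0 n1 .
  next
    case False
    then have "2 * r \<le> i" using r by simp
    then show ?thesis using False F unfolding n0 n1 by (simp add: app_def reframe_def recomb_def VV_def)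
  qed
qed

text \<open>The entry processed first survives Gram-Schmidt unchanged: the second member of one
  frame is \<open>x 1\<close>, that of the other is \<open>x 0\<close>. Carrying frame to frame thus
  carries one face to the other.\<close>

lemma switch_dr: "apx (switch x) (dr 0 x) = dr 1 x"
proof
  fix j
  obtain n0 where n0: "gs [x 0, x 1] = [n0, x 1]" using gs01 by blast
  obtain n1 where n1: "gs [x 1, x 0] = [n1, x 0]" using gs01 by blast
  have F: "sframe r [n0, x 1]" using fr01(1) unfolding n0 .
  have s: "om (snd (x 1)) (fst (x 1)) = - 1" by (subst om_anti) (simp only: om01)
  have p: "om (fst (x 1)) (fst n0) = 0" "om (fst (x 1)) (snd n0) = 0" "om (snd (x 1)) (fst n0) = 0" "om (snd (x 1)) (snd n0) = 0"
    using F om_zero_sym[of _ "fst n0"] om_zero_sym[of _ "snd n0"] by auto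
  have "ap (switch x) (x 1) = x 0" unfolding ap_def app_switch
    using prj01 unfolding n0 n1 by (simp add: reframe_def recomb_def p[simplified] s[simplified] om01[simplified])
  then show "apx (switch x) (dr 0 x) j = dr 1 x j"
    using XX_tail[OF x] by (cases j) (auto simp: apx_apply dr_def)
qed

end

lemma switch_apx:
  assumes r: "r \<le> N" and x: "x \<in> XX r 2" and a: "a \<in> GG r"
  shows "mul (switch (apx a x)) a = mul a (switch x)"
proof
  fix j
  have g: "gs [apx a x 0, apx a x 1] = map (ap a) (gs [x 0, x 1])" "gs [apx a x 1, apx a x 0] = map (ap a) (gs [x 1, x 0])"
    using gs_ap[OF a r, of "[x 0, x 1]"] gs_ap[OF a r, of "[x 1, x 0]"] by (simp_all add: apx_apply del: gs.simps)
  have t: "reframe (map (ap a) [n0, x 1]) (map (ap a) [n1, x 0]) (app a v) = app a (reframe [n0, x 1] [n1, x 0] v)" for n0 n1 v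
    unfolding reframe_def prj_ap[OF a r] by (simp add: recomb_def om_ap[OF a r] del: prj.simps)
  have "mul (switch (apx a x)) a j = app (switch (apx a x)) (app a (bas j))"
    by (simp add: mul_apply GG_app_bas[OF a r])
  also have "\<dots> = app a (reframe (gs [x 0, x 1]) (gs [x 1, x 0]) (bas j))"
    unfolding app_switch[OF r apx_XX[OF a r x]] g using gs01[OF r x] t by auto
  finally show "mul (switch (apx a x)) a j = mul a (switch x) j" by (simp add: mul_apply switch_def)
qed

lemma tendsto_switch:
  fixes xs :: "'s \<Rightarrow> nat \<Rightarrow> 'k::real_normed_field pair"
  assumes r: "r \<le> N" and xs: "(xs \<longlongrightarrow> x) A" and x: "x \<in> XX r 2"
  shows "((\<lambda>s. switch (xs s)) \<longlongrightarrow> switch x) A"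
proof -
  have c: "((\<lambda>s. xs s j) \<longlongrightarrow> x j) A" for j using xs by (simp add: tendsto_fun_iff[where f=xs])
  have l: "ltends (\<lambda>s. gs [xs s 0, xs s 1]) (gs [x 0, x 1]) A" "ltends (\<lambda>s. gs [xs s 1, xs s 0]) (gs [x 1, x 0]) A"
    by (intro ltends_gs ltends_Cons ltends_Nil c good01[OF r x] good10[OF r x])+
  have n: "((\<lambda>s. gs [xs s 0, xs s 1] ! i) \<longlongrightarrow> gs [x 0, x 1] ! i) A" "((\<lambda>s. gs [xs s 1, xs s 0] ! i) \<longlongrightarrow> gs [x 1, x 0] ! i) A" if "i < 2" for i
    using l that unfolding ltends_def by (simp_all del: gs.simps)
  have sw: "((\<lambda>s. recomb (u s) (w s) y) \<longlongrightarrow> recomb u0 w0 y) A"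
    if u: "(u \<longlongrightarrow> u0) A" "(w \<longlongrightarrow> w0) A" for u w u0 w0 and y :: "nat \<Rightarrow> 'k"
  proof -
    have w: "((\<lambda>s. fst (w s) i) \<longlongrightarrow> fst w0 i) A" "((\<lambda>s. snd (w s) i) \<longlongrightarrow> snd w0 i) A" for i
      using tendsto_fst[OF u(2)] tendsto_snd[OF u(2)] by (simp_all add: tendsto_fun_iff[where f="\<lambda>s. fst (w s)"] tendsto_fun_iff[where f="\<lambda>s. snd (w s)"])
    show ?thesis unfolding tendsto_fun_iff recomb_def
      by (intro allI tendsto_intros w tendsto_fst[OF u(1)] tendsto_snd[OF u(1)])
  qed
  have P: "((\<lambda>s. prj (gs [xs s 0, xs s 1]) y i) \<longlongrightarrow> prj (gs [x 0, x 1]) y i) A" for y i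
    using tendsto_prj[OF l(1) tendsto_const, of y] by (simp only: tendsto_fun_iff[where f="\<lambda>s. prj (gs [xs s 0, xs s 1]) y"])
  have S: "((\<lambda>s. recomb (gs [xs s 0, xs s 1] ! k) (gs [xs s 1, xs s 0] ! k) y i) \<longlongrightarrow> recomb (gs [x 0, x 1] ! k) (gs [x 1, x 0] ! k) y i) A"
    if "k < 2" for k y i
    using sw[OF n(1)[OF that] n(2)[OF that], of y] by (simp only: tendsto_fun_iff[where f="\<lambda>s. recomb (gs [xs s 0, xs s 1] ! k) (gs [xs s 1, xs s 0] ! k) y"])
  show ?thesis unfolding tendsto_fun_iff switch_def reframe_def
    by (intro allI tendsto_add P S) simp_all
qed

lemma dd_face: "dd r p (\<lambda>g z. if fst z \<in> X then F g (h (fst z), snd z) else 0) = (\<lambda>g z. if fst z \<in> X then dd r p F g (h (fst z), snd z) else 0)"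
  by (auto simp: dd_def fun_eq_iff)

text \<open>Left multiplication of all entries by \<open>switch\<close> is an equivariant self-map,
  constant in the averaging parameter, and pulls \<open>c1\<close>, which sees the face
  \<open>dr 1\<close>, back to \<open>c\<close> on the face \<open>dr 0\<close>. Being homotopic to
  the identity it makes the difference of the two a coboundary.\<close>

lemma dl_cocycle_Bd:
  fixes c :: "('k::real_normed_field, 'k pairs \<times> 'm::metric_space) cochain"
  assumes r: "r \<le> N" and c: "c \<in> Cc r 1 M p" "dd r p c = 0"
  shows "dl r 1 c \<in> Bd r actx (XX r 2 \<times> M) p"
proof -
  define \<Theta> :: "real \<Rightarrow> 'k elt \<Rightarrow> 'k pairs \<times> 'm \<Rightarrow> nat \<Rightarrow> nat \<Rightarrow> 'k"
    where "\<Theta> = (\<lambda>t g z. mul (switch (fst z)) g)"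
  define c1 where "c1 = (\<lambda>g z. if fst z \<in> XX r (Suc 1) then c g (dr 1 (fst z), snd z) else 0)"
  have two: "Suc 1 = 2" by simp
  have c1: "c1 \<in> Cc r 2 M p" unfolding c1_def two[symmetric] by (rule face_Cc[OF r c(1) order_refl])
  have dc1: "dd r p c1 = 0" unfolding c1_def dd_face c(2) by (simp add: fun_eq_iff)
  have TG: "\<Theta> t g z \<in> GG r" if "g \<in> GG r" "z \<in> XX r 2 \<times> M" for t g z
    unfolding \<Theta>_def using that by (intro mul_GG switch_GG r) auto
  have TE: "\<Theta> t (mul a g) (actx a z) = mul a (\<Theta> t g z)" if a: "a \<in> GG r" and z: "z \<in> XX r 2 \<times> M" for t a g z
  proof -
    have "fst z \<in> XX r 2" using z by auto
    then show ?thesis unfolding \<Theta>_def using switch_apx[OF r _ a] by (simp add: actx_def mul_assoc[symmetric])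
  qed
  have TR: "ract (\<lambda>t z. \<Theta> t (fst z) (snd z)) (GG r \<times> (XX r 2 \<times> M))"
    unfolding ract_def cont_pt_def
  proof (intro ballI exI[of _ "{}"] conjI allI impI)
    fix y :: "'k elt \<times> 'k pairs \<times> 'm" and ys :: "nat \<Rightarrow> _"
    assume y: "y \<in> GG r \<times> XX r 2 \<times> M" and ys: "ys \<longlonglongrightarrow> y"
    have "fst (snd y) \<in> XX r 2" using y by auto
    then show "(\<lambda>n. \<Theta> (ts n) (fst (ys n)) (snd (ys n))) \<longlonglongrightarrow> \<Theta> t (fst y) (snd y)" for ts t
      unfolding \<Theta>_def by (intro tendsto_mul tendsto_switch[OF r] tendsto_fst tendsto_snd ys)
  qed simp
  have "c1 - avg_map r (XX r 2 \<times> M) \<Theta> p c1 \<in> Bd r actx (XX r 2 \<times> M) p"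
    by (rule avg_map_homotopic[OF r _ _ _ TR c1 dc1]) (rule actx_in[OF r], assumption+, rule TG, assumption+, rule TE, assumption+)
  moreover have "dl r 1 c = - (c1 - avg_map r (XX r 2 \<times> M) \<Theta> p c1)"
  proof (intro ext)
    fix g :: "'k elts" and z :: "'k pairs \<times> 'm"
    have "avg_map r (XX r 2 \<times> M) \<Theta> p c1 g z = (if fst z \<in> XX r 2 then c g (dr 0 (fst z), snd z) else 0)"
    proof (cases "g \<in> Tup r p \<and> z \<in> XX r 2 \<times> M")
      case True
      then have x: "fst z \<in> XX r 2" by auto
      have "g j = (\<lambda>_ _. 0)" if "\<not> j \<le> p" for j using Tup_tail[of g r p] True that by simp
      then have T: "map_tup \<Theta> p t g z = lact (switch (fst z)) g" for t
        by (intro ext) (simp add: map_tup_def lact_def \<Theta>_def)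
      have "c1 (lact (switch (fst z)) g) z = c (lact (switch (fst z)) g) (apx (switch (fst z)) (dr 0 (fst z)), snd z)"
        using x by (simp add: c1_def switch_dr[OF r x] two del: One_nat_def)
      also have "\<dots> = c g (dr 0 (fst z), snd z)"
        using True by (intro Cc_inv_all[OF c(1) switch_GG[OF r x] r]) simp
      finally show ?thesis using True x by (simp add: avg_map_def T)
    next
      case False
      then have "fst z \<in> XX r 2 \<Longrightarrow> c g (dr 0 (fst z), snd z) = 0" by (intro Co_zero[OF c(1)]) (auto simp: mem_Times_iff)
      then show ?thesis using False by (auto simp: avg_map_def)
    qed
    then show "dl r 1 c g z = (- (c1 - avg_map r (XX r 2 \<times> M) \<Theta> p c1)) g z"
      by (simp add: dl_def c1_def numeral_2_eq_2)
  qed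
  ultimately show ?thesis using Bd_uminus by metis
qed


section \<open>One step of stability, by evaluation at a single normal form\<close>

lemma Kk_eval:
  fixes \<kappa> :: "('k::real_normed_field, 'k pairs \<times> 'm::metric_space) cochain"
  assumes r: "r \<le> N" and K: "\<kappa> \<in> Kk r k M p" and x: "x \<in> XX r k"
  shows "(\<lambda>g m. \<kappa> g (x, m)) \<in> Aa r M p"
proof -
  have C: "\<kappa> \<in> Cc r k M p" by (rule Kk_Cc[OF K])
  obtain B where B: "\<And>g y. \<bar>\<kappa> g y\<bar> \<le> B" using Co_bdd[OF C] by blast
  show ?thesis
  proof (rule CoI)
    have "continuous_on (Tup r p \<times> M) (\<lambda>z. (\<lambda>z. \<kappa> (fst z) (snd z)) (fst z, (x, snd z)))"
      by (rule continuous_on_compose2[OF Co_cont[OF C]]) (intro continuous_on_Pair continuous_on_fst continuous_on_const continuous_on_snd continuous_on_id, use x in auto)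
    then show "continuous_on (Tup r p \<times> M) (\<lambda>z. \<kappa> (fst z) (x, snd z))" by simp
    show "\<bar>\<kappa> g (x, m)\<bar> \<le> B" for g m by (rule B)
  next
    fix a :: "'k elt" and g :: "'k elts" and m
    assume a: "a \<in> GG r" "g \<in> Tup r p" "m \<in> M"
    show "\<kappa> (lact a g) (x, m) = \<kappa> g (x, m)"
      using Kk_inv[OF K a(1) x, of "lact a g" m] Cc_inv_all[OF C a(1) r a(2), of x m] by simp
  next
    fix g :: "'k elts" and m assume "\<not> (g \<in> Tup r p \<and> m \<in> M)"
    then show "\<kappa> g (x, m) = 0" by (intro Co_zero[OF C]) auto
  qed
qed

lemma dd_eval: "dd r p (\<lambda>g m. \<kappa> g (x, m)) = (\<lambda>g m. dd r p \<kappa> g (x, m))"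
  by (simp add: dd_def)

lemma Mk_1_nonempty:
  assumes "0 < r" "r \<le> N"
  shows "\<exists>x. x \<in> (Mk r 1 :: 'k::real_normed_field pairs set)"
proof -
  have z: "(\<lambda>_. (\<lambda>_. 0, \<lambda>_. 0)) \<in> (XX r 0 :: 'k pairs set)"
    by (rule XXI) auto
  have "case_nat (stdp (r - Suc 0)) (nu r 0 (\<lambda>_. (\<lambda>_. 0, \<lambda>_. 0))) \<in> (XX r (Suc 0) :: 'k pairs set)"
    by (rule XX_orthx[OF Mk_XX[OF nu_Mk[OF assms(2) _ z]]]) (use stdp_orthx[OF assms(2), of 0 0] assms in auto)
  then show ?thesis using nu_Mk[OF assms(2), of 1] assms(1) by force
qed

lemma pull_snd:
  fixes b :: "('k::real_normed_field, 'm::metric_space) cochain" and X :: "'x::metric_space set"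
  assumes r: "r \<le> N" and b: "b \<in> Aa r M p"
  shows "res r (X \<times> M) p (\<lambda>g y. b g (snd y)) \<in> Aa r (X \<times> M) p"
proof (rule res_Co[OF r order_refl])
  show "(\<lambda>g y. b g (snd y)) \<in> Aa r ((UNIV :: 'x set) \<times> M) p" 
    by (rule pull_Aa[OF _ _ b]) (auto intro: continuous_intros)
qed auto

lemma pull_snd_Bd:
  fixes b :: "('k::real_normed_field, 'm::metric_space) cochain" and X :: "'x::metric_space set"
  assumes r: "r \<le> N" and b: "b \<in> Bd r (\<lambda>_ y. y) M p"
  shows "res r (X \<times> M) p (\<lambda>g y. b g (snd y)) \<in> Bd r (\<lambda>_ y. y) (X \<times> M) p"
proof (rule res_Bd[OF r order_refl])
  show "(\<lambda>g y. b g (snd y)) \<in> Bd r (\<lambda>_ y. y) ((UNIV :: 'x set) \<times> M) p" 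
    by (rule pull_Bd[OF continuous_on_snd[OF continuous_on_id] _ b]) auto
qed auto

lemma extend_0: "r \<le> N \<Longrightarrow> k \<le> r \<Longrightarrow> extend r k M p 0 = (0 :: 'k::real_normed_field elts \<Rightarrow> 'k pairs \<times> 'm::metric_space \<Rightarrow> real)"
  by (simp add: extend_def zero_fun_def cong: if_cong)

context
  fixes r p :: nat and M :: "'m::metric_space set" and ty :: "'k::real_normed_field itself"
  assumes r: "r \<le> N" and rp: "p + 2 < r"
    and Q: "\<And>s k. s < p \<Longrightarrow> k + s \<le> p + 2 \<Longrightarrow> lifts TYPE('k) s r k M"
begin

text \<open>A cocycle of the smaller group is extended to column one. Its horizontal coboundary is a
  vertical coboundary by the exchange of faces, so the zigzag with right-hand side \<open>0\<close>
  moves it into \<open>Kk\<close>. There it does not depend on the tuple within an orbit and can be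
  evaluated to a cocycle of \<open>GG r\<close>.\<close>

lemma surj_step: "Surj TYPE('k) r (r - 1) p M"
  unfolding Surj_def
proof (intro ballI impI)
  fix b :: "('k, 'm) cochain"
  assume b: "b \<in> Aa (r - 1) M p" "dd (r - 1) p b = 0"
  have r1: "1 \<le> r" "0 < r" "r - 1 \<le> N" "r - 1 \<le> r" using r rp by auto
  let ?X = "Mk r 1 :: 'k pairs set"
  define b' where "b' = res (r - 1) (?X \<times> M) p (\<lambda>g y. b g (snd y))"
  have b': "b' \<in> Aa (r - 1) (?X \<times> M) p" unfolding b'_def by (rule pull_snd[OF r1(3) b(1)])
  have db': "dd (r - 1) p b' = 0" unfolding b'_def
    by (rule dd_res_0[OF order_refl], simp only: dd_pull b(2)) (simp add: fun_eq_iff)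
  define c where "c = extend r 1 M p b'"
  have c: "c \<in> Cc r 1 M p" unfolding c_def by (rule extend_Co(1)[OF r r1(1) b'])
  have dc: "dd r p c = 0" unfolding c_def by (simp only: extend_dd[OF r r1(1) b', symmetric] db' extend_0[OF r r1(1)])
  have "dl r 1 c \<in> Bd r actx (XX r 2 \<times> M) p" by (rule dl_cocycle_Bd[OF r c dc])
  then have "dl r (Suc 0) c - 0 \<in> Bd r actx (XX r (Suc (Suc 0)) \<times> M) p" by (simp add: numeral_2_eq_2)
  moreover have "0 \<in> Kk r (Suc (Suc 0)) M p" by (rule Kk_0)
  moreover have "c \<in> Cc r (Suc 0) M p" using c by simp
  ultimately obtain u \<beta> where u: "u \<in> Kk r (Suc 0) M p" "\<beta> \<in> Cc r 0 M p" "c - u - dl r 0 \<beta> \<in> Bd r actx (XX r (Suc 0) \<times> M) p"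
    using zigzag_atD[OF zigzag[OF r], of p 0 M c 0] Q rp by auto
  define \<kappa> where "\<kappa> = u + dl r 0 \<beta>"
  have \<kappa>: "\<kappa> \<in> Kk r 1 M p" unfolding \<kappa>_def using u(1) dl_Kk[OF r Cc_0_Kk[OF u(2)]] by (simp add: Kk_add)
  have B: "c - \<kappa> \<in> Bd r actx (XX r 1 \<times> M) p" using u(3) by (simp add: \<kappa>_def algebra_simps)
  have d\<kappa>: "dd r p \<kappa> = 0" using Bd_closed[OF r B] dc by (simp add: dd_lin)
  \<comment> \<open>\<open>b'\<close> is constant along the normal forms, so evaluation at any one
    of them recovers \<open>b\<close>.\<close>
  obtain x where x: "x \<in> ?X" using Mk_1_nonempty[OF r1(2) r] by blast
  define a where "a = (\<lambda>g m. \<kappa> g (x, m))"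
  have a: "a \<in> Aa r M p" unfolding a_def by (rule Kk_eval[OF r \<kappa> Mk_XX[OF x]])
  have da: "dd r p a = 0" unfolding a_def dd_eval d\<kappa> by (simp add: fun_eq_iff)
  have id: "actx a y = y" if "a \<in> GG (r - 1)" "y \<in> ?X \<times> M" for a y
    using Mk_fix[OF r r1(1) that(1), of "fst y"] that(2) by (auto simp: actx_def)
  have "b' - res (r - 1) (?X \<times> M) p c \<in> Bd (r - 1) (\<lambda>_ y. y) (?X \<times> M) p"
    unfolding c_def by (rule res_extend[OF r r1(1) b' db'])
  moreover have "res (r - 1) (?X \<times> M) p (c - \<kappa>) \<in> Bd (r - 1) (\<lambda>_ y. y) (?X \<times> M) p"
    by (rule res_Bd[OF r1(3,4) _ B]) (use id in \<open>auto simp: Mk_def\<close>)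
  ultimately have "(b' - res (r - 1) (?X \<times> M) p c) + res (r - 1) (?X \<times> M) p (c - \<kappa>) \<in> Bd (r - 1) (\<lambda>_ y. y) (?X \<times> M) p"
    by (rule Bd_add)
  then have "b' - res (r - 1) (?X \<times> M) p \<kappa> \<in> Bd (r - 1) (\<lambda>_ y. y) (?X \<times> M) p" by (simp add: res_lin)
  then have "(\<lambda>g m. (b' - res (r - 1) (?X \<times> M) p \<kappa>) g (x, m)) \<in> Bd (r - 1) (\<lambda>_ y. y) M p"
    by (rule pull_Bd[rotated 2]) (use x in \<open>auto intro: continuous_intros\<close>)
  moreover have "(\<lambda>g m. (b' - res (r - 1) (?X \<times> M) p \<kappa>) g (x, m)) = b - res (r - 1) M p a"
    using x Co_zero[OF b(1)] by (auto simp: fun_eq_iff b'_def res_def a_def)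
  ultimately show "\<exists>a\<in>Aa r M p. dd r p a = 0 \<and> b - res (r - 1) M p a \<in> Bd (r - 1) (\<lambda>_ y. y) M p"
    using a da by auto
qed

text \<open>The given cocycle, viewed as constant along column one, restricts to a coboundary and so
  has a primitive \<open>F\<close> there. \<open>F\<close> need not be constant along the tuples;
  its horizontal coboundary is a cocycle in column two, which the assumed surjectivity moves into
  \<open>Kk\<close>, and the zigzag then corrects \<open>F\<close>.\<close>

lemma inj_step:
  assumes S: "Surj TYPE('k) r (r - 2) p (Mk r 2 \<times> M :: ('k pairs \<times> 'm) set)"
  shows "Inj TYPE('k) r (r - 1) (Suc p) M"
  unfolding Inj_def
proof (intro ballI impI)
  fix a :: "('k, 'm) cochain"
  assume a: "a \<in> Aa r M (Suc p)" "dd r (Suc p) a = 0" "res (r - 1) M (Suc p) a \<in> Bd (r - 1) (\<lambda>_ y. y) M (Suc p)"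
  have r1: "1 \<le> r" "0 < r" "r - 1 \<le> N" "r - 1 \<le> r" "2 \<le> r" using r rp by auto
  let ?X = "Mk r 1 :: 'k pairs set"
  define a' where "a' = res r (?X \<times> M) (Suc p) (\<lambda>g y. a g (snd y))"
  have a': "a' \<in> Aa r (?X \<times> M) (Suc p)" unfolding a'_def by (rule pull_snd[OF r a(1)])
  have da': "dd r (Suc p) a' = 0" unfolding a'_def
    by (rule dd_res_0[OF order_refl], simp only: dd_pull a(2)) (simp add: fun_eq_iff)
  define c where "c = inflate r 1 a'"
  have c: "c \<in> Cc r 1 M (Suc p)" unfolding c_def by (rule Kk_Cc[OF inflate_Kk[OF r r1(1) a']])
  have dc: "dd r (Suc p) c = 0" unfolding c_def inflate_dd da' by (simp add: inflate_def fun_eq_iff)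
  have ca: "c g (x, m) = a g m" if "x \<in> XX r 1" for g x m
    using that nu_Mk[OF r r1(1) that] Co_zero[OF a(1)] by (auto simp: c_def inflate_def a'_def res_def)
  have dlc: "dl r 1 c = 0"
  proof (intro ext)
    fix g :: "'k elts" and z :: "'k pairs \<times> 'm"
    show "dl r 1 c g z = 0 g z"
    proof (cases "fst z \<in> XX r (Suc 1)")
      case True
      then have "dr j (fst z) \<in> XX r 1" if "j \<le> 1" for j using that by (intro XX_dr) auto
      then have "c g (dr 0 (fst z), snd z) = a g (snd z)" "c g (dr 1 (fst z), snd z) = a g (snd z)" by (auto intro!: ca)
      then show ?thesis by (simp add: dl_def)
    qed (simp add: dl_def)
  qed
  have "res (r - 1) (?X \<times> M) (Suc p) c = res (r - 1) (?X \<times> M) (Suc p) (\<lambda>g y. res (r - 1) M (Suc p) a g (snd y))"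
    by (auto simp: res_def fun_eq_iff intro!: ca Mk_XX)
  also have "\<dots> \<in> Bd (r - 1) (\<lambda>_ y. y) (?X \<times> M) (Suc p)" by (rule pull_snd_Bd[OF r1(3) a(3)])
  finally have "extend r 1 M (Suc p) (res (r - 1) (?X \<times> M) (Suc p) c) \<in> Bd r actx (XX r 1 \<times> M) (Suc p)"
    by (rule extend_Bd[OF r r1(1)])
  then have "(c - extend r 1 M (Suc p) (res (r - 1) (?X \<times> M) (Suc p) c)) + extend r 1 M (Suc p) (res (r - 1) (?X \<times> M) (Suc p) c) \<in> Bd r actx (XX r 1 \<times> M) (Suc p)"
    by (intro Bd_add extend_res[OF r r1(1) c dc])
  then obtain F where F: "F \<in> Cc r 1 M p" "c = dd r p F" by (auto simp: Bd_def)
  have "dd r p (dl r 1 F) = 0" by (simp only: dd_dl F(2)[symmetric] dlc)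
  moreover have "dl r 1 F \<in> Cc r 2 M p" using dl_Cc[OF r F(1)] by (simp add: numeral_2_eq_2)
  ultimately obtain \<kappa> where \<kappa>: "\<kappa> \<in> Kk r 2 M p" "dl r 1 F - \<kappa> \<in> Bd r actx (XX r 2 \<times> M) p"
    using cocycle_Kk[OF r r1(5) S, of "dl r 1 F"] by blast
  obtain u \<beta> where u: "u \<in> Kk r (Suc 0) M p" "\<beta> \<in> Cc r 0 M p" "F - u - dl r 0 \<beta> \<in> Bd r actx (XX r (Suc 0) \<times> M) p"
    using zigzag_atD[OF zigzag[OF r], of p 0 M F \<kappa>] Q rp F(1) \<kappa> by (auto simp: numeral_2_eq_2)
  have "dd r p (F - u - dl r 0 \<beta>) = 0" by (rule Bd_closed[OF r u(3)])
  then have e: "c = dd r p u + dl r 0 (dd r p \<beta>)" by (simp add: dd_lin F(2) dd_dl algebra_simps)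
  obtain x where x: "x \<in> ?X" using Mk_1_nonempty[OF r1(2) r] by blast
  have x': "x \<in> XX r (Suc 0)" "dr 0 x \<in> XX r 0" using Mk_XX[OF x] XX_dr[of x r 0 0] by auto
  \<comment> \<open>Both summands come from separately invariant cochains, \<open>u\<close> in
    column one and \<open>\<beta>\<close> in column zero, so they can be evaluated at
    \<open>x\<close> and at its face.\<close>
  define h where "h = (\<lambda>g m. u g (x, m)) + (\<lambda>g m. \<beta> g (dr 0 x, m))"
  have h: "h \<in> Aa r M p" unfolding h_def
    by (intro Co_add Kk_eval[OF r u(1) x'(1)] Kk_eval[OF r Cc_0_Kk[OF u(2)] x'(2)])
  have "a = dd r p h"
  proof (intro ext)
    fix g m
    have "a g m = c g (x, m)" using ca[of x g m] x'(1) by simp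
    also have "\<dots> = dd r p u g (x, m) + dd r p \<beta> g (dr 0 x, m)" using x'(1) by (simp add: e dl_def)
    also have "\<dots> = dd r p h g m" unfolding h_def dd_lin dd_eval by simp
    finally show "a g m = dd r p h g m" .
  qed
  then show "a \<in> Bd r (\<lambda>_ y. y) M (Suc p)" using Bd_dd[OF h] by simp
qed

end


section \<open>Induction on the degree\<close>

text \<open>Injectivity in degree \<open>p + 1\<close> at rank \<open>r\<close> uses surjectivity in
  degree \<open>p\<close> also at rank \<open>r - 1\<close>, over a larger parameter space; hence
  the strict inequality in the second part.\<close>

definition stable_at :: "'k::real_normed_field itself \<Rightarrow> nat \<Rightarrow> bool" where
  "stable_at ty p \<longleftrightarrow> (\<forall>r (Y :: (nat \<Rightarrow> 'k pairs) set). r \<le> N \<longrightarrow>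
     ((p + 4)^2 \<le> r \<longrightarrow> Surj TYPE('k) r (r - 1) p Y) \<and> ((p + 4)^2 < r \<longrightarrow> Inj TYPE('k) r (r - 1) (Suc p) Y))"

lemma stable_atD:
  fixes Y :: "(nat \<Rightarrow> 'k::real_normed_field pairs) set"
  assumes "stable_at TYPE('k) p" "r \<le> N"
  shows "(p + 4)^2 \<le> r \<Longrightarrow> Surj TYPE('k) r (r - 1) p Y" "(p + 4)^2 < r \<Longrightarrow> Inj TYPE('k) r (r - 1) (Suc p) Y"
  using assms unfolding stable_at_def by auto

text \<open>The induction hypothesis speaks about parameter spaces of one type only. The parameter spaces \<open>Mk r k \<times> Y\<close> of the
  induction step are coded into that type.\<close>

lemma coded_homeo:
  fixes X :: "'k::real_normed_field pairs set" 
    and Y :: "(nat \<Rightarrow> 'k pairs) set"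
  shows "(\<And>Z :: (nat \<Rightarrow> 'k pairs) set. Surj TYPE('k) r r' p Z) \<Longrightarrow> Surj TYPE('k) r r' p (X \<times> Y)"
    and "(\<And>Z :: (nat \<Rightarrow> 'k pairs) set. Inj TYPE('k) r r' p Z) \<Longrightarrow> Inj TYPE('k) r r' p (X \<times> Y)"
proof -
  let ?e = "\<lambda>z :: 'k pairs \<times> (nat \<Rightarrow> 'k pairs). case_nat (fst z) (snd z)"
  let ?d = "\<lambda>w :: nat \<Rightarrow> nat \<Rightarrow> 'k pair. (w 0, \<lambda>n. w (Suc n))"
  have e: "continuous_on UNIV ?e" unfolding continuous_on_def
    by (intro ballI tendsto_case_nat tendsto_fst tendsto_snd tendsto_ident_at)
  have d: "continuous_on UNIV ?d"
    by (intro continuous_on_Pair continuous_on_coordinatewise_then_product continuous_on_product_coordinates)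
  have de: "?d (?e z) = z" for z by simp
  have ed: "?e (?d w) = w" for w by (auto simp: fun_eq_iff split: nat.split)
  show "(\<And>Z :: (nat \<Rightarrow> 'k pairs) set. Surj TYPE('k) r r' p Z) \<Longrightarrow> Surj TYPE('k) r r' p (X \<times> Y)"
    by (rule Surj_transport[where e="?e" and d="?d", OF e d de ed refl])
  show "(\<And>Z :: (nat \<Rightarrow> 'k pairs) set. Inj TYPE('k) r r' p Z) \<Longrightarrow> Inj TYPE('k) r r' p (X \<times> Y)"
    by (rule Inj_transport[where e="?e" and d="?d", OF e d de ed refl])
qed

text \<open>In column \<open>k\<close> the induction hypothesis in degree \<open>s\<close> is
  applied at all ranks from \<open>r\<close> down to \<open>r - k + 1\<close>, so these ranks have
  to stay above the threshold for \<open>s\<close>.\<close>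

lemma square_gap: "s < p \<Longrightarrow> k + s \<le> p + 2 \<Longrightarrow> (p + 4)^2 \<le> (r::nat) \<Longrightarrow> (s + 4)^2 + k < r"
proof -
  assume a: "s < p" "k + s \<le> p + 2" "(p + 4)^2 \<le> r"
  have "(s + 5)^2 \<le> (p + 4)^2" by (rule power_mono) (use a in auto)
  moreover have "(s + 5)^2 = (s + 4)^2 + 2 * s + 9" by (simp add: power2_eq_square algebra_simps)
  moreover have "(p + 4) * (p + 4) \<ge> (p + 4) * (s + 5)" by (rule mult_le_mono2) (use a in simp)
  moreover have "(p + 4) * (s + 5) = (p + 4) * (s + 4) + (p + 4)" by (simp add: algebra_simps)
  moreover have "(s + 4) * (s + 4) \<le> (p + 4) * (s + 4)" by (rule mult_le_mono1) (use a in simp)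
  ultimately show ?thesis using a by (simp only: power2_eq_square)
qed

lemma stable: "stable_at TYPE('k::real_normed_field) p"
proof (induct p rule: less_induct)
  case (less p)
  have Q: "lifts TYPE('k) s r k Y" if r: "r \<le> N" "(p + 4)^2 \<le> r" and s: "s < p" "k + s \<le> p + 2"
    for s r k and Y :: "(nat \<Rightarrow> 'k pairs) set"
  proof (rule lifts_if[OF r(1)])
    have g: "(s + 4)^2 + k < r" by (rule square_gap[OF s r(2)])
    then show k: "k \<le> r" by simp
    show "Surj TYPE('k) r (r - k) s (Mk r k \<times> Y :: ('k pairs \<times> _) set)"
      by (rule coded_homeo(1), rule Surj_chain[OF r(1) k], rule stable_atD(1)[OF less[OF s(1)]]) (use r(1) g in auto)
    show "Inj TYPE('k) r (r - k) (Suc s) (Mk r k \<times> Y :: ('k pairs \<times> _) set)"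
      by (rule coded_homeo(2), rule Inj_chain[OF r(1) k], rule stable_atD(2)[OF less[OF s(1)]]) (use r(1) g in auto)
  qed
  have gp: "p + 2 < r" if "(p + 4)^2 \<le> r" for r
  proof -
    have "p + 4 \<le> (p + 4)^2" by (simp add: power2_eq_square)
    then show ?thesis using that by linarith
  qed
  have S: "Surj TYPE('k) r (r - 1) p Y" if r: "r \<le> N" "(p + 4)^2 \<le> r" 
    for r and Y :: "(nat \<Rightarrow> 'k pairs) set"
    by (rule surj_step[OF r(1) gp[OF r(2)] Q[OF r]])
  have I: "Inj TYPE('k) r (r - 1) (Suc p) Y" if r: "r \<le> N" "(p + 4)^2 < r" 
    for r and Y :: "(nat \<Rightarrow> 'k pairs) set"
  proof (rule inj_step[OF r(1)])
    have r': "(p + 4)^2 \<le> r" using r(2) by simp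
    show "p + 2 < r" by (rule gp[OF r'])
    show "lifts TYPE('k) s r k Y" if "s < p" "k + s \<le> p + 2" for s k by (rule Q[OF r(1) r' that])
    \<comment> \<open>Two restriction steps, from \<open>r\<close> and from \<open>r - 1\<close>,
      both in the degree \<open>p\<close> just treated; the new factor \<open>Mk r 2\<close> is
      harmless because the parameter space is arbitrary.\<close>
    show "Surj TYPE('k) r (r - 2) p (Mk r 2 \<times> Y :: ('k pairs \<times> _) set)"
      by (rule coded_homeo(1), rule Surj_chain[OF r(1)], use gp[OF r'] in simp, rule S) (use r in auto)
  qed
  show ?case unfolding stable_at_def using S I by blast
qed

text \<open>The main induction gives injectivity in positive degrees only. In degree zero a cocycle
  is constant in the group variable, so its value can be read off at the identity, which lies in the
  smaller group.\<close>

lemma Inj_0: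
  fixes Y :: "'y::metric_space set"
  assumes r: "r' \<le> r" "r \<le> N"
  shows "Inj TYPE('k::real_normed_field) r r' 0 Y"
  unfolding Inj_def
proof (intro ballI impI)
  fix a :: "('k, 'y) cochain"
  assume a: "a \<in> Aa r Y 0" "dd r 0 a = 0" "res r' Y 0 a \<in> Bd r' (\<lambda>_ y. y) Y 0"
  define o1 :: "'k elts" where "o1 = (\<lambda>j. if j = 0 then bas else (\<lambda>_ _. 0))"
  have o1: "o1 \<in> Tup r'' 0" for r'' by (rule TupI) (auto simp: o1_def one_GG)
  have "a g y = 0" if g: "g \<in> Tup r 0" and y: "y \<in> Y" for g y
  proof -
    \<comment> \<open>The edge from \<open>g\<close> to the identity tuple \<open>o1\<close>, on
      which the cocycle condition compares the two values.\<close>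
    define h where "h = (\<lambda>j. if j = 0 then g 0 else o1 (j - 1))"
    have "h \<in> Tup r (Suc 0)" 
      by (rule TupI) (use Tup_GG[OF g] in \<open>auto simp: h_def o1_def one_GG\<close>)
    moreover have "dd r 0 a h y = 0" by (simp add: a(2))
    moreover have "dr 0 h = o1" by (auto simp: dr_def h_def)
    moreover have "dr 1 h = g" 
    proof
      fix j show "dr 1 h j = g j" using Tup_tail[OF g, of j] by (cases j) (auto simp: dr_def h_def o1_def)
    qed
    ultimately have "a g y = a o1 y" by (simp add: dd_def)
    also have "\<dots> = res r' Y 0 a o1 y" using o1 y by (simp add: res_def)
    also have "\<dots> = 0" using a(3) by (simp add: Bd_def)
    finally show ?thesis .
  qed
  then have "a = 0" using Co_zero[OF a(1)] by (intro ext) (metis zero_fun_apply)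
  then show "a \<in> Bd r (\<lambda>_ y. y) Y 0" by (simp add: Bd_0)
qed

end

section \<open>Comparison with the matrix groups\<close>

text \<open>The form \<open>symp_form r\<close> pairs the coordinates \<open>i\<close> and \<open>r + i\<close>, here \<open>2 * i\<close> and \<open>2 * i + 1\<close> are paired.\<close>

definition std_idx :: "nat \<Rightarrow> nat \<Rightarrow> nat" where "std_idx r j = (if even j then j div 2 else r + j div 2)"
definition int_idx :: "nat \<Rightarrow> nat \<Rightarrow> nat" where "int_idx r l = (if l < r then 2 * l else 2 * (l - r) + 1)"

lemma std_idx_less [simp]: "j < 2 * r \<Longrightarrow> std_idx r j < 2 * r" by (auto simp: std_idx_def elim!: evenE oddE)
lemma int_idx_less [simp]: "l < 2 * r \<Longrightarrow> int_idx r l < 2 * r" by (auto simp: int_idx_def)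
lemma int_idx_std_idx [simp]: "j < 2 * r \<Longrightarrow> int_idx r (std_idx r j) = j" by (auto simp: std_idx_def int_idx_def elim!: evenE oddE)
lemma std_idx_int_idx [simp]: "l < 2 * r \<Longrightarrow> std_idx r (int_idx r l) = l" by (auto simp: std_idx_def int_idx_def)

lemma sum_int_idx: "(\<Sum>j<2*r. f j) = (\<Sum>l<2*r. f (int_idx r l))"
  by (rule sum.reindex_bij_witness[of _ "int_idx r" "std_idx r"]) auto

lemma sum_std_idx: "(\<Sum>j<2*r. f (std_idx r j)) = (\<Sum>l<2*r. f l)"
  by (rule sum.reindex_bij_witness[of _ "int_idx r" "std_idx r"]) auto

context ambient
begin

definition toG :: "nat \<Rightarrow> 'k::real_normed_field mat \<Rightarrow> nat \<Rightarrow> nat \<Rightarrow> 'k" where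
  "toG r A = (\<lambda>j. if j < 2*r then (\<lambda>i. if i < 2*r then A $$ (std_idx r i, std_idx r j) else 0) else bas j)"

definition fromG :: "nat \<Rightarrow> 'k::real_normed_field elt \<Rightarrow> 'k mat" where
  "fromG r g = mat (2*r) (2*r) (\<lambda>(a, b). g (int_idx r b) (int_idx r a))"

definition interleave :: "nat \<Rightarrow> 'k::real_normed_field vec \<Rightarrow> nat \<Rightarrow> 'k" where
  "interleave r v = (\<lambda>i. if i < 2*r then v $ std_idx r i else 0)"

lemma interleave_VV: "interleave r v \<in> VV r" by (simp add: interleave_def VV_def)

lemma om_interleave:
  assumes "r \<le> N"
  shows "om (interleave r v) (interleave r w) = symp_form r v w"
proof -
  have "om (interleave r v) (interleave r w) = (\<Sum>i<N. if i < r then v $ i * w $ (r + i) - v $ (r + i) * w $ i else 0)"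
    unfolding om_def by (intro sum.cong refl) (auto simp: interleave_def std_idx_def)
  also have "\<dots> = symp_form r v w" unfolding symp_form_def
    by (rule sum.mono_neutral_cong_right) (use assms in auto)
  finally show ?thesis .
qed

lemma sum_VV:
  assumes "r \<le> N" "v \<in> VV r"
  shows "(\<Sum>j<2*N. v j * f j) = (\<Sum>j<2*r. v j * f j)"
  by (rule sum.mono_neutral_right) (use assms in \<open>auto simp: VV_def\<close>)

lemma interleave_mult:
  assumes r: "r \<le> N" and A: "A \<in> carrier_mat (2*r) (2*r)" and v: "v \<in> carrier_vec (2*r)"
  shows "interleave r (A *\<^sub>v v) = app (toG r A) (interleave r v)"
proof
  fix i
  show "interleave r (A *\<^sub>v v) i = app (toG r A) (interleave r v) i"
  proof (cases "i < 2*r")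
    case True
    then have "app (toG r A) (interleave r v) i = (\<Sum>j<2*r. interleave r v j * toG r A j i)"
      using r by (simp add: app_def sum_VV[OF r interleave_VV])
    also have "\<dots> = (\<Sum>j<2*r. v $ std_idx r j * A $$ (std_idx r i, std_idx r j))"
      using True by (intro sum.cong refl) (simp add: interleave_def toG_def)
    also have "\<dots> = (\<Sum>l<2*r. v $ l * A $$ (std_idx r i, l))" by (rule sum_std_idx)
    also have "\<dots> = (\<Sum>l<2*r. A $$ (std_idx r i, l) * v $ l)" by (simp only: mult.commute)
    also have "\<dots> = interleave r (A *\<^sub>v v) i" using True A v
      by (auto simp: interleave_def scalar_prod_def lessThan_atLeast0)
    finally show ?thesis ..
  next
    case False
    have "app (toG r A) (interleave r v) i = (if i < 2*N then \<Sum>j<2*r. interleave r v j * toG r A j i else interleave r v i)"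
      by (simp add: app_def sum_VV[OF r interleave_VV])
    also have "\<dots> = 0" using False by (auto simp: interleave_def toG_def)
    finally show ?thesis using False by (simp add: interleave_def)
  qed
qed

lemma interleave_unit: "j < 2*r \<Longrightarrow> interleave r (unit_vec (2*r) (std_idx r j)) = (bas j :: nat \<Rightarrow> 'k::real_normed_field)"
proof
  fix i assume j: "j < 2*r"
  show "interleave r (unit_vec (2*r) (std_idx r j)) i = (bas j i :: 'k)"
    using j int_idx_std_idx[OF j] int_idx_std_idx[of i r] by (auto simp: interleave_def unit_vec_def bas_apply) (metis int_idx_std_idx)
qed

lemma om_bas_VV: "v \<in> VV r \<Longrightarrow> j \<ge> 2*r \<Longrightarrow> om (bas j) v = 0" "v \<in> VV r \<Longrightarrow> j \<ge> 2*r \<Longrightarrow> om v (bas j) = 0"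
  by (auto simp: om_bas VV_def elim!: oddE)

lemma toG_GG:
  assumes r: "r \<le> N" and A: "A \<in> Sp_set r"
  shows "toG r A \<in> GG r"
proof (rule GGI)
  have Ac: "A \<in> carrier_mat (2*r) (2*r)" using A by (simp add: Sp_set_def)
  have V: "toG r A j \<in> VV r" if "j < 2*r" for j using that by (simp add: toG_def VV_def)
  have ge: "toG r A j = bas j" if "j \<ge> 2*r" for j using that by (simp add: toG_def)
  show "j \<ge> 2*r \<Longrightarrow> toG r A j = bas j" for j by (rule ge)
  show "j < 2*N \<Longrightarrow> toG r A j \<in> VV N" for j
    using V[of j] ge[of j] VV_mono[OF r] bas_VV[of j N] by (cases "j < 2*r") auto
  have c: "toG r A j = interleave r (A *\<^sub>v unit_vec (2*r) (std_idx r j))" if "j < 2*r" for j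
    using interleave_mult[OF r Ac, of "unit_vec (2*r) (std_idx r j)"] app_bas[of j "toG r A"] V[OF that] VV_mono[OF r] r that
    by (auto simp: interleave_unit)
  fix i j
  consider "i < 2*r" "j < 2*r" | "i \<ge> 2*r" "j < 2*r" | "i < 2*r" "j \<ge> 2*r" | "i \<ge> 2*r" "j \<ge> 2*r" by linarith
  then show "om (toG r A i) (toG r A j) = om (bas i) (bas j)"
  proof cases
    case 1
    then show ?thesis using A unfolding c[OF 1(1)] c[OF 1(2)] om_interleave[OF r] interleave_unit[OF 1(1), symmetric] interleave_unit[OF 1(2), symmetric]
      by (simp add: Sp_set_def)
  next
    case 2 then show ?thesis by (simp only: ge[OF 2(1)] om_bas_VV(1)[OF V[OF 2(2)] 2(1)] om_bas_VV(1)[OF bas_VV[OF 2(2)] 2(1)]) 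
  next
    case 3 then show ?thesis by (simp only: ge[OF 3(2)] om_bas_VV(2)[OF V[OF 3(1)] 3(2)] om_bas_VV(2)[OF bas_VV[OF 3(1)] 3(2)])
  qed (simp only: ge)
qed

lemma GG_VV: "g \<in> GG r \<Longrightarrow> r \<le> N \<Longrightarrow> j < 2*r \<Longrightarrow> g j \<in> VV r"
  using app_VV[of g r "bas j"] GG_app_bas[of g r j] bas_VV[of j r] by simp

lemma to_from: 
  assumes r: "r \<le> N" and g: "g \<in> GG r"
  shows "toG r (fromG r g) = g"
proof (intro ext)
  fix j i
  show "toG r (fromG r g) j i = g j i"
    using GG_ge[OF g, of j] GG_VV[OF g r, of j] by (auto simp: toG_def fromG_def VV_def)
qed

lemma from_to: "A \<in> carrier_mat (2*r) (2*r) \<Longrightarrow> fromG r (toG r A) = A"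
  by (rule eq_matI) (auto simp: fromG_def toG_def)

lemma fromG_mul:
  assumes r: "r \<le> N" and g: "g \<in> GG r" and h: "h \<in> GG r"
  shows "fromG r (mul g h) = fromG r g * fromG r h"
proof (rule eq_matI)
  fix a b assume "a < dim_row (fromG r g * fromG r h)" "b < dim_col (fromG r g * fromG r h)"
  then have ab: "a < 2*r" "b < 2*r" by (auto simp: fromG_def)
  then have "int_idx r a < 2*N" using r int_idx_less[of a r] by linarith
  then have "fromG r (mul g h) $$ (a, b) = (\<Sum>j<2*r. h (int_idx r b) j * g j (int_idx r a))"
    using ab by (simp add: fromG_def mul_apply app_def sum_VV[OF r GG_VV[OF h r]])
  also have "\<dots> = (\<Sum>l<2*r. h (int_idx r b) (int_idx r l) * g (int_idx r l) (int_idx r a))" by (rule sum_int_idx)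
  also have "\<dots> = (fromG r g * fromG r h) $$ (a, b)"
    using ab by (auto simp: fromG_def scalar_prod_def lessThan_atLeast0 mult.commute intro!: sum.cong)
  finally show "fromG r (mul g h) $$ (a, b) = (fromG r g * fromG r h) $$ (a, b)" .
qed (auto simp: fromG_def)

lemma fromG_bas: "fromG r bas = (1\<^sub>m (2*r) :: 'k::real_normed_field mat)"
proof (rule eq_matI)
  fix a b assume "a < dim_row (1\<^sub>m (2*r) :: 'k mat)" "b < dim_col (1\<^sub>m (2*r) :: 'k mat)"
  then show "fromG r bas $$ (a, b) = (1\<^sub>m (2*r) :: 'k mat) $$ (a, b)"
    using std_idx_int_idx[of a r] std_idx_int_idx[of b r] by (auto simp: fromG_def bas_apply) (metis std_idx_int_idx)
qed (auto simp: fromG_def)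

lemma fromG_Sp:
  assumes r: "r \<le> N" and g: "g \<in> GG r"
  shows "fromG r g \<in> Sp_set r"
proof -
  have c: "fromG r h \<in> carrier_mat (2*r) (2*r)" for h :: "'a elt" by (simp add: fromG_def)
  have "fromG r g * fromG r (inv' g) = 1\<^sub>m (2*r)" "fromG r (inv' g) * fromG r g = 1\<^sub>m (2*r)"
    using fromG_mul[OF r g inv_GG[OF g r]] fromG_mul[OF r inv_GG[OF g r] g] by (simp_all add: mul_inv[OF g r] inv_mul[OF g r] fromG_bas)
  then have "invertible_mat (fromG r g)" unfolding invertible_mat_def inverts_mat_def using c[of g] c[of "inv' g"] by auto
  moreover have "symp_form r (fromG r g *\<^sub>v v) (fromG r g *\<^sub>v w) = symp_form r v w"
    if "v \<in> carrier_vec (2*r)" "w \<in> carrier_vec (2*r)" for v w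
    unfolding om_interleave[OF r, symmetric] interleave_mult[OF r c that(1)] interleave_mult[OF r c that(2)] to_from[OF r g] by (rule om_app[OF g r])
  ultimately show ?thesis using c by (simp add: Sp_set_def)
qed

lemma Sp_carrier: "A \<in> Sp_set r \<Longrightarrow> A \<in> carrier_mat (2*r) (2*r)" by (simp add: Sp_set_def)

lemma toG_mult:
  assumes r: "r \<le> N" and A: "A \<in> Sp_set r" and B: "B \<in> Sp_set r"
  shows "toG r (A * B) = mul (toG r A) (toG r B)"
proof -
  have "fromG r (mul (toG r A) (toG r B)) = A * B"
    using fromG_mul[OF r toG_GG[OF r A] toG_GG[OF r B]] by (simp add: from_to Sp_carrier A B)
  then show ?thesis using to_from[OF r mul_GG[OF toG_GG[OF r A] toG_GG[OF r B] r]] by simp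
qed


section \<open>Cochains on the matrix groups and on the ambient model\<close>

lemma topspace_Sp [simp]: "topspace (Sp_top r :: 'k::real_normed_field mat topology) = Sp_set r"
  unfolding Sp_top_def topspace_pullback_topology by auto

lemma carrier_Sp [simp]: "carrier (Sp r) = Sp_set r" "mult (Sp r) = (*)" by (simp_all add: Sp_def)

lemma entry_continuous:
  assumes "p \<in> {..<2*r} \<times> {..<2*r}"
  shows "continuous_map (Sp_top r) euclidean (\<lambda>A :: 'k::real_normed_field mat. A $$ p)"
proof -
  have "continuous_map (Sp_top r) euclidean ((\<lambda>x. x p) \<circ> (\<lambda>A :: 'k mat. \<lambda>p\<in>{..<2*r} \<times> {..<2*r}. A $$ p))"
    unfolding Sp_top_def by (rule continuous_map_pullback[OF continuous_map_product_projection[OF assms]])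
  then show ?thesis using assms by (simp add: comp_def)
qed

definition toT :: "nat \<Rightarrow> nat \<Rightarrow> (nat \<Rightarrow> 'k::real_normed_field mat) \<Rightarrow> nat \<Rightarrow> nat \<Rightarrow> nat \<Rightarrow> 'k" where
  "toT r q x = (\<lambda>j. if j \<le> q then toG r (x j) else (\<lambda>_ _. 0))"

definition fromT :: "nat \<Rightarrow> nat \<Rightarrow> 'k::real_normed_field elts \<Rightarrow> nat \<Rightarrow> 'k mat" where
  "fromT r q g = (\<lambda>i\<in>{..q}. fromG r (g i))"

text \<open>The parameter space is the point \<open>undefined\<close>.\<close>

definition to_Sp :: "nat \<Rightarrow> nat \<Rightarrow> ('k::real_normed_field, 'y) cochain \<Rightarrow> (nat \<Rightarrow> 'k mat) \<Rightarrow> real" where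
  "to_Sp r q F x = (if x \<in> tuples (Sp r) q then F (toT r q x) undefined else 0)"

definition from_Sp :: "nat \<Rightarrow> nat \<Rightarrow> ((nat \<Rightarrow> 'k::real_normed_field mat) \<Rightarrow> real) \<Rightarrow> 'k elts \<Rightarrow> 'y \<Rightarrow> real" where
  "from_Sp r q f g y = (if g \<in> Tup r q \<and> y \<in> {undefined} then f (fromT r q g) else 0)"

lemma tuplesD: "x \<in> tuples (Sp r) q \<Longrightarrow> j \<le> q \<Longrightarrow> x j \<in> Sp_set r"
  unfolding tuples_def by auto

lemma toT_Tup: "r \<le> N \<Longrightarrow> x \<in> tuples (Sp r) q \<Longrightarrow> toT r q x \<in> Tup r q"
  by (rule TupI) (auto simp: toT_def intro: toG_GG tuplesD)

lemma fromT_tuples: "r \<le> N \<Longrightarrow> g \<in> Tup r q \<Longrightarrow> fromT r q g \<in> tuples (Sp r) q"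
  unfolding tuples_def fromT_def by (auto intro!: fromG_Sp Tup_GG)

lemma toT_fromT: "r \<le> N \<Longrightarrow> g \<in> Tup r q \<Longrightarrow> toT r q (fromT r q g) = g"
  by (rule ext) (auto simp: toT_def fromT_def to_from Tup_GG Tup_tail)

lemma fromT_toT: "x \<in> tuples (Sp r) q \<Longrightarrow> fromT r q (toT r q x) = x"
  unfolding tuples_def by (rule ext) (auto simp: toT_def fromT_def intro!: from_to Sp_carrier)

lemma toT_continuous:
  "continuous_map (product_topology (\<lambda>_. Sp_top r) {..q}) euclidean (toT r q :: (nat \<Rightarrow> 'k::real_normed_field mat) \<Rightarrow> _)"
proof -
  let ?P = "product_topology (\<lambda>_. Sp_top r :: 'k mat topology) {..q}"
  have "continuous_map ?P euclidean (\<lambda>x. toT r q x j i l)" for j i l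
  proof (cases "j \<le> q \<and> i < 2*r \<and> l < 2*r")
    case True
    then have "continuous_map ?P euclidean ((\<lambda>A. A $$ (std_idx r l, std_idx r i)) \<circ> (\<lambda>x. x j))"
      by (intro continuous_map_compose[where X'="Sp_top r"] continuous_map_product_projection entry_continuous) auto
    moreover have "toT r q x j i l = ((\<lambda>A. A $$ (std_idx r l, std_idx r i)) \<circ> (\<lambda>x. x j)) x" for x :: "nat \<Rightarrow> 'k mat"
      using True by (simp add: toT_def toG_def)
    ultimately show ?thesis by (simp only: comp_def)
  next
    case False
    then have "toT r q x j i l = (if j \<le> q \<and> \<not> i < 2*r then bas i l else 0)" for x :: "nat \<Rightarrow> 'k mat" by (auto simp: toT_def toG_def)
    then show ?thesis by simp
  qed
  then show ?thesis
    unfolding euclidean_product_topology[symmetric] continuous_map_componentwise_UNIV by blast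
qed

lemma to_Sp_cochain:
  fixes F :: "('k::real_normed_field, 'y::metric_space) cochain"
  assumes r: "r \<le> N" and F: "F \<in> Aa r {undefined} q"
  shows "to_Sp r q F \<in> cb_cochains (Sp r) (Sp_top r) q"
  unfolding cb_cochains_def
proof (intro CollectI conjI ballI allI impI)
  let ?P = "product_topology (\<lambda>_. Sp_top r :: 'k mat topology) {..q}"
  have ts: "topspace ?P = tuples (Sp r) q" by (simp add: tuples_def)
  have "continuous_on (Tup r q) (\<lambda>g. (\<lambda>z. F (fst z) (snd z)) (g, undefined))"
    by (rule continuous_on_compose2[OF Co_cont[OF F]], intro continuous_on_Pair continuous_on_id continuous_on_const) auto
  then have "continuous_map (top_of_set (Tup r q)) euclideanreal (\<lambda>g. F g undefined)" by simp
  moreover have "continuous_map ?P (top_of_set (Tup r q)) (toT r q)"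
    unfolding continuous_map_in_subtopology ts using toT_continuous toT_Tup[OF r] by auto
  ultimately have "continuous_map ?P euclideanreal ((\<lambda>g. F g undefined) \<circ> toT r q)" by (rule continuous_map_compose[rotated])
  then show "continuous_map ?P euclideanreal (to_Sp r q F)"
    by (rule continuous_map_eq) (simp only: ts, simp add: to_Sp_def)
  obtain B where B: "\<And>g y. \<bar>F g y\<bar> \<le> B" using Co_bdd[OF F] by blast
  show "bounded (to_Sp r q F ` tuples (Sp r) q)"
    unfolding bounded_iff by (rule exI[of _ B]) (auto simp: to_Sp_def B)
  show "to_Sp r q F x = 0" if "x \<notin> tuples (Sp r) q" for x using that by (simp add: to_Sp_def)
  fix A :: "'k mat" and x :: "nat \<Rightarrow> 'k mat" assume A: "A \<in> carrier (Sp r)" and x: "x \<in> tuples (Sp r) q"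
  let ?x = "\<lambda>i\<in>{..q}. A \<otimes>\<^bsub>Sp r\<^esub> x i"
  have e: "toT r q ?x = lact (toG r A) (toT r q x)"
    using A tuplesD[OF x] by (auto simp: toT_def lact_def toG_mult[OF r] intro!: ext)
  have "?x = fromT r q (lact (toG r A) (toT r q x))"
  proof
    fix i
    show "?x i = fromT r q (lact (toG r A) (toT r q x)) i"
      using A tuplesD[OF x, of i] by (simp add: fromT_def lact_def toT_def fromG_mul[OF r] toG_GG[OF r] from_to Sp_carrier)
  qed
  then have "?x \<in> tuples (Sp r) q" using fromT_tuples[OF r Tup_lact[OF toG_GG[OF r] r toT_Tup[OF r x]]] A by simp
  then show "to_Sp r q F ?x = to_Sp r q F x" unfolding to_Sp_def e
    using x Co_inv[OF F toG_GG[OF r] toT_Tup[OF r x], of A undefined] A by simp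
qed

lemma from_Sp_Aa:
  fixes f :: "(nat \<Rightarrow> 'k::real_normed_field mat) \<Rightarrow> real"
  assumes r: "r \<le> N" and f: "f \<in> cb_cochains (Sp r) (Sp_top r) q"
  shows "from_Sp r q f \<in> Aa r {undefined :: 'y::metric_space} q"
proof -
  let ?P = "product_topology (\<lambda>_. Sp_top r :: 'k mat topology) {..q}"
  have fc: "continuous_map ?P euclideanreal f" and fb: "bounded (f ` tuples (Sp r) q)"
    and fi: "\<And>A x. A \<in> Sp_set r \<Longrightarrow> x \<in> tuples (Sp r) q \<Longrightarrow> f (\<lambda>i\<in>{..q}. A * x i) = f x"
    using f unfolding cb_cochains_def by auto
  obtain B0 where B0: "\<And>x. x \<in> tuples (Sp r) q \<Longrightarrow> \<bar>f x\<bar> \<le> B0" using fb unfolding bounded_iff by auto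
  show ?thesis
  proof (rule CoI)
    have "continuous_map (top_of_set (Tup r q)) (Sp_top r) (\<lambda>g. fromG r (g i) :: 'k mat)" if "i \<le> q" for i
      unfolding Sp_top_def
    proof (rule continuous_map_pullback')
      have "continuous_map (top_of_set (Tup r q)) euclidean (\<lambda>g. (fromG r (g i) :: 'k mat) $$ p)" if p: "p \<in> {..<2*r} \<times> {..<2*r}" for p
      proof -
        have "continuous_on (Tup r q) (\<lambda>g :: nat \<Rightarrow> nat \<Rightarrow> nat \<Rightarrow> 'k. g i (int_idx r (snd p)) (int_idx r (fst p)))"
          by (rule continuous_on_product_then_coordinatewise[OF continuous_on_product_then_coordinatewise[OF continuous_on_product_then_coordinatewise[OF continuous_on_id]]])
        then show ?thesis using p by (auto simp: fromG_def)
      qed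
      then show "continuous_map (top_of_set (Tup r q)) (product_topology (\<lambda>_. euclidean) ({..<2*r} \<times> {..<2*r}))
         ((\<lambda>A. \<lambda>p\<in>{..<2*r} \<times> {..<2*r}. A $$ p) \<circ> (\<lambda>g. fromG r (g i) :: 'k mat))"
        by (auto simp: continuous_map_componentwise comp_def)
      show "topspace (top_of_set (Tup r q)) \<subseteq> (\<lambda>g. fromG r (g i) :: 'k mat) -` Sp_set r"
        using fromG_Sp[OF r Tup_GG[OF _ that]] by auto
    qed
    then have "continuous_map (top_of_set (Tup r q)) ?P (fromT r q)"
      unfolding continuous_map_componentwise by (auto simp: fromT_def)
    then have "continuous_map (top_of_set (Tup r q)) euclideanreal (f \<circ> fromT r q)" by (rule continuous_map_compose[OF _ fc])
    then have c: "continuous_on (Tup r q) (f \<circ> fromT r q)" by (simp only: continuous_map_iff_continuous)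
    have "continuous_on (Tup r q \<times> {undefined}) (\<lambda>z :: _ \<times> 'y. (f \<circ> fromT r q) (fst z))"
      by (rule continuous_on_compose2[OF c continuous_on_fst[OF continuous_on_id]]) auto
    then show "continuous_on (Tup r q \<times> {undefined}) (\<lambda>z :: _ \<times> 'y. from_Sp r q f (fst z) (snd z))"
      by (rule continuous_on_eq) (auto simp: from_Sp_def)
    show "\<bar>from_Sp r q f g y\<bar> \<le> max B0 0" for g and y :: 'y
      using B0[OF fromT_tuples[OF r], of g] by (auto simp: from_Sp_def)
  next
    fix a :: "'k elt" and g :: "'k elts" and y :: 'y
    assume a: "a \<in> GG r" "g \<in> Tup r q"
    have "fromT r q (lact a g) = (\<lambda>i\<in>{..q}. fromG r a * fromT r q g i)"
      using a Tup_GG[OF a(2)] by (auto simp: fromT_def lact_def fromG_mul[OF r])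
    then show "from_Sp r q f (lact a g) y = from_Sp r q f g y"
      using fi[OF fromG_Sp[OF r a(1)] fromT_tuples[OF r a(2)]] Tup_lact[OF a(1) r a(2)] a by (simp add: from_Sp_def)
  qed (auto simp: from_Sp_def)
qed

lemma to_Sp_from_Sp:
  assumes "r \<le> N" "f \<in> cb_cochains (Sp r) (Sp_top r) q"
  shows "to_Sp r q (from_Sp r q f) = f"
  using assms toT_Tup[OF assms(1)] by (auto simp: fun_eq_iff to_Sp_def from_Sp_def fromT_toT cb_cochains_def)

lemma from_Sp_to_Sp:
  assumes "r \<le> N" "F \<in> Aa r {undefined} q"
  shows "from_Sp r q (to_Sp r q F) = F"
  using assms Co_zero[OF assms(2)] by (auto simp: fun_eq_iff to_Sp_def from_Sp_def toT_fromT fromT_tuples)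

lemma from_Sp_coboundary:
  assumes r: "r \<le> N"
  shows "from_Sp r (Suc q) (coboundary_map (Sp r) q f) = dd r q (from_Sp r q f)"
proof (intro ext)
  fix g :: "'a elts" and y :: 'b
  have "omit q i (fromT r (Suc q) g) = fromT r q (dr i g)" if "i \<le> Suc q" for i
    using that by (auto simp: omit_def fromT_def dr_def fun_eq_iff)
  then show "from_Sp r (Suc q) (coboundary_map (Sp r) q f) g y = dd r q (from_Sp r q f) g y"
    using fromT_tuples[OF r, of g "Suc q"] Tup_dr[of g r q] by (auto simp: from_Sp_def coboundary_map_def dd_def intro!: sum.cong)
qed

lemma omit_tuples:
  assumes "x \<in> tuples G (Suc q)" "i \<le> Suc q"
  shows "omit q i x \<in> tuples G q"
  using assms unfolding tuples_def omit_def by (auto simp: PiE_iff)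

lemma to_Sp_dd:
  assumes r: "r \<le> N"
  shows "to_Sp r (Suc q) (dd r q F) = coboundary_map (Sp r) q (to_Sp r q F)"
proof
  fix x :: "nat \<Rightarrow> 'a mat"
  have "toT r q (omit q i x) = dr i (toT r (Suc q) x)" if "i \<le> Suc q" for i
    using that by (auto simp: omit_def toT_def dr_def fun_eq_iff)
  then show "to_Sp r (Suc q) (dd r q F) x = coboundary_map (Sp r) q (to_Sp r q F) x"
    using toT_Tup[OF r, of x "Suc q"] by (auto simp: to_Sp_def coboundary_map_def dd_def omit_tuples intro!: sum.cong)
qed

end

section \<open>Cohomology classes\<close>

lemma cochain_0: "(\<lambda>_. 0) \<in> cb_cochains G T q"
  unfolding cb_cochains_def by (auto simp: bounded_iff)

lemma cochain_add: 
  assumes "f \<in> cb_cochains G T q" "g \<in> cb_cochains G T q"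
  shows "(\<lambda>x. f x + g x) \<in> cb_cochains G T q"
  using assms unfolding cb_cochains_def by (auto intro: continuous_map_add bounded_plus_comp)

lemma cochain_scale: 
  assumes "f \<in> cb_cochains G T q"
  shows "(\<lambda>x. c * f x) \<in> cb_cochains G T q"
proof -
  have "bounded ((\<lambda>x. c * f x) ` tuples G q)"
    using assms bounded_scaling[of "f ` tuples G q" c] unfolding cb_cochains_def by (simp add: image_image)
  then show ?thesis using assms unfolding cb_cochains_def by (auto intro: continuous_map_real_mult_left)
qed

lemma coboundary_map_add: "coboundary_map G q (\<lambda>x. f x + g x) = (\<lambda>x. coboundary_map G q f x + coboundary_map G q g x)"
  by (auto simp: coboundary_map_def fun_eq_iff sum.distrib[symmetric] distrib_left intro!: sum.cong)

lemma coboundary_map_scale: "coboundary_map G q (\<lambda>x. c * f x) = (\<lambda>x. c * coboundary_map G q f x)"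
  by (auto simp: coboundary_map_def fun_eq_iff sum_distrib_left mult.left_commute simp del: sum.atMost_Suc intro!: sum.cong)

lemma cocycle_add: "f \<in> cb_cocycles G T q \<Longrightarrow> g \<in> cb_cocycles G T q \<Longrightarrow> (\<lambda>x. f x + g x) \<in> cb_cocycles G T q"
  by (auto simp: cb_cocycles_def cochain_add coboundary_map_add)

lemma cocycle_scale: "f \<in> cb_cocycles G T q \<Longrightarrow> (\<lambda>x. c * f x) \<in> cb_cocycles G T q"
  by (auto simp: cb_cocycles_def cochain_scale coboundary_map_scale)

lemma coboundary_0: "(\<lambda>_. 0) \<in> cb_coboundaries G T q"
  by (cases q) (auto simp: coboundary_map_def intro!: image_eqI[OF _ cochain_0])

lemma coboundary_add: "f \<in> cb_coboundaries G T q \<Longrightarrow> g \<in> cb_coboundaries G T q \<Longrightarrow> (\<lambda>x. f x + g x) \<in> cb_coboundaries G T q"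
  by (cases q) (auto simp: coboundary_map_add[symmetric] intro!: imageI cochain_add)

lemma coboundary_scale: "f \<in> cb_coboundaries G T q \<Longrightarrow> (\<lambda>x. c * f x) \<in> cb_coboundaries G T q"
  by (cases q) (auto simp: coboundary_map_scale[symmetric] intro!: imageI cochain_scale)

lemma classI: "b \<in> cb_coboundaries G T q \<Longrightarrow> h = (\<lambda>x. f x + b x) \<Longrightarrow> h \<in> cb_class G T q f"
  unfolding cb_class_def by blast

lemma class_self: "f \<in> cb_class G T q f"
  by (rule classI[OF coboundary_0]) simp

lemma Hcb_ops:
  "X \<oplus>\<^bsub>Hcb G T q\<^esub> Y = {\<lambda>x. f x + g x | f g. f \<in> X \<and> g \<in> Y}"
  "c \<odot>\<^bsub>Hcb G T q\<^esub> X = {\<lambda>x. c * f x + b x | f b. f \<in> X \<and> b \<in> cb_coboundaries G T q}"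
  by (simp_all add: Hcb_def)

lemma class_eq_iff: "cb_class G T q f = cb_class G T q g \<longleftrightarrow> (\<lambda>x. f x - g x) \<in> cb_coboundaries G T q"
proof
  assume "cb_class G T q f = cb_class G T q g"
  then have "f \<in> cb_class G T q g" using class_self by metis
  then obtain b where "b \<in> cb_coboundaries G T q" "f = (\<lambda>x. g x + b x)" by (auto simp: cb_class_def)
  then show "(\<lambda>x. f x - g x) \<in> cb_coboundaries G T q" by simp
next
  assume d: "(\<lambda>x. f x - g x) \<in> cb_coboundaries G T q"
  have sub: "cb_class G T q f \<subseteq> cb_class G T q g" if d: "(\<lambda>x. f x - g x) \<in> cb_coboundaries G T q" for f g
  proof
    fix h assume "h \<in> cb_class G T q f"
    then obtain b where b: "b \<in> cb_coboundaries G T q" "h = (\<lambda>x. f x + b x)" by (auto simp: cb_class_def)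
    then have "h = (\<lambda>x. g x + ((f x - g x) + b x))" by auto
    then show "h \<in> cb_class G T q g" by (rule classI[OF coboundary_add[OF d b(1)]])
  qed
  have "(\<lambda>x. g x - f x) \<in> cb_coboundaries G T q" using coboundary_scale[OF d, of "-1"] by simp
  then show "cb_class G T q f = cb_class G T q g" using sub d by blast
qed

lemma class_add: "cb_class G T q f \<oplus>\<^bsub>Hcb G T q\<^esub> cb_class G T q g = cb_class G T q (\<lambda>x. f x + g x)"
proof (intro equalityI subsetI)
  fix h assume "h \<in> cb_class G T q f \<oplus>\<^bsub>Hcb G T q\<^esub> cb_class G T q g"
  then obtain b b' where b: "b \<in> cb_coboundaries G T q" "b' \<in> cb_coboundaries G T q" "h = (\<lambda>x. (f x + b x) + (g x + b' x))"
    by (auto simp: Hcb_ops cb_class_def)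
  then have "h = (\<lambda>x. (f x + g x) + (b x + b' x))" by auto
  then show "h \<in> cb_class G T q (\<lambda>x. f x + g x)" by (rule classI[OF coboundary_add[OF b(1,2)]])
next
  fix h assume "h \<in> cb_class G T q (\<lambda>x. f x + g x)"
  then obtain b where b: "b \<in> cb_coboundaries G T q" "h = (\<lambda>x. (f x + g x) + b x)" by (auto simp: cb_class_def)
  have "(\<lambda>x. g x + b x) \<in> cb_class G T q g" by (rule classI[OF b(1)]) simp
  moreover have "h = (\<lambda>x. f x + (g x + b x))" using b by auto
  ultimately show "h \<in> cb_class G T q f \<oplus>\<^bsub>Hcb G T q\<^esub> cb_class G T q g"
    unfolding Hcb_ops mem_Collect_eq using class_self[of f G T q] by (intro exI conjI)
qed

lemma class_scale: "c \<odot>\<^bsub>Hcb G T q\<^esub> cb_class G T q f = cb_class G T q (\<lambda>x. c * f x)"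
proof (intro equalityI subsetI)
  fix h assume "h \<in> c \<odot>\<^bsub>Hcb G T q\<^esub> cb_class G T q f"
  then obtain b b' where b: "b \<in> cb_coboundaries G T q" "b' \<in> cb_coboundaries G T q" "h = (\<lambda>x. c * (f x + b x) + b' x)"
    by (auto simp: Hcb_ops cb_class_def)
  then have "h = (\<lambda>x. c * f x + (c * b x + b' x))" by (auto simp: algebra_simps)
  then show "h \<in> cb_class G T q (\<lambda>x. c * f x)" by (rule classI[OF coboundary_add[OF coboundary_scale[OF b(1)] b(2)]])
next
  fix h assume "h \<in> cb_class G T q (\<lambda>x. c * f x)"
  then obtain b where b: "b \<in> cb_coboundaries G T q" "h = (\<lambda>x. c * f x + b x)" by (auto simp: cb_class_def)
  then show "h \<in> c \<odot>\<^bsub>Hcb G T q\<^esub> cb_class G T q f" unfolding Hcb_ops using class_self[of f G T q] by blast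
qed

text \<open>In the application \<rho> is restriction and leads from the larger group to the smaller
  one, while the isomorphism is wanted in the other direction. It is the inverse of the induced map,
  so a cocycle representing the preimage of a class has to be chosen.\<close>

lemma lin_iso_Hcb:
  assumes add: "\<And>f g. \<rho> (\<lambda>x. f x + g x) = (\<lambda>x. \<rho> f x + \<rho> g x)" and scale: "\<And>c f. \<rho> (\<lambda>x. c * f x) = (\<lambda>x. c * \<rho> f x)"
    and Z: "\<And>f. f \<in> cb_cocycles G T q \<Longrightarrow> \<rho> f \<in> cb_cocycles H S q"
    and B: "\<And>f. f \<in> cb_cocycles G T q \<Longrightarrow> \<rho> f \<in> cb_coboundaries H S q \<longleftrightarrow> f \<in> cb_coboundaries G T q"
    and surj: "\<And>h. h \<in> cb_cocycles H S q \<Longrightarrow> \<exists>f\<in>cb_cocycles G T q. (\<lambda>x. h x - \<rho> f x) \<in> cb_coboundaries H S q"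
  shows "lin_iso (Hcb H S q) (Hcb G T q)"
proof -
  define \<phi> where "\<phi> = (\<lambda>X. cb_class G T q (SOME f. f \<in> cb_cocycles G T q \<and> cb_class H S q (\<rho> f) = X))"
  have diff: "cb_class H S q (\<rho> f) = cb_class H S q (\<rho> g) \<longleftrightarrow> cb_class G T q f = cb_class G T q g"
    if "f \<in> cb_cocycles G T q" "g \<in> cb_cocycles G T q" for f g
  proof -
    have "(\<lambda>x. f x + (-1) * g x) \<in> cb_cocycles G T q" by (intro cocycle_add cocycle_scale that)
    then show ?thesis unfolding class_eq_iff using B[of "\<lambda>x. f x + (-1) * g x"] by (simp only: add scale) simp
  qed
  have \<phi>: "\<phi> (cb_class H S q (\<rho> f)) = cb_class G T q f" if f: "f \<in> cb_cocycles G T q" for f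
  proof -
    let ?P = "\<lambda>f'. f' \<in> cb_cocycles G T q \<and> cb_class H S q (\<rho> f') = cb_class H S q (\<rho> f)"
    have "?P (SOME f'. ?P f')" by (rule someI[of ?P f]) (simp add: f)
    then show ?thesis unfolding \<phi>_def using diff[OF _ f] by blast
  qed
  have carr: "\<exists>f\<in>cb_cocycles G T q. X = cb_class H S q (\<rho> f)" if "X \<in> carrier (Hcb H S q)" for X
  proof -
    from that obtain h where h: "h \<in> cb_cocycles H S q" "X = cb_class H S q h" by (auto simp: Hcb_def)
    then show ?thesis using surj[OF h(1)] class_eq_iff by fastforce
  qed
  have in_carr: "f \<in> cb_cocycles G T q \<Longrightarrow> cb_class H S q (\<rho> f) \<in> carrier (Hcb H S q)" "f \<in> cb_cocycles G T q \<Longrightarrow> cb_class G T q f \<in> carrier (Hcb G T q)" for f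
    using Z by (auto simp: Hcb_def)
  show ?thesis unfolding lin_iso_def
  proof (intro exI conjI ballI allI)
    show "bij_betw \<phi> (carrier (Hcb H S q)) (carrier (Hcb G T q))"
    proof (rule bij_betw_imageI)
      show "inj_on \<phi> (carrier (Hcb H S q))"
      proof (rule inj_onI)
        fix X Y assume "X \<in> carrier (Hcb H S q)" "Y \<in> carrier (Hcb H S q)" and e: "\<phi> X = \<phi> Y"
        then obtain f g where "f \<in> cb_cocycles G T q" "X = cb_class H S q (\<rho> f)" "g \<in> cb_cocycles G T q" "Y = cb_class H S q (\<rho> g)"
          using carr by meson
        then show "X = Y" using e \<phi> diff by simp
      qed
      show "\<phi> ` carrier (Hcb H S q) = carrier (Hcb G T q)"
      proof (intro equalityI subsetI)
        fix V assume "V \<in> \<phi> ` carrier (Hcb H S q)"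
        then show "V \<in> carrier (Hcb G T q)" using carr \<phi> in_carr by fastforce
      next
        fix V assume "V \<in> carrier (Hcb G T q)"
        then obtain f where "f \<in> cb_cocycles G T q" "V = cb_class G T q f" by (auto simp: Hcb_def)
        then show "V \<in> \<phi> ` carrier (Hcb H S q)" using \<phi> in_carr(1) by (metis imageI)
      qed
    qed
  next
    fix X Y assume "X \<in> carrier (Hcb H S q)" "Y \<in> carrier (Hcb H S q)"
    then obtain f g where f: "f \<in> cb_cocycles G T q" "X = cb_class H S q (\<rho> f)" and g: "g \<in> cb_cocycles G T q" "Y = cb_class H S q (\<rho> g)"
      using carr by meson
    show "\<phi> (X \<oplus>\<^bsub>Hcb H S q\<^esub> Y) = \<phi> X \<oplus>\<^bsub>Hcb G T q\<^esub> \<phi> Y"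
      unfolding f g class_add \<phi>[OF f(1)] \<phi>[OF g(1)] using \<phi>[OF cocycle_add[OF f(1) g(1)]] by (simp only: add)
  next
    fix c X assume "X \<in> carrier (Hcb H S q)"
    then obtain f where f: "f \<in> cb_cocycles G T q" "X = cb_class H S q (\<rho> f)" using carr by meson
    show "\<phi> (c \<odot>\<^bsub>Hcb H S q\<^esub> X) = c \<odot>\<^bsub>Hcb G T q\<^esub> \<phi> X"
      unfolding f class_scale \<phi>[OF f(1)] using \<phi>[OF cocycle_scale[OF f(1)]] by (simp only: scale)
  qed
qed

context ambient
begin

lemma to_Sp_lin:
  "to_Sp r q (F + H) = (\<lambda>x. to_Sp r q F x + to_Sp r q H x)" "to_Sp r q (F - H) = (\<lambda>x. to_Sp r q F x - to_Sp r q H x)"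
  by (auto simp: to_Sp_def)

lemma to_Sp_Bd:
  fixes F :: "('k::real_normed_field, 'y::metric_space) cochain"
  assumes r: "r \<le> N" and F: "F \<in> Bd r (\<lambda>_ y. y) {undefined} q"
  shows "to_Sp r q F \<in> cb_coboundaries (Sp r) (Sp_top r) q"
proof (cases q)
  case 0 then show ?thesis using F by (auto simp: Bd_def to_Sp_def)
next
  case (Suc p)
  then obtain H where H: "H \<in> Aa r {undefined} p" "F = dd r p H" using F by (auto simp: Bd_def)
  show ?thesis unfolding Suc H(2) to_Sp_dd[OF r] by (simp add: to_Sp_cochain[OF r H(1)])
qed

lemma from_Sp_Bd:
  fixes f :: "(nat \<Rightarrow> 'k::real_normed_field mat) \<Rightarrow> real"
  assumes r: "r \<le> N" and f: "f \<in> cb_coboundaries (Sp r) (Sp_top r) q"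
  shows "from_Sp r q f \<in> Bd r (\<lambda>_ y. y) {undefined :: 'y::metric_space} q"
proof (cases q)
  case 0 then show ?thesis using f by (auto simp: Bd_def from_Sp_def fun_eq_iff)
next
  case (Suc p)
  then obtain h where "h \<in> cb_cochains (Sp r) (Sp_top r) p" "f = coboundary_map (Sp r) p h" using f by auto
  then show ?thesis using Suc from_Sp_Aa[OF r] from_Sp_coboundary[OF r] Bd_dd by metis
qed

lemma to_Sp_cocycle:
  assumes r: "r \<le> N" and F: "F \<in> Aa r {undefined} q" "dd r q F = 0"
  shows "to_Sp r q F \<in> cb_cocycles (Sp r) (Sp_top r) q"
proof -
  have "coboundary_map (Sp r) q (to_Sp r q F) = (\<lambda>_. 0)"
    unfolding to_Sp_dd[OF r, symmetric] F(2) by (simp add: to_Sp_def fun_eq_iff)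
  then show ?thesis using to_Sp_cochain[OF r F(1)] by (simp add: cb_cocycles_def)
qed

lemma from_Sp_cocycle:
  fixes f :: "(nat \<Rightarrow> 'k::real_normed_field mat) \<Rightarrow> real"
  assumes r: "r \<le> N" and f: "f \<in> cb_cocycles (Sp r) (Sp_top r) q"
  shows "from_Sp r q f \<in> Aa r {undefined :: 'y::metric_space} q" "dd r q (from_Sp r q f :: _ \<Rightarrow> 'y \<Rightarrow> real) = 0"
proof -
  show "from_Sp r q f \<in> Aa r {undefined :: 'y} q" using f by (intro from_Sp_Aa[OF r]) (simp add: cb_cocycles_def)
  have "coboundary_map (Sp r) q f = (\<lambda>_. 0)" using f by (simp add: cb_cocycles_def)
  then show "dd r q (from_Sp r q f :: _ \<Rightarrow> 'y \<Rightarrow> real) = 0" 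
    unfolding from_Sp_coboundary[OF r, symmetric] by (simp add: from_Sp_def fun_eq_iff)
qed

lemma lin_iso_of_Surj_Inj:
  assumes r: "r' \<le> r" "r \<le> N" 
    and S: "Surj TYPE('k::real_normed_field) r r' q {undefined :: 'y::metric_space}" and I: "Inj TYPE('k) r r' q {undefined :: 'y}"
  shows "lin_iso (Hcb (Sp r' :: 'k mat monoid) (Sp_top r') q) (Hcb (Sp r :: 'k mat monoid) (Sp_top r) q)"
proof -
  have r': "r' \<le> N" using r by simp
  define \<rho> :: "((nat \<Rightarrow> 'k mat) \<Rightarrow> real) \<Rightarrow> (nat \<Rightarrow> 'k mat) \<Rightarrow> real"
    where "\<rho> f = to_Sp r' q (res r' {undefined :: 'y} q (from_Sp r q f))" for f
  show ?thesis
  proof (rule lin_iso_Hcb)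
    show "\<rho> (\<lambda>x. f x + g x) = (\<lambda>x. \<rho> f x + \<rho> g x)" "\<rho> (\<lambda>x. c * f x) = (\<lambda>x. c * \<rho> f x)" for f g c
      by (auto simp: \<rho>_def to_Sp_def from_Sp_def res_def)
  next
    fix f :: "(nat \<Rightarrow> 'k mat) \<Rightarrow> real" assume f: "f \<in> cb_cocycles (Sp r) (Sp_top r) q"
    let ?F = "from_Sp r q f :: _ \<Rightarrow> 'y \<Rightarrow> real"
    note F = from_Sp_cocycle[OF r(2) f, where 'y='y]
    have R: "res r' {undefined :: 'y} q ?F \<in> Aa r' {undefined} q" "dd r' q (res r' {undefined :: 'y} q ?F) = 0"
      using res_Aa[OF r' r(1) F(1)] dd_res_0[OF r(1) F(2)] by auto
    show "\<rho> f \<in> cb_cocycles (Sp r') (Sp_top r') q" unfolding \<rho>_def by (rule to_Sp_cocycle[OF r' R])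
    show "\<rho> f \<in> cb_coboundaries (Sp r') (Sp_top r') q \<longleftrightarrow> f \<in> cb_coboundaries (Sp r) (Sp_top r) q"
    proof
      assume "\<rho> f \<in> cb_coboundaries (Sp r') (Sp_top r') q"
      then have "from_Sp r' q (\<rho> f) \<in> Bd r' (\<lambda>_ y. y) {undefined :: 'y} q" by (rule from_Sp_Bd[OF r'])
      then have "res r' {undefined :: 'y} q ?F \<in> Bd r' (\<lambda>_ y. y) {undefined :: 'y} q"
        unfolding \<rho>_def from_Sp_to_Sp[OF r' R(1)] .
      then have "?F \<in> Bd r (\<lambda>_ y. y) {undefined} q" using I F unfolding Inj_def by blast
      then have "to_Sp r q ?F \<in> cb_coboundaries (Sp r) (Sp_top r) q" by (rule to_Sp_Bd[OF r(2)])
      then show "f \<in> cb_coboundaries (Sp r) (Sp_top r) q"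
        using to_Sp_from_Sp[OF r(2), of f q, where 'b='y] f by (simp add: cb_cocycles_def)
    next
      assume "f \<in> cb_coboundaries (Sp r) (Sp_top r) q"
      then have "?F \<in> Bd r (\<lambda>_ y. y) {undefined :: 'y} q" by (rule from_Sp_Bd[OF r(2)])
      then have "res r' {undefined :: 'y} q ?F \<in> Bd r' (\<lambda>_ y. y) {undefined :: 'y} q"
        by (rule res_Bd[OF r' r(1) order_refl]) auto
      then show "\<rho> f \<in> cb_coboundaries (Sp r') (Sp_top r') q" unfolding \<rho>_def by (rule to_Sp_Bd[OF r'])
    qed
  next
    fix h :: "(nat \<Rightarrow> 'k mat) \<Rightarrow> real" assume h: "h \<in> cb_cocycles (Sp r') (Sp_top r') q"
    let ?H = "from_Sp r' q h :: _ \<Rightarrow> 'y \<Rightarrow> real"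
    obtain a where a: "a \<in> Aa r {undefined :: 'y} q" "dd r q a = 0" "?H - res r' {undefined} q a \<in> Bd r' (\<lambda>_ y. y) {undefined} q"
      using S from_Sp_cocycle[OF r' h, where 'y='y] unfolding Surj_def by blast
    have "to_Sp r' q (?H - res r' {undefined} q a) \<in> cb_coboundaries (Sp r') (Sp_top r') q" by (rule to_Sp_Bd[OF r' a(3)])
    moreover have "to_Sp r' q ?H = h" by (rule to_Sp_from_Sp[OF r']) (use h in \<open>simp add: cb_cocycles_def\<close>)
    moreover have "from_Sp r q (to_Sp r q a) = a" by (rule from_Sp_to_Sp[OF r(2) a(1)])
    ultimately have "(\<lambda>x. h x - \<rho> (to_Sp r q a) x) \<in> cb_coboundaries (Sp r') (Sp_top r') q"
      by (simp add: \<rho>_def to_Sp_lin)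
    then show "\<exists>f\<in>cb_cocycles (Sp r) (Sp_top r) q. (\<lambda>x. h x - \<rho> f x) \<in> cb_coboundaries (Sp r') (Sp_top r') q"
      using to_Sp_cocycle[OF r(2) a(1,2)] by blast
  qed
qed

text \<open>A one-point parameter space recovers plain cochains. Injectivity in a positive degree
  \<open>q\<close> comes from the stability statement in degree \<open>q - 1\<close>, whose
  threshold is smaller; degree zero is \<open>Inj_0\<close>.\<close>

lemma lin_iso_stable:
  assumes r: "Suc r \<le> N" "(q + 4)^2 \<le> r"
  shows "lin_iso (Hcb (Sp r :: 'k::real_normed_field mat monoid) (Sp_top r) q) (Hcb (Sp (Suc r) :: 'k mat monoid) (Sp_top (Suc r)) q)"
proof (rule lin_iso_of_Surj_Inj[OF _ r(1)])
  let ?Y = "{undefined :: nat \<Rightarrow> nat \<Rightarrow> 'k pair}"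
  show "Surj TYPE('k) (Suc r) r q ?Y" using stable_atD(1)[OF stable r(1), of q ?Y] r(2) by simp
  show "Inj TYPE('k) (Suc r) r q ?Y"
  proof (cases q)
    case 0 then show ?thesis using Inj_0[OF _ r(1), of r ?Y] by simp
  next
    case (Suc p)
    have "(p + 4)^2 \<le> (q + 4)^2" by (rule power_mono) (simp_all add: Suc)
    then have "(p + 4)^2 < Suc r" using r(2) by linarith
    then show ?thesis using stable_atD(2)[OF stable r(1), of p ?Y] by (simp add: Suc)
  qed
qed simp

end

lemma Hcb_Sp_stable:
  "\<exists>r0\<ge>1. \<forall>r\<ge>r0. lin_iso (Hcb (Sp r :: 'k::real_normed_field mat monoid) (Sp_top r) q)
     (Hcb (Sp (r + 1) :: 'k mat monoid) (Sp_top (r + 1)) q)"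
  using ambient.lin_iso_stable[of _ _ q, where 'k='k] by (intro exI[of _ "(q + 4)^2"]) (auto simp: Suc_le_eq)

theorem theorem1p2:
  shows "(\<forall>q. \<exists>r0\<ge>1. \<forall>r\<ge>r0.
            lin_iso (Hcb (Sp r :: real mat monoid) (Sp_top r) q)
                    (Hcb (Sp (r + 1) :: real mat monoid) (Sp_top (r + 1)) q)) \<and>
         (\<forall>q. \<exists>r0\<ge>1. \<forall>r\<ge>r0.
            lin_iso (Hcb (Sp r :: complex mat monoid) (Sp_top r) q)
                    (Hcb (Sp (r + 1) :: complex mat monoid) (Sp_top (r + 1)) q))"
  by (intro conjI allI Hcb_Sp_stable)

end
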